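(* Let $n\ge 3$ and let $c_1,\dots,c_n$ be nonnegative integers. Let $P$ be the $(c_1,\dots,c_n)$-generalized double circle. Then $P$ is universal.
   Context: All point sets are in the plane and in general position (no three collinear). An edge of a point set is a segment with two distinct endpoints in it; a triangulation is a maximal set of pairwise non-crossing edges. For point sets $P,Q$ and a bijection $f:P\to Q$, a compatible triangulation of $(P,Q)$ with respect to $f$ is a pair $(T_P,T_Q)$ of triangulations of $P$ and $Q$ such that $(p,p')\in T_P$ iff $(f(p),f(p'))\in T_Q$. A bijection $f_0$ from the convex hull vertices of $P$ to those of $Q$ is cyclic if for all hull vertices $p_1,p_2$ of $P$, $p_1p_2$ is a hull edge of $P$ iff $f_0(p_1)f_0(p_2)$ is a hull edge of $Q$. A point set $P$ is universal if for every point set $Q$ with $|Q|=|P|$ and every cyclic bijection $f_0$ from the hull vertices of $P$ to those of $Q$, there is a bijection $f:P\to Q$ extending $f_0$ and a compatible triangulation of $(P,Q)$ with respect to $f$. A $(c_1,\dots,c_n)$-generalized double circle is a point set with $n+\sum_i c_i$ points whose convex hull has exactly the $n$ vertices $P_1,\dots,P_n$ (in cyclic order, indices mod $n$), such that for each $i$ there are $c_i$ points $A_{i,1},\dots,A_{i,c_i}$ placed along the edge $P_iP_{i+1}$, slightly offset towards the interior of the polygon, the polygon $P_iA_{i,1}\dots A_{i,c_i}P_{i+1}$ is convex, and the closed chain $P_1A_{1,1}\dots A_{1,c_1}P_2A_{2,1}\dots P_nA_{n,1}\dots A_{n,c_n}P_1$ is an unavoidable spanning cycle, i.e. each of its edges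 (including $P_iP_{i+1}$ when $c_i=0$) belongs to every triangulation of the point set. *)

theory Defs
  imports "HOL-Analysis.Analysis"
begin

type_synonym point = "real ^ 2"

definition general_position :: "point set \<Rightarrow> bool" where
  "general_position P \<longleftrightarrow>
     (\<forall>a\<in>P. \<forall>b\<in>P. \<forall>c\<in>P. a \<noteq> b \<and> a \<noteq> c \<and> b \<noteq> c \<longrightarrow> \<not> collinear {a, b, c})"

definition point_set :: "point set \<Rightarrow> bool" where
  "point_set P \<longleftrightarrow> finite P \<and> general_position P"

definition point_set_edges :: "point set \<Rightarrow> point set set" where
  "point_set_edges P = {closed_segment p q | p q. p \<in> P \<and> q \<in> P \<and> p \<noteq> q}"

text \<open>
  The relative interior of a segment with distinct endpoints is the open segment. In general
  position no point of \<open>P\<close> lies in the open segment of an edge, so two edges cross iff they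
  are distinct and their relative interiors meet.
\<close>

definition noncrossing :: "point set \<Rightarrow> point set \<Rightarrow> bool" where
  "noncrossing s t \<longleftrightarrow> rel_interior s \<inter> rel_interior t = {}"

definition planar_triangulation :: "point set \<Rightarrow> point set set \<Rightarrow> bool" where
  "planar_triangulation P T \<longleftrightarrow>
     T \<subseteq> point_set_edges P \<and> pairwise noncrossing T \<and>
     (\<forall>T'. T \<subseteq> T' \<and> T' \<subseteq> point_set_edges P \<and> pairwise noncrossing T' \<longrightarrow> T' = T)"

definition compatible_triangulation ::
    "point set \<Rightarrow> point set \<Rightarrow> (point \<Rightarrow> point) \<Rightarrow> point set set \<Rightarrow> point set set \<Rightarrow> bool" where
  "compatible_triangulation P Q f TP TQ \<longleftrightarrow>
     planar_triangulation P TP \<and> planar_triangulation Q TQ \<and>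
     (\<forall>p\<in>P. \<forall>p'\<in>P. closed_segment p p' \<in> TP \<longleftrightarrow> closed_segment (f p) (f p') \<in> TQ)"

definition hull_vertices :: "point set \<Rightarrow> point set" where
  "hull_vertices P = {p. p extreme_point_of (convex hull P)}"

definition hull_edge :: "point set \<Rightarrow> point \<Rightarrow> point \<Rightarrow> bool" where
  "hull_edge P p q \<longleftrightarrow> closed_segment p q edge_of (convex hull P)"

definition cyclic_bijection :: "point set \<Rightarrow> point set \<Rightarrow> (point \<Rightarrow> point) \<Rightarrow> bool" where
  "cyclic_bijection P Q f0 \<longleftrightarrow>
     bij_betw f0 (hull_vertices P) (hull_vertices Q) \<and>
     (\<forall>p1\<in>hull_vertices P. \<forall>p2\<in>hull_vertices P.
        hull_edge P p1 p2 \<longleftrightarrow> hull_edge Q (f0 p1) (f0 p2))"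

definition universal :: "point set \<Rightarrow> bool" where
  "universal P \<longleftrightarrow>
     (\<forall>Q f0. point_set Q \<and> card Q = card P \<and> cyclic_bijection P Q f0 \<longrightarrow>
        (\<exists>f. bij_betw f P Q \<and> (\<forall>p\<in>hull_vertices P. f p = f0 p) \<and>
             (\<exists>TP TQ. compatible_triangulation P Q f TP TQ)))"

text \<open>
  The list \<open>xs\<close> is the vertex sequence of a convex polygon, in one of its two cyclic orders.
  A two-element list of distinct points also qualifies, as a degenerate polygon.
\<close>

definition convex_polygon :: "point list \<Rightarrow> bool" where
  "convex_polygon xs \<longleftrightarrow>
     distinct xs \<and> hull_vertices (set xs) = set xs \<and>
     (\<forall>i<length xs. hull_edge (set xs) (xs ! i) (xs ! (Suc i mod length xs)))"

definition unavoidable_spanning_cycle :: "point set \<Rightarrow> point list \<Rightarrow> bool" where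
  "unavoidable_spanning_cycle P xs \<longleftrightarrow>
     distinct xs \<and> set xs = P \<and>
     (\<forall>i<length xs. \<forall>T. planar_triangulation P T \<longrightarrow>
        closed_segment (xs ! i) (xs ! (Suc i mod length xs)) \<in> T)"

text \<open>
  Numbering everything from 0, \<open>vs ! i\<close> is the \<open>i\<close>-th hull vertex and \<open>As ! i\<close> lists the
  points along the hull edge from \<open>vs ! i\<close> to its successor, in order from \<open>vs ! i\<close>. These points
  lie strictly inside the hull, since they
  are not hull vertices and \<open>P\<close> is in general position. How far they may be moved away from
  the edge is what the unavoidability of the closed chain controls: no segment between two
  points of \<open>P\<close> crosses the chain.
\<close>

definition generalized_double_circle :: "nat list \<Rightarrow> point set \<Rightarrow> bool" where
  "generalized_double_circle c P \<longleftrightarrow>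
     point_set P \<and> card P = length c + sum_list c \<and>
     (\<exists>vs As.
        length vs = length c \<and> map length As = c \<and>
        convex_polygon vs \<and> hull_vertices P = set vs \<and>
        (\<forall>i<length c. convex_polygon (vs ! i # As ! i @ [vs ! (Suc i mod length c)])) \<and>
        unavoidable_spanning_cycle P (concat (map (\<lambda>i. vs ! i # As ! i) [0..<length c])))"

end

theory Submission
  imports Defs "HOL-Library.Sublist"
begin

text \<open>
  As no segment crosses the closed chain of a generalized double circle \<open>P\<close>, its order type is
  determined where it matters: three points in cyclic order are positively oriented unless they lie
  on a common chain \<open>P\<^sub>i A\<^sub>i\<^sub>,\<^sub>1 \<dots> P\<^sub>i\<^sub>+\<^sub>1\<close>, and points of a common chain are negatively oriented.
  It therefore suffices to order the points of \<open>Q\<close> cyclically, with \<open>c\<^sub>i\<close> inner points between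
  consecutive hull vertices, and to tile the hull of \<open>Q\<close> by triangles each of which is either increasing
  and not contained in a chain, or decreasing within a chain: the corresponding triangles tile the hull of \<open>P\<close>.

  The inner points of \<open>Q\<close> are assigned to the hull edges so that the product of the distances to the
  assigned edges is minimal. This makes the classes pairwise non-crossing, so that their inner hull
  chains bound a simple polygon, which can be triangulated. The points between a chain and its hull
  edge are moved into the triangles adjacent to the chain: since every such point is seen in the wedge
  of some triangle behind a chain edge, a path can be threaded through it and the triangle subdivided
  around the path. The pockets between the threaded paths and the hull edges are again simple polygons.

  A tiling is a family of positively oriented triangles whose boundary is the hull cycle, where
  boundaries are compared on antisymmetric weights of directed edges. The boundary condition is purely
  combinatorial, so it can be carried from \<open>Q\<close> to \<open>P\<close>; evaluating it on the signed crossings with a ray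
  shows that almost every point of the hull lies in exactly one triangle.
\<close>

section \<open>Orientations\<close>

text \<open>The obstacle is that the inner points of \<open>Q\<close> have no convex order: those
  between an inner hull chain and its hull edge may lie anywhere, while in \<open>P\<close> three
  points of a chain always turn the same way. Hence the cyclic order on \<open>Q\<close> cannot be
  fixed in advance. It is read off from the threaded paths, and \<open>separable\<close> is the
  invariant that keeps such a path simple when pieces are joined. The product of distances comes
  from the exchange inequality d_i(x) d_j(y) \<le> d_i(y) d_j(x): the ratio d_i / d_j on class i
  never exceeds that on class j, which is weak separation by a line of the pencil of the two hull
  lines. At a common hull vertex the ratio measures the angle, so neighbouring classes are also
  sorted around it. No interior of a polygon is defined. Its orientation is a sign read off at an
  extreme vertex, and disjointness of tiles is a count: tiles around the origin of a ray contribute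
  1, all others at least 0, and the total is 1. The hull vertices of \<open>P\<close> and
  \<open>Q\<close> may run in either sense, independently, so each set is normalised by its own
  reflection.\<close>

definition ori :: "point \<Rightarrow> point \<Rightarrow> point \<Rightarrow> real" where
  "ori a b c = (b$1 - a$1) * (c$2 - a$2) - (b$2 - a$2) * (c$1 - a$1)"

text \<open>Proper crossing: both sign conditions are strict, so segments with a common endpoint
  never cross and consecutive edges of a polygon need no exception.\<close>

definition crosses :: "point \<Rightarrow> point \<Rightarrow> point \<Rightarrow> point \<Rightarrow> bool" where
  "crosses a b c d \<longleftrightarrow> ori a b c * ori a b d < 0 \<and> ori c d a * ori c d b < 0"

definition gen_pos :: "point set \<Rightarrow> bool" where
  "gen_pos S \<longleftrightarrow> (\<forall>a\<in>S. \<forall>b\<in>S. \<forall>c\<in>S. a \<noteq> b \<longrightarrow> a \<noteq> c \<longrightarrow> b \<noteq> c \<longrightarrow> ori a b c \<noteq> 0)"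

text \<open>Separating lines, supporting lines and orientations with two fixed points are all
  treated as affine functions, so that one polynomial identity serves them all.\<close>

definition affine_fun :: "(point \<Rightarrow> real) \<Rightarrow> bool" where
  "affine_fun f \<longleftrightarrow> (\<exists>\<alpha> \<beta> \<gamma>. \<forall>x. f x = \<alpha> * x$1 + \<beta> * x$2 + \<gamma>)"

lemma ori_rot: "ori b c a = ori a b c" and ori_rot2: "ori c a b = ori a b c"
  and ori_swap: "ori b a c = - ori a b c" and ori_swap2: "ori a c b = - ori a b c"
  and ori_swap3: "ori c b a = - ori a b c"
  by (simp_all add: ori_def algebra_simps)

lemma ori_same [simp]: "ori a a b = 0" "ori a b a = 0" "ori b a a = 0"
  by (simp_all add: ori_def algebra_simps)

lemma ori_split: "ori a b c = ori x b c + ori a x c + ori a b x"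
  by (simp add: ori_def algebra_simps)

lemma aff_ori [simp]: "affine_fun (ori a b)"
proof -
  have "\<forall>x. ori a b x = (a$2 - b$2) * x$1 + (b$1 - a$1) * x$2 + (a$1 * b$2 - a$2 * b$1)"
    by (simp add: ori_def algebra_simps)
  then show ?thesis unfolding affine_fun_def by blast
qed

lemma aff_comb:
  assumes "affine_fun f" "affine_fun g" shows "affine_fun (\<lambda>x. s * f x + t * g x)"
proof -
  obtain a b c where "\<forall>x. f x = a * x$1 + b * x$2 + c" using assms(1) unfolding affine_fun_def by auto
  moreover obtain a' b' c' where "\<forall>x. g x = a' * x$1 + b' * x$2 + c'"
    using assms(2) unfolding affine_fun_def by auto
  ultimately have "\<forall>x. s * f x + t * g x = (s*a + t*a') * x$1 + (s*b + t*b') * x$2 + (s*c+t*c')"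
    by (simp add: algebra_simps)
  then show ?thesis unfolding affine_fun_def by blast
qed

lemma aff_seg:
  assumes "affine_fun f" shows "f ((1 - t) *\<^sub>R a + t *\<^sub>R b) = (1 - t) * f a + t * f b"
proof -
  obtain \<alpha> \<beta> \<gamma> where "\<forall>x. f x = \<alpha> * x$1 + \<beta> * x$2 + \<gamma>" using assms unfolding affine_fun_def by auto
  then show ?thesis by (simp add: algebra_simps)
qed

text \<open>Barycentric coordinates of \<open>d\<close> with respect to \<open>a\<close>,
  \<open>b\<close>, \<open>c\<close>, cleared of the denominator \<open>ori a b c\<close> and hence
  valid for degenerate triangles too. With an orientation as \<open>f\<close> it is a
  Grassmann-Pluecker relation, the source of many sign arguments below.\<close>

lemma aff_bary:
  assumes "affine_fun f"
  shows "f d * ori a b c = f a * ori d b c + f b * ori a d c + f c * ori a b d"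
proof -
  obtain \<alpha> \<beta> \<gamma> where "\<forall>x. f x = \<alpha> * x$1 + \<beta> * x$2 + \<gamma>" using assms unfolding affine_fun_def by auto
  then show ?thesis by (simp add: ori_def algebra_simps)
qed

lemma gpD: "gen_pos S \<Longrightarrow> a \<in> S \<Longrightarrow> b \<in> S \<Longrightarrow> c \<in> S \<Longrightarrow> a \<noteq> b \<Longrightarrow> a \<noteq> c \<Longrightarrow> b \<noteq> c \<Longrightarrow> ori a b c \<noteq> 0"
  unfolding gen_pos_def by blast

lemma gp_subset: "gen_pos S \<Longrightarrow> T \<subseteq> S \<Longrightarrow> gen_pos T"
  unfolding gen_pos_def by blast

lemma crs_sym: "crosses a b c d \<longleftrightarrow> crosses c d a b"
  unfolding crosses_def by auto

lemma crs_swap: "crosses b a c d \<longleftrightarrow> crosses a b c d" "crosses a b d c \<longleftrightarrow> crosses a b c d"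
  unfolding crosses_def by (auto simp: ori_swap[of a b] ori_swap[of c d] mult.commute)

lemma crs_distinct:
  assumes "crosses a b c d" shows "a \<noteq> b" "c \<noteq> d" "a \<noteq> c" "a \<noteq> d" "b \<noteq> c" "b \<noteq> d"
  using assms unfolding crosses_def by auto

text \<open>The four signed areas are the coefficients of the affine dependency between four points
  of the plane.\<close>

lemma crs_balance:
  assumes "affine_fun f"
  shows "f d * ori a b c - f c * ori a b d + f b * ori c d a - f a * ori c d b = 0"
proof -
  obtain \<alpha> \<beta> \<gamma> where "\<forall>x. f x = \<alpha> * x$1 + \<beta> * x$2 + \<gamma>" using assms unfolding affine_fun_def by auto
  then show ?thesis by (simp add: ori_def algebra_simps)
qed

lemma ori_diff: "ori a b c - ori a b d = ori c d b - ori c d a"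
  by (simp add: ori_def algebra_simps)

text \<open>Under weak separation by the line \<open>f = 0\<close>, all four summands of
  \<open>crs_balance\<close> have the same sign, so each vanishes, and the areas are nonzero. A line
  separating two crossing segments weakly thus contains both.\<close>

lemma crs_sep:
  assumes f: "affine_fun f" and le: "f a \<ge> 0" "f b \<ge> 0" "f c \<le> 0" "f d \<le> 0"
    and c: "crosses a b c d"
  shows "f a = 0 \<and> f b = 0 \<and> f c = 0 \<and> f d = 0"
proof -
  let ?A = "ori a b c" and ?B = "ori a b d" and ?C = "ori c d a" and ?D = "ori c d b"
  have bal: "f d * ?A - f c * ?B + f b * ?C - f a * ?D = 0" by (rule crs_balance[OF f])
  have df: "?A - ?B = ?D - ?C" by (rule ori_diff)
  have "?A * ?B < 0" "?C * ?D < 0" using c unfolding crosses_def by auto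
  then consider "?A > 0" "?B < 0" "?C < 0" "?D > 0" | "?A < 0" "?B > 0" "?C > 0" "?D < 0"
    using df by (auto simp: mult_less_0_iff)
  then show ?thesis
  proof cases
    case 1
    have "f d * ?A \<le> 0" "f c * ?B \<ge> 0" "f b * ?C \<le> 0" "f a * ?D \<ge> 0"
      using 1 le by (auto simp: mult_le_0_iff zero_le_mult_iff)
    then have "f d * ?A = 0" "f c * ?B = 0" "f b * ?C = 0" "f a * ?D = 0" using bal by linarith+
    then show ?thesis using 1 by auto
  next
    case 2
    have "f d * ?A \<ge> 0" "f c * ?B \<le> 0" "f b * ?C \<ge> 0" "f a * ?D \<le> 0"
      using 2 le by (auto simp: mult_le_0_iff zero_le_mult_iff)
    then have "f d * ?A = 0" "f c * ?B = 0" "f b * ?C = 0" "f a * ?D = 0" using bal by linarith+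
    then show ?thesis using 2 by auto
  qed
qed

lemma crs_point:
  assumes "crosses a b c d"
  obtains s t where "0 < s" "s < 1" "0 < t" "t < 1"
    "(1 - s) *\<^sub>R a + s *\<^sub>R b = (1 - t) *\<^sub>R c + t *\<^sub>R d"
proof -
  let ?A = "ori a b c" and ?B = "ori a b d" and ?C = "ori c d a" and ?D = "ori c d b"
  have df: "?A - ?B = ?D - ?C" by (rule ori_diff)
  have "?A * ?B < 0" "?C * ?D < 0" using assms unfolding crosses_def by auto
  then have cs: "(?A > 0 \<and> ?B < 0 \<and> ?C < 0 \<and> ?D > 0) \<or> (?A < 0 \<and> ?B > 0 \<and> ?C > 0 \<and> ?D < 0)"
    using df by (auto simp: mult_less_0_iff)
  \<comment> \<open>The crossing point divides each segment in the ratio of the areas of its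
    endpoints over the other segment.\<close>
  define t where "t = ?A / (?A - ?B)"
  define s where "s = ?C / (?C - ?D)"
  have N: "?A - ?B \<noteq> 0" using cs by auto
  have s1: "0 < s" "s < 1" and t1: "0 < t" "t < 1"
    using cs unfolding s_def t_def by (auto simp: field_simps)
  have s2: "s = - ?C / (?A - ?B)" unfolding s_def using df N
    by (metis minus_diff_eq minus_divide_divide minus_divide_left nonzero_minus_divide_right right_minus_eq)
  have *: "(1 - s) * (a$i) + s * (b$i) = (1 - t) * (c$i) + t * (d$i)" for i
  proof -
    have i: "i = 1 \<or> i = 2" by (rule exhaust_2)
    have af: "affine_fun (\<lambda>x. x$i)"
      using i unfolding affine_fun_def
      apply (elim disjE)
       apply (rule exI[of _ 1], rule exI[of _ 0], rule exI[of _ 0], simp)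
      apply (rule exI[of _ 0], rule exI[of _ 1], rule exI[of _ 0], simp)
      done
    have bal: "d$i * ?A - c$i * ?B + b$i * ?C - a$i * ?D = 0" using crs_balance[OF af] by simp
    have D: "?D = ?A - ?B + ?C" using df by simp
    have Ns: "(?A - ?B) * s = - ?C" unfolding s2 using N by simp
    have Nt: "(?A - ?B) * t = ?A" unfolding t_def using N by simp
    have "(?A - ?B) * ((1 - s) * (a$i) + s * (b$i))
        = (?A - ?B) * (a$i) - ((?A - ?B) * s) * (a$i) + ((?A - ?B) * s) * (b$i)"
      by (simp only: algebra_simps)
    then have "(?A - ?B) * ((1 - s) * (a$i) + s * (b$i)) = (?A - ?B + ?C) * (a$i) - ?C * (b$i)"
      unfolding Ns by (simp add: algebra_simps)
    moreover have "(?A - ?B) * ((1 - t) * (c$i) + t * (d$i))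
        = (?A - ?B) * (c$i) - ((?A - ?B) * t) * (c$i) + ((?A - ?B) * t) * (d$i)"
      by (simp only: algebra_simps)
    then have "(?A - ?B) * ((1 - t) * (c$i) + t * (d$i)) = - ?B * (c$i) + ?A * (d$i)"
      unfolding Nt by (simp add: algebra_simps)
    moreover have "(?A - ?B + ?C) * (a$i) - ?C * (b$i) = - ?B * (c$i) + ?A * (d$i)"
      using bal unfolding D by (simp add: algebra_simps)
    ultimately have "(?A - ?B) * ((1 - s) * (a$i) + s * (b$i)) = (?A - ?B) * ((1 - t) * (c$i) + t * (d$i))"
      by simp
    then show ?thesis using N mult_left_cancel by blast
  qed
  have "(1 - s) *\<^sub>R a + s *\<^sub>R b = (1 - t) *\<^sub>R c + t *\<^sub>R d"
    by (simp add: vec_eq_iff *)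
  then show ?thesis using that s1 t1 by blast
qed

text \<open>Walking from \<open>e\<close>, which lies in the triangle \<open>v x u\<close> or on its
  side \<open>x u\<close>, towards \<open>a\<close>, the segment must leave the triangle. It cannot
  pass \<open>x u\<close>, since \<open>a\<close> is on the inner side of that line; the side on
  which it passes \<open>v\<close> decides between \<open>v x\<close> and
  \<open>v u\<close>.\<close>

lemma exit_pos:
  assumes T: "ori v x u > 0"
    and e: "ori v x e > 0" "ori u v e > 0" "ori x u e \<ge> 0"
    and t: "0 < t" "t < 1" and ee: "e = (1 - t) *\<^sub>R a + t *\<^sub>R b"
    and a: "ori x u a > 0" "\<not> (ori v x a > 0 \<and> ori u v a > 0)" "ori v x a \<noteq> 0" "ori u v a \<noteq> 0"
    and abv: "ori a b v \<noteq> 0"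
  shows "crosses a b v x \<or> crosses a b v u"
proof -
  have O: "ori e a p = - t * ori a b p" for p
    unfolding ee by (simp add: ori_def algebra_simps)
  have F: "affine_fun f \<Longrightarrow> f e = (1 - t) * f a + t * f b" for f
    unfolding ee by (rule aff_seg)
  have i1: "ori v x e * ori u v a = ori v x a * ori u v e - ori e a v * ori v x u"
    by (simp add: ori_def algebra_simps)
  have i2: "ori v x e * ori x u a = ori v x a * ori x u e + ori e a x * ori v x u"
    by (simp add: ori_def algebra_simps)
  have i3: "ori u v e * ori x u a = ori u v a * ori x u e - ori e a u * ori v x u"
    by (simp add: ori_def algebra_simps)
  have i4: "ori u v e * ori v x a = ori u v a * ori v x e + ori e a v * ori v x u"
    by (simp add: ori_def algebra_simps)
  consider "ori e a v < 0" | "ori e a v > 0"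
    using abv O[of v] t by fastforce
  then show ?thesis
  proof cases
    case 1
    have n: "ori v x a < 0"
    proof (rule ccontr)
      assume "\<not> ori v x a < 0"
      then have p: "ori v x a > 0" using a by linarith
      have "ori v x a * ori u v e > 0" "ori e a v * ori v x u < 0"
        using p e 1 T by (auto simp: mult_less_0_iff)
      then have "ori v x e * ori u v a > 0" using i1 by linarith
      then have "ori u v a > 0" using e by (simp add: zero_less_mult_iff)
      then show False using p a by auto
    qed
    have "ori v x a * ori x u e \<le> 0" "ori v x e * ori x u a > 0"
      using n e a by (auto simp: mult_le_0_iff)
    then have "ori e a x * ori v x u > 0" using i2 by linarith
    then have x: "ori e a x > 0" using T by (simp add: zero_less_mult_iff)
    have "ori a b v > 0" "ori a b x < 0"
      using 1 x O[of v] O[of x] t by (auto simp: mult_less_0_iff zero_less_mult_iff)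
    moreover have "ori v x b > 0"
    proof -
      have "t * ori v x b = ori v x e - (1 - t) * ori v x a" using F[of "ori v x"] by simp
      moreover have "(1 - t) * ori v x a < 0" using n t by (simp add: mult_less_0_iff)
      ultimately have "t * ori v x b > 0" using e by linarith
      then show ?thesis using t by (simp add: zero_less_mult_iff)
    qed
    ultimately have "crosses a b v x" unfolding crosses_def using n by (simp add: mult_less_0_iff)
    then show ?thesis ..
  next
    case 2
    have n: "ori u v a < 0"
    proof (rule ccontr)
      assume "\<not> ori u v a < 0"
      then have p: "ori u v a > 0" using a by linarith
      have "ori u v a * ori v x e > 0" "ori e a v * ori v x u > 0"
        using p e 2 T by auto
      then have "ori u v e * ori v x a > 0" using i4 by linarith
      then have "ori v x a > 0" using e by (simp add: zero_less_mult_iff)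
      then show False using p a by auto
    qed
    have "ori u v a * ori x u e \<le> 0" "ori u v e * ori x u a > 0"
      using n e a by (auto simp: mult_le_0_iff)
    then have "ori e a u * ori v x u < 0" using i3 by linarith
    then have x: "ori e a u < 0" using T by (simp add: mult_less_0_iff)
    have "ori a b v < 0" "ori a b u > 0"
      using 2 x O[of v] O[of u] t by (auto simp: mult_less_0_iff zero_less_mult_iff)
    moreover have "ori u v b > 0"
    proof -
      have "t * ori u v b = ori u v e - (1 - t) * ori u v a" using F[of "ori u v"] by simp
      moreover have "(1 - t) * ori u v a < 0" using n t by (simp add: mult_less_0_iff)
      ultimately have "t * ori u v b > 0" using e by linarith
      then show ?thesis using t by (simp add: zero_less_mult_iff)
    qed
    ultimately have "crosses a b u v" unfolding crosses_def using n by (simp add: mult_less_0_iff)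
    then show ?thesis using crs_swap by blast
  qed
qed

text \<open>The factor \<open>ori a b c\<close> makes the predicate independent of the orientation
  of the triangle, and a degenerate triangle has no interior.\<close>

definition in_triangle :: "point \<Rightarrow> point \<Rightarrow> point \<Rightarrow> point \<Rightarrow> bool" where
  "in_triangle a b c x \<longleftrightarrow> ori a b c * ori a b x > 0 \<and> ori a b c * ori b c x > 0 \<and> ori a b c * ori c a x > 0"

lemma exit_gen:
  assumes gen_pos: "gen_pos {a, b, v, x, u}" and T: "v \<noteq> x" "v \<noteq> u" "x \<noteq> u"
    and e: "ori v x u * ori v x e > 0" "ori v x u * ori u v e > 0" "ori v x u * ori x u e \<ge> 0"
    and t: "0 < t" "t < 1" and ee: "e = (1 - t) *\<^sub>R a + t *\<^sub>R b"
    and a: "ori v x u * ori x u a > 0" "\<not> in_triangle v x u a" and ab: "a \<noteq> b" "a \<noteq> v" "b \<noteq> v"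
  shows "crosses a b v x \<or> crosses a b v u"
proof -
  have T0: "ori v x u \<noteq> 0" using gpD[OF gen_pos, of v x u] T by auto
  have ax: "a \<noteq> x" "a \<noteq> u" using a(1) by auto
  have n: "ori v x a \<noteq> 0" "ori u v a \<noteq> 0" "ori a b v \<noteq> 0"
    using gpD[OF gen_pos, of v x a] gpD[OF gen_pos, of u v a] gpD[OF gen_pos, of a b v] T ab ax by auto
  show ?thesis
  proof (cases "ori v x u > 0")
    case True
    have "\<not> (ori v x a > 0 \<and> ori u v a > 0)"
      using a True unfolding in_triangle_def by (auto simp: zero_less_mult_iff)
    then show ?thesis using exit_pos[OF True _ _ _ t ee] e a n True
      by (auto simp: zero_less_mult_iff zero_le_mult_iff)
  next
    case False
    then have F: "ori v x u < 0" using T0 by auto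
    have T': "ori v u x > 0" using F ori_swap2[of v u x] by simp
    have s: "ori v u y = - ori u v y" "ori x v y = - ori v x y" "ori u x y = - ori x u y" for y
      by (simp_all add: ori_def algebra_simps)
    have "\<not> (ori u v a < 0 \<and> ori v x a < 0)"
      using a F unfolding in_triangle_def by (auto simp: zero_less_mult_iff)
    then have "crosses a b v u \<or> crosses a b v x"
      using exit_pos[OF T' _ _ _ t ee] e a n F unfolding s
      by (auto simp: zero_less_mult_iff zero_le_mult_iff)
    then show ?thesis by blast
  qed
qed

section \<open>Paths, closed polygons and boundaries\<close>

fun path_edges :: "'a list \<Rightarrow> ('a \<times> 'a) list" where
  "path_edges (x # y # zs) = (x, y) # path_edges (y # zs)"
| "path_edges _ = []"

definition cycle_edges :: "'a list \<Rightarrow> ('a \<times> 'a) list" where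
  "cycle_edges xs = path_edges (xs @ [hd xs])"

definition path_weight :: "('a \<Rightarrow> 'a \<Rightarrow> real) \<Rightarrow> 'a list \<Rightarrow> real" where
  "path_weight w xs = (\<Sum>(a, b)\<leftarrow>path_edges xs. w a b)"

definition cycle_weight :: "('a \<Rightarrow> 'a \<Rightarrow> real) \<Rightarrow> 'a list \<Rightarrow> real" where
  "cycle_weight w xs = (\<Sum>(a, b)\<leftarrow>cycle_edges xs. w a b)"

text \<open>On an antisymmetric weight the contributions of an edge shared by two consistently oriented triangles cancel.\<close>

definition boundary :: "('a \<times> 'a \<times> 'a) list \<Rightarrow> ('a \<Rightarrow> 'a \<Rightarrow> real) \<Rightarrow> real" where
  "boundary D w = (\<Sum>(a, b, c)\<leftarrow>D. w a b + w b c + w c a)"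

definition antisym_weight :: "('a \<Rightarrow> 'a \<Rightarrow> real) \<Rightarrow> bool" where
  "antisym_weight w \<longleftrightarrow> (\<forall>a b. w a b = - w b a)"

definition cyclic_subseq :: "'a list \<Rightarrow> 'a \<Rightarrow> 'a \<Rightarrow> 'a \<Rightarrow> bool" where
  "cyclic_subseq xs a b c \<longleftrightarrow> subseq [a, b, c] xs \<or> subseq [b, c, a] xs \<or> subseq [c, a, b] xs"

text \<open>Only proper crossings are excluded. For distinct vertices in general position this is
  simplicity, since no vertex lies on a foreign edge.\<close>

definition simple :: "point list \<Rightarrow> bool" where
  "simple p \<longleftrightarrow> (\<forall>(a, b)\<in>set (cycle_edges p). \<forall>(c, d)\<in>set (cycle_edges p). \<not> crosses a b c d)"

text \<open>Here \<open>s\<close> is the orientation of the polygon, shared by all triangles.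
  Disjointness is not part of the notion; the common sign together with the boundary condition takes
  its place.\<close>

definition fills :: "point list \<Rightarrow> (point \<times> point \<times> point) list \<Rightarrow> real \<Rightarrow> bool" where
  "fills p D s \<longleftrightarrow> (s = 1 \<or> s = - 1) \<and> (\<forall>(a, b, c)\<in>set D. cyclic_subseq p a b c \<and> s * ori a b c > 0)
     \<and> (\<forall>w. antisym_weight w \<longrightarrow> boundary D w = cycle_weight w p)"

section \<open>Edges and weights of paths and cycles\<close>

lemma pe_append: "path_edges (xs @ y # ys) = path_edges (xs @ [y]) @ path_edges (y # ys)"
proof (induction xs)
  case (Cons a xs) then show ?case by (cases xs) auto
qed simp

lemma pe_zip: "path_edges xs = zip xs (tl xs)"
  by (induction xs rule: path_edges.induct) auto

lemma pe_mem: "(a, b) \<in> set (path_edges xs) \<Longrightarrow> a \<in> set xs \<and> b \<in> set xs"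
  by (induction xs rule: path_edges.induct) auto

lemma pe_neq: "distinct xs \<Longrightarrow> (a, b) \<in> set (path_edges xs) \<Longrightarrow> a \<noteq> b"
proof (induction xs rule: path_edges.induct)
  case (1 x y zs) then show ?case by (auto dest: pe_mem)
qed auto

lemma pe_last_notfst: "distinct xs \<Longrightarrow> (a, b) \<in> set (path_edges xs) \<Longrightarrow> a \<noteq> last xs"
proof (induction xs rule: path_edges.induct)
  case (1 x y zs) then show ?case by (auto dest: pe_mem)
qed auto

lemma pe_hd_notsnd: "distinct xs \<Longrightarrow> (a, b) \<in> set (path_edges xs) \<Longrightarrow> b \<noteq> hd xs"
  by (cases xs rule: path_edges.cases) (auto dest: pe_mem)

lemma ce_Cons: "q \<noteq> [] \<Longrightarrow> cycle_edges (v # q) = (v, hd q) # path_edges q @ [(last q, v)]"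
proof -
  assume "q \<noteq> []"
  then obtain r u where q: "q = r @ [u]" by (metis rev_exhaust)
  have "path_edges (v # q @ [v]) = (v, hd q) # path_edges (q @ [v])" using \<open>q \<noteq> []\<close> by (cases q) auto
  also have "path_edges (q @ [v]) = path_edges q @ [(u, v)]" unfolding q using pe_append[of r u "[v]"] by simp
  finally show ?thesis unfolding cycle_edges_def using q by simp
qed

lemma ce_pe: "q \<noteq> [] \<Longrightarrow> cycle_edges q = path_edges q @ [(last q, hd q)]"
proof -
  assume "q \<noteq> []"
  then obtain r u where q: "q = r @ [u]" by (metis rev_exhaust)
  show ?thesis unfolding cycle_edges_def q using pe_append[of r u "[hd (r @ [u])]"] by simp
qed

lemma ce_mem: "(a, b) \<in> set (cycle_edges xs) \<Longrightarrow> xs \<noteq> [] \<Longrightarrow> a \<in> set xs \<and> b \<in> set xs"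
  by (auto simp: ce_pe dest: pe_mem)

lemma pw_Nil [simp]: "path_weight w [] = 0" "path_weight w [x] = 0" and pw_Cons [simp]: "path_weight w (x # y # zs) = w x y + path_weight w (y # zs)"
  by (simp_all add: path_weight_def)

lemma pw_append: "path_weight w (xs @ y # ys) = path_weight w (xs @ [y]) + path_weight w (y # ys)"
  unfolding path_weight_def by (subst pe_append) simp

lemma cw_pw: "q \<noteq> [] \<Longrightarrow> cycle_weight w q = path_weight w q + w (last q) (hd q)"
  unfolding cycle_weight_def path_weight_def by (simp add: ce_pe)

lemma cw_Cons: "q \<noteq> [] \<Longrightarrow> cycle_weight w (v # q) = w v (hd q) + path_weight w q + w (last q) v"
  unfolding cycle_weight_def path_weight_def by (simp add: ce_Cons)

lemma ce_rotate: "set (cycle_edges (xs @ ys)) = set (cycle_edges (ys @ xs))"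
proof (cases "xs = [] \<or> ys = []")
  case False
  then obtain x xs' y ys' where x: "xs = x # xs'" and y: "ys = y # ys'" by (meson list.exhaust)
  have "path_edges ((x # xs') @ (y # ys') @ [x]) = path_edges ((x # xs') @ [y]) @ path_edges (y # ys' @ [x])"
    using pe_append[of "x # xs'" y "ys' @ [x]"] by simp
  moreover have "path_edges ((y # ys') @ (x # xs') @ [y]) = path_edges ((y # ys') @ [x]) @ path_edges (x # xs' @ [y])"
    using pe_append[of "y # ys'" x "xs' @ [y]"] by simp
  ultimately show ?thesis unfolding cycle_edges_def x y by auto
qed auto

lemma cw_rotate: "cycle_weight w (xs @ ys) = cycle_weight w (ys @ xs)"
proof (cases "xs = [] \<or> ys = []")
  case False
  then obtain x xs' y ys' where x: "xs = x # xs'" and y: "ys = y # ys'" by (meson list.exhaust)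
  have "path_edges ((x # xs') @ (y # ys') @ [x]) = path_edges ((x # xs') @ [y]) @ path_edges (y # ys' @ [x])"
    using pe_append[of "x # xs'" y "ys' @ [x]"] by simp
  moreover have "path_edges ((y # ys') @ (x # xs') @ [y]) = path_edges ((y # ys') @ [x]) @ path_edges (x # xs' @ [y])"
    using pe_append[of "y # ys'" x "xs' @ [y]"] by simp
  ultimately show ?thesis unfolding cycle_weight_def cycle_edges_def x y by simp
qed auto

lemma bd_Nil [simp]: "boundary [] w = 0"
  and bd_Cons [simp]: "boundary ((a, b, c) # D) w = w a b + w b c + w c a + boundary D w"
  and bd_append [simp]: "boundary (D @ E) w = boundary D w + boundary E w"
  by (simp_all add: boundary_def)

section \<open>Cyclic subsequences\<close>

lemma cseq_rot: "cyclic_subseq xs a b c \<Longrightarrow> cyclic_subseq xs b c a"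
  unfolding cyclic_subseq_def by blast

lemma cseq_subseq: "cyclic_subseq xs a b c \<Longrightarrow> subseq xs ys \<Longrightarrow> cyclic_subseq ys a b c"
  unfolding cyclic_subseq_def using subseq_order.trans by blast

lemma subseq3_rotate:
  assumes "subseq [a, b, c] (xs @ ys)" shows "cyclic_subseq (ys @ xs) a b c"
proof -
  obtain us vs where uv: "[a, b, c] = us @ vs" "subseq us xs" "subseq vs ys"
    using assms by (auto elim: subseq_appendE)
  have "subseq (vs @ us) (ys @ xs)" using uv by (simp add: list_emb_append_mono)
  moreover have "us = [] \<and> vs = [a,b,c] \<or> us = [a] \<and> vs = [b,c] \<or> us = [a,b] \<and> vs = [c] \<or> us = [a,b,c] \<and> vs = []"
    using uv(1) by (auto simp: Cons_eq_append_conv)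
  ultimately show ?thesis unfolding cyclic_subseq_def by (elim disjE) simp_all
qed

lemma cseq_rotate: "cyclic_subseq (xs @ ys) a b c \<Longrightarrow> cyclic_subseq (ys @ xs) a b c"
  unfolding cyclic_subseq_def[of "xs @ ys"] by (meson subseq3_rotate cseq_rot)

lemma subseq_mem: "subseq xs ys \<Longrightarrow> x \<in> set xs \<Longrightarrow> x \<in> set ys"
  by (erule list_emb_set) auto

lemma cseq_mem:
  assumes "cyclic_subseq xs a b c" shows "a \<in> set xs \<and> b \<in> set xs \<and> c \<in> set xs"
proof -
  have m: "a \<in> set [a,b,c]" "b \<in> set [a,b,c]" "c \<in> set [a,b,c]"
    "a \<in> set [b,c,a]" "b \<in> set [b,c,a]" "c \<in> set [b,c,a]"
    "a \<in> set [c,a,b]" "b \<in> set [c,a,b]" "c \<in> set [c,a,b]" by simp_all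
  show ?thesis using assms m unfolding cyclic_subseq_def by (blast intro: subseq_mem)
qed

lemma asymD: "antisym_weight w \<Longrightarrow> w a b = - w b a"
  unfolding antisym_weight_def by blast

section \<open>Ray weights\<close>

text \<open>The signed number of crossings of the segment from \<open>a\<close> to \<open>b\<close> with the ray from \<open>m\<close> through \<open>v\<close>.\<close>

definition ray_weight :: "point \<Rightarrow> point \<Rightarrow> point \<Rightarrow> point \<Rightarrow> real" where
  "ray_weight m v a b = (if ori m v a < 0 \<and> 0 < ori m v b \<and> ori m a b > 0 then 1 else 0)
               - (if ori m v b < 0 \<and> 0 < ori m v a \<and> ori m b a > 0 then 1 else 0)"

lemma asym_chi: "antisym_weight (ray_weight m v)"
  unfolding antisym_weight_def ray_weight_def by auto

text \<open>If \<open>a\<close> is alone on its side of the line through \<open>m\<close> and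
  \<open>v\<close>, the line meets the two edges at \<open>a\<close>, and for a positive triangle
  the one counted +1 lies farther along the ray. Hence whenever the ray meets the edge counted -1 it
  also meets the other.\<close>

lemma chi_core:
  assumes O: "ori a b c > 0"
  shows "ori m v a < 0 \<Longrightarrow> 0 < ori m v b \<Longrightarrow> 0 < ori m v c \<Longrightarrow> ori m a c > 0 \<Longrightarrow> ori m a b > 0"
    and "ori m v a > 0 \<Longrightarrow> 0 > ori m v b \<Longrightarrow> 0 > ori m v c \<Longrightarrow> ori m b a > 0 \<Longrightarrow> ori m c a > 0"
proof -
  have i1: "ori m a b * (ori m v c - ori m v a)
      = - ori a b c * ori m v a + ori m a c * (ori m v b - ori m v a)"
    by (simp add: ori_def algebra_simps)
  have s: "ori m c a = - ori m a c" "ori m b a = - ori m a b" by (rule ori_swap2)+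
  show "ori m a b > 0" if "ori m v a < 0" "0 < ori m v b" "0 < ori m v c" "ori m a c > 0"
  proof -
    have "- ori a b c * ori m v a > 0" "ori m a c * (ori m v b - ori m v a) > 0"
      using that O by (auto simp: mult_less_0_iff)
    then have "ori m a b * (ori m v c - ori m v a) > 0" using i1 by linarith
    then show ?thesis using that by (simp add: zero_less_mult_iff)
  qed
  show "ori m c a > 0" if h: "ori m v a > 0" "0 > ori m v b" "0 > ori m v c" "ori m b a > 0"
  proof -
    have "- ori a b c * ori m v a < 0" using h O by (auto simp: mult_less_0_iff)
    moreover have "ori m a b * (ori m v c - ori m v a) > 0"
      using h s by (auto simp: zero_less_mult_iff)
    ultimately have "ori m a c * (ori m v b - ori m v a) > 0" using i1 by linarith
    then show ?thesis using h s by (auto simp: zero_less_mult_iff)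
  qed
qed

text \<open>The line of the ray meets either no edge or two edges of the triangle, and in the second
  case \<open>chi_core\<close> pairs every count of -1 with a count of +1.\<close>

lemma chi_tri_nonneg:
  assumes O: "ori a b c > 0" and nz: "ori m v a \<noteq> 0" "ori m v b \<noteq> 0" "ori m v c \<noteq> 0"
  shows "ray_weight m v a b + ray_weight m v b c + ray_weight m v c a \<ge> 0"
proof -
  have O2: "ori b c a > 0" "ori c a b > 0" using O ori_rot[of b c a] ori_rot2[of c a b] by linarith+
  consider "ori m v a > 0" "ori m v b > 0" "ori m v c > 0" | "ori m v a < 0" "ori m v b > 0" "ori m v c > 0"
    | "ori m v a > 0" "ori m v b < 0" "ori m v c > 0" | "ori m v a > 0" "ori m v b > 0" "ori m v c < 0"
    | "ori m v a < 0" "ori m v b < 0" "ori m v c > 0" | "ori m v a < 0" "ori m v b > 0" "ori m v c < 0"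
    | "ori m v a > 0" "ori m v b < 0" "ori m v c < 0" | "ori m v a < 0" "ori m v b < 0" "ori m v c < 0"
    using nz unfolding neq_iff by blast
  then show ?thesis
  proof cases
    case 2 then show ?thesis using chi_core(1)[OF O, of m v] unfolding ray_weight_def by auto
  next
    case 3 then show ?thesis using chi_core(1)[OF O2(1), of m v] unfolding ray_weight_def by auto
  next
    case 4 then show ?thesis using chi_core(1)[OF O2(2), of m v] unfolding ray_weight_def by auto
  next
    case 5 then show ?thesis using chi_core(2)[OF O2(2), of m v] unfolding ray_weight_def by auto
  next
    case 6 then show ?thesis using chi_core(2)[OF O2(1), of m v] unfolding ray_weight_def by auto
  next
    case 7 then show ?thesis using chi_core(2)[OF O, of m v] unfolding ray_weight_def by auto
  qed (auto simp: ray_weight_def)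
qed

text \<open>From inside, the ray leaves the triangle through exactly one edge. The identity
  \<open>i\<close> excludes that all vertices are on one side of its line.\<close>

lemma chi_tri_inside:
  assumes O: "ori m a b > 0" "ori m b c > 0" "ori m c a > 0"
    and nz: "ori m v a \<noteq> 0" "ori m v b \<noteq> 0" "ori m v c \<noteq> 0"
  shows "ray_weight m v a b + ray_weight m v b c + ray_weight m v c a = 1"
proof -
  have s: "ori m b a < 0" "ori m c b < 0" "ori m a c < 0" 
    using O ori_swap2[of m b a] ori_swap2[of m c b] ori_swap2[of m a c] by linarith+
  have i: "ori m a b * ori m v c + ori m b c * ori m v a + ori m c a * ori m v b = 0"
    by (simp add: ori_def algebra_simps)
  have "\<not> (ori m v a > 0 \<and> ori m v b > 0 \<and> ori m v c > 0)"
    using i O by (smt (verit) mult_pos_pos)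
  moreover have "\<not> (ori m v a < 0 \<and> ori m v b < 0 \<and> ori m v c < 0)"
    using i O by (smt (verit) mult_pos_neg)
  ultimately show ?thesis using O s nz unfolding ray_weight_def by auto
qed

lemma chi_tri_sign:
  assumes s: "s = 1 \<or> s = - 1" and O: "s * ori a b c > 0"
    and nz: "ori m v a \<noteq> 0" "ori m v b \<noteq> 0" "ori m v c \<noteq> 0"
  shows "s * (ray_weight m v a b + ray_weight m v b c + ray_weight m v c a) \<ge> 0"
proof (cases "s = 1")
  case True then show ?thesis using chi_tri_nonneg[of a b c] O nz by simp
next
  case False
  then have s': "s = -1" using s by auto
  have "ori c b a > 0" using O s' ori_swap3[of c b a] by auto
  then have "ray_weight m v c b + ray_weight m v b a + ray_weight m v a c \<ge> 0" using chi_tri_nonneg nz by blast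
  then show ?thesis using s' asymD[OF asym_chi, of m v c b] asymD[OF asym_chi, of m v b a]
      asymD[OF asym_chi, of m v a c] by simp
qed

section \<open>Triangulating simple polygons\<close>

text \<open>At the point where the segment crosses \<open>x u\<close>, one of its endpoints is on
  the inner side of that line and yet outside the triangle, so \<open>exit_gen\<close> applies: an
  edge that spoils the ear would already cross one of its two polygon edges.\<close>

lemma ear_ok:
  assumes gen_pos: "gen_pos {a, b, v, x, u}" and T: "v \<noteq> x" "v \<noteq> u" "x \<noteq> u" "a \<noteq> v" "b \<noteq> v"
    and ni: "\<not> in_triangle v x u a" "\<not> in_triangle v x u b" and c: "crosses a b x u"
  shows "crosses a b v x \<or> crosses a b v u"
proof -
  let ?T = "ori v x u"
  have T0: "?T \<noteq> 0" using gpD[OF gen_pos, of v x u] T by auto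
  then have TT: "?T * ?T > 0" by (simp add: zero_less_mult_iff) linarith
  obtain s t where st: "0 < s" "s < 1" "0 < t" "t < 1"
    and e: "(1 - s) *\<^sub>R a + s *\<^sub>R b = (1 - t) *\<^sub>R x + t *\<^sub>R u"
    using crs_point[OF c] by metis
  define e' where "e' = (1 - s) *\<^sub>R a + s *\<^sub>R b"
  have e2: "e' = (1 - (1 - s)) *\<^sub>R b + (1 - s) *\<^sub>R a" unfolding e'_def by (simp add: algebra_simps)
  have "ori v x e' = t * ?T" "ori u v e' = (1 - t) * ?T" "ori x u e' = 0"
    unfolding e'_def e using aff_seg[of "ori v x"] aff_seg[of "ori u v"] aff_seg[of "ori x u"] ori_rot2[of u v x] ori_rot[of x u v] by simp_all
  then have F: "?T * ori v x e' > 0" "?T * ori u v e' > 0" "?T * ori x u e' \<ge> 0"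
    using TT st by (auto simp: mult.left_commute[of ?T])
  have "ori x u a * ori x u b < 0" using c unfolding crosses_def by auto
  then have "?T * ori x u a > 0 \<or> ?T * ori x u b > 0"
    using T0 by (auto simp: mult_less_0_iff zero_less_mult_iff)
  then show ?thesis
  proof
    assume "?T * ori x u a > 0"
    then show ?thesis using exit_gen[OF gen_pos T(1-3) F st(1,2) e'_def _ ni(1)] T crs_distinct[OF c] by auto
  next
    assume h: "?T * ori x u b > 0"
    have gp': "gen_pos {b, a, v, x, u}" using gen_pos by (simp add: insert_commute)
    have "crosses b a v x \<or> crosses b a v u"
      using exit_gen[OF gp' T(1-3) F _ _ e2 h ni(2)] T crs_distinct[OF c] st by auto
    then show ?thesis using crs_swap by blast
  qed
qed

lemma intri_sum: "ori v x z + ori x u z + ori u v z = ori v x u"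
  by (simp add: ori_def algebra_simps)

text \<open>The assumptions \<open>ni\<close> say that neither endpoint lying in the triangle is
  farther from \<open>x u\<close> than \<open>z\<close>. The crossing point on \<open>v z\<close> is
  farther than \<open>z\<close>, so one endpoint is too; it is therefore outside the triangle, and
  the segment leaves through a side at \<open>v\<close>.\<close>

lemma diag_ok:
  assumes gen_pos: "gen_pos {a, b, v, x, u}" and T: "v \<noteq> x" "v \<noteq> u" "x \<noteq> u"
    and z: "in_triangle v x u z"
    and ni: "in_triangle v x u a \<Longrightarrow> ori v x u * ori x u a \<le> ori v x u * ori x u z"
      "in_triangle v x u b \<Longrightarrow> ori v x u * ori x u b \<le> ori v x u * ori x u z"
    and c: "crosses a b v z"
  shows "crosses a b v x \<or> crosses a b v u"
proof -
  let ?T = "ori v x u"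
  have T0: "?T \<noteq> 0" using gpD[OF gen_pos, of v x u] T by auto
  obtain s t where st: "0 < s" "s < 1" "0 < t" "t < 1"
    and e: "(1 - s) *\<^sub>R a + s *\<^sub>R b = (1 - t) *\<^sub>R v + t *\<^sub>R z"
    using crs_point[OF c] by metis
  define e' where "e' = (1 - s) *\<^sub>R a + s *\<^sub>R b"
  have e2: "e' = (1 - (1 - s)) *\<^sub>R b + (1 - s) *\<^sub>R a" unfolding e'_def by (simp add: algebra_simps)
  have "ori v x e' = t * ori v x z" "ori u v e' = t * ori u v z"
    and h: "ori x u e' = (1 - t) * ?T + t * ori x u z"
    unfolding e'_def e using aff_seg[of "ori v x"] aff_seg[of "ori u v"] aff_seg[of "ori x u"] ori_rot2[of u v x] ori_rot[of x u v] by simp_all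
  then have F: "?T * ori v x e' > 0" "?T * ori u v e' > 0"
    using z st unfolding in_triangle_def by (auto simp: mult.left_commute[of ?T])
  have zigzag_between: "?T * ori x u z > 0" "?T * ori v x z > 0" "?T * ori u v z > 0"
    using z unfolding in_triangle_def by auto
  have "?T * (ori v x z + ori x u z + ori u v z) = ?T * ?T" by (simp only: intri_sum)
  then have lt: "?T * ori x u z < ?T * ?T" using zigzag_between by (simp add: algebra_simps)
  have "?T * ori x u e' = (1 - t) * (?T * ?T) + t * (?T * ori x u z)"
    unfolding h by (simp add: algebra_simps)
  moreover have "(1 - t) * (?T * ?T) > (1 - t) * (?T * ori x u z)" using lt st by simp
  ultimately have he: "?T * ori x u e' > ?T * ori x u z" by (simp add: algebra_simps)
  then have F3: "?T * ori x u e' \<ge> 0" using zigzag_between by linarith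
  have hue: "ori x u e' = (1 - s) * ori x u a + s * ori x u b"
    unfolding e'_def using aff_seg[of "ori x u"] by simp
  then have hab: "?T * ori x u e' = (1 - s) * (?T * ori x u a) + s * (?T * ori x u b)"
    unfolding hue by (simp add: algebra_simps)
  have "?T * ori x u a > ?T * ori x u z \<or> ?T * ori x u b > ?T * ori x u z"
  proof (rule ccontr)
    assume "\<not> ?thesis"
    then have "(1 - s) * (?T * ori x u a) \<le> (1 - s) * (?T * ori x u z)"
      "s * (?T * ori x u b) \<le> s * (?T * ori x u z)" using st by (auto intro: mult_left_mono)
    then have "?T * ori x u e' \<le> (1 - s) * (?T * ori x u z) + s * (?T * ori x u z)" using hab by linarith
    then show False using he by (simp add: algebra_simps)
  qed
  then show ?thesis
  proof
    assume g: "?T * ori x u a > ?T * ori x u z"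
    then have n: "\<not> in_triangle v x u a" "?T * ori x u a > 0" using ni zigzag_between by auto
    then show ?thesis using exit_gen[OF gen_pos T F F3 st(1,2) e'_def n(2,1)] T crs_distinct[OF c] by auto
  next
    assume g: "?T * ori x u b > ?T * ori x u z"
    then have n: "\<not> in_triangle v x u b" "?T * ori x u b > 0" using ni zigzag_between by auto
    have gp': "gen_pos {b, a, v, x, u}" using gen_pos by (simp add: insert_commute)
    have "crosses b a v x \<or> crosses b a v u"
      using exit_gen[OF gp' T F F3 _ _ e2 n(2,1)] T crs_distinct[OF c] st by auto
    then show ?thesis using crs_swap by blast
  qed
qed

lemma finite_argmax:
  fixes f :: "'a \<Rightarrow> real"
  assumes "finite A" "A \<noteq> {}"
  shows "\<exists>x\<in>A. \<forall>y\<in>A. f y \<le> f x"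
proof -
  have "Max (f ` A) \<in> f ` A" using assms by (intro Max_in) auto
  then obtain x where "x \<in> A" "f x = Max (f ` A)" by force
  then show ?thesis using assms by (intro bexI[of _ x]) auto
qed

lemma bd_pos_elem:
  assumes "boundary D w > 0"
  shows "\<exists>(a, b, c)\<in>set D. w a b + w b c + w c a > 0"
proof (rule ccontr)
  assume "\<not> ?thesis"
  then have "\<forall>x\<in>set (map (\<lambda>(a, b, c). - (w a b + w b c + w c a)) D). x \<ge> 0" by fastforce
  then have "(\<Sum>(a, b, c)\<leftarrow>D. - (w a b + w b c + w c a)) \<ge> 0" by (intro sum_list_nonneg) blast
  moreover have "(\<Sum>(a, b, c)\<leftarrow>D. - (w a b + w b c + w c a)) = - boundary D w"
    unfolding boundary_def by (induction D) auto
  ultimately show False using assms by simp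
qed

lemma pw_zero: "(\<And>a b. (a, b) \<in> set (path_edges q) \<Longrightarrow> w a b = 0) \<Longrightarrow> path_weight w q = 0"
  by (induction q rule: path_edges.induct) (auto simp: path_weight_def)

lemma bd_sign_zero:
  assumes "boundary D w = 0" "\<forall>(a, b, c)\<in>set D. s * (w a b + w b c + w c a) \<ge> 0"
  shows "\<forall>(a, b, c)\<in>set D. s * (w a b + w b c + w c a) = 0"
proof -
  have "(\<Sum>(a,b,c)\<leftarrow>D. s * (w a b + w b c + w c a)) = s * boundary D w"
    unfolding boundary_def by (simp add: sum_list_const_mult case_prod_unfold)
  then have z: "(\<Sum>t\<leftarrow>D. (case t of (a,b,c) \<Rightarrow> s * (w a b + w b c + w c a))) = 0" using assms by simp
  have "\<forall>x\<in>set (map (\<lambda>t. case t of (a,b,c) \<Rightarrow> s * (w a b + w b c + w c a)) D). x \<ge> 0"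
    using assms(2) by (auto simp: case_prod_unfold)
  then have "\<forall>x\<in>set (map (\<lambda>t. case t of (a,b,c) \<Rightarrow> s * (w a b + w b c + w c a)) D). x = 0"
    using z sum_list_nonneg_eq_0_iff by blast
  then show ?thesis by (force simp: case_prod_unfold)
qed

lemma bd_sign_nonneg:
  assumes "\<forall>(a, b, c)\<in>set D. s * (w a b + w b c + w c a) \<ge> 0"
  shows "s * boundary D w \<ge> 0"
proof -
  have "(\<Sum>(a,b,c)\<leftarrow>D. s * (w a b + w b c + w c a)) = s * boundary D w"
    unfolding boundary_def by (simp add: sum_list_const_mult case_prod_unfold)
  moreover have "(\<Sum>(a,b,c)\<leftarrow>D. s * (w a b + w b c + w c a)) \<ge> 0"
    using assms by (intro sum_list_nonneg) (auto simp: case_prod_unfold)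
  ultimately show ?thesis by simp
qed

lemma fills_mem:
  assumes "fills p D s" "(a, b, c) \<in> set D"
  shows "a \<in> set p" "b \<in> set p" "c \<in> set p" "s * ori a b c > 0"
  using assms cseq_mem[of p a b c] unfolding fills_def by auto

text \<open>In an open half-plane bounded by a line through \<open>v\<close> the angular order
  around \<open>v\<close> is linear and measured by a slope: \<open>h\<close> is a coordinate along
  the boundary line, \<open>f\<close> one across it, and \<open>h / f\<close> the slope. The factor
  \<open>N\<close> is the squared gradient of \<open>f\<close>.\<close>

lemma slope_exists:
  assumes f: "affine_fun f" "f v = 0" and nz: "f p \<noteq> 0"
  shows "\<exists>g :: point \<Rightarrow> real. \<forall>y z. f y > 0 \<longrightarrow> f z > 0 \<longrightarrow> (g y < g z \<longleftrightarrow> ori v y z > 0)"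
proof -
  obtain \<alpha> \<beta> \<gamma> where fe: "\<And>x. f x = \<alpha> * x$1 + \<beta> * x$2 + \<gamma>" using f(1) unfolding affine_fun_def by auto
  define h where "h y = - \<beta> * (y$1 - v$1) + \<alpha> * (y$2 - v$2)" for y :: point
  define N where "N = \<alpha> * \<alpha> + \<beta> * \<beta>"
  have f2: "f y = \<alpha> * (y$1 - v$1) + \<beta> * (y$2 - v$2)" for y
    using fe[of y] fe[of v] f(2) by (simp add: algebra_simps)
  have "\<alpha> \<noteq> 0 \<or> \<beta> \<noteq> 0" using nz f2 by auto
  then have N: "N > 0" unfolding N_def by (metis sum_squares_gt_zero_iff)
  have det: "f y * h z - h y * f z = N * ori v y z" for y z
    unfolding f2 h_def N_def ori_def by (simp add: algebra_simps)
  have "h y / f y < h z / f z \<longleftrightarrow> ori v y z > 0" if "f y > 0" "f z > 0" for y z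
  proof -
    have "h y / f y < h z / f z \<longleftrightarrow> h y * f z < h z * f y" using that by (simp add: divide_simps)
    also have "\<dots> \<longleftrightarrow> N * ori v y z > 0" using det[of y z] by (simp add: algebra_simps)
    also have "\<dots> \<longleftrightarrow> ori v y z > 0" using N by (simp add: zero_less_mult_iff)
    finally show ?thesis .
  qed
  then show ?thesis by (intro exI[of _ "\<lambda>y. h y / f y"]) blast
qed

text \<open>At a vertex that is extreme the sign is read off with the weight given by the slope as seen from it.\<close>

lemma sign_at_extreme:
  assumes F: "fills (v # q) D s" and f: "affine_fun f" "f v = 0" "\<And>y. y \<in> set q \<Longrightarrow> f y > 0"
    and q: "q \<noteq> []" and nz: "ori v (hd q) (last q) \<noteq> 0"
  shows "s * ori v (hd q) (last q) > 0"
proof -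
  have vq: "v \<notin> set q" using f(2) f(3)[of v] by auto
  have hl: "f (hd q) > 0" "f (last q) > 0" using f(3) q by auto
  then have "f (hd q) \<noteq> 0" by simp
  from slope_exists[OF f(1,2) this] obtain g :: "point \<Rightarrow> real"
    where "\<forall>y z. f y > 0 \<longrightarrow> f z > 0 \<longrightarrow> (g y < g z \<longleftrightarrow> ori v y z > 0)" ..
  then have g: "g y < g z \<longleftrightarrow> ori v y z > 0" if "f y > 0" "f z > 0" for y z using that by simp
  have s: "s = 1 \<or> s = - 1" using F unfolding fills_def by auto
  have gpos: "s * (g y - g z) < 0" if "s * ori v y z > 0" "f y > 0" "f z > 0" for y z
    using s that g[of y z] g[of z y] ori_swap2[of v z y] by auto
  \<comment> \<open>Only edges at \<open>v\<close> carry weight. A triangle with vertices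
    \<open>v\<close>, \<open>b\<close>, \<open>c\<close> contributes \<open>g b - g c\<close>,
    always of the sign opposite to \<open>s\<close>, and of the cycle only its two edges at
    \<open>v\<close> remain.\<close>
  define w where "w a b = (if a = v \<and> b \<noteq> v then g b else if b = v \<and> a \<noteq> v then - g a else 0)" for a b
  have antisym_weight: "antisym_weight w" unfolding antisym_weight_def w_def by auto
  have tri: "- s * (w a b + w b c + w c a) \<ge> 0" if "(a, b, c) \<in> set D" for a b c
  proof -
    note m = fills_mem[OF F that]
    have ne: "a \<noteq> b" "b \<noteq> c" "a \<noteq> c" using m(4) by auto
    have O: "s * ori b c a > 0" "s * ori c a b > 0" using m(4) ori_rot[of b c a] ori_rot2[of c a b] by simp_all
    have fp: "y \<in> set (v # q) \<Longrightarrow> y \<noteq> v \<Longrightarrow> f y > 0" for y using f(3) by auto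
    consider "a = v" | "b = v" | "c = v" | "a \<noteq> v" "b \<noteq> v" "c \<noteq> v" by blast
    then show ?thesis
    proof cases
      case 1 then show ?thesis using gpos[of b c] m fp[of b] fp[of c] ne unfolding w_def by (auto simp: algebra_simps)
    next
      case 2 then show ?thesis using gpos[of c a] O m fp[of a] fp[of c] ne unfolding w_def by (auto simp: algebra_simps)
    next
      case 3 then show ?thesis using gpos[of a b] O m fp[of a] fp[of b] ne unfolding w_def by (auto simp: algebra_simps)
    qed (simp add: w_def)
  qed
  have "- s * boundary D w \<ge> 0" using bd_sign_nonneg[of D "- s" w] tri by auto
  moreover have "boundary D w = cycle_weight w (v # q)" using F antisym_weight unfolding fills_def by auto
  moreover have "path_weight w q = 0"
  proof -
    show ?thesis by (rule pw_zero) (use pe_mem[of _ _ q] vq in \<open>auto simp: w_def\<close>)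
  qed
  moreover have "hd q \<noteq> v" "last q \<noteq> v" using vq q by auto
  ultimately have le: "- s * (g (hd q) - g (last q)) \<ge> 0"
    using q by (simp add: cw_Cons w_def algebra_simps)
  show ?thesis using s le nz g[OF hl] g[OF hl(2,1)] ori_swap2[of v "last q" "hd q"] by auto
qed

text \<open>The ray from a generic point of the new edge towards the cut-off vertex meets no edge of the rest.\<close>

lemma ear_sign:
  assumes F: "fills q D s" and f: "affine_fun f" "f v = 0" "\<And>y. y \<in> set q \<Longrightarrow> f y > 0"
    and gen_pos: "gen_pos (insert v (set q))" and d: "distinct q" "length q \<ge> 3"
    and xu: "x = hd q" "u = last q"
    and nc: "\<And>a b. (a, b) \<in> set (path_edges q) \<Longrightarrow> \<not> crosses a b v x \<and> \<not> crosses a b v u"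
    and ni: "\<And>z. z \<in> set q \<Longrightarrow> \<not> in_triangle v x u z"
  shows "s * ori v x u > 0"
proof -
  let ?T = "ori v x u"
  have vq: "v \<notin> set q" using f(2) f(3)[of v] by auto
  have "q \<noteq> []" using d by auto
  then have xuq: "x \<in> set q" "u \<in> set q" using xu by auto
  have "x \<noteq> u"
  proof (cases q rule: path_edges.cases)
    case (1 a b r)
    then have "u \<in> set (b # r)" using xu by auto
    then show ?thesis using 1 xu d by auto
  qed (use d in auto)
  have ne: "v \<noteq> x" "v \<noteq> u" "x \<noteq> u" using xuq vq \<open>x \<noteq> u\<close> by auto
  have T0: "?T \<noteq> 0" using gpD[OF gen_pos, of v x u] ne xuq by auto
  \<comment> \<open>The origin of the ray lies on the closing edge \<open>u x\<close> of
    \<open>q\<close>. All but finitely many \<open>t\<close> keep every vertex of \<open>q\<close>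
    off the line through it and \<open>v\<close>.\<close>
  define m where "m t = (1 - t) *\<^sub>R x + t *\<^sub>R u" for t
  have om: "ori (m t) v p = (1 - t) * ori x v p + t * ori u v p" for t p
    unfolding m_def by (simp add: ori_def algebra_simps)
  have fin: "finite {t. ori (m t) v p = 0}" if p: "p \<in> set q" for p
  proof -
    have "p \<noteq> v" using p vq by auto
    have nz: "ori x v p \<noteq> 0 \<or> ori u v p \<noteq> 0"
      using gpD[OF gen_pos, of x v p] gpD[OF gen_pos, of u v p] p xuq ne \<open>p \<noteq> v\<close> by (cases "p = x") auto
    have "t = t'" if "ori (m t) v p = 0" "ori (m t') v p = 0" for t t'
    proof -
      have "(t - t') * (ori u v p - ori x v p) = 0" using that unfolding om by (simp add: algebra_simps)
      then have "t = t' \<or> ori u v p = ori x v p" by auto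
      moreover have "ori x v p = 0" if "ori u v p = ori x v p"
        using \<open>ori (m t) v p = 0\<close> that unfolding om by (simp add: algebra_simps)
      ultimately show ?thesis using nz by auto
    qed
    then have "\<exists>t0. {t. ori (m t) v p = 0} \<subseteq> {t0}" by blast
    then show ?thesis by (meson finite.emptyI finite_insert finite_subset)
  qed
  have "finite (\<Union>p\<in>set q. {t. ori (m t) v p = 0})" using fin by auto
  moreover have "infinite {0<..<1::real}" by (simp add: infinite_Ioo)
  ultimately have "infinite ({0<..<1} - (\<Union>p\<in>set q. {t. ori (m t) v p = 0}))" by (rule Diff_infinite_finite)
  then have "{0<..<1} - (\<Union>p\<in>set q. {t. ori (m t) v p = 0}) \<noteq> {}" by (metis finite.emptyI)
  then obtain t where "t \<in> {0<..<1} - (\<Union>p\<in>set q. {t. ori (m t) v p = 0})" by blast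
  then have t: "0 < t" "t < 1" and gen: "\<And>p. p \<in> set q \<Longrightarrow> ori (m t) v p \<noteq> 0" by auto
  let ?m = "m t"
  have fm: "f ?m > 0" unfolding m_def aff_seg[OF f(1)] using t f(3)[OF xuq(1)] f(3)[OF xuq(2)]
    by (simp add: add_pos_pos)
  have bad: False if path_edges: "(a, b) \<in> set (path_edges q) \<or> (b, a) \<in> set (path_edges q)" and h: "ori ?m v a < 0" "0 < ori ?m v b" "ori ?m a b > 0" for a b
  proof -
    have ab: "a \<in> set q" "b \<in> set q" using path_edges pe_mem[of _ _ q] by auto
    \<comment> \<open>Since \<open>f\<close> vanishes at \<open>v\<close> and is positive on the
      path, an edge that meets the ray meets it before \<open>v\<close>, hence inside the triangle
      \<open>v x u\<close>.\<close>
    have "f v * ori a b ?m - f ?m * ori a b v + f b * ori ?m v a - f a * ori ?m v b = 0"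
      by (rule crs_balance[OF f(1), of v a b ?m])
    moreover have "f b * ori ?m v a < 0" "f a * ori ?m v b > 0"
      using h f(3) ab by (auto simp: mult_less_0_iff)
    ultimately have "f ?m * ori a b v < 0" using f(2) by simp
    then have neg: "ori a b v < 0" using fm by (simp add: mult_less_0_iff)
    have pos: "ori a b ?m > 0" using h ori_rot[of a b ?m] by simp
    have "crosses a b v ?m" unfolding crosses_def using neg pos h ori_swap[of v ?m a] ori_swap[of v ?m b]
      by (simp add: mult_less_0_iff)
    then obtain r r' where r: "0 < r" "r < 1" "0 < r'" "r' < 1"
      and e: "(1 - r) *\<^sub>R a + r *\<^sub>R b = (1 - r') *\<^sub>R v + r' *\<^sub>R ?m"
      using crs_point by metis
    define e' where "e' = (1 - r) *\<^sub>R a + r *\<^sub>R b"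
    have e2: "e' = (1 - (1 - r)) *\<^sub>R b + (1 - r) *\<^sub>R a" unfolding e'_def by (simp add: algebra_simps)
    have TT: "?T * ?T > 0" using T0 by (simp add: zero_less_mult_iff) linarith
    have "ori v x ?m = t * ?T" "ori u v ?m = (1 - t) * ?T" "ori x u ?m = 0"
      unfolding m_def using aff_seg[of "ori v x"] aff_seg[of "ori u v"] aff_seg[of "ori x u"] ori_rot2[of u v x]
      by simp_all
    then have "ori v x e' = (r' * t) * ?T" "ori u v e' = (r' * (1 - t)) * ?T" "ori x u e' = (1 - r') * ?T"
      unfolding e'_def e using aff_seg[of "ori v x"] aff_seg[of "ori u v"] aff_seg[of "ori x u"] ori_rot[of x u v]
      by simp_all
    then have F3: "?T * ori v x e' > 0" "?T * ori u v e' > 0" "?T * ori x u e' > 0"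
      using TT r t by (auto simp: mult.left_commute[of ?T])
    have hue: "ori x u e' = (1 - r) * ori x u a + r * ori x u b"
      unfolding e'_def using aff_seg[of "ori x u"] by simp
    then have "?T * ori x u e' = (1 - r) * (?T * ori x u a) + r * (?T * ori x u b)"
      unfolding hue by (simp add: algebra_simps)
    then have "?T * ori x u a > 0 \<or> ?T * ori x u b > 0"
      using F3(3) r by (smt (verit) mult_nonneg_nonpos)
    moreover have "a \<noteq> b" using path_edges pe_neq[OF d(1)] by metis
    moreover have "a \<noteq> v" "b \<noteq> v" using ab vq by auto
    moreover have gp1: "gen_pos {a, b, v, x, u}" by (rule gp_subset[OF gen_pos]) (use ab xuq in auto)
    moreover have gp2: "gen_pos {b, a, v, x, u}" by (rule gp_subset[OF gen_pos]) (use ab xuq in auto)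
    ultimately have "crosses a b v x \<or> crosses a b v u \<or> crosses b a v x \<or> crosses b a v u"
      using exit_gen[OF gp1 ne F3(1,2) less_imp_le[OF F3(3)] r(1,2) e'_def _ ni[OF ab(1)]]
        exit_gen[OF gp2 ne F3(1,2) less_imp_le[OF F3(3)] _ _ e2 _ ni[OF ab(2)]] r by auto
    then show False using nc path_edges crs_swap(1) by blast
  qed
  have chi0: "ray_weight ?m v a b = 0" if e: "(a, b) \<in> set (path_edges q)" for a b
    using bad[of a b] bad[of b a] e unfolding ray_weight_def by auto
  have mx: "ori ?m x y = t * ori u x y" "ori ?m u y = (1 - t) * ori x u y" for y
    unfolding m_def by (simp_all add: ori_def algebra_simps)
  \<comment> \<open>The closing edge contains the origin of the ray, so the strict inequality on
    \<open>ori\<close> excludes it from the count.\<close>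
  have "ray_weight ?m v u x = 0" unfolding ray_weight_def using mx(1)[of u] mx(2)[of x] by simp
  moreover have q0: "q \<noteq> []" using d by auto
  ultimately have "cycle_weight (ray_weight ?m v) q = 0" using pw_zero[of q "ray_weight ?m v"] chi0 xu by (simp add: cw_pw)
  then have bd0: "boundary D (ray_weight ?m v) = 0" using F asym_chi unfolding fills_def by auto
  have s: "s = 1 \<or> s = - 1" using F unfolding fills_def by auto
  have Z: "s * (ray_weight ?m v a b + ray_weight ?m v b c + ray_weight ?m v c a) = 0" if "(a, b, c) \<in> set D" for a b c
  proof -
    have nn: "s * (ray_weight ?m v a b + ray_weight ?m v b c + ray_weight ?m v c a) \<ge> 0" if "(a, b, c) \<in> set D" for a b c
      by (rule chi_tri_sign[OF s fills_mem(4)[OF F that]]) (use fills_mem[OF F that] gen in auto)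
    have "\<forall>(a, b, c)\<in>set D. s * (ray_weight ?m v a b + ray_weight ?m v b c + ray_weight ?m v c a) \<ge> 0"
      using nn by auto
    from bd_sign_zero[OF bd0 this] that show ?thesis by auto
  qed
  \<comment> \<open>This weight sees only the closing edge, so some triangle must have
    \<open>u x\<close> as a directed edge.\<close>
  define w where "w a b = (if a = u \<and> b = x then 1 else if a = x \<and> b = u then - 1 else 0 :: real)" for a b
  have antisym_weight: "antisym_weight w" unfolding antisym_weight_def w_def using ne by auto
  have "path_weight w q = 0"
  proof (rule pw_zero)
    fix a b assume e: "(a, b) \<in> set (path_edges q)"
    have "a \<noteq> u" using pe_last_notfst[OF d(1) e] xu by simp
    moreover have "\<not> (a = x \<and> b = u)"
    proof
      assume h: "a = x \<and> b = u"
      obtain x' y z r where "q = x' # y # z # r" using d(2) by (auto simp: numeral_3_eq_3 Suc_le_length_iff)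
      then have q: "q = x # y # z # r" using xu by simp
      have "last q \<in> set (z # r)" unfolding q using last_in_set[of "z # r"] by simp
      then have "u \<noteq> y" using d(1) unfolding xu(2) q by auto
      have "(x, u) \<in> set (path_edges (y # z # r))" using e h \<open>u \<noteq> y\<close> unfolding q by simp
      then have "x \<in> set (y # z # r)" using pe_mem by metis
      then show False using d(1) q by auto
    qed
    ultimately show "w a b = 0" unfolding w_def by auto
  qed
  then have "cycle_weight w q = 1" using q0 xu by (simp add: cw_pw w_def)
  then have "boundary D w > 0" using F antisym_weight unfolding fills_def by auto
  then obtain a b c where abc: "(a, b, c) \<in> set D" and pos: "w a b + w b c + w c a > 0"
    using bd_pos_elem by fast
  have "\<exists>y. y \<in> set q \<and> s * ori u x y > 0 \<and> ray_weight ?m v u x + ray_weight ?m v x y + ray_weight ?m v y u = 0"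
  proof -
    note mem = fills_mem[OF F abc]
    have z: "ray_weight ?m v a b + ray_weight ?m v b c + ray_weight ?m v c a = 0" using Z[OF abc] s by auto
    have "(a = u \<and> b = x) \<or> (b = u \<and> c = x) \<or> (c = u \<and> a = x)"
      using pos unfolding w_def by (auto split: if_splits)
    then show ?thesis
    proof (elim disjE conjE)
      assume "a = u" "b = x" then show ?thesis using mem z by blast
    next
      assume "b = u" "c = x" then show ?thesis using mem z ori_rot[of u x a] by (intro exI[of _ a]) simp
    next
      assume "c = u" "a = x" then show ?thesis using mem z ori_rot2[of u x b] by (intro exI[of _ b]) simp
    qed
  qed
  then obtain y where y: "y \<in> set q" "s * ori u x y > 0"
    and cz: "ray_weight ?m v u x + ray_weight ?m v x y + ray_weight ?m v y u = 0" by blast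
  let ?K = "ori u x y"
  have K0: "?K \<noteq> 0" using y by auto
  have ax: "ori ?m v x = t * ?T" and au: "ori ?m v u = - (1 - t) * ?T"
    unfolding m_def by (simp_all add: ori_def algebra_simps)
  have oxy: "ori ?m x y = t * ?K" "ori ?m y x = - t * ?K" "ori ?m u y = - (1 - t) * ?K" "ori ?m y u = (1 - t) * ?K"
    unfolding m_def by (simp_all add: ori_def algebra_simps)
  \<comment> \<open>Were the third vertex \<open>y\<close> on the same side of \<open>x u\<close> as
    \<open>v\<close>, the ray would start into this triangle and leave it through one of the other
    two edges, although its count is zero.\<close>
  have "?K * ?T > 0"
  proof (rule ccontr)
    assume "\<not> ?thesis"
    then consider "?T > 0" "?K < 0" | "?T < 0" "?K > 0"
      using T0 K0 by (auto simp: zero_less_mult_iff)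
    then show False
    proof cases
      case 1
      have "ori ?m v x > 0" "ori ?m v u < 0" "ori ?m x y < 0" "ori ?m y x > 0" "ori ?m u y > 0" "ori ?m y u < 0"
        unfolding ax au oxy using 1 t by (simp_all add: mult_less_0_iff zero_less_mult_iff)
      then show False using cz gen[OF y(1)] \<open>ray_weight ?m v u x = 0\<close> unfolding ray_weight_def[of _ _ x y] ray_weight_def[of _ _ y u]
        by (cases "ori ?m v y > 0") auto
    next
      case 2
      have "ori ?m v x < 0" "ori ?m v u > 0" "ori ?m x y > 0" "ori ?m y x < 0" "ori ?m u y < 0" "ori ?m y u > 0"
        unfolding ax au oxy using 2 t by (simp_all add: mult_less_0_iff zero_less_mult_iff)
      then show False using cz gen[OF y(1)] \<open>ray_weight ?m v u x = 0\<close> unfolding ray_weight_def[of _ _ x y] ray_weight_def[of _ _ y u]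
        by (cases "ori ?m v y > 0") auto
    qed
  qed
  then show ?thesis using y(2) s by (auto simp: zero_less_mult_iff mult_less_0_iff)
qed

lemma simple_insert_edge:
  assumes sub: "set (cycle_edges p) \<subseteq> insert (g, h) E"
    and E: "\<And>a b c d. (a, b) \<in> E \<Longrightarrow> (c, d) \<in> E \<Longrightarrow> \<not> crosses a b c d"
    and gh: "\<And>a b. (a, b) \<in> E \<Longrightarrow> \<not> crosses a b g h"
  shows "simple p"
proof -
  have "\<not> crosses a b c d" if "(a, b) \<in> set (cycle_edges p)" "(c, d) \<in> set (cycle_edges p)" for a b c d
  proof (cases "(a, b) = (g, h)")
    case True
    show ?thesis
    proof (cases "(c, d) = (g, h)")
      case True
      then show ?thesis using \<open>(a, b) = (g, h)\<close> by (auto dest: crs_distinct)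
    next
      case False
      then have "\<not> crosses c d g h" using that(2) sub by (intro gh) auto
      then show ?thesis using True crs_sym[of c d g h] by simp
    qed
  next
    case False
    then have ab: "(a, b) \<in> E" using that(1) sub by auto
    show ?thesis
    proof (cases "(c, d) = (g, h)")
      case True
      then show ?thesis using gh[OF ab] by simp
    next
      case False
      then have "(c, d) \<in> E" using that(2) sub by auto
      then show ?thesis by (rule E[OF ab])
    qed
  qed
  then show ?thesis unfolding simple_def by fast
qed

text \<open>Cut at the vertex \<open>v\<close> farthest from the origin, either
  cutting off the ear at \<open>v\<close> or along the diagonal from \<open>v\<close> to the deepest vertex inside that ear.\<close>

theorem simple_polygon_fills:
  assumes "distinct p" "length p \<ge> 3" "gen_pos (set p)" "simple p"
  shows "\<exists>D s. fills p D s"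
  using assms
proof (induction "length p" arbitrary: p rule: less_induct)
  case less
  have p0: "p \<noteq> []" using less.prems by auto
  obtain v where v: "v \<in> set p" and vmax: "\<And>y. y \<in> set p \<Longrightarrow> inner y y \<le> inner v v"
    using finite_argmax[of "set p" "\<lambda>y. inner y y"] p0 by auto
  obtain ys zs where split: "p = ys @ v # zs" using split_list[OF v] by auto
  define q where "q = zs @ ys"
  have dq: "distinct (v # q)" "set (v # q) = set p" and lq: "length p = Suc (length q)"
    using less.prems(1) unfolding split q_def by auto
  have gpq: "gen_pos (insert v (set q))" using less.prems(3) dq by simp
  have ceq: "set (cycle_edges (v # q)) = set (cycle_edges p)" unfolding split q_def using ce_rotate[of ys "v # zs"] by simp
  have sim: "\<not> crosses a b c d" if "(a, b) \<in> set (cycle_edges (v # q))" "(c, d) \<in> set (cycle_edges (v # q))" for a b c d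
    using less.prems(4) that unfolding simple_def ceq by fast
  have bk: "\<exists>D s. fills p D s" if F: "fills (v # q) D s" for D s
  proof -
    have cs: "cyclic_subseq p a b c" if "cyclic_subseq (v # q) a b c" for a b c
      using that cseq_rotate[of "v # zs" ys a b c] unfolding split q_def by simp
    have cc: "cycle_weight w (v # q) = cycle_weight w p" for w unfolding split q_def using cw_rotate[of w ys "v # zs"] by simp
    have "fills p D s" using F unfolding fills_def cc by (auto intro: cs)
    then show ?thesis by blast
  qed
  \<comment> \<open>The tangent at \<open>v\<close> to the circle around the origin through
    \<open>v\<close>: by the choice of \<open>v\<close> all other vertices lie strictly on its inner
    side.\<close>
  define f where "f y = inner v (v - y)" for y
  have "f y = v$1 * (v$1 - y$1) + v$2 * (v$2 - y$2)" for y
    unfolding f_def inner_vec_def sum_2 by simp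
  then have "\<forall>y. f y = (- v$1) * y$1 + (- v$2) * y$2 + (v$1 * v$1 + v$2 * v$2)"
    by (simp add: algebra_simps)
  then have faff: "affine_fun f" unfolding affine_fun_def by blast
  have f0: "f v = 0" unfolding f_def by simp
  have fpos: "f y > 0" if "y \<in> set q" for y
  proof -
    have "y \<noteq> v" using that dq by auto
    then have "inner (v - y) (v - y) > 0" by simp
    moreover have "inner y y \<le> inner v v" using vmax that dq by auto
    ultimately show ?thesis unfolding f_def by (simp add: inner_diff_left inner_diff_right inner_commute)
  qed
  have l2: "length q \<ge> 2" using less.prems(2) lq by simp
  then have q0: "q \<noteq> []" by auto
  define x where "x = hd q"
  define u where "u = last q"
  have xuq: "x \<in> set q" "u \<in> set q" unfolding x_def u_def using q0 by auto
  have "x \<noteq> u" using l2 dq unfolding x_def u_def by (cases q) (auto simp: Suc_le_eq)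
  then have ne: "v \<noteq> x" "v \<noteq> u" "x \<noteq> u" using xuq dq by auto
  have T0: "ori v x u \<noteq> 0" using gpD[OF gpq, of v x u] ne xuq by auto
  have cev: "cycle_edges (v # q) = (v, x) # path_edges q @ [(u, v)]" using ce_Cons[OF q0] unfolding x_def u_def .
  show ?case
  proof (cases "length q = 2")
    case True
    then have q: "q = [x, u]" unfolding x_def u_def by (cases q rule: path_edges.cases) auto
    have "fills (v # q) [(v, x, u)] (sgn (ori v x u))"
      unfolding fills_def q using T0
      by (auto simp: cyclic_subseq_def sgn_if cycle_weight_def cycle_edges_def)
    then show ?thesis by (rule bk)
  next
    case False
    then have l3: "length q \<ge> 3" using l2 by simp
    show ?thesis
    proof (cases "\<exists>z\<in>set q. in_triangle v x u z")
      case False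
      have ok: "\<not> crosses a b x u" if "(a, b) \<in> set (path_edges q)" for a b
      proof
        assume c: "crosses a b x u"
        have ab: "a \<in> set q" "b \<in> set q" using pe_mem[OF that] by auto
        have "gen_pos {a, b, v, x, u}" by (rule gp_subset[OF gpq]) (use ab xuq in auto)
        then have "crosses a b v x \<or> crosses a b v u" using ear_ok[OF _ ne] c False ab dq by auto
        then show False using sim[of a b v x] sim[of a b u v] that cev crs_swap(2) by auto
      qed
      have cq: "set (cycle_edges q) = insert (u, x) (set (path_edges q))" using ce_pe[OF q0] unfolding x_def u_def by auto
      have "simple q"
      proof (rule simple_insert_edge)
        show "set (cycle_edges q) \<subseteq> insert (u, x) (set (path_edges q))" using cq by simp
        show "\<not> crosses a b c d" if "(a, b) \<in> set (path_edges q)" "(c, d) \<in> set (path_edges q)" for a b c d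
          using sim[of a b c d] that cev by simp
        show "\<not> crosses a b u x" if "(a, b) \<in> set (path_edges q)" for a b using ok[OF that] crs_swap(2)[of a b u x] by simp
      qed
      moreover have "gen_pos (set q)" by (rule gp_subset[OF gpq]) auto
      ultimately obtain D s where F: "fills q D s" using less.hyps[of q] lq l3 dq by auto
      have sg: "s * ori v x u > 0"
      proof (rule ear_sign[OF F faff f0 fpos gpq _ l3 x_def u_def])
        show "distinct q" using dq by auto
        show "\<not> crosses a b v x \<and> \<not> crosses a b v u" if "(a, b) \<in> set (path_edges q)" for a b
          using sim[of a b v x] sim[of a b u v] that cev crs_swap(2)[of a b u v] by auto
        show "\<not> in_triangle v x u z" if "z \<in> set q" for z using False that by auto
      qed
      have "fills (v # q) ((v, x, u) # D) s"
        unfolding fills_def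
      proof (intro conjI allI impI ballI)
        show "s = 1 \<or> s = - 1" using F unfolding fills_def by auto
        show "case t of (a, b, c) \<Rightarrow> cyclic_subseq (v # q) a b c \<and> 0 < s * ori a b c" if "t \<in> set ((v, x, u) # D)" for t
        proof (cases "t = (v, x, u)")
          case True
          obtain r where "q = x # r" unfolding x_def using q0 by (cases q) auto
          moreover have "u \<in> set r" using calculation xuq ne by auto
          ultimately have "subseq [v, x, u] (v # q)" by (simp add: subseq_singleton_left)
          then show ?thesis using True sg by (simp add: cyclic_subseq_def)
        next
          case False
          have "subseq q (v # q)" by auto
          then show ?thesis using F False that cseq_subseq unfolding fills_def by fastforce
        qed
        show "boundary ((v, x, u) # D) w = cycle_weight w (v # q)" if "antisym_weight w" for w
        proof -
          have "boundary D w = cycle_weight w q" using F that unfolding fills_def by auto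
          then show ?thesis using cw_Cons[OF q0, of w v] cw_pw[OF q0, of w] asymD[OF that, of x u] x_def u_def by simp
        qed
      qed
      then show ?thesis by (rule bk)
    next
      case True
      define H where "H z = ori v x u * ori x u z" for z
      have "finite {z\<in>set q. in_triangle v x u z}" "{z\<in>set q. in_triangle v x u z} \<noteq> {}" using True by auto
      then obtain z where z: "z \<in> set q" "in_triangle v x u z"
        and zmax: "\<And>z'. z' \<in> set q \<Longrightarrow> in_triangle v x u z' \<Longrightarrow> H z' \<le> H z"
        using finite_argmax[of "{z\<in>set q. in_triangle v x u z}" H] by auto
      have ok: "\<not> crosses a b v z" if "(a, b) \<in> set (cycle_edges (v # q))" for a b
      proof
        assume c: "crosses a b v z"
        have ab: "a \<in> set q" "b \<in> set q" using ce_mem[OF that] crs_distinct[OF c] by auto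
        have "gen_pos {a, b, v, x, u}" by (rule gp_subset[OF gpq]) (use ab xuq in auto)
        then have "crosses a b v x \<or> crosses a b v u"
          using diag_ok[OF _ ne z(2) _ _ c] zmax[OF ab(1)] zmax[OF ab(2)] unfolding H_def by auto
        then show False using sim[OF that, of v x] sim[OF that, of u v] cev crs_swap(2) by auto
      qed
      have zne: "z \<noteq> x" "z \<noteq> u" "z \<noteq> v" using z unfolding in_triangle_def by auto
      obtain q1 q2 where q: "q = q1 @ z # q2" using split_list[OF z(1)] by auto
      have q1: "q1 \<noteq> []" using zne(1) unfolding x_def q by (cases q1) auto
      have q2: "q2 \<noteq> []" using zne(2) unfolding u_def q by (cases q2 rule: rev_cases) auto
      have x1: "hd q1 = x" unfolding x_def q using q1 by simp
      have u2: "last q2 = u" unfolding u_def q using q2 by simp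
      let ?p1 = "v # q1 @ [z]" and ?p2 = "v # z # q2"
      have pq: "path_edges q = path_edges (q1 @ [z]) @ path_edges (z # q2)" unfolding q by (rule pe_append)
      have ce1: "cycle_edges ?p1 = (v, x) # path_edges (q1 @ [z]) @ [(z, v)]" using ce_Cons[of "q1 @ [z]" v] x1 q1 by simp
      have ce2: "cycle_edges ?p2 = (v, z) # path_edges (z # q2) @ [(u, v)]" using ce_Cons[of "z # q2" v] u2 q2 by simp
      have okz: "\<not> crosses a b z v" if "(a, b) \<in> set (cycle_edges (v # q))" for a b
        using ok[OF that] crs_swap(2)[of a b z v] by simp
      have sub1: "set (cycle_edges ?p1) \<subseteq> insert (z, v) (set (cycle_edges (v # q)))" unfolding ce1 cev pq by auto
      have sub2: "set (cycle_edges ?p2) \<subseteq> insert (v, z) (set (cycle_edges (v # q)))" unfolding ce2 cev pq by auto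
      have s1: "simple ?p1" by (rule simple_insert_edge[OF sub1 sim okz])
      have s2: "simple ?p2" by (rule simple_insert_edge[OF sub2 sim ok])
      have g1: "gen_pos (set ?p1)" "gen_pos (set ?p2)" by (rule gp_subset[OF gpq], use q in auto)+
      have "\<exists>D s. fills ?p1 D s"
        by (rule less.hyps) (use lq q q1 q2 dq g1 s1 in \<open>auto simp: Suc_le_eq numeral_eq_Suc\<close>)
      then obtain D1 r1 where F1: "fills ?p1 D1 r1" by auto
      have "\<exists>D s. fills ?p2 D s"
        by (rule less.hyps) (use lq q q1 q2 dq g1 s2 in \<open>auto simp: Suc_le_eq numeral_eq_Suc\<close>)
      then obtain D2 r2 where F2: "fills ?p2 D2 r2" by auto
      have zi: "ori v x u * ori v x z > 0" "ori v x u * ori u v z > 0" using z(2) unfolding in_triangle_def by auto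
      have n1: "ori v x z \<noteq> 0" "ori v z u \<noteq> 0" using zi ori_rot[of v z u] by auto
      have "r1 * ori v (hd (q1 @ [z])) (last (q1 @ [z])) > 0"
        by (rule sign_at_extreme[OF F1 faff f0]) (use fpos q q1 x1 n1 in auto)
      then have sg1: "r1 * ori v x z > 0" using q1 x1 by simp
      have "r2 * ori v (hd (z # q2)) (last (z # q2)) > 0"
        by (rule sign_at_extreme[OF F2 faff f0]) (use fpos q q2 u2 n1 in auto)
      then have sg2: "r2 * ori u v z > 0" using q2 u2 ori_rot[of v z u] by simp
      have rr: "r1 = 1 \<or> r1 = - 1" "r2 = 1 \<or> r2 = - 1" using F1 F2 unfolding fills_def by auto
      \<comment> \<open>The vertex \<open>v\<close> is extreme in both parts and \<open>z\<close>
        lies within the angle at \<open>v\<close>, so both orientations agree with that of the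
        ear.\<close>
      have r: "r1 = r2" using sg1 sg2 zi rr by (auto simp: zero_less_mult_iff)
      have ss: "subseq ?p1 (v # q)" "subseq ?p2 (v # q)"
        unfolding q using q1 subseq_drop_many[of "z # q2" "z # q2" q1] by (auto intro!: list_emb_append_mono)
      have "fills (v # q) (D1 @ D2) r1"
        unfolding fills_def
      proof (intro conjI allI impI ballI)
        show "case t of (a, b, c) \<Rightarrow> cyclic_subseq (v # q) a b c \<and> 0 < r1 * ori a b c" if "t \<in> set (D1 @ D2)" for t
          using F1 F2 ss that cseq_subseq unfolding fills_def r by fastforce
        show "boundary (D1 @ D2) w = cycle_weight w (v # q)" if "antisym_weight w" for w
        proof -
          have "boundary D1 w = cycle_weight w ?p1" "boundary D2 w = cycle_weight w ?p2" using F1 F2 that unfolding fills_def by auto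
          moreover have "cycle_weight w ?p1 = w v x + path_weight w (q1 @ [z]) + w z v" using cw_Cons[of "q1 @ [z]" w v] q1 x1 by simp
          moreover have "cycle_weight w ?p2 = w v z + path_weight w (z # q2) + w u v" using cw_Cons[of "z # q2" w v] q2 u2 by simp
          moreover have "cycle_weight w (v # q) = w v x + path_weight w q + w u v" using cw_Cons[OF q0, of w v] x_def u_def by simp
          moreover have "path_weight w q = path_weight w (q1 @ [z]) + path_weight w (z # q2)" unfolding q by (rule pw_append)
          ultimately show ?thesis using asymD[OF that, of z v] by simp
        qed
      qed (use rr in auto)
      then show ?thesis by (rule bk)
    qed
  qed
qed

section \<open>The covering degree of a family of triangles\<close>

definition hull_cycle :: "point set \<Rightarrow> point list \<Rightarrow> bool" where
  "hull_cycle V vs \<longleftrightarrow> distinct vs \<and> length vs \<ge> 3 \<and> set vs \<subseteq> V \<and>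
     (\<forall>(a, b)\<in>set (cycle_edges vs). \<forall>p\<in>V. p \<noteq> a \<longrightarrow> p \<noteq> b \<longrightarrow> ori a b p > 0)"

text \<open>Positive triangles with the right boundary, nothing more. That they cover the hull
  exactly once, apart from points on finitely many lines, is derived by counting along rays.\<close>

definition covers :: "point set \<Rightarrow> point list \<Rightarrow> (point \<times> point \<times> point) list \<Rightarrow> bool" where
  "covers V vs D \<longleftrightarrow> finite V \<and> gen_pos V \<and> hull_cycle V vs \<and>
     (\<forall>(a, b, c)\<in>set D. a \<in> V \<and> b \<in> V \<and> c \<in> V \<and> ori a b c > 0) \<and>
     (\<forall>w. antisym_weight w \<longrightarrow> boundary D w = cycle_weight w vs)"

definition inside :: "point \<times> point \<times> point \<Rightarrow> point \<Rightarrow> bool" where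
  "inside t y \<longleftrightarrow> (case t of (a, b, c) \<Rightarrow> ori a b y > 0 \<and> ori b c y > 0 \<and> ori c a y > 0)"

section \<open>Successors and sign changes on a cycle\<close>

lemma map_fst_ce: "map fst (cycle_edges xs) = xs"
proof -
  have "map fst (path_edges (xs @ [x])) = xs" for x :: 'a
    by (induction xs rule: path_edges.induct) auto
  then show ?thesis unfolding cycle_edges_def by simp
qed

lemma distinct_ce: "distinct xs \<Longrightarrow> distinct (cycle_edges xs)"
  by (metis distinct_map map_fst_ce)

lemma ce_fst_inj: "distinct xs \<Longrightarrow> (a, b) \<in> set (cycle_edges xs) \<Longrightarrow> (a, c) \<in> set (cycle_edges xs) \<Longrightarrow> b = c"
proof -
  assume d: "distinct xs" "(a, b) \<in> set (cycle_edges xs)" "(a, c) \<in> set (cycle_edges xs)"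
  have "inj_on fst (set (cycle_edges xs))" using d(1) by (metis distinct_map map_fst_ce)
  then have "(a, b) = (a, c)" using d(2,3) by (metis fst_conv inj_onD)
  then show "b = c" by simp
qed

lemma ce_ex: "a \<in> set xs \<Longrightarrow> \<exists>b. (a, b) \<in> set (cycle_edges xs)"
proof -
  assume "a \<in> set xs"
  then have "a \<in> fst ` set (cycle_edges xs)" by (metis map_fst_ce list.set_map)
  then show ?thesis by force
qed

lemma pe_switch: "P (hd xs) \<Longrightarrow> x \<in> set xs \<Longrightarrow> \<not> P x \<Longrightarrow> \<exists>(a, b)\<in>set (path_edges xs). P a \<and> \<not> P b"
proof (induction xs rule: path_edges.induct)
  case (1 x' y zs) then show ?case by (cases "P y") auto
qed auto

lemma ce_switch:
  assumes "x \<in> set xs" "P x" "y \<in> set xs" "\<not> P y"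
  shows "\<exists>(a, b)\<in>set (cycle_edges xs). P a \<and> \<not> P b"
proof -
  obtain us vs where xs: "xs = us @ x # vs" using split_list[OF assms(1)] by auto
  have "\<exists>(a, b)\<in>set (path_edges (x # vs @ us @ [x])). P a \<and> \<not> P b"
    by (rule pe_switch[of P _ y]) (use assms xs in auto)
  moreover have "set (path_edges (x # vs @ us @ [x])) = set (cycle_edges xs)"
    unfolding xs using ce_rotate[of us "x # vs"] by (simp add: cycle_edges_def)
  ultimately show ?thesis by simp
qed

lemma pw_telescope: "xs \<noteq> [] \<Longrightarrow> path_weight (\<lambda>a b. g b - g a) xs = g (last xs) - g (hd xs)"
  by (induction xs rule: path_edges.induct) auto

lemma cw_telescope: "xs \<noteq> [] \<Longrightarrow> cycle_weight (\<lambda>a b. g b - g a) xs = 0"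
  by (simp add: cw_pw pw_telescope)

text \<open>A ray from an interior point leaves a convex polygon exactly once. Were all vertices on
  one side of its line, their slope around \<open>m\<close> would increase along the whole cycle and
  return to its start; two edges changing sign in the same direction contradict convexity.\<close>

lemma hull_ray:
  assumes h: "distinct vs" "vs \<noteq> []" "\<And>a b p. (a, b) \<in> set (cycle_edges vs) \<Longrightarrow> p \<in> set vs \<Longrightarrow> p \<noteq> a \<Longrightarrow> p \<noteq> b \<Longrightarrow> ori a b p > 0"
    and m: "\<And>a b. (a, b) \<in> set (cycle_edges vs) \<Longrightarrow> ori a b m > 0"
    and nz: "\<And>p. p \<in> set vs \<Longrightarrow> ori m v p \<noteq> 0"
  shows "cycle_weight (ray_weight m v) vs = 1"
proof -
  have c: "ray_weight m v a b = (if ori m v a < 0 \<and> ori m v b > 0 then 1 else 0)" if "(a, b) \<in> set (cycle_edges vs)" for a b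
    using m[OF that] ori_rot2[of m a b] ori_swap2[of m b a] unfolding ray_weight_def by auto
  have same: False if s: "s = 1 \<or> s = - 1" and all: "\<And>p. p \<in> set vs \<Longrightarrow> s * ori m v p > 0" for s
  proof -
    define f where "f y = s * ori m v y + 0 * ori m v y" for y
    have fa: "affine_fun f" unfolding f_def by (rule aff_comb) auto
    have fp: "p \<in> set vs \<Longrightarrow> f p > 0" for p using all unfolding f_def by simp
    then have "f (hd vs) \<noteq> 0" using h(2) by (metis hd_in_set less_irrefl)
    moreover have "f m = 0" unfolding f_def by simp
    ultimately have "\<exists>g :: point \<Rightarrow> real. \<forall>y z. f y > 0 \<longrightarrow> f z > 0 \<longrightarrow> (g y < g z \<longleftrightarrow> ori m y z > 0)"
      using slope_exists[OF fa] by blast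
    then obtain g :: "point \<Rightarrow> real" where g: "\<forall>y z. f y > 0 \<longrightarrow> f z > 0 \<longrightarrow> (g y < g z \<longleftrightarrow> ori m y z > 0)" ..
    have p: "g b - g a > 0" if "(a, b) \<in> set (cycle_edges vs)" for a b
      using g fp ce_mem[OF that h(2)] m[OF that] ori_rot2[of m a b] by simp
    have ne: "cycle_edges vs \<noteq> []" using h(2) map_fst_ce by (metis list.map_disc_iff)
    then obtain a b where ab: "(a, b) \<in> set (cycle_edges vs)" by (metis hd_in_set surj_pair)
    have z: "cycle_weight (\<lambda>a b. g b - g a) vs = 0" by (rule cw_telescope[OF h(2)])
    have "\<forall>x\<in>set (map (\<lambda>(a, b). g b - g a) (cycle_edges vs)). x \<ge> 0" using p by (auto intro: less_imp_le)
    then have "\<forall>x\<in>set (map (\<lambda>(a, b). g b - g a) (cycle_edges vs)). x = 0"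
      using z unfolding cycle_weight_def using sum_list_nonneg_eq_0_iff by blast
    then show False using p[OF ab] ab by auto
  qed
  have "\<exists>x\<in>set vs. ori m v x < 0" using same[of 1] nz by force
  then obtain x where x: "x \<in> set vs" "ori m v x < 0" by blast
  have "\<exists>y\<in>set vs. ori m v y > 0" using same[of "- 1"] nz by force
  then obtain y where y: "y \<in> set vs" "\<not> ori m v y < 0" by force
  from ce_switch[of x vs "\<lambda>p. ori m v p < 0", OF x y] obtain a b
    where ab: "(a, b) \<in> set (cycle_edges vs)" "ori m v a < 0" "\<not> ori m v b < 0" by auto
  have abv: "a \<in> set vs" "b \<in> set vs" using ce_mem[OF ab(1) h(2)] by auto
  have b: "ori m v b > 0" using ab(3) nz[OF abv(2)] by linarith
  have uniq: "(c', d) = (a, b)" if cd: "(c', d) \<in> set (cycle_edges vs)" "ori m v c' < 0" "ori m v d > 0" for c' d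
  proof (rule ccontr)
    assume ne: "(c', d) \<noteq> (a, b)"
    have cdv: "c' \<in> set vs" "d \<in> set vs" using ce_mem[OF cd(1) h(2)] by auto
    have ne1: "c' \<noteq> b" "d \<noteq> a" using cd ab b by auto
    have ca: "c' \<noteq> a" using ce_fst_inj[OF h(1)] ab(1) cd(1) ne by auto
    have p1: "ori a b c' > 0" using h(3)[OF ab(1) cdv(1)] ca ne1 by auto
    have p2: "ori a b d \<ge> 0" using h(3)[OF ab(1) cdv(2)] ne1 by (cases "d = b") auto
    have p3: "ori c' d a > 0" using h(3)[OF cd(1) abv(1)] ca ne1 by auto
    have p4: "ori c' d b \<ge> 0" using h(3)[OF cd(1) abv(2)] ne1 by (cases "d = b") auto
    let ?A = "ori m v a" and ?B = "ori m v b" and ?C = "ori m v c'" and ?D = "ori m v d"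
    \<comment> \<open>The sum vanishes identically, while the positions of the two edges make each
      bracket positive.\<close>
    have "(?D * ori a b c' - ?C * ori a b d) + (?B * ori c' d a - ?A * ori c' d b) = 0"
      by (simp add: ori_def algebra_simps)
    moreover have "?D * ori a b c' > 0" "?C * ori a b d \<le> 0" "?B * ori c' d a > 0" "?A * ori c' d b \<le> 0"
      using p1 p2 p3 p4 ab b cd by (auto simp: mult_le_0_iff)
    ultimately show False by linarith
  qed
  have "cycle_weight (ray_weight m v) vs = (\<Sum>e\<leftarrow>cycle_edges vs. if e = (a, b) then 1 else 0)"
    unfolding cycle_weight_def
  proof (rule arg_cong[where f = sum_list], rule map_cong[OF refl])
    fix e assume e: "e \<in> set (cycle_edges vs)"
    obtain c' d where cd: "e = (c', d)" by (cases e)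
    show "(case e of (a, b) \<Rightarrow> ray_weight m v a b) = (if e = (a, b) then 1 else 0)"
    proof (cases "ori m v c' < 0 \<and> ori m v d > 0")
      case True
      then have "(c', d) = (a, b)" using uniq e cd by blast
      then show ?thesis using c[OF e[unfolded cd]] True cd by simp
    next
      case False
      then have "(c', d) \<noteq> (a, b)" using ab b by auto
      then show ?thesis using c[OF e[unfolded cd]] False cd by simp
    qed
  qed
  also have "\<dots> = (\<Sum>e\<in>set (cycle_edges vs). if e = (a, b) then 1 else 0)"
    by (rule sum_list_distinct_conv_sum_set[OF distinct_ce[OF h(1)]])
  also have "\<dots> = 1" using ab(1) by simp
  finally show ?thesis .
qed

section \<open>Generic points\<close>

lemma at_right_eventually_pos:
  fixes A B :: real
  assumes "A > 0" shows "\<forall>\<^sub>F d in at_right 0. A + d * B > 0"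
proof -
  have "((\<lambda>d. A + d * B) \<longlongrightarrow> A + 0 * B) (at_right 0)" by (intro tendsto_intros)
  then show ?thesis using order_tendstoD(1)[of _ "A" "at_right 0" 0] assms by simp
qed

text \<open>A small step from \<open>y\<close> in a direction parallel to no segment between points
  of \<open>V\<close> leaves every such line through \<open>y\<close> and violates no strict
  inequality.\<close>

lemma near_generic:
  assumes V: "finite V"
  shows "\<exists>m. \<forall>a\<in>V. \<forall>b\<in>V. a \<noteq> b \<longrightarrow> ori a b m \<noteq> 0 \<and> (ori a b y > 0 \<longrightarrow> ori a b m > 0)"
proof -
  have "finite {t. (b$1 - a$1) * t = b$2 - a$2}" if "a \<noteq> b" for a b :: point
  proof (cases "b$1 = a$1")
    case True
    then have "b$2 \<noteq> a$2" using that by (auto simp: vec_eq_iff forall_2)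
    then have "{t. (b$1 - a$1) * t = b$2 - a$2} = {}" using True by auto
    then show ?thesis by simp
  next
    case False
    then have "{t. (b$1 - a$1) * t = b$2 - a$2} = {(b$2 - a$2) / (b$1 - a$1)}" by (auto simp: field_simps)
    then show ?thesis by simp
  qed
  then have "finite (\<Union>p\<in>{p \<in> V \<times> V. fst p \<noteq> snd p}. {t. (snd p$1 - fst p$1) * t = snd p$2 - fst p$2})"
    using V by (intro finite_UN_I) auto
  then obtain t where "t \<notin> (\<Union>p\<in>{p \<in> V \<times> V. fst p \<noteq> snd p}. {t. (snd p$1 - fst p$1) * t = snd p$2 - fst p$2})"
    using ex_new_if_finite[OF infinite_UNIV_char_0] by blast
  then have t: "(b$1 - a$1) * t \<noteq> b$2 - a$2" if "a \<in> V" "b \<in> V" "a \<noteq> b" for a b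
    using that by auto
  \<comment> \<open>The direction has slope \<open>t\<close>, chosen different from the slopes of
    all pairs; \<open>S a b\<close> is the rate at which the orientation changes and is therefore
    nonzero.\<close>
  define m where "m d = (vector [y$1 + d, y$2 + d * t] :: point)" for d
  define S where "S a b = (b$1 - a$1) * t - (b$2 - a$2)" for a b :: point
  have om: "ori a b (m d) = ori a b y + d * S a b" for a b d
    unfolding m_def S_def by (simp add: ori_def algebra_simps)
  have ev: "\<forall>\<^sub>F d in at_right 0. ori a b (m d) \<noteq> 0 \<and> (ori a b y > 0 \<longrightarrow> ori a b (m d) > 0)"
    if "a \<in> V" "b \<in> V" "a \<noteq> b" for a b
  proof -
    consider "ori a b y > 0" | "ori a b y < 0" | "ori a b y = 0" by linarith
    then show ?thesis
    proof cases
      case 1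
      show ?thesis using at_right_eventually_pos[OF 1, of "S a b"] unfolding om by eventually_elim auto
    next
      case 2
      then have "- ori a b y > 0" by simp
      from at_right_eventually_pos[OF this, of "- S a b"] show ?thesis
        unfolding om by eventually_elim (use 2 in auto)
    next
      case 3
      have "S a b \<noteq> 0" using t[OF that] unfolding S_def by auto
      then show ?thesis unfolding om 3 using eventually_at_right_less[of "0::real"] by (auto elim: eventually_mono)
    qed
  qed
  have "\<forall>\<^sub>F d in at_right 0. \<forall>p\<in>{p \<in> V \<times> V. fst p \<noteq> snd p}. ori (fst p) (snd p) (m d) \<noteq> 0 \<and>
      (ori (fst p) (snd p) y > 0 \<longrightarrow> ori (fst p) (snd p) (m d) > 0)"
    by (rule eventually_ball_finite) (use V ev in auto)
  from eventually_happens[OF this] obtain d where "\<forall>p\<in>{p \<in> V \<times> V. fst p \<noteq> snd p}. ori (fst p) (snd p) (m d) \<noteq> 0 \<and>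
      (ori (fst p) (snd p) y > 0 \<longrightarrow> ori (fst p) (snd p) (m d) > 0)"
    using trivial_limit_at_right_real by blast
  then show ?thesis by (intro exI[of _ "m d"]) auto
qed

lemma generic_direction:
  assumes V: "finite V" and m: "m \<notin> V"
  shows "\<exists>v. \<forall>p\<in>V. ori m v p \<noteq> 0"
proof -
  have fin: "finite {t. (p$1 - m$1) * t = p$2 - m$2}" if "p \<noteq> m" for p :: point
  proof (cases "p$1 = m$1")
    case True
    then have "p$2 \<noteq> m$2" using that by (auto simp: vec_eq_iff forall_2)
    then have "{t. (p$1 - m$1) * t = p$2 - m$2} = {}" using True by auto
    then show ?thesis by simp
  next
    case False
    then have "{t. (p$1 - m$1) * t = p$2 - m$2} = {(p$2 - m$2) / (p$1 - m$1)}" by (auto simp: field_simps)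
    then show ?thesis by simp
  qed
  have "finite (\<Union>p\<in>V. {t. (p$1 - m$1) * t = p$2 - m$2})"
    by (rule finite_UN_I[OF V], rule fin) (use m in auto)
  then obtain t where "t \<notin> (\<Union>p\<in>V. {t. (p$1 - m$1) * t = p$2 - m$2})"
    using ex_new_if_finite[OF infinite_UNIV_char_0] by blast
  then have "ori m (vector [m$1 + 1, m$2 + t]) p \<noteq> 0" if "p \<in> V" for p
    using that by (auto simp: ori_def algebra_simps)
  then show ?thesis by blast
qed

section \<open>Triangles covering a convex polygon once\<close>

lemma hullp_nonneg:
  assumes "hull_cycle V vs" "(a, b) \<in> set (cycle_edges vs)" "p \<in> V"
  shows "ori a b p \<ge> 0" "p \<noteq> a \<Longrightarrow> p \<noteq> b \<Longrightarrow> ori a b p > 0"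
proof -
  show g: "p \<noteq> a \<Longrightarrow> p \<noteq> b \<Longrightarrow> ori a b p > 0" using assms unfolding hull_cycle_def by auto
  then show "ori a b p \<ge> 0" by (cases "p = a \<or> p = b") auto
qed

lemma inside_hull:
  assumes h: "hull_cycle V vs" and t: "a \<in> V" "b \<in> V" "c \<in> V" "ori a b c > 0" and i: "inside (a, b, c) y"
    and e: "(p, q) \<in> set (cycle_edges vs)"
  shows "ori p q y > 0"
proof -
  have i: "ori a b y > 0" "ori b c y > 0" "ori c a y > 0" using i unfolding inside_def by auto
  have r: "ori y b c = ori b c y" "ori a y c = ori c a y" by (rule ori_rot[symmetric], rule ori_rot2[symmetric])
  have B: "ori p q y * ori a b c = ori p q a * ori b c y + ori p q b * ori c a y + ori p q c * ori a b y"
    using aff_bary[OF aff_ori, of p q y a b c] unfolding r .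
  have n: "ori p q a \<ge> 0" "ori p q b \<ge> 0" "ori p q c \<ge> 0" using hullp_nonneg(1)[OF h e] t by auto
  have "ori p q a > 0 \<or> ori p q b > 0 \<or> ori p q c > 0"
  proof -
    have "a \<noteq> b" "b \<noteq> c" "a \<noteq> c" using t by auto
    then have "(a \<noteq> p \<and> a \<noteq> q) \<or> (b \<noteq> p \<and> b \<noteq> q) \<or> (c \<noteq> p \<and> c \<noteq> q)" by metis
    then show ?thesis using hullp_nonneg(2)[OF h e] t by blast
  qed
  moreover have "ori p q a * ori b c y \<ge> 0" "ori p q b * ori c a y \<ge> 0" "ori p q c * ori a b y \<ge> 0"
    using n i by auto
  moreover have "ori p q a > 0 \<Longrightarrow> ori p q a * ori b c y > 0" "ori p q b > 0 \<Longrightarrow> ori p q b * ori c a y > 0"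
    "ori p q c > 0 \<Longrightarrow> ori p q c * ori a b y > 0" using i by auto
  ultimately have "ori p q y * ori a b c > 0" unfolding B by linarith
  then show ?thesis using t(4) by (simp add: zero_less_mult_iff)
qed

lemma covers_mem:
  assumes "covers V vs D" "(a, b, c) \<in> set D"
  shows "a \<in> V" "b \<in> V" "c \<in> V" "ori a b c > 0"
  using assms unfolding covers_def by auto

lemma chi_one:
  assumes C: "covers V vs D" and t: "(a, b, c) \<in> set D" and i: "inside (a, b, c) y" and v: "\<forall>p\<in>V. ori y v p \<noteq> 0"
  shows "ray_weight y v a b + ray_weight y v b c + ray_weight y v c a = 1"
proof -
  have "ori y a b > 0" "ori y b c > 0" "ori y c a > 0"
    using i ori_rot2[of y a b] ori_rot2[of y b c] ori_rot2[of y c a] unfolding inside_def by auto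
  then show ?thesis using chi_tri_inside v covers_mem[OF C t] by blast
qed

lemma covers_degree:
  assumes C: "covers V vs D" and gen: "\<forall>p\<in>V. ori y v p \<noteq> 0"
    and h: "\<And>p q. (p, q) \<in> set (cycle_edges vs) \<Longrightarrow> ori p q y > 0"
  shows "boundary D (ray_weight y v) = 1"
proof -
  have H: "hull_cycle V vs" using C unfolding covers_def by auto
  then have vs: "distinct vs" "vs \<noteq> []" "set vs \<subseteq> V" unfolding hull_cycle_def by auto
  have "cycle_weight (ray_weight y v) vs = 1"
    by (rule hull_ray[OF vs(1,2) _ h]) (use hullp_nonneg(2)[OF H] vs(3) gen in auto)
  then show ?thesis using C asym_chi unfolding covers_def by auto
qed

lemma covers_chi_nonneg:
  assumes C: "covers V vs D" and gen: "\<forall>p\<in>V. ori y v p \<noteq> 0" and E: "set E \<subseteq> set D"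
  shows "boundary E (ray_weight y v) \<ge> 0"
proof -
  have "ray_weight y v a b + ray_weight y v b c + ray_weight y v c a \<ge> 0" if "(a, b, c) \<in> set E" for a b c
    by (rule chi_tri_nonneg) (use covers_mem[OF C] that E gen in auto)
  then have "\<forall>(a, b, c)\<in>set E. 1 * (ray_weight y v a b + ray_weight y v b c + ray_weight y v c a) \<ge> 0" by auto
  from bd_sign_nonneg[OF this] show ?thesis by simp
qed

lemma notin_of_generic:
  assumes "card V \<ge> 2" "\<forall>a\<in>V. \<forall>b\<in>V. a \<noteq> b \<longrightarrow> ori a b m \<noteq> 0"
  shows "m \<notin> V"
proof
  assume "m \<in> V"
  have "\<exists>b\<in>V. b \<noteq> m"
  proof (rule ccontr)
    assume "\<not> ?thesis"
    then have "V \<subseteq> {m}" by auto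
    then have "card V \<le> 1" by (metis card.empty card_insert_disjoint card_mono empty_iff finite.emptyI finite.insertI One_nat_def)
    then show False using assms(1) by simp
  qed
  then show False using assms(2) \<open>m \<in> V\<close> by (metis ori_same(2))
qed

lemma covers_card: "covers V vs D \<Longrightarrow> card V \<ge> 2"
proof -
  assume C: "covers V vs D"
  then have "distinct vs" "length vs \<ge> 3" "set vs \<subseteq> V" "finite V" unfolding covers_def hull_cycle_def by auto
  then have "3 \<le> card V" by (metis card_mono distinct_card order_trans)
  then show ?thesis by simp
qed

text \<open>Perturbed to a generic point, \<open>y\<close> has degree 1, but both triangles
  contribute 1 and no other triangle is negative. Decomposing the list distinguishes occurrences, so
  a repeated triangle is excluded as well.\<close>

lemma covers_disjoint:
  assumes C: "covers V vs D" and D: "D = D1 @ t1 # D2 @ t2 # D3"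
    and i: "inside t1 y" "inside t2 y"
  shows False
proof -
  obtain a b c where t1: "t1 = (a, b, c)" by (cases t1)
  obtain p q r where t2: "t2 = (p, q, r)" by (cases t2)
  have m1: "(a, b, c) \<in> set D" and m2: "(p, q, r) \<in> set D" using D t1 t2 by auto
  note c1 = covers_mem[OF C m1] and c2 = covers_mem[OF C m2]
  have V: "finite V" and H: "hull_cycle V vs" using C unfolding covers_def by auto
  from near_generic[OF V, of y] obtain m where
    m: "\<forall>a\<in>V. \<forall>b\<in>V. a \<noteq> b \<longrightarrow> ori a b m \<noteq> 0 \<and> (ori a b y > 0 \<longrightarrow> ori a b m > 0)" ..
  have pos: "ori a b m > 0" if "a \<in> V" "b \<in> V" "ori a b y > 0" for a b
    using m that by (cases "a = b") auto
  have i1: "inside (a, b, c) m" using i(1) pos c1 unfolding t1 inside_def by auto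
  have i2: "inside (p, q, r) m" using i(2) pos c2 unfolding t2 inside_def by auto
  have "m \<notin> V" by (rule notin_of_generic[OF covers_card[OF C]]) (use m in auto)
  from generic_direction[OF V this] obtain v where v: "\<forall>p\<in>V. ori m v p \<noteq> 0" ..
  have d: "boundary D (ray_weight m v) = 1" by (rule covers_degree[OF C v]) (rule inside_hull[OF H c1 i1])
  have "boundary D (ray_weight m v) = boundary D1 (ray_weight m v) + 1 + boundary D2 (ray_weight m v) + 1 + boundary D3 (ray_weight m v)"
    unfolding D t1 t2 using chi_one[OF C m1 i1 v] chi_one[OF C m2 i2 v] by simp
  moreover have "boundary D1 (ray_weight m v) \<ge> 0" "boundary D2 (ray_weight m v) \<ge> 0" "boundary D3 (ray_weight m v) \<ge> 0"
    by (rule covers_chi_nonneg[OF C v], use D in auto)+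
  ultimately show False using d by simp
qed

text \<open>For a triangle \<open>a b c\<close> seen from \<open>m\<close>, the numbers
  \<open>X\<close>, \<open>Y\<close>, \<open>Z\<close> are the areas over its edges and
  \<open>A\<close>, \<open>B\<close>, \<open>C\<close> locate its vertices with respect to the ray.
  The vertex of \<open>A\<close> is alone on its side; the two edges at it agree in sign, for
  otherwise the count is zero.\<close>

lemma chi_nonzero_aux:
  fixes A B C X Y Z :: real
  assumes I: "X * C + Y * A + Z * B = 0" and S: "X + Y + Z > 0" and "X \<noteq> 0" "Z \<noteq> 0"
    and s: "(A < 0 \<and> B > 0 \<and> C > 0) \<or> (A > 0 \<and> B < 0 \<and> C < 0)" and XZ: "X > 0 \<longleftrightarrow> Z > 0"
  shows "X > 0 \<and> Y > 0 \<and> Z > 0"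
proof (cases "X > 0")
  case True
  then have Z: "Z > 0" using XZ by simp
  have "Y > 0"
  proof (rule ccontr)
    assume "\<not> Y > 0"
    then have y: "Y \<le> 0" by simp
    from s show False
    proof
      assume h: "A < 0 \<and> B > 0 \<and> C > 0"
      then have "X * C > 0" "Z * B > 0" "Y * A \<ge> 0" using True Z y by (auto simp: zero_le_mult_iff)
      then show False using I by linarith
    next
      assume h: "A > 0 \<and> B < 0 \<and> C < 0"
      then have "X * C < 0" "Z * B < 0" "Y * A \<le> 0" using True Z y by (auto simp: mult_le_0_iff mult_less_0_iff)
      then show False using I by linarith
    qed
  qed
  then show ?thesis using True Z by simp
next
  case False
  then have X: "X < 0" and Z: "Z < 0" using XZ assms(3,4) by auto
  then have Y: "Y > 0" using S by linarith
  from s show ?thesis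
  proof
    assume h: "A < 0 \<and> B > 0 \<and> C > 0"
    then have "X * C < 0" "Z * B < 0" "Y * A < 0" using X Y Z by (auto simp: mult_less_0_iff)
    then show ?thesis using I by linarith
  next
    assume h: "A > 0 \<and> B < 0 \<and> C < 0"
    then have "X * C > 0" "Z * B > 0" "Y * A > 0" using X Y Z by (auto simp: zero_less_mult_iff)
    then show ?thesis using I by linarith
  qed
qed

text \<open>The converse of \<open>chi_tri_inside\<close> for generic points: only triangles around
  \<open>m\<close> contribute, so a positive degree yields a triangle containing
  \<open>m\<close>.\<close>

lemma chi_tri_nonzero_inside:
  assumes O: "ori a b c > 0" and nz: "ori m v a \<noteq> 0" "ori m v b \<noteq> 0" "ori m v c \<noteq> 0"
    and g: "ori m a b \<noteq> 0" "ori m b c \<noteq> 0" "ori m c a \<noteq> 0"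
    and ch: "ray_weight m v a b + ray_weight m v b c + ray_weight m v c a \<noteq> 0"
  shows "ori m a b > 0 \<and> ori m b c > 0 \<and> ori m c a > 0"
proof -
  have i: "ori m a b * ori m v c + ori m b c * ori m v a + ori m c a * ori m v b = 0"
    by (simp add: ori_def algebra_simps)
  have s: "ori m a b + ori m b c + ori m c a = ori a b c" by (simp add: ori_def algebra_simps)
  have w: "ori m b a = - ori m a b" "ori m c b = - ori m b c" "ori m a c = - ori m c a"
    by (simp_all add: ori_def algebra_simps)
  define A where "A = ori m v a"
  define B where "B = ori m v b"
  define C where "C = ori m v c"
  define X where "X = ori m a b"
  define Y where "Y = ori m b c"
  define Z where "Z = ori m c a"
  note defs = A_def B_def C_def X_def Y_def Z_def
  have I: "X * C + Y * A + Z * B = 0" and S: "X + Y + Z > 0" using i s O unfolding defs by auto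
  have I2: "Y * A + Z * B + X * C = 0" "Z * B + X * C + Y * A = 0" and S2: "Y + Z + X > 0" "Z + X + Y > 0"
    using I S by linarith+
  have n: "A \<noteq> 0" "B \<noteq> 0" "C \<noteq> 0" "X \<noteq> 0" "Y \<noteq> 0" "Z \<noteq> 0" using nz g unfolding defs by auto
  note ch' = ch[unfolded ray_weight_def w defs[symmetric]]
  consider "A > 0" "B > 0" "C > 0" | "A < 0" "B < 0" "C < 0"
    | "(A < 0 \<and> B > 0 \<and> C > 0) \<or> (A > 0 \<and> B < 0 \<and> C < 0)"
    | "(B < 0 \<and> C > 0 \<and> A > 0) \<or> (B > 0 \<and> C < 0 \<and> A < 0)"
    | "(C < 0 \<and> A > 0 \<and> B > 0) \<or> (C > 0 \<and> A < 0 \<and> B < 0)"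
    using n unfolding neq_iff by blast
  then have "X > 0 \<and> Y > 0 \<and> Z > 0"
  proof cases
    case 1 then show ?thesis using ch' by simp
  next
    case 2 then show ?thesis using ch' by simp
  next
    case 3
    have "X > 0 \<longleftrightarrow> Z > 0" using ch' 3 n by (auto split: if_splits)
    then show ?thesis using chi_nonzero_aux[OF I S n(4,6) 3] by simp
  next
    case 4
    have "Y > 0 \<longleftrightarrow> X > 0" using ch' 4 n by (auto split: if_splits)
    then show ?thesis using chi_nonzero_aux[OF I2(1) S2(1) n(5,4) 4] by simp
  next
    case 5
    have "Z > 0 \<longleftrightarrow> Y > 0" using ch' 5 n by (auto split: if_splits)
    then show ?thesis using chi_nonzero_aux[OF I2(2) S2(2) n(6,5) 5] by simp
  qed
  then show ?thesis unfolding defs by simp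
qed

lemma covers_ex:
  assumes C: "covers V vs D" and g: "\<forall>a\<in>V. \<forall>b\<in>V. a \<noteq> b \<longrightarrow> ori a b m \<noteq> 0"
    and h: "\<And>p q. (p, q) \<in> set (cycle_edges vs) \<Longrightarrow> ori p q m > 0"
  shows "\<exists>t\<in>set D. inside t m"
proof -
  have V: "finite V" using C unfolding covers_def by auto
  have "m \<notin> V" by (rule notin_of_generic[OF covers_card[OF C] g])
  from generic_direction[OF V this] obtain v where v: "\<forall>p\<in>V. ori m v p \<noteq> 0" ..
  have "boundary D (ray_weight m v) > 0" using covers_degree[OF C v h] by simp
  then obtain a b c where t: "(a, b, c) \<in> set D" and "ray_weight m v a b + ray_weight m v b c + ray_weight m v c a > 0"
    using bd_pos_elem by fast
  then have ne: "ray_weight m v a b + ray_weight m v b c + ray_weight m v c a \<noteq> 0" by simp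
  note c = covers_mem[OF C t]
  have d: "a \<noteq> b" "b \<noteq> c" "c \<noteq> a" using c by auto
  have r: "ori m a b = ori a b m" "ori m b c = ori b c m" "ori m c a = ori c a m" by (rule ori_rot2)+
  have "ori m a b > 0 \<and> ori m b c > 0 \<and> ori m c a > 0"
    by (rule chi_tri_nonzero_inside[OF c(4) _ _ _ _ _ _ ne]) (use v c g d in \<open>auto simp: r\<close>)
  then have "inside (a, b, c) m" unfolding inside_def r by simp
  then show ?thesis using t by blast
qed

lemma covers_disjoint':
  assumes C: "covers V vs D" and t: "t1 \<in> set D" "t2 \<in> set D" "t1 \<noteq> t2"
    and i: "inside t1 y" "inside t2 y"
  shows False
proof -
  obtain D1 D2 where D: "D = D1 @ t1 # D2" using split_list[OF t(1)] by auto
  have "t2 \<in> set D1 \<or> t2 \<in> set D2" using t(2,3) D by auto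
  then show False
  proof
    assume "t2 \<in> set D1"
    then obtain E F where "D1 = E @ t2 # F" by (meson split_list)
    then have "D = E @ t2 # F @ t1 # D2" using D by simp
    from covers_disjoint[OF C this i(2,1)] show False .
  next
    assume "t2 \<in> set D2"
    then obtain E F where "D2 = E @ t2 # F" by (meson split_list)
    then have "D = D1 @ t1 # E @ t2 # F" using D by simp
    from covers_disjoint[OF C this i] show False .
  qed
qed

section \<open>From coverings to triangulations\<close>

definition tile :: "('a \<times> 'a \<times> 'a) list \<Rightarrow> 'a \<Rightarrow> 'a \<Rightarrow> 'a \<Rightarrow> bool" where
  "tile D a b c \<longleftrightarrow> (a, b, c) \<in> set D \<or> (b, c, a) \<in> set D \<or> (c, a, b) \<in> set D"

lemma tr_rot: "tile D a b c \<Longrightarrow> tile D b c a"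
  unfolding tile_def by blast

lemma tr_inside:
  assumes "tile D a b c"
  shows "\<exists>t\<in>set D. (\<forall>y. inside t y \<longleftrightarrow> ori a b y > 0 \<and> ori b c y > 0 \<and> ori c a y > 0) \<and>
    {fst t, fst (snd t), snd (snd t)} = {a, b, c}"
  using assms unfolding tile_def
proof (elim disjE)
  assume "(a, b, c) \<in> set D" then show ?thesis by (rule bexI[rotated]) (auto simp: inside_def)
next
  assume "(b, c, a) \<in> set D" then show ?thesis by (rule bexI[rotated]) (auto simp: inside_def)
next
  assume "(c, a, b) \<in> set D" then show ?thesis by (rule bexI[rotated]) (auto simp: inside_def)
qed

lemma tr_mem:
  assumes "covers V vs D" "tile D a b c"
  shows "a \<in> V \<and> b \<in> V \<and> c \<in> V \<and> ori a b c > 0"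
  using assms(2) covers_mem[OF assms(1), of a b c] covers_mem[OF assms(1), of b c a]
    covers_mem[OF assms(1), of c a b] ori_rot[of b c a] ori_rot2[of c a b]
  unfolding tile_def by metis

definition tile_edges :: "(point \<times> point \<times> point) list \<Rightarrow> point set set" where
  "tile_edges D = {closed_segment a b | a b c. tile D a b c}"

lemma ori_shift: "ori a b (y + d *\<^sub>R n) = ori a b y + d * ((b$1 - a$1) * n$2 - (b$2 - a$2) * n$1)"
  by (simp add: ori_def algebra_simps)

lemma crs_open:
  assumes "crosses a b c d" shows "open_segment a b \<inter> open_segment c d \<noteq> {}"
proof -
  obtain s t where st: "0 < s" "s < 1" "0 < t" "t < 1"
    and e: "(1 - s) *\<^sub>R a + s *\<^sub>R b = (1 - t) *\<^sub>R c + t *\<^sub>R d" using crs_point[OF assms] by metis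
  have "(1 - s) *\<^sub>R a + s *\<^sub>R b \<in> open_segment a b" using st crs_distinct[OF assms] by (auto simp: in_segment)
  moreover have "(1 - s) *\<^sub>R a + s *\<^sub>R b \<in> open_segment c d" unfolding e using st crs_distinct[OF assms] by (auto simp: in_segment)
  ultimately show ?thesis by blast
qed

lemma open_crs:
  assumes gen_pos: "gen_pos V" and V: "a \<in> V" "b \<in> V" "c \<in> V" "d \<in> V" and ne: "a \<noteq> b" "c \<noteq> d"
    and o: "open_segment a b \<inter> open_segment c d \<noteq> {}" and ab: "{a, b} \<noteq> {c, d}"
  shows "crosses a b c d"
proof -
  obtain e where "e \<in> open_segment a b" "e \<in> open_segment c d" using o by blast
  then obtain s t where st: "0 < s" "s < 1" "0 < t" "t < 1"
    and e: "e = (1 - s) *\<^sub>R a + s *\<^sub>R b" "e = (1 - t) *\<^sub>R c + t *\<^sub>R d" by (auto simp: in_segment)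
  have z1: "(1 - t) * ori a b c + t * ori a b d = 0"
    using aff_seg[of "ori a b" t c d] aff_seg[of "ori a b" s a b] e by simp
  have z2: "(1 - s) * ori c d a + s * ori c d b = 0"
    using aff_seg[of "ori c d" t c d] aff_seg[of "ori c d" s a b] e by simp
  have "c \<noteq> a \<and> c \<noteq> b \<and> d \<noteq> a \<and> d \<noteq> b"
  proof (rule ccontr)
    assume "\<not> ?thesis"
    then have "(c \<in> {a, b} \<and> d \<notin> {a, b}) \<or> (d \<in> {a, b} \<and> c \<notin> {a, b})" using ab ne by auto
    then show False
    proof
      assume h: "c \<in> {a, b} \<and> d \<notin> {a, b}"
      then have "ori a b c = 0" by auto
      then have "ori a b d = 0" using z1 st by simp
      then show False using gpD[OF gen_pos V(1,2,4)] ne h by auto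
    next
      assume h: "d \<in> {a, b} \<and> c \<notin> {a, b}"
      then have "ori a b d = 0" by auto
      then have "ori a b c = 0" using z1 st by simp
      then show False using gpD[OF gen_pos V(1,2,3)] ne h by auto
    qed
  qed
  then have nz: "ori a b c \<noteq> 0" "ori c d a \<noteq> 0"
    using gpD[OF gen_pos V(1,2,3)] gpD[OF gen_pos V(3,4,1)] ne by auto
  have opp: "x * y < 0" if "(1 - r) * x + r * y = 0" "0 < r" "r < 1" "x \<noteq> 0" for r x y :: real
  proof -
    have ry: "r * y = - ((1 - r) * x)" using that by linarith
    have "r * (x * y) = x * (r * y)" by simp
    also have "\<dots> = - ((1 - r) * (x * x))" unfolding ry by simp
    finally have e: "r * (x * y) = - ((1 - r) * (x * x))" .
    have "x * x > 0" using that(4) by (metis not_real_square_gt_zero)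
    then have "(1 - r) * (x * x) > 0" using that(3) by simp
    then have "r * (x * y) < 0" using e by linarith
    then show ?thesis using that(2) by (simp add: mult_less_0_iff)
  qed
  show ?thesis unfolding crosses_def using opp[OF z1 st(3,4) nz(1)] opp[OF z2 st(1,2) nz(2)] by simp
qed

text \<open>A small step from the vertex \<open>z\<close> into its own tile, along the sum
  \<open>n\<close> of the two edge vectors, would reach a point inside both the tile and
  \<open>t\<close>.\<close>

lemma covers_empty:
  assumes C: "covers V vs D" and cov: "tile D z q r" and t: "t \<in> set D" and i: "inside t z"
  shows False
proof -
  obtain a b c where abc: "t = (a, b, c)" by (cases t)
  note T = tr_mem[OF C cov]
  obtain t' where t': "t' \<in> set D" and t'i: "\<And>y. inside t' y \<longleftrightarrow> ori z q y > 0 \<and> ori q r y > 0 \<and> ori r z y > 0"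
    using tr_inside[OF cov] by auto
  have "\<not> inside t' z" unfolding t'i by simp
  then have ne: "t \<noteq> t'" using i by auto
  have I: "ori a b z > 0" "ori b c z > 0" "ori c a z > 0" using i unfolding abc inside_def by auto
  define n where "n = (q - z) + (r - z)"
  have ev: "\<forall>\<^sub>F d in at_right 0. ori a b (z + d *\<^sub>R n) > 0" if "ori a b z > 0" for a b
    unfolding ori_shift by (rule at_right_eventually_pos[OF that])
  have "ori q r z > 0" using T ori_rot[of q r z] by simp
  from ev[OF this] ev[OF I(1)] ev[OF I(2)] ev[OF I(3)] eventually_at_right_less[of "0::real"]
  have "\<forall>\<^sub>F d in at_right 0. inside t (z + d *\<^sub>R n) \<and> inside t' (z + d *\<^sub>R n)"
  proof eventually_elim
    case (elim d)
    have "ori z q (z + d *\<^sub>R n) = d * ori z q r" "ori r z (z + d *\<^sub>R n) = d * ori z q r"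
      unfolding n_def by (simp_all add: ori_def algebra_simps)
    then have "inside t' (z + d *\<^sub>R n)" unfolding t'i using elim T by simp
    moreover have "inside t (z + d *\<^sub>R n)" unfolding abc inside_def using elim by simp
    ultimately show ?case by simp
  qed
  then obtain d where "inside t (z + d *\<^sub>R n) \<and> inside t' (z + d *\<^sub>R n)"
    using eventually_happens'[OF trivial_limit_at_right_real] by blast
  then show False using covers_disjoint'[OF C t t' ne] by blast
qed

text \<open>Tiles lie to the left of their edges. Moving from the crossing point to the left of both
  segments would therefore enter two different tiles at once.\<close>

lemma covers_nocross:
  assumes C: "covers V vs D" and t1: "tile D a b x" and t2: "tile D c d z"
  shows "\<not> crosses a b c d"
proof
  assume X: "crosses a b c d"
  note T1 = tr_mem[OF C t1] and T2 = tr_mem[OF C t2]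
  obtain t where t: "t \<in> set D" and ti: "\<And>y. inside t y \<longleftrightarrow> ori a b y > 0 \<and> ori b x y > 0 \<and> ori x a y > 0"
    and ts: "{fst t, fst (snd t), snd (snd t)} = {a, b, x}" using tr_inside[OF t1] by auto
  obtain t' where t': "t' \<in> set D" and t'i: "\<And>y. inside t' y \<longleftrightarrow> ori c d y > 0 \<and> ori d z y > 0 \<and> ori z c y > 0"
    and ts': "{fst t', fst (snd t'), snd (snd t')} = {c, d, z}" using tr_inside[OF t2] by auto
  have ne: "t \<noteq> t'"
  proof
    assume "t = t'"
    then have "{c, d} \<subseteq> {a, b, x}" using ts ts' by auto
    then show False using crs_distinct[OF X] by auto
  qed
  obtain s u where su: "0 < s" "s < 1" "0 < u" "u < 1"
    and e: "(1 - s) *\<^sub>R a + s *\<^sub>R b = (1 - u) *\<^sub>R c + u *\<^sub>R d" using crs_point[OF X] by metis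
  define y where "y = (1 - s) *\<^sub>R a + s *\<^sub>R b"
  define \<Delta> where "\<Delta> = (b$1 - a$1) * (d$2 - c$2) - (b$2 - a$2) * (d$1 - c$1)"
  have "\<Delta> = ori a b d - ori a b c" unfolding \<Delta>_def ori_def by (simp add: algebra_simps)
  moreover have "ori a b c * ori a b d < 0" using X unfolding crosses_def by simp
  ultimately have D0: "\<Delta> \<noteq> 0" by (auto simp: mult_less_0_iff)
  \<comment> \<open>\<open>\<Delta>\<close> is the cross product of the two directions; dividing by
    it gives a vector along which both orientations grow at unit rate, whatever the sign of the
    crossing.\<close>
  define n where "n = (1 / \<Delta>) *\<^sub>R ((d - c) - (b - a))"
  have n1: "n$1 = ((d$1 - c$1) - (b$1 - a$1)) / \<Delta>" "n$2 = ((d$2 - c$2) - (b$2 - a$2)) / \<Delta>"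
    unfolding n_def by simp_all
  have "(b$1 - a$1) * n$2 - (b$2 - a$2) * n$1 = \<Delta> / \<Delta>"
    unfolding n1 \<Delta>_def by (simp add: diff_divide_distrib[symmetric] algebra_simps)
  then have m1: "(b$1 - a$1) * n$2 - (b$2 - a$2) * n$1 = 1" using D0 by simp
  have "(d$1 - c$1) * n$2 - (d$2 - c$2) * n$1 = \<Delta> / \<Delta>"
    unfolding n1 \<Delta>_def by (simp add: diff_divide_distrib[symmetric] algebra_simps)
  then have m2: "(d$1 - c$1) * n$2 - (d$2 - c$2) * n$1 = 1" using D0 by simp
  have ev: "\<forall>\<^sub>F d in at_right 0. ori a b (y + d *\<^sub>R n) > 0" if "ori a b y > 0" for a b
    unfolding ori_shift by (rule at_right_eventually_pos[OF that])
  have y1: "ori a b y = 0" "ori b x y = (1 - s) * ori a b x" "ori x a y = s * ori a b x"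
    unfolding y_def by (simp_all add: ori_def algebra_simps)
  have y2: "ori c d y = 0" "ori d z y = (1 - u) * ori c d z" "ori z c y = u * ori c d z"
    unfolding y_def e by (simp_all add: ori_def algebra_simps)
  have p: "ori b x y > 0" "ori x a y > 0" "ori d z y > 0" "ori z c y > 0"
    using y1 y2 T1 T2 su by simp_all
  from ev[OF p(1)] ev[OF p(2)] ev[OF p(3)] ev[OF p(4)] eventually_at_right_less[of "0::real"]
  have "\<forall>\<^sub>F d in at_right 0. inside t (y + d *\<^sub>R n) \<and> inside t' (y + d *\<^sub>R n)"
  proof eventually_elim
    case (elim h)
    have "ori a b (y + h *\<^sub>R n) = h" "ori c d (y + h *\<^sub>R n) = h"
      unfolding ori_shift m1 m2 y1 y2 by simp_all
    then show ?case using elim unfolding ti t'i by simp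
  qed
  then obtain h where "inside t (y + h *\<^sub>R n) \<and> inside t' (y + h *\<^sub>R n)"
    using eventually_happens'[OF trivial_limit_at_right_real] by blast
  then show False using covers_disjoint'[OF C t t' ne] by blast
qed

lemma hull_edge_tr:
  assumes C: "covers V vs D" and e: "(a, b) \<in> set (cycle_edges vs)"
  shows "\<exists>x. tile D a b x"
proof -
  have H: "hull_cycle V vs" using C unfolding covers_def by auto
  then have vs: "distinct vs" "length vs \<ge> 3" "vs \<noteq> []" "set vs \<subseteq> V" unfolding hull_cycle_def by auto
  have ab: "a \<in> set vs" "b \<in> set vs" using ce_mem[OF e vs(3)] by auto
  have "card (set vs - {a, b}) > 0"
  proof -
    have "card {a, b} \<le> 2" by (simp add: card_insert_if)
    moreover have "card (set vs) \<ge> 3" using vs by (simp add: distinct_card)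
    moreover have "finite {a, b}" by simp
    ultimately show ?thesis using diff_card_le_card_Diff[of "{a, b}" "set vs"] by linarith
  qed
  then have "set vs - {a, b} \<noteq> {}" by (metis card.empty less_irrefl)
  then obtain z where z: "z \<in> set vs" "z \<noteq> a" "z \<noteq> b" by blast
  have p: "ori a b z > 0" using hullp_nonneg(2)[OF H e] z vs by auto
  have nba: "(b, a) \<notin> set (cycle_edges vs)"
    using hullp_nonneg(2)[OF H, of b a z] z vs p ori_swap[of b a z] by auto
  have "a \<noteq> b" using p by auto
  define w where "w x y = (if x = a \<and> y = b then 1 else if x = b \<and> y = a then - 1 else 0 :: real)" for x y
  have antisym_weight: "antisym_weight w" unfolding antisym_weight_def w_def using \<open>a \<noteq> b\<close> by auto
  have "cycle_weight w vs = (\<Sum>e\<leftarrow>cycle_edges vs. if e = (a, b) then 1 else 0)"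
    unfolding cycle_weight_def
  proof (rule arg_cong[where f = sum_list], rule map_cong[OF refl])
    fix e assume "e \<in> set (cycle_edges vs)"
    then have "e \<noteq> (b, a)" using nba by auto
    then show "(case e of (x, y) \<Rightarrow> w x y) = (if e = (a, b) then 1 else 0)"
      by (cases e) (auto simp: w_def)
  qed
  also have "\<dots> = (\<Sum>e\<in>set (cycle_edges vs). if e = (a, b) then 1 else 0)"
    by (rule sum_list_distinct_conv_sum_set[OF distinct_ce[OF vs(1)]])
  also have "\<dots> = 1" using e by simp
  finally have "boundary D w > 0" using C antisym_weight unfolding covers_def by auto
  then obtain x y u where t: "(x, y, u) \<in> set D" and pos: "w x y + w y u + w u x > 0"
    using bd_pos_elem by fast
  have "(x = a \<and> y = b) \<or> (y = a \<and> u = b) \<or> (u = a \<and> x = b)"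
    using pos unfolding w_def by (auto split: if_splits)
  then show ?thesis using t unfolding tile_def by blast
qed

text \<open>For maximality, consider an additional edge \<open>p q\<close>. Near \<open>p\<close> it
  runs, up to a generic perturbation, inside a tile with vertex \<open>p\<close>. As no point of the
  set is inside a tile, \<open>q\<close> lies beyond the opposite edge of that tile, which is then
  crossed.\<close>

theorem covers_triangulation:
  assumes C: "covers V vs D" and full: "\<And>p. p \<in> V \<Longrightarrow> \<exists>q r. tile D p q r"
  shows "planar_triangulation V (tile_edges D)"
proof -
  have V: "finite V" and gen_pos: "gen_pos V" and H: "hull_cycle V vs" using C unfolding covers_def by auto
  have ri: "rel_interior (closed_segment a b) = open_segment a b" if "a \<noteq> b" for a b :: point
    using that by (simp add: rel_interior_closed_segment)
  have sub: "tile_edges D \<subseteq> point_set_edges V"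
  proof
    fix s assume "s \<in> tile_edges D"
    then obtain a b c where s: "s = closed_segment a b" "tile D a b c" unfolding tile_edges_def by auto
    from tr_mem[OF C s(2)] have "a \<in> V" "b \<in> V" "a \<noteq> b" by auto
    then show "s \<in> point_set_edges V" unfolding s(1) point_set_edges_def by blast
  qed
  have nc: "pairwise noncrossing (tile_edges D)"
    unfolding pairwise_def
  proof (intro ballI impI)
    fix s s' assume s: "s \<in> tile_edges D" "s' \<in> tile_edges D" "s \<noteq> s'"
    then obtain a b x c d z where s1: "s = closed_segment a b" "tile D a b x"
      and s2: "s' = closed_segment c d" "tile D c d z" unfolding tile_edges_def by blast
    from tr_mem[OF C s1(2)] have m1: "a \<in> V" "b \<in> V" "a \<noteq> b" by auto
    from tr_mem[OF C s2(2)] have m2: "c \<in> V" "d \<in> V" "c \<noteq> d" by auto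
    have ne: "{a, b} \<noteq> {c, d}" using s(3) s1(1) s2(1) closed_segment_eq by blast
    show "noncrossing s s'"
      unfolding noncrossing_def s1(1) s2(1) ri[OF m1(3)] ri[OF m2(3)]
      using open_crs[OF gen_pos m1(1,2) m2(1,2) m1(3) m2(3) _ ne] covers_nocross[OF C s1(2) s2(2)] by blast
  qed
  have max: "T' = tile_edges D" if T': "tile_edges D \<subseteq> T'" "T' \<subseteq> point_set_edges V" "pairwise noncrossing T'" for T'
  proof (rule ccontr)
    assume "T' \<noteq> tile_edges D"
    then obtain s where s: "s \<in> T'" "s \<notin> tile_edges D" using T'(1) by blast
    then obtain p q where pq: "s = closed_segment p q" "p \<in> V" "q \<in> V" "p \<noteq> q"
      using T'(2) unfolding point_set_edges_def by auto
    have nt: "\<not> tile D p q x" "\<not> tile D q p x" for x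
      using s(2) closed_segment_commute[of p q] unfolding pq(1) tile_edges_def by blast+
    \<comment> \<open>A point of \<open>p q\<close> so near to \<open>p\<close> that every strict
      orientation inequality at \<open>p\<close> persists. The generic point \<open>m\<close> chosen
      below preserves those that hold at \<open>m0 d\<close>.\<close>
    define m0 where "m0 d = p + d *\<^sub>R (q - p)" for d
    have ev1: "\<forall>\<^sub>F d in at_right 0. ori a b (m0 d) > 0" if "ori a b p > 0" for a b
      unfolding m0_def ori_shift by (rule at_right_eventually_pos[OF that])
    have "\<forall>\<^sub>F d in at_right 0. \<forall>e\<in>{e\<in>V \<times> V. ori (fst e) (snd e) p > 0}. ori (fst e) (snd e) (m0 d) > 0"
      by (rule eventually_ball_finite) (use V ev1 in auto)
    moreover have "\<forall>\<^sub>F d in at_right 0. d < (1::real)" using eventually_at_right_less[of 0]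
      by (auto simp: eventually_at_right_field intro: exI[of _ 1])
    ultimately have "\<forall>\<^sub>F d in at_right 0. (\<forall>e\<in>{e\<in>V \<times> V. ori (fst e) (snd e) p > 0}. ori (fst e) (snd e) (m0 d) > 0) \<and> d < 1 \<and> 0 < d"
      using eventually_at_right_less[of "0::real"] by eventually_elim auto
    from eventually_happens'[OF trivial_limit_at_right_real this] obtain d where
      d: "0 < d" "d < 1" and dp: "\<forall>e\<in>{e\<in>V \<times> V. ori (fst e) (snd e) p > 0}. ori (fst e) (snd e) (m0 d) > 0" by blast
    have dpos: "ori a b (m0 d) > 0" if "a \<in> V" "b \<in> V" "ori a b p > 0" for a b using dp that by auto
    have om: "ori a b (m0 d) = (1 - d) * ori a b p + d * ori a b q" for a b
      unfolding m0_def by (simp add: ori_def algebra_simps)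
    from near_generic[OF V, of "m0 d"] obtain m where
      m: "\<forall>a\<in>V. \<forall>b\<in>V. a \<noteq> b \<longrightarrow> ori a b m \<noteq> 0 \<and> (ori a b (m0 d) > 0 \<longrightarrow> ori a b m > 0)" ..
    have pos: "ori a b m > 0" if "a \<in> V" "b \<in> V" "ori a b (m0 d) > 0" for a b
      using m that by (cases "a = b") auto
    have hm: "ori a b m > 0" if e: "(a, b) \<in> set (cycle_edges vs)" for a b
    proof (rule pos)
      have vs: "vs \<noteq> []" "set vs \<subseteq> V" using H unfolding hull_cycle_def by auto
      show "a \<in> V" "b \<in> V" using ce_mem[OF e vs(1)] vs(2) by auto
      have n: "ori a b p \<ge> 0" "ori a b q \<ge> 0" using hullp_nonneg(1)[OF H e] pq by auto
      \<comment> \<open>Otherwise \<open>p q\<close> would be a hull edge, and every hull edge is an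
        edge of a tile.\<close>
      have "ori a b p > 0 \<or> ori a b q > 0"
      proof (rule ccontr)
        assume "\<not> ?thesis"
        then have "p \<in> {a, b}" "q \<in> {a, b}" using hullp_nonneg(2)[OF H e] pq by auto
        then have "(a, b) = (p, q) \<or> (a, b) = (q, p)" using pq(4) by auto
        then show False using hull_edge_tr[OF C e] nt by auto
      qed
      then show "ori a b (m0 d) > 0" unfolding om using n d
        by (metis add_nonneg_pos add_pos_nonneg diff_gt_0_iff_gt less_imp_le mult_nonneg_nonneg mult_pos_pos)
    qed
    obtain t where t: "t \<in> set D" "inside t m" using covers_ex[OF C _ hm] m by blast
    obtain a b c where abc: "t = (a, b, c)" by (cases t)
    have tm: "(a, b, c) \<in> set D" using t abc by simp
    note cm = covers_mem[OF C tm]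
    have im: "ori a b m > 0" "ori b c m > 0" "ori c a m > 0" using t(2) unfolding abc inside_def by auto
    have notneg: "\<not> ori x y m > 0" if "x \<in> V" "y \<in> V" "ori x y (m0 d) < 0" for x y
      using pos[of y x] that ori_swap[of y x "m0 d"] ori_swap[of y x m] by simp
    have "p \<in> {a, b, c}"
    proof (rule ccontr)
      assume pn: "p \<notin> {a, b, c}"
      have "ori x y p > 0" if "x \<in> V" "y \<in> V" "ori x y m > 0" "p \<noteq> x" "p \<noteq> y" for x y
      proof -
        have "x \<noteq> y" using that by auto
        then have nz: "ori x y p \<noteq> 0" using gpD[OF gen_pos that(1,2) pq(2)] that by auto
        have "\<not> ori y x p > 0"
          using dpos[of y x] pos[of y x] that ori_swap[of y x m] by auto
        then show ?thesis using nz ori_swap[of y x p] by simp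
      qed
      then have "inside (a, b, c) p" unfolding inside_def using im cm pn by auto
      then show False using covers_empty[OF C _ tm] full[OF pq(2)] by blast
    qed
    then obtain b' c' where tile: "tile D p b' c'" and ib: "ori p b' m > 0" "ori c' p m > 0"
      using tm im unfolding tile_def by blast
    note T = tr_mem[OF C tile]
    have qb: "q \<noteq> b'" using tile nt by auto
    have qc: "q \<noteq> c'" using tr_rot[OF tr_rot[OF tile]] nt by auto
    have ne: "p \<noteq> b'" "p \<noteq> c'" "b' \<noteq> c'" using T by auto
    have o1: "ori p b' q > 0"
    proof -
      have "ori p b' q \<noteq> 0" using gpD[OF gen_pos pq(2) _ pq(3)] T ne qb pq(4) by auto
      moreover have "\<not> ori p b' q < 0" using notneg[of p b'] T pq ib d unfolding om by (auto simp: mult_less_0_iff)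
      ultimately show ?thesis by simp
    qed
    have o2: "ori c' p q > 0"
    proof -
      have "ori c' p q \<noteq> 0" using gpD[OF gen_pos _ pq(2,3)] T ne qc pq(4) by auto
      moreover have "\<not> ori c' p q < 0" using notneg[of c' p] T pq ib d unfolding om by (auto simp: mult_less_0_iff)
      ultimately show ?thesis by simp
    qed
    have o3: "ori b' c' q < 0"
    proof -
      have "ori b' c' q \<noteq> 0" using gpD[OF gen_pos _ _ pq(3)] T ne qb qc by auto
      moreover have "\<not> ori b' c' q > 0"
      proof
        assume "ori b' c' q > 0"
        moreover obtain t' where "t' \<in> set D" "inside t' q \<longleftrightarrow> ori p b' q > 0 \<and> ori b' c' q > 0 \<and> ori c' p q > 0"
          using tr_inside[OF tile] by auto
        ultimately show False using o1 o2 covers_empty[OF C] full[OF pq(3)] by blast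
      qed
      ultimately show ?thesis by simp
    qed
    have "ori p q b' < 0" "ori p q c' > 0" "ori b' c' p > 0"
      using o1 o2 T ori_swap2[of p q b'] ori_rot[of p q c'] ori_rot[of b' c' p] by simp_all
    then have X: "crosses p q b' c'" unfolding crosses_def using o3 by (simp add: mult_less_0_iff)
    have s2: "closed_segment b' c' \<in> T'" using tr_rot[OF tile] T'(1) unfolding tile_edges_def by blast
    have "closed_segment p q \<noteq> closed_segment b' c'"
      using qb qc ne pq(4) closed_segment_eq[of p q b' c'] by auto
    then have "noncrossing s (closed_segment b' c')" using T'(3) s(1) s2 pq(1) unfolding pairwise_def by blast
    then show False using crs_open[OF X] unfolding noncrossing_def pq(1) ri[OF pq(4)] ri[OF ne(3)] by blast
  qed
  show ?thesis unfolding planar_triangulation_def using sub nc max by blast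
qed

section \<open>Separable paths\<close>

text \<open>A path that can be cut at a vertex \<open>p\<close> by a line through \<open>p\<close>
  and an arbitrary point \<open>q\<close>, with the two parts strictly on opposite sides, and so on
  down to single edges. It is a certificate of freedom from crossings that composes when paths are
  joined at a separated vertex.\<close>

inductive separable :: "point list \<Rightarrow> bool" where
  sp_edge: "separable [a, b]"
| sp_join: "separable (xs @ [p]) \<Longrightarrow> separable (p # ys) \<Longrightarrow> (\<And>x. x \<in> set xs \<Longrightarrow> ori p q x > 0) \<Longrightarrow>
    (\<And>y. y \<in> set ys \<Longrightarrow> ori p q y < 0) \<Longrightarrow> separable (xs @ p # ys)"

text \<open>Reflecting \<open>q\<close> in \<open>p\<close> reverses the direction of the cutting
  line, so the sides may be exchanged.\<close>

lemma sp_join': "separable (xs @ [p]) \<Longrightarrow> separable (p # ys) \<Longrightarrow> (\<And>x. x \<in> set xs \<Longrightarrow> ori p q x < 0) \<Longrightarrow>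
    (\<And>y. y \<in> set ys \<Longrightarrow> ori p q y > 0) \<Longrightarrow> separable (xs @ p # ys)"
proof -
  assume h: "separable (xs @ [p])" "separable (p # ys)" "\<And>x. x \<in> set xs \<Longrightarrow> ori p q x < 0" "\<And>y. y \<in> set ys \<Longrightarrow> ori p q y > 0"
  have "ori p (2 *\<^sub>R p - q) x = - ori p q x" for x by (simp add: ori_def algebra_simps)
  then show ?thesis using sp_join[OF h(1,2), of "2 *\<^sub>R p - q"] h(3,4) by simp
qed

lemma sp_nocross:
  assumes "separable l" shows "(a, b) \<in> set (path_edges l) \<Longrightarrow> (c, d) \<in> set (path_edges l) \<Longrightarrow> \<not> crosses a b c d"
  using assms
proof (induction arbitrary: a b c d)
  case (sp_edge x y) then show ?case by (auto dest: crs_distinct)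
next
  case (sp_join xs p ys q)
  have mixed: "\<not> crosses a b c d" if 1: "(a, b) \<in> set (path_edges (xs @ [p]))" and 2: "(c, d) \<in> set (path_edges (p # ys))" for a b c d
  proof
    assume X: "crosses a b c d"
    have ab: "a \<in> set xs \<or> a = p" "b \<in> set xs \<or> b = p" using pe_mem[OF 1] by auto
    have cd: "c \<in> set ys \<or> c = p" "d \<in> set ys \<or> d = p" using pe_mem[OF 2] by auto
    have "ori p q a = 0 \<and> ori p q b = 0 \<and> ori p q c = 0 \<and> ori p q d = 0"
      by (rule crs_sep[OF aff_ori _ _ _ _ X])
         (use ab cd sp_join.hyps(3,4) in \<open>auto intro: less_imp_le\<close>)
    then have "a = p" "b = p" using ab sp_join.hyps(3) by force+
    then show False using crs_distinct[OF X] by simp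
  qed
  have e: "path_edges (xs @ p # ys) = path_edges (xs @ [p]) @ path_edges (p # ys)" by (rule pe_append)
  show ?case using sp_join.prems sp_join.IH mixed[of a b c d] mixed[of c d a b] crs_sym[of a b c d] unfolding e by auto
qed

section \<open>Zigzags between two separated sets\<close>

text \<open>The heights of \<open>p\<close> over the lines \<open>x w\<close> and
  \<open>u y\<close>, each scaled by the increment of \<open>s\<close> along the other segment,
  change equally along level lines of \<open>s\<close>. Their difference is thus a function of
  \<open>s\<close> alone.\<close>

lemma aff_move:
  assumes "affine_fun s"
  shows "((s y - s u) * ori x p w - (s w - s x) * ori u p y - ((s y - s u) * ori x u w)) * (s w - s u)
    = (- (s w - s x) * ori u w y - (s y - s u) * ori x u w) * (s p - s u)"
proof -
  obtain \<alpha> \<beta> \<gamma> where "\<forall>x. s x = \<alpha> * x$1 + \<beta> * x$2 + \<gamma>" using assms unfolding affine_fun_def by auto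
  then show ?thesis by (simp add: ori_def algebra_simps)
qed

text \<open>Of the two candidate bridges through \<open>x, w\<close> and \<open>u, y\<close>, at least one stays below all other points.\<close>

lemma bridge_contra:
  assumes s: "affine_fun s" "s u < 0" "s x < 0" "s a < 0" "s w > 0" "s y > 0" "s b > 0"
    and x: "ori u x w > 0" and y: "ori u y w > 0"
    and a: "ori x a w \<ge> 0" "ori u a y < 0" and b: "ori u b y \<ge> 0" "ori x b w < 0"
  shows False
proof -
  define k2 where "k2 = s y - s u"
  define k1 where "k1 = s w - s x"
  \<comment> \<open>The scaled difference of heights from \<open>aff_move\<close>. It increases with
    \<open>s\<close>, so its value at \<open>a\<close> is smaller than at \<open>b\<close>, while
    the assumptions on \<open>a\<close> and \<open>b\<close> make it larger.\<close>
  define g where "g p = k2 * ori x p w - k1 * ori u p y" for p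
  have k: "k1 > 0" "k2 > 0" using s unfolding k1_def k2_def by auto
  have gid: "(g p - k2 * ori x u w) * (s w - s u) = (- k1 * ori u w y - k2 * ori x u w) * (s p - s u)" for p
    using aff_move[OF s(1), of y u x p w] unfolding g_def k1_def k2_def by (simp add: algebra_simps)
  have "ori x u w < 0" "ori u w y < 0" using x y ori_swap[of x u w] ori_swap2[of u w y] by auto
  then have "k1 * ori u w y < 0" "k2 * ori x u w < 0" using k by (auto simp: mult_less_0_iff)
  then have G: "- k1 * ori u w y - k2 * ori x u w > 0" by simp
  have S: "s w - s u > 0" using s by simp
  have "k2 * ori x a w \<ge> 0" "k1 * ori u a y < 0" "k1 * ori u b y \<ge> 0" "k2 * ori x b w < 0"
    using k a b by (auto simp: mult_less_0_iff)
  then have "g a > g b" unfolding g_def by linarith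
  then have "(g a - g b) * (s w - s u) > 0" using S by simp
  moreover have "(g a - g b) * (s w - s u) = (- k1 * ori u w y - k2 * ori x u w) * (s a - s b)"
    using gid[of a] gid[of b] by (simp add: algebra_simps)
  moreover have "(- k1 * ori u w y - k2 * ori x u w) * (s a - s b) < 0"
    using G s by (intro mult_pos_neg) auto
  ultimately show False by simp
qed

text \<open>An extreme point of the angular order around \<open>w\<close> in the half-plane bounded
  by the line \<open>u w\<close>. The sign \<open>s\<close> lets the lemma serve both ends of a
  base.\<close>

lemma lowest_exists:
  assumes "finite A" "A \<noteq> {}" and gen_pos: "gen_pos (insert w (insert u A))" and "u \<noteq> w" "w \<notin> A" "u \<notin> A"
    and up: "\<And>a. a \<in> A \<Longrightarrow> s * ori u a w > 0" and s: "s = 1 \<or> s = - 1"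
  shows "\<exists>x\<in>A. \<forall>a\<in>A. a \<noteq> x \<longrightarrow> s * ori x a w > 0"
proof -
  define f where "f p = s * ori w u p + 0 * ori w u p" for p
  have fa: "affine_fun f" unfolding f_def by (rule aff_comb) auto
  have fp: "a \<in> A \<Longrightarrow> f a > 0" for a using up[of a] ori_rot2[of w u a] unfolding f_def by simp
  have "f w = 0" unfolding f_def by simp
  obtain a0 where "a0 \<in> A" using assms(2) by blast
  then have "f a0 \<noteq> 0" using fp by force
  from slope_exists[OF fa \<open>f w = 0\<close> this] obtain g :: "point \<Rightarrow> real"
    where g: "\<forall>y z. f y > 0 \<longrightarrow> f z > 0 \<longrightarrow> (g y < g z \<longleftrightarrow> ori w y z > 0)" ..
  obtain x where x: "x \<in> A" "\<forall>a\<in>A. s * - g a \<le> s * - g x" using finite_argmax[OF assms(1,2), of "\<lambda>a. s * - g a"] by auto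
  have "s * ori x a w > 0" if "a \<in> A" "a \<noteq> x" for a
  proof -
    have nz: "ori x a w \<noteq> 0" using gpD[OF gen_pos, of x a w] that x assms(5) by auto
    have "g a < g x \<longleftrightarrow> ori w a x > 0" "g x < g a \<longleftrightarrow> ori w x a > 0" using g fp that x by auto
    moreover have "ori w x a = ori x a w" "ori w a x = - ori x a w" by (rule ori_rot2, rule ori_swap3)
    ultimately show ?thesis using x(2) that nz s by auto
  qed
  then show ?thesis using x(1) by blast
qed

text \<open>Points \<open>A\<close> behind the edge \<open>u V\<close> and \<open>B\<close> behind
  \<open>V w\<close> are ordered along two paths \<open>la\<close> and \<open>lb\<close>, and
  \<open>D\<close> fills the region between these paths and the chord \<open>w u\<close>. The
  conditions on the positions of the vertices later keep each triangle from lying within one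
  class.\<close>

definition zigzag_between :: "point set \<Rightarrow> point set \<Rightarrow> point \<Rightarrow> point \<Rightarrow> point \<Rightarrow> point list \<Rightarrow> point list \<Rightarrow>
    (point \<times> point \<times> point) list \<Rightarrow> bool" where
  "zigzag_between A B u V w la lb D \<longleftrightarrow> set la = A \<and> distinct la \<and> set lb = B \<and> distinct lb \<and>
    separable (u # la @ [V]) \<and> separable (V # lb @ [w]) \<and>
    (\<forall>\<omega>. antisym_weight \<omega> \<longrightarrow> boundary D \<omega> = path_weight \<omega> (u # la @ [V]) + path_weight \<omega> (V # lb @ [w]) + \<omega> w u) \<and>
    (\<forall>a b c. (a, b, c) \<in> set D \<longrightarrow> ori a b c > 0 \<and> subseq [a, b, c] (u # la @ V # lb @ [w]) \<and>
       a \<in> insert u A \<and> c \<in> insert w B \<and>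
       (b \<in> A \<or> b \<in> B \<or> b = V \<and> (A \<noteq> {} \<longrightarrow> a \<in> A) \<and> (B \<noteq> {} \<longrightarrow> c \<in> B)))"

lemma zzD:
  assumes "zigzag_between A B u V w la lb D"
  shows "set la = A" "distinct la" "set lb = B" "distinct lb" "separable (u # la @ [V])" "separable (V # lb @ [w])"
    "antisym_weight \<omega> \<Longrightarrow> boundary D \<omega> = path_weight \<omega> (u # la @ [V]) + path_weight \<omega> (V # lb @ [w]) + \<omega> w u"
    "(a, b, c) \<in> set D \<Longrightarrow> ori a b c > 0 \<and> subseq [a, b, c] (u # la @ V # lb @ [w]) \<and>
       a \<in> insert u A \<and> c \<in> insert w B \<and>
       (b \<in> A \<or> b \<in> B \<or> b = V \<and> (A \<noteq> {} \<longrightarrow> a \<in> A) \<and> (B \<noteq> {} \<longrightarrow> c \<in> B))"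
proof -
  note z = assms[unfolded zigzag_between_def]
  show "set la = A" "distinct la" "set lb = B" "distinct lb" "separable (u # la @ [V])" "separable (V # lb @ [w])"
    using z by simp_all
  show "antisym_weight \<omega> \<Longrightarrow> boundary D \<omega> = path_weight \<omega> (u # la @ [V]) + path_weight \<omega> (V # lb @ [w]) + \<omega> w u"
    using z by simp
  assume t: "(a, b, c) \<in> set D"
  have "\<forall>a b c. (a, b, c) \<in> set D \<longrightarrow> ori a b c > 0 \<and> subseq [a, b, c] (u # la @ V # lb @ [w]) \<and>
       a \<in> insert u A \<and> c \<in> insert w B \<and>
       (b \<in> A \<or> b \<in> B \<or> b = V \<and> (A \<noteq> {} \<longrightarrow> a \<in> A) \<and> (B \<noteq> {} \<longrightarrow> c \<in> B))"
    using z by (elim conjE) assumption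
  from this[rule_format, OF t] show "ori a b c > 0 \<and> subseq [a, b, c] (u # la @ V # lb @ [w]) \<and>
       a \<in> insert u A \<and> c \<in> insert w B \<and>
       (b \<in> A \<or> b \<in> B \<or> b = V \<and> (A \<noteq> {} \<longrightarrow> a \<in> A) \<and> (B \<noteq> {} \<longrightarrow> c \<in> B))" .
qed

text \<open>A triangle over the base \<open>u w\<close> is cut off whose apex is the lowest point of
  \<open>A\<close> or of \<open>B\<close>, and the base becomes \<open>x w\<close> or
  \<open>u y\<close>. The remaining points must all lie above the new base;
  \<open>bridge_contra\<close> ensures this for one of the two choices.\<close>

lemma zigzag:
  assumes "finite A" "finite B" "gen_pos (A \<union> B \<union> {u, V, w})"
    and "distinct [u, V, w]" "A \<inter> B = {}" "u \<notin> A \<union> B" "V \<notin> A \<union> B" "w \<notin> A \<union> B"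
    and "\<And>p. p \<in> A \<union> B \<Longrightarrow> ori u p w > 0"
    and "\<And>a b. a \<in> insert u A \<Longrightarrow> b \<in> insert w B \<Longrightarrow> ori a V b > 0"
    and "A \<noteq> {} \<Longrightarrow> B \<noteq> {} \<Longrightarrow> \<exists>s. affine_fun s \<and> (\<forall>a\<in>insert u A. s a < 0) \<and> (\<forall>b\<in>insert w B. s b > 0)"
  shows "\<exists>la lb D. zigzag_between A B u V w la lb D"
  using assms
proof (induction "card A + card B" arbitrary: A B u w rule: less_induct)
  case less
  note fin = less.prems(1,2) and gen_pos = less.prems(3) and dist = less.prems(4) and dj = less.prems(5-8)
    and up = less.prems(9) and VV = less.prems(10) and sep = less.prems(11)
  have opt: "(A = {} \<and> B = {}) \<or> (\<exists>x\<in>A. (\<forall>a\<in>A. a \<noteq> x \<longrightarrow> ori x a w > 0) \<and> (\<forall>b\<in>B. ori x b w > 0)) \<or>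
    (\<exists>y\<in>B. (\<forall>b\<in>B. b \<noteq> y \<longrightarrow> ori u b y > 0) \<and> (\<forall>a\<in>A. ori u a y > 0))"
  proof -
    have gA: "gen_pos (insert w (insert u A))" "gen_pos (insert u (insert w B))" by (rule gp_subset[OF gen_pos], auto)+
    have upB: "-1 * ori w b u > 0" if "b \<in> B" for b using up[of b] that ori_swap3[of w b u] by auto
    have xx: "\<exists>x\<in>A. \<forall>a\<in>A. a \<noteq> x \<longrightarrow> 1 * ori x a w > 0" if "A \<noteq> {}"
      by (rule lowest_exists[OF fin(1) that gA(1)]) (use dist dj up in auto)
    have conv: "-1 * ori y b u = ori u b y" for y b using ori_swap3[of y b u] by simp
    have yy: "\<exists>y\<in>B. \<forall>b\<in>B. b \<noteq> y \<longrightarrow> ori u b y > 0" if "B \<noteq> {}"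
      unfolding conv[symmetric] by (rule lowest_exists[OF fin(2) that gA(2)]) (use dist dj upB in auto)
    show ?thesis
    proof (cases "A = {} \<or> B = {}")
      case True
      then show ?thesis
      proof (cases "A = {}")
        case True
        then show ?thesis using yy by (cases "B = {}") auto
      next
        case False
        then have "B = {}" using True by auto
        then show ?thesis using xx[OF False] by auto
      qed
    next
      case False
      then obtain x where x: "x \<in> A" "\<forall>a\<in>A. a \<noteq> x \<longrightarrow> ori x a w > 0" using xx by auto
      obtain y where y0: "y \<in> B" and y: "\<forall>b\<in>B. b \<noteq> y \<longrightarrow> ori u b y > 0" using yy False by auto
      obtain s where s: "affine_fun s" "\<forall>a\<in>insert u A. s a < 0" "\<forall>b\<in>insert w B. s b > 0" using sep False by auto
      show ?thesis
      proof (rule ccontr)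
        assume "\<not> ?thesis"
        then obtain a b where b: "b \<in> B" "\<not> ori x b w > 0" and a: "a \<in> A" "\<not> ori u a y > 0"
          using x y y0 by blast
        have "ori x b w \<noteq> 0" using gpD[OF gen_pos, of x b w] x(1) b(1) dj by auto
        moreover have "ori u a y \<noteq> 0" using gpD[OF gen_pos, of u a y] a(1) y0 dj by auto
        moreover have "ori x a w \<ge> 0" using x a by (cases "a = x") (auto intro: less_imp_le)
        moreover have "ori u b y \<ge> 0" using y b by (cases "b = y") (auto intro: less_imp_le)
        ultimately show False
          using bridge_contra[of s u x a w y b] s x(1) y0 a b up[of x] up[of y] by force
      qed
    qed
  qed
  then consider "A = {}" "B = {}"
    | x where "x \<in> A" "\<forall>a\<in>A. a \<noteq> x \<longrightarrow> ori x a w > 0" "\<forall>b\<in>B. ori x b w > 0"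
    | y where "y \<in> B" "\<forall>b\<in>B. b \<noteq> y \<longrightarrow> ori u b y > 0" "\<forall>a\<in>A. ori u a y > 0"
    by blast
  then show ?case
  proof cases
    case 1
    have "zigzag_between A B u V w [] [] [(u, V, w)]"
      unfolding zigzag_between_def using 1 VV[of u w] by (auto intro: sp_edge)
    then show ?thesis by blast
  next
    case (2 x)
    let ?A = "A - {x}"
    have "card ?A < card A" using 2(1) fin(1) by (meson card_Diff1_less)
    then have lt: "card ?A + card B < card A + card B" by simp
    have "\<exists>la lb D. zigzag_between (?A) (B) x V w la lb D"
    proof (rule less.hyps[OF lt])
      show "gen_pos (?A \<union> B \<union> {x, V, w})" by (rule gp_subset[OF gen_pos]) (use 2(1) in auto)
      show "\<exists>s. affine_fun s \<and> (\<forall>a\<in>insert x ?A. s a < 0) \<and> (\<forall>b\<in>insert w B. s b > 0)" if AB: "?A \<noteq> {}" "B \<noteq> {}"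
      proof -
        obtain s where s: "affine_fun s" "\<forall>a\<in>insert u A. s a < 0" "\<forall>b\<in>insert w B. s b > 0" using sep[OF _ AB(2)] 2(1) by blast
        then show ?thesis using 2(1) by (intro exI[of _ s]) auto
      qed
      show "ori a V b > 0" if "a \<in> insert x ?A" "b \<in> insert w B" for a b using that VV 2(1) by auto
    qed (use 2 fin dist dj in auto)
    then obtain la lb D where Z: "zigzag_between (?A) (B) x V w la lb D" by blast
    note la = zzD(1,2)[OF Z] and lb = zzD(3,4)[OF Z] and spA = zzD(5)[OF Z] and spB = zzD(6)[OF Z]
      and bdD = zzD(7)[OF Z] and D = zzD(8)[OF Z]
    have o: "ori u x w > 0" using up 2(1) by auto
    \<comment> \<open>The line of the new base \<open>x w\<close> separates the old end
      \<open>u\<close> from the rest of the path.\<close>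
    have sp': "separable ([u] @ x # la @ [V])"
    proof (rule sp_join[of _ _ _ w])
      show "separable ([u] @ [x])" by (simp add: sp_edge)
      show "ori x w y > 0" if "y \<in> set [u]" for y using that o ori_rot[of x w u] by simp
      show "ori x w y < 0" if "y \<in> set (la @ [V])" for y
      proof -
        have "ori x y w > 0" using that la(1) 2(2) VV[of x w] 2(1) by auto
        then show ?thesis using ori_swap2[of x w y] by simp
      qed
    qed (use spA in simp)
    have Dnew: "ori a b c > 0 \<and> subseq [a, b, c] (u # (x # la) @ V # lb @ [w]) \<and>
         a \<in> insert u A \<and> c \<in> insert w B \<and>
         (b \<in> A \<or> b \<in> B \<or> b = V \<and> (A \<noteq> {} \<longrightarrow> a \<in> A) \<and> (B \<noteq> {} \<longrightarrow> c \<in> B))"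
      if "(a, b, c) \<in> set ((u, x, w) # D)" for a b c
    proof (cases "(a, b, c) = (u, x, w)")
      case True
      then have "a = u" "b = x" "c = w" by auto
      moreover have "subseq [u, x, w] (u # (x # la) @ V # lb @ [w])"
        using subseq_drop_many[of "[w]" "[w]" "la @ V # lb"] by simp
      ultimately show ?thesis using o 2(1) by simp
    next
      case False
      then have "(a, b, c) \<in> set D" using that by auto
      note d = D[OF this]
      have "subseq [a, b, c] (u # (x # la) @ V # lb @ [w])" using d by (metis append_Cons list_emb_Cons)
      moreover have "a \<in> A" using d 2(1) by blast
      ultimately show ?thesis using d by blast
    qed
    have bdn: "boundary ((u, x, w) # D) \<omega> = path_weight \<omega> (u # (x # la) @ [V]) + path_weight \<omega> (V # lb @ [w]) + \<omega> w u" if "antisym_weight \<omega>" for \<omega>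
      using bdD[OF that] asymD[OF that, of w x] by simp
    have "zigzag_between A B u V w (x # la) lb ((u, x, w) # D)"
    proof -
      have c: "set (x # la) = A" "distinct (x # la)" "separable (u # (x # la) @ [V])" using la sp' 2(1) by auto
      have d: "\<forall>\<omega>. antisym_weight \<omega> \<longrightarrow> boundary ((u, x, w) # D) \<omega> = path_weight \<omega> (u # (x # la) @ [V]) + path_weight \<omega> (V # lb @ [w]) + \<omega> w u"
        using bdn by blast
      show ?thesis unfolding zigzag_between_def by (intro conjI c lb spB d allI[OF allI[OF allI[OF impI[OF Dnew]]]])
    qed
    then show ?thesis by blast
  next
    case (3 y)
    let ?B = "B - {y}"
    have "card ?B < card B" using 3(1) fin(2) by (meson card_Diff1_less)
    then have lt: "card A + card ?B < card A + card B" by simp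
    have "\<exists>la lb D. zigzag_between (A) (?B) u V y la lb D"
    proof (rule less.hyps[OF lt])
      show "gen_pos (A \<union> ?B \<union> {u, V, y})" by (rule gp_subset[OF gen_pos]) (use 3(1) in auto)
      show "\<exists>s. affine_fun s \<and> (\<forall>a\<in>insert u A. s a < 0) \<and> (\<forall>b\<in>insert y ?B. s b > 0)" if AB: "A \<noteq> {}" "?B \<noteq> {}"
      proof -
        obtain s where s: "affine_fun s" "\<forall>a\<in>insert u A. s a < 0" "\<forall>b\<in>insert w B. s b > 0" using sep[OF AB(1)] 3(1) by blast
        then show ?thesis using 3(1) by (intro exI[of _ s]) auto
      qed
      show "ori a V b > 0" if "a \<in> insert u A" "b \<in> insert y ?B" for a b using that VV 3(1) by auto
    qed (use 3 fin dist dj in auto)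
    then obtain la lb D where Z: "zigzag_between (A) (?B) u V y la lb D" by blast
    note la = zzD(1,2)[OF Z] and lb = zzD(3,4)[OF Z] and spA = zzD(5)[OF Z] and spB = zzD(6)[OF Z]
      and bdD = zzD(7)[OF Z] and D = zzD(8)[OF Z]
    have o: "ori u y w > 0" using up 3(1) by auto
    have sp': "separable ((V # lb) @ y # [w])"
    proof (rule sp_join[of _ _ _ u])
      show "separable ((V # lb) @ [y])" using spB by simp
      show "separable [y, w]" by (rule sp_edge)
      show "ori y u p < 0" if "p \<in> set [w]" for p using that o ori_swap[of y u w] by simp
      show "ori y u p > 0" if "p \<in> set (V # lb)" for p
      proof -
        have "ori u p y > 0" using that lb(1) 3(2) VV[of u y] 3(1) by auto
        then show ?thesis using ori_rot2[of y u p] by simp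
      qed
    qed
    have Dnew: "ori a b c > 0 \<and> subseq [a, b, c] (u # la @ V # (lb @ [y]) @ [w]) \<and>
         a \<in> insert u A \<and> c \<in> insert w B \<and>
         (b \<in> A \<or> b \<in> B \<or> b = V \<and> (A \<noteq> {} \<longrightarrow> a \<in> A) \<and> (B \<noteq> {} \<longrightarrow> c \<in> B))"
      if "(a, b, c) \<in> set ((u, y, w) # D)" for a b c
    proof (cases "(a, b, c) = (u, y, w)")
      case True
      have "subseq ([] @ [y, w]) ((la @ V # lb) @ [y, w])" by (rule list_emb_append_mono) auto
      then have "subseq [u, y, w] (u # la @ V # (lb @ [y]) @ [w])" by simp
      moreover have "a = u" "b = y" "c = w" using True by auto
      ultimately show ?thesis using o 3(1) by simp
    next
      case False
      then have "(a, b, c) \<in> set D" using that by auto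
      note d = D[OF this]
      have "subseq [a, b, c] ((u # la @ V # lb @ [y]) @ [w])" using d subseq_rev_drop_many by blast
      then have "subseq [a, b, c] (u # la @ V # (lb @ [y]) @ [w])" by simp
      moreover have "c \<in> B" using d 3(1) by blast
      ultimately show ?thesis using d by blast
    qed
    have pwl: "path_weight \<omega> (V # (lb @ [y]) @ [w]) = path_weight \<omega> (V # lb @ [y]) + \<omega> y w" for \<omega>
      using pw_append[of \<omega> "V # lb" y "[w]"] by simp
    have bdn: "boundary ((u, y, w) # D) \<omega> = path_weight \<omega> (u # la @ [V]) + path_weight \<omega> (V # (lb @ [y]) @ [w]) + \<omega> w u" if "antisym_weight \<omega>" for \<omega>
      using bdD[OF that] asymD[OF that, of y u] pwl by simp
    have "zigzag_between A B u V w la (lb @ [y]) ((u, y, w) # D)"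
    proof -
      have c: "set (lb @ [y]) = B" "distinct (lb @ [y])" "separable (V # (lb @ [y]) @ [w])" using lb sp' 3(1) by auto
      have d: "\<forall>\<omega>. antisym_weight \<omega> \<longrightarrow> boundary ((u, y, w) # D) \<omega> = path_weight \<omega> (u # la @ [V]) + path_weight \<omega> (V # (lb @ [y]) @ [w]) + \<omega> w u"
        using bdn by blast
      show ?thesis unfolding zigzag_between_def by (intro conjI c la spA d allI[OF allI[OF allI[OF impI[OF Dnew]]]])
    qed
    then show ?thesis by blast
  qed
qed

section \<open>Inner hull chains\<close>

lemma pluecker: "ori r q p * ori p s x + ori r s p * ori p x q + ori r x p * ori p q s = 0"
  by (simp add: ori_def algebra_simps)

text \<open>From \<open>p\<close> the three points are seen within an open half-plane bounded by the
  line \<open>r p\<close>, where the angular order is transitive.\<close>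

lemma cone_trans:
  assumes "ori r p s < 0" "ori r p q < 0" "ori r p x < 0" "ori p s q > 0" "ori p q x > 0"
  shows "ori p s x > 0"
proof -
  have "ori r q p > 0" "ori r s p > 0" "ori r x p > 0" "ori p x q < 0" "ori p q s < 0"
    using assms ori_swap2[of r q p] ori_swap2[of r s p] ori_swap2[of r x p] ori_swap2[of p x q] ori_swap2[of p q s]
    by linarith+
  then have "ori r s p * ori p x q < 0" "ori r x p * ori p q s < 0" by (auto simp: mult_less_0_iff)
  then have "ori r q p * ori p s x > 0" using pluecker[of r q p s x] by linarith
  then show ?thesis using \<open>ori r q p > 0\<close> by (simp add: zero_less_mult_iff)
qed

lemma first_split:
  "\<exists>(a, b)\<in>set (path_edges l). P a b \<Longrightarrow> \<exists>L p q R. l = L @ p # q # R \<and> P p q \<and> (\<forall>(a, b)\<in>set (path_edges (L @ [p])). \<not> P a b)"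
proof (induction l rule: path_edges.induct)
  case (1 x y zs)
  show ?case
  proof (cases "P x y")
    case True
    then show ?thesis by (intro exI[of _ "[]"] exI[of _ x] exI[of _ y] exI[of _ zs]) auto
  next
    case False
    then obtain L p q R where h: "y # zs = L @ p # q # R" "P p q" "\<forall>(a, b)\<in>set (path_edges (L @ [p])). \<not> P a b"
      using 1 by auto
    have hd: "hd (L @ [p]) = y" using h(1) by (cases L) auto
    have "\<forall>(a, b)\<in>set (path_edges ((x # L) @ [p])). \<not> P a b"
      using h(3) hd False by (cases L) auto
    then show ?thesis using h by (intro exI[of _ "x # L"] exI[of _ p] exI[of _ q] exI[of _ R]) auto
  qed
qed auto

lemma last_split:
  "\<exists>(a, b)\<in>set (path_edges l). P a b \<Longrightarrow> \<exists>M p q L. l = M @ p # q # L \<and> P p q \<and> (\<forall>(a, b)\<in>set (path_edges (q # L)). \<not> P a b)"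
proof (induction l rule: path_edges.induct)
  case (1 x y zs)
  show ?case
  proof (cases "\<exists>(a, b)\<in>set (path_edges (y # zs)). P a b")
    case True
    then obtain M p q L where h: "y # zs = M @ p # q # L" "P p q" "\<forall>(a, b)\<in>set (path_edges (q # L)). \<not> P a b"
      using 1 by auto
    then show ?thesis by (intro exI[of _ "x # M"] exI[of _ p] exI[of _ q] exI[of _ L]) auto
  next
    case False
    then have "P x y" using 1(2) by auto
    then show ?thesis using False by (intro exI[of _ "[]"] exI[of _ x] exI[of _ y] exI[of _ zs]) auto
  qed
qed auto

text \<open>For \<open>X\<close> to the left of \<open>u v\<close>, this is the hull boundary of
  \<open>X\<close>, \<open>u\<close>, \<open>v\<close> without the edge \<open>u v\<close>,
  traversed clockwise from \<open>u\<close> to \<open>v\<close>. For empty \<open>X\<close> it is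
  that edge itself.\<close>

definition convex_chain :: "point set \<Rightarrow> point \<Rightarrow> point \<Rightarrow> point list \<Rightarrow> bool" where
  "convex_chain X u v bs \<longleftrightarrow> distinct (u # bs @ [v]) \<and> set bs \<subseteq> X \<and>
     (\<forall>(p, q)\<in>set (path_edges (u # bs @ [v])). \<forall>x\<in>X \<union> {u, v}. x \<noteq> p \<longrightarrow> x \<noteq> q \<longrightarrow> ori p q x < 0)"

lemma pe_last: "l \<noteq> [] \<Longrightarrow> (last l, q) \<in> set (path_edges (l @ [q]))"
proof -
  assume "l \<noteq> []"
  then obtain r x where l: "l = r @ [x]" by (metis rev_exhaust)
  show ?thesis unfolding l using pe_append[of r x "[q]"] by simp
qed

text \<open>Adding a point replaces the edges between the first and the last edge it is above of.\<close>

lemma chain_exists: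
  assumes "finite X" "gen_pos (insert u (insert v X))" "u \<noteq> v" "u \<notin> X" "v \<notin> X" "\<And>x. x \<in> X \<Longrightarrow> ori u v x > 0"
  shows "\<exists>bs. convex_chain X u v bs"
  using assms
proof (induction X rule: finite_induct)
  case empty
  then show ?case by (intro exI[of _ "[]"]) (auto simp: convex_chain_def)
next
  case (insert x X)
  have "\<exists>bs. convex_chain X u v bs"
    by (rule insert.IH) (use insert.prems in \<open>auto intro: gp_subset[OF insert.prems(1)]\<close>)
  then obtain bs where bs: "convex_chain X u v bs" ..
  let ?l = "u # bs @ [v]"
  have d: "distinct ?l" and sub: "set bs \<subseteq> X"
    and E: "\<And>p q s. (p, q) \<in> set (path_edges ?l) \<Longrightarrow> s \<in> X \<union> {u, v} \<Longrightarrow> s \<noteq> p \<Longrightarrow> s \<noteq> q \<Longrightarrow> ori p q s < 0"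
    using bs unfolding convex_chain_def by auto
  have lX: "set ?l \<subseteq> X \<union> {u, v}" using sub by auto
  have xn: "x \<notin> X \<union> {u, v}" using insert by auto
  have up: "s \<in> insert x X \<Longrightarrow> ori v u s < 0" for s using insert.prems(5)[of s] ori_swap[of v u s] by auto
  have gen_pos: "gen_pos (insert x (X \<union> {u, v}))" by (rule gp_subset[OF insert.prems(1)]) auto
  show ?case
  proof (cases "\<exists>(p, q)\<in>set (path_edges ?l). ori p q x > 0")
    case False
    have "ori p q x < 0" if "(p, q) \<in> set (path_edges ?l)" for p q
    proof -
      have "p \<in> X \<union> {u, v}" "q \<in> X \<union> {u, v}" "p \<noteq> q" using pe_mem[OF that] pe_neq[OF d that] lX by auto
      then have "ori p q x \<noteq> 0" using gpD[OF gen_pos, of p q x] xn by auto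
      moreover have "\<not> ori p q x > 0" using False that by auto
      ultimately show ?thesis by simp
    qed
    then have "convex_chain (insert x X) u v bs" unfolding convex_chain_def using d sub E by auto
    then show ?thesis ..
  next
    case True
    obtain L p q R where F: "?l = L @ p # q # R" "ori p q x > 0"
      and Fn: "\<forall>(a, b)\<in>set (path_edges (L @ [p])). \<not> ori a b x > 0"
      using first_split[OF True] by blast
    have "\<exists>(a, b)\<in>set (path_edges (p # q # R)). ori a b x > 0" using F(2) by auto
    from last_split[OF this] obtain M p' q' L2 where G: "p # q # R = M @ p' # q' # L2" "ori p' q' x > 0"
      and Gn: "\<forall>(a, b)\<in>set (path_edges (q' # L2)). \<not> ori a b x > 0" by blast
    have l2: "?l = L @ M @ p' # q' # L2" using F(1) G(1) by simp
    have e1: "(p, q) \<in> set (path_edges ?l)" unfolding F(1) using pe_append[of L p "q # R"] by simp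
    have e2: "(p', q') \<in> set (path_edges ?l)" unfolding l2 using pe_append[of "L @ M" p' "q' # L2"] by simp
    have eL: "set (path_edges (L @ [p])) \<subseteq> set (path_edges ?l)" unfolding F(1) using pe_append[of L p "q # R"] by auto
    have eL2: "set (path_edges (q' # L2)) \<subseteq> set (path_edges ?l)" unfolding l2 using pe_append[of "L @ M @ [p']" q' L2] by auto
    have pm: "p \<in> X \<union> {u, v}" "q \<in> X \<union> {u, v}" "p' \<in> X \<union> {u, v}" "q' \<in> X \<union> {u, v}"
      using pe_mem[OF e1] pe_mem[OF e2] lX by auto
    have pq: "p \<noteq> q" "p' \<noteq> q'" using pe_neq[OF d] e1 e2 by auto
    have neg: "ori a b x < 0" if "(a, b) \<in> set (path_edges ?l)" "\<not> ori a b x > 0" for a b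
    proof -
      have "a \<in> X \<union> {u, v}" "b \<in> X \<union> {u, v}" "a \<noteq> b" using pe_mem[OF that(1)] pe_neq[OF d that(1)] lX by auto
      then have "ori a b x \<noteq> 0" using gpD[OF gen_pos, of a b x] xn by auto
      then show ?thesis using that(2) by simp
    qed
    text \<open>Points of the old chain other than \<open>u, v\<close> exist only if \<open>uv\<close> is not a chain edge.\<close>
    have base: "X = {}" if "(u, v) \<in> set (path_edges ?l)"
    proof (rule ccontr)
      assume "X \<noteq> {}"
      then obtain s where "s \<in> X" by auto
      then have "ori u v s < 0" "ori u v s > 0" using E[OF that, of s] insert.prems(3,4,5) by auto
      then show False by simp
    qed
    \<comment> \<open>The predecessor of \<open>p\<close> on the closed hull boundary, which is
      \<open>v\<close> when \<open>p = u\<close>. It bounds, together with \<open>p q\<close>, the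
      angle at \<open>p\<close> containing all old points.\<close>
    have R1: "\<exists>r\<in>X \<union> {u, v}. r \<noteq> p \<and> ori r p x < 0 \<and> (\<forall>s\<in>X \<union> {u, v}. s \<noteq> r \<longrightarrow> s \<noteq> p \<longrightarrow> ori r p s < 0)"
    proof (cases "L = []")
      case True
      then have "p = u" using F(1) by simp
      then show ?thesis using up insert.prems(2) by (intro bexI[of _ v]) auto
    next
      case False
      have m: "(last L, p) \<in> set (path_edges (L @ [p]))" using pe_last[OF False] .
      then have m': "(last L, p) \<in> set (path_edges ?l)" using eL by auto
      show ?thesis
        using neg[OF m'] Fn m E[OF m'] pe_mem[OF m'] lX pe_neq[OF d m'] by (intro bexI[of _ "last L"]) auto
    qed
    then obtain r where r: "r \<in> X \<union> {u, v}" "r \<noteq> p" "ori r p x < 0"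
      "\<And>s. s \<in> X \<union> {u, v} \<Longrightarrow> s \<noteq> r \<Longrightarrow> s \<noteq> p \<Longrightarrow> ori r p s < 0" by blast
    have R2: "\<exists>r\<in>X \<union> {u, v}. r \<noteq> q' \<and> ori q' r x < 0 \<and> (\<forall>s\<in>X \<union> {u, v}. s \<noteq> r \<longrightarrow> s \<noteq> q' \<longrightarrow> ori q' r s < 0)"
    proof (cases L2)
      case Nil
      have "last ?l = q'" unfolding l2 Nil by simp
      then have "q' = v" by simp
      then show ?thesis using up insert.prems(2) by (intro bexI[of _ u]) auto
    next
      case (Cons r2 L3)
      have m: "(q', r2) \<in> set (path_edges (q' # L2))" unfolding Cons by simp
      then have m': "(q', r2) \<in> set (path_edges ?l)" using eL2 by auto
      show ?thesis
        using neg[OF m'] Gn m E[OF m'] pe_mem[OF m'] lX pe_neq[OF d m'] by (intro bexI[of _ r2]) auto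
    qed
    then obtain r' where r': "r' \<in> X \<union> {u, v}" "r' \<noteq> q'" "ori q' r' x < 0"
      "\<And>s. s \<in> X \<union> {u, v} \<Longrightarrow> s \<noteq> r' \<Longrightarrow> s \<noteq> q' \<Longrightarrow> ori q' r' s < 0" by blast
    have xp: "x \<noteq> p" "x \<noteq> q'" using xn pm by auto
    have new1: "ori p x s < 0" if s: "s \<in> X \<union> {u, v}" "s \<noteq> p" for s
    proof (cases "s = r \<or> s = q")
      case True
      then show ?thesis using r(3) F(2) ori_rot[of p x r] ori_swap2[of p x q] by auto
    next
      case False
      show ?thesis
      proof (cases "q = r")
        case True
        then have "ori r p s < 0" "ori p q s < 0" using r(4)[of s] E[OF e1 s(1)] s False by auto
        then show ?thesis using True ori_swap[of p r s] by simp
      next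
        case qr: False
        have "ori p s x > 0"
        proof (rule cone_trans[of r p s q x])
          show "ori r p s < 0" using r(4) s False by auto
          show "ori r p q < 0" using r(4) pm qr pq by auto
          show "ori p s q > 0" using E[OF e1 s(1)] s False ori_swap2[of p s q] by auto
        qed (use r F in auto)
        then show ?thesis using ori_swap2[of p x s] by simp
      qed
    qed
    have new2: "ori x q' s < 0" if s: "s \<in> X \<union> {u, v}" "s \<noteq> q'" for s
    proof (cases "s = r' \<or> s = p'")
      case True
      then show ?thesis using r'(3) G(2) ori_rot2[of x q' r'] ori_swap3[of x q' p'] by auto
    next
      case False
      show ?thesis
      proof (cases "p' = r'")
        case True
        then have "ori q' r' s < 0" "ori p' q' s < 0" using r'(4)[of s] E[OF e2 s(1)] s False by auto
        then show ?thesis using True ori_swap[of q' r' s] by simp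
      next
        case qr: False
        have n: "ori r' q' y = - ori q' r' y" for y by (rule ori_swap)
        have "ori q' x p' > 0" using G(2) ori_rot[of q' x p'] by simp
        moreover have "ori q' p' s > 0" using E[OF e2 s(1)] s False ori_swap[of q' p' s] by auto
        moreover have "ori q' r' s < 0" "ori q' r' p' < 0" using r'(4) s False pm qr pq by auto
        moreover have P: "ori r' p' q' * ori q' x s + ori r' x q' * ori q' s p' + ori r' s q' * ori q' p' x = 0"
          by (rule pluecker)
        moreover have "ori r' p' q' = ori q' r' p'" "ori r' x q' = ori q' r' x" "ori r' s q' = ori q' r' s"
          by (rule ori_rot)+
        moreover have "ori q' s p' = - ori q' p' s" "ori q' p' x = - ori q' x p'" by (rule ori_swap2)+
        moreover have "ori q' r' x * (- ori q' p' s) > 0" "ori q' r' s * (- ori q' x p') > 0"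
          using calculation r'(3) by (auto simp: mult_less_0_iff zero_less_mult_iff)
        ultimately have "ori q' r' p' * ori q' x s < 0" by simp
        then have "ori q' x s > 0" using \<open>ori q' r' p' < 0\<close> by (simp add: mult_less_0_iff)
        then show ?thesis using ori_swap[of x q' s] by simp
      qed
    qed
    let ?n = "L @ p # x # q' # L2"
    have "subseq (L @ p # q' # L2) ?l"
    proof -
      have "subseq ([p] @ q' # L2) ((p # q # R))"
      proof (cases M)
        case Nil then show ?thesis using G(1) by auto
      next
        case (Cons m M')
        have "subseq (q' # L2) ((M' @ [p']) @ q' # L2)" by (rule subseq_drop_many) simp
        then show ?thesis using G(1) Cons by simp
      qed
      then have "subseq (L @ ([p] @ q' # L2)) (L @ (p # q # R))" by (intro list_emb_append_mono) simp_all
      then show ?thesis unfolding F(1) by simp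
    qed
    note ss = this
    have dn: "distinct (L @ p # q' # L2)"
      using subseqs_distinctD[OF _ d] ss unfolding in_set_subseqs by blast
    have sn: "set (L @ p # q' # L2) \<subseteq> set ?l" using subseq_mem[OF ss] by blast
    have hd: "hd ?n = u" using F(1) by (cases L) auto
    have la: "last ?n = v"
    proof -
      have "last ?l = last (q' # L2)" unfolding l2 by simp
      moreover have "last ?n = last (q' # L2)" by simp
      ultimately show ?thesis by simp
    qed
    define n1 where "n1 = tl ?n"
    have n1: "?n = u # n1" unfolding n1_def using hd by (cases L) simp_all
    have "n1 \<noteq> []" unfolding n1_def by (cases L) simp_all
    then have "last n1 = v" using la unfolding n1 by simp
    then have n2: "n1 = butlast n1 @ [v]" using append_butlast_last_id[OF \<open>n1 \<noteq> []\<close>] by simp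
    define cs where "cs = butlast n1"
    have cs: "?n = u # cs @ [v]" unfolding n1 cs_def using n2 by simp
    have xm: "x \<notin> set (L @ p # q' # L2)" using sn lX xn by blast
    have "distinct ?n" using dn xm by auto
    then have dcs: "distinct (u # cs @ [v])" by (simp only: cs)
    have "convex_chain (insert x X) u v cs" unfolding convex_chain_def
    proof (intro conjI)
      show "distinct (u # cs @ [v])" by (rule dcs)
      have "u \<notin> set cs" "v \<notin> set cs" using dcs by simp_all
      moreover have "set cs \<subseteq> set ?n" unfolding cs by (simp add: subset_insertI2)
      moreover have "set ?n \<subseteq> insert x (set (L @ p # q' # L2))" by auto
      ultimately show "set cs \<subseteq> insert x X" using sn lX by blast
      have pn: "path_edges ?n = path_edges (L @ [p]) @ (p, x) # (x, q') # path_edges (q' # L2)" using pe_append[of L p "x # q' # L2"] by simp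
      show "\<forall>(a, b)\<in>set (path_edges (u # cs @ [v])). \<forall>s\<in>insert x X \<union> {u, v}. s \<noteq> a \<longrightarrow> s \<noteq> b \<longrightarrow> ori a b s < 0"
      proof (clarify)
        fix a b s assume ab: "(a, b) \<in> set (path_edges (u # cs @ [v]))" and s: "s \<in> insert x X \<union> {u, v}" "s \<noteq> a" "s \<noteq> b"
        have ab': "(a, b) \<in> set (path_edges ?n)" using ab unfolding cs .
        then consider "(a, b) \<in> set (path_edges (L @ [p]))" | "a = p" "b = x" | "a = x" "b = q'" | "(a, b) \<in> set (path_edges (q' # L2))"
          unfolding pn by auto
        then show "ori a b s < 0"
        proof cases
          case 1
          then show ?thesis using eL neg[of a b] Fn E[of a b s] s by (cases "s = x") auto
        next
          case 2
          then show ?thesis using new1 s by auto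
        next
          case 3
          then show ?thesis using new2 s by auto
        next
          case 4
          then show ?thesis using eL2 neg[of a b] Gn E[of a b s] s by (cases "s = x") auto
        qed
      qed
    qed
    then show ?thesis ..
  qed
qed

section \<open>Convex chains\<close>

lemma cw_trans:
  assumes "ori a y b < 0" "ori a y c < 0" "ori a y d < 0" "ori a b c < 0" "ori a c d < 0"
  shows "ori a b d < 0"
proof -
  have r: "ori (2 *\<^sub>R a - y) a x = ori a y x" for x by (simp add: ori_def algebra_simps)
  have "ori a d b > 0"
    by (rule cone_trans[of "2 *\<^sub>R a - y" a d c b])
       (use assms ori_swap2[of a d c] ori_swap2[of a c b] in \<open>simp_all add: r\<close>)
  then show ?thesis using ori_swap2[of a b d] by simp
qed

lemma fan_sorted:
  assumes "\<forall>z\<in>set zs. ori a y z < 0" "\<forall>(p, q)\<in>set (path_edges zs). ori a p q < 0" "subseq [b, c] zs"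
  shows "ori a b c < 0"
proof -
  have tail: "\<forall>c\<in>set r. ori a z c < 0"
    if "\<forall>z\<in>set (z # r). ori a y z < 0" "\<forall>(p, q)\<in>set (path_edges (z # r)). ori a p q < 0" for z r
    using that
  proof (induction r arbitrary: z)
    case (Cons z' r)
    have 1: "ori a z z' < 0" using Cons.prems by simp
    have 2: "\<forall>c\<in>set r. ori a z' c < 0" using Cons.IH[of z'] Cons.prems by simp
    have "ori a z c < 0" if "c \<in> set r" for c
      by (rule cw_trans[of a y z z' c]) (use Cons.prems 1 2 that in auto)
    then show ?case using 1 by simp
  qed simp
  show ?thesis using assms
  proof (induction zs)
    case (Cons z r)
    show ?case
    proof (cases "b = z \<and> subseq [c] r")
      case True
      then show ?thesis using tail[OF Cons.prems(1,2)] by (simp add: subseq_singleton_left)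
    next
      case False
      then have s: "subseq [b, c] r" using Cons.prems(3) by (cases "b = z") auto
      have "\<forall>(p, q)\<in>set (path_edges r). ori a p q < 0" using Cons.prems(2) by (cases r) auto
      then show ?thesis using Cons.IH[OF _ _ s] Cons.prems(1) by simp
    qed
  qed simp
qed

text \<open>From edges to arbitrary increasing triples: seen from the first vertex, the later ones
  lie in a half-plane bounded by its edge and each turns clockwise from the one before, so the
  comparisons compose.\<close>

lemma convex_triples:
  assumes "distinct l" "\<And>p q x. (p, q) \<in> set (path_edges l) \<Longrightarrow> x \<in> set l \<Longrightarrow> x \<noteq> p \<Longrightarrow> x \<noteq> q \<Longrightarrow> ori p q x < 0"
    and "subseq [a, b, c] l"
  shows "ori a b c < 0"
  using assms
proof (induction l)
  case (Cons x r)
  have dr: "distinct r" using Cons.prems(1) by simp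
  have er: "(p, q) \<in> set (path_edges r) \<Longrightarrow> (p, q) \<in> set (path_edges (x # r))" for p q by (cases r) auto
  show ?case
  proof (cases "subseq [a, b, c] r")
    case True
    show ?thesis by (rule Cons.IH[OF dr _ True]) (use Cons.prems(2) er in auto)
  next
    case False
    then have ax: "a = x" and bc: "subseq [b, c] r" using Cons.prems(3) by (cases "a = x"; auto)+
    then obtain y zs where r: "r = y # zs" by (cases r) auto
    have xy: "\<forall>z\<in>set zs. ori x y z < 0" using Cons.prems(1,2) unfolding r by auto
    have pz: "ori x p q < 0" if "(p, q) \<in> set (path_edges zs)" for p q
    proof -
      have "(p, q) \<in> set (path_edges r)" using that unfolding r by (cases zs) auto
      moreover have "x \<noteq> p" "x \<noteq> q" using pe_mem[OF that] Cons.prems(1) unfolding r by auto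
      ultimately have "ori p q x < 0" using Cons.prems(2)[of p q x] er by auto
      then show ?thesis using ori_rot2[of x p q] by simp
    qed
    show ?thesis
    proof (cases "b = y \<and> subseq [c] zs")
      case True
      then show ?thesis using xy ax by (simp add: subseq_singleton_left)
    next
      case False
      then have "subseq [b, c] zs" using bc unfolding r by (cases "b = y") auto
      then show ?thesis using fan_sorted[OF xy _, of b c] pz ax by auto
    qed
  qed
qed simp

section \<open>Distributing points behind the edges of a convex chain\<close>

definition full :: "(nat \<Rightarrow> 'a) \<Rightarrow> (nat \<Rightarrow> 'a list) \<Rightarrow> nat \<Rightarrow> nat \<Rightarrow> 'a list" where
  "full c l i k = concat (map (\<lambda>j. c j # l j) [i..<k]) @ [c k]"

text \<open>A line through a vertex of a convex polygon meets the boundary in at most one further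
  point outside the edges at that vertex. If it separates the ends of the chain, it separates the
  two whole parts.\<close>

lemma sides:
  fixes c :: "nat \<Rightarrow> point"
  assumes cv: "\<And>a b d. i \<le> a \<Longrightarrow> a < b \<Longrightarrow> b < d \<Longrightarrow> d \<le> k \<Longrightarrow> ori (c a) (c b) (c d) < 0"
    and j: "i < j" "j < k" and f: "affine_fun f" "f (c j) = 0" "f (c i) > 0" "f (c k) < 0"
  shows "i \<le> m \<Longrightarrow> m < j \<Longrightarrow> f (c m) > 0" and "j < m \<Longrightarrow> m \<le> k \<Longrightarrow> f (c m) < 0"
proof -
  have B: "f p * ori (c j) x y = f x * ori (c j) p y + f y * ori (c j) x p" for p x y
    using aff_bary[OF f(1), of p "c j" x y] f(2) by simp
  have R: "ori (c j) (c k) (c i) < 0" using cv[of i j k] j ori_rot[of "c j" "c k" "c i"] by simp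
  show "f (c m) > 0" if m: "i \<le> m" "m < j"
  proof (cases "m = i")
    case False
    then have im: "i < m" using m by simp
    have o1: "ori (c j) (c k) (c m) < 0" using cv[of m j k] m j ori_rot[of "c j" "c k" "c m"] by simp
    have o2: "ori (c j) (c i) (c m) < 0" using cv[of i m j] m im j ori_rot2[of "c j" "c i" "c m"] by simp
    have "f (c i) * ori (c j) (c k) (c m) = f (c k) * ori (c j) (c i) (c m) + f (c m) * ori (c j) (c k) (c i)"
      by (rule B)
    moreover have "f (c i) * ori (c j) (c k) (c m) < 0" "f (c k) * ori (c j) (c i) (c m) > 0"
      using f o1 o2 by (auto simp: mult_less_0_iff zero_less_mult_iff)
    ultimately have "f (c m) * ori (c j) (c k) (c i) < 0" by linarith
    then show ?thesis using R by (simp add: mult_less_0_iff)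
  qed (use f in simp)
  show "f (c m) < 0" if m: "j < m" "m \<le> k"
  proof (cases "m = k")
    case False
    then have mk: "m < k" using m by simp
    have o1: "ori (c j) (c m) (c i) < 0" using cv[of i j m] m j ori_rot[of "c j" "c m" "c i"] by simp
    have o2: "ori (c j) (c m) (c k) < 0" using cv[of j m k] m mk j by simp
    have "f (c k) * ori (c j) (c m) (c i) = f (c m) * ori (c j) (c k) (c i) + f (c i) * ori (c j) (c m) (c k)"
      by (rule B)
    moreover have "f (c k) * ori (c j) (c m) (c i) > 0" "f (c i) * ori (c j) (c m) (c k) < 0"
      using f o1 o2 by (auto simp: mult_less_0_iff zero_less_mult_iff)
    ultimately have "f (c m) * ori (c j) (c k) (c i) > 0" by linarith
    then show ?thesis using R by (simp add: zero_less_mult_iff)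
  qed (use f in simp)
qed

text \<open>The extensions of \<open>z b\<close> and \<open>z c\<close> beyond the edge \<open>bc\<close> diverge, so they cannot both miss the chord \<open>ad\<close>
  on opposite sides.\<close>

lemma late_early_contra:
  assumes q: "ori a b c < 0" "ori b c d < 0" "ori a c d < 0"
    and z: "ori b c z > 0" "ori b d z < 0" "ori a c z < 0"
  shows False
proof -
  have "ori a c z * ori b c d = ori a c b * ori z c d + ori a c c * ori b z d + ori a c d * ori b c z"
    by (rule aff_bary[OF aff_ori])
  moreover have "ori a c z * ori b c d > 0" "ori a c d * ori b c z < 0"
    using q z by (auto simp: mult_less_0_iff zero_less_mult_iff)
  ultimately have "ori a c b * ori z c d > 0" by simp
  moreover have "ori a c b > 0" using q ori_swap2[of a c b] by simp
  ultimately have "ori z c d > 0" by (simp add: zero_less_mult_iff)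
  moreover have "ori b c d = ori z c d + ori b z d + ori b c z" by (rule ori_split)
  moreover have "ori b z d = - ori b d z" by (rule ori_swap2)
  ultimately show False using q z by linarith
qed

text \<open>The points \<open>X\<close> lie behind a convex chain, and \<open>z j\<close> is the
  apex of the triangle in front of its edge at \<open>c j\<close>. Each point must be seen from the
  apex of its cell through the edge, and paths through the cells must join to a separable path. Both
  come from cutting at a vertex by a line whose two sides meet the end condition of the left part
  and the start condition of the right part.\<close>

lemma body:
  fixes c z :: "nat \<Rightarrow> point"
  assumes "i < k" "finite X" "gen_pos S" "c ` {i..k} \<union> z ` {i..<k} \<union> X \<subseteq> S"
    and "\<And>j. i \<le> j \<Longrightarrow> j \<le> k \<Longrightarrow> c j \<notin> X" "\<And>j. i \<le> j \<Longrightarrow> j < k \<Longrightarrow> z j \<notin> X"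
      "\<And>j m. i \<le> j \<Longrightarrow> j < k \<Longrightarrow> i \<le> m \<Longrightarrow> m \<le> k \<Longrightarrow> z j \<noteq> c m" "inj_on c {i..k}"
    and "\<And>a b d. i \<le> a \<Longrightarrow> a < b \<Longrightarrow> b < d \<Longrightarrow> d \<le> k \<Longrightarrow> ori (c a) (c b) (c d) < 0"
    and "\<And>j. i \<le> j \<Longrightarrow> j < k \<Longrightarrow> ori (c j) (c (Suc j)) (z j) > 0"
    and "\<And>j x. i \<le> j \<Longrightarrow> j < k \<Longrightarrow> x \<in> X \<Longrightarrow> ori (c j) (c (Suc j)) x < 0"
    and "\<And>x. x \<in> X \<Longrightarrow> ori (c i) x (z i) > 0" "\<And>x. x \<in> X \<Longrightarrow> ori x (c k) (z (k - 1)) > 0"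
    and "\<And>j x. i < j \<Longrightarrow> j < k \<Longrightarrow> x \<in> X \<Longrightarrow> ori x (c j) (z (j - 1)) > 0 \<or> ori (c j) x (z j) > 0"
  shows "\<exists>cell. (\<Union>j\<in>{i..<k}. cell j) = X \<and> (\<forall>j\<in>{i..<k}. \<forall>m\<in>{i..<k}. j \<noteq> m \<longrightarrow> cell j \<inter> cell m = {}) \<and>
    (\<forall>j\<in>{i..<k}. \<forall>x\<in>cell j. ori (c j) x (z j) > 0 \<and> ori x (c (Suc j)) (z j) > 0) \<and>
    (\<forall>l. (\<forall>j\<in>{i..<k}. set (l j) = cell j \<and> separable (c j # l j @ [c (Suc j)])) \<longrightarrow> separable (full c l i k))"
  using assms
proof (induction "k - i" arbitrary: i k X rule: less_induct)
  case less
  note ik = less.prems(1) and fin = less.prems(2) and gen_pos = less.prems(3) and S = less.prems(4)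
    and cX = less.prems(5) and zX = less.prems(6) and zc = less.prems(7) and inj = less.prems(8)
    and cv = less.prems(9) and zl = less.prems(10) and xr = less.prems(11)
    and fi = less.prems(12) and la = less.prems(13) and cl = less.prems(14)
  have cS: "c j \<in> S" if "i \<le> j" "j \<le> k" for j using S that by auto
  have zS: "z j \<in> S" if "i \<le> j" "j < k" for j using S that by auto
  have xS: "x \<in> S" if "x \<in> X" for x using S that by auto
  show ?case
  proof (cases "k = Suc i")
    case True
    then have r: "{i..<k} = {i}" by auto
    have "separable (full c l i k)" if "\<forall>j\<in>{i..<k}. set (l j) = X \<and> separable (c j # l j @ [c (Suc j)])" for l
      using that unfolding r full_def by (simp add: True)
    then show ?thesis unfolding r using fi la True by (intro exI[of _ "\<lambda>_. X"]) auto
  next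
    case False
    \<comment> \<open>\<open>A j > 0\<close> is the condition at \<open>c j\<close> as last vertex
      of the left part, \<open>R j > 0\<close> the condition at \<open>c j\<close> as first vertex
      of the right part.\<close>
    define A where "A j p = ori p (c j) (z (j - 1))" for j p
    define R where "R j p = ori (c j) p (z j)" for j p
    have affA: "affine_fun (A j)" for j
    proof -
      have "A j = ori (c j) (z (j - 1))" unfolding A_def by (rule ext) (rule ori_rot[symmetric])
      then show ?thesis by simp
    qed
    have affR: "affine_fun (R j)" for j
    proof -
      have "R j = ori (z j) (c j)" unfolding R_def by (rule ext) (rule ori_rot2[symmetric])
      then show ?thesis by simp
    qed
    have AR0: "A j (c j) = 0" "R j (c j) = 0" for j unfolding A_def R_def by simp_all
    have cne: "c j \<noteq> c m" if "i \<le> j" "j \<le> k" "i \<le> m" "m \<le> k" "j \<noteq> m" for j m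
      using inj that unfolding inj_on_def by auto
    have nzc: "A j (c m) \<noteq> 0 \<and> R j (c m) \<noteq> 0" if h: "i < j" "j < k" "i \<le> m" "m \<le> k" "m \<noteq> j" for j m
    proof -
      have r: "i \<le> j - 1" "j - 1 < k" "i \<le> j" "j \<le> k" using h by auto
      have "ori (c m) (c j) (z (j - 1)) \<noteq> 0"
        by (rule gpD[OF gen_pos cS[OF h(3,4)] cS[OF r(3,4)] zS[OF r(1,2)]])
           (use zc[OF r(1,2) h(3,4)] zc[OF r(1,2,3,4)] cne[OF h(3,4) r(3,4) h(5)] in auto)
      moreover have "ori (c j) (c m) (z j) \<noteq> 0"
        by (rule gpD[OF gen_pos cS[OF r(3,4)] cS[OF h(3,4)] zS[OF r(3) h(2)]])
           (use zc[OF r(3) h(2) h(3,4)] zc[OF r(3) h(2) r(3,4)] cne[OF h(3,4) r(3,4) h(5)] in auto)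
      ultimately show ?thesis unfolding A_def R_def ..
    qed
    have nzx: "A j x \<noteq> 0 \<and> R j x \<noteq> 0" if h: "i < j" "j < k" "x \<in> X" for j x
    proof -
      have r: "i \<le> j - 1" "j - 1 < k" "i \<le> j" "j \<le> k" using h by auto
      have "ori x (c j) (z (j - 1)) \<noteq> 0"
        by (rule gpD[OF gen_pos xS[OF h(3)] cS[OF r(3,4)] zS[OF r(1,2)]])
           (use zc[OF r(1,2,3,4)] cX[OF r(3,4)] zX[OF r(1,2)] h in auto)
      moreover have "ori (c j) x (z j) \<noteq> 0"
        by (rule gpD[OF gen_pos cS[OF r(3,4)] xS[OF h(3)] zS[OF r(3) h(2)]])
           (use zc[OF r(3) h(2) r(3,4)] cX[OF r(3,4)] zX[OF r(3) h(2)] h in auto)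
      ultimately show ?thesis unfolding A_def R_def ..
    qed
    text \<open>A vertex through which a line can separate the two parts of the chain as well as the points.\<close>
    have good: "\<exists>j. i < j \<and> j < k \<and> R j (c k) > 0 \<and> A j (c i) > 0"
    proof (rule ccontr)
      assume no: "\<not> ?thesis"
      \<comment> \<open>Without a suitable vertex, \<open>late_early_contra\<close> carries
        negativity of \<open>R j (c k)\<close> from each vertex to the next, up to
        \<open>j = k - 1\<close>, where \<open>c k\<close> is the end of the edge and the value is
        positive.\<close>
      have late0: "R (Suc i + d) (c k) < 0" if "Suc i + d < k" for d
        using that
      proof (induction d)
        case 0
        have "A (Suc i) (c i) > 0" unfolding A_def using zl[of i] ik by simp
        then have "\<not> R (Suc i) (c k) > 0" using no 0 by auto
        then show ?case using nzc[of "Suc i" k] 0 ik by auto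
      next
        case (Suc d)
        define j where "j = Suc i + d"
        have ij: "i < j" "Suc j < k" using Suc.prems unfolding j_def by auto
        have L: "R j (c k) < 0" using Suc unfolding j_def by auto
        have "R (Suc j) (c k) < 0"
        proof (rule ccontr)
          assume "\<not> R (Suc j) (c k) < 0"
          then have "R (Suc j) (c k) > 0" using nzc[of "Suc j" k] ij by auto
          then have "\<not> A (Suc j) (c i) > 0" using no ij by auto
          then have E: "A (Suc j) (c i) < 0" using nzc[of "Suc j" i] ij by auto
          show False
            by (rule late_early_contra[of "c i" "c j" "c (Suc j)" "c k" "z j"])
               (use cv[of i j "Suc j"] cv[of j "Suc j" k] cv[of i "Suc j" k] zl[of j] L E ij in \<open>auto simp: A_def R_def\<close>)
        qed
        then show ?case unfolding j_def by simp
      qed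
      have "k - 1 > i" "k - 1 < k" using ik False by auto
      then have e: "Suc i + (k - 1 - Suc i) = k - 1" by simp
      have "R (Suc i + (k - 1 - Suc i)) (c k) < 0" by (rule late0) (simp only: e \<open>k - 1 < k\<close>)
      then have "R (k - 1) (c k) < 0" by (simp only: e)
      moreover have "R (k - 1) (c k) > 0" unfolding R_def using zl[of "k - 1"] ik by simp
      ultimately show False by simp
    qed
    then obtain j where j: "i < j" "j < k" and Rk: "R j (c k) > 0" and Ai: "A j (c i) > 0" by blast
    \<comment> \<open>The cut is the line of \<open>z (j - 1)\<close> and \<open>c j\<close> if it
      separates the ends of the chain, or the line of \<open>z j\<close> and \<open>c j\<close> if
      that one does, or else a generic line from \<open>c j\<close> to the chord of the ends. In the
      first two cases each point fulfils the right condition because it fulfils one of the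
      two.\<close>
    have "\<exists>f. (\<exists>q. f = ori (c j) q \<or> f = (\<lambda>p. - ori (c j) q p)) \<and> f (c i) > 0 \<and> f (c k) < 0 \<and>
      (\<forall>x\<in>X. f x \<noteq> 0 \<and> (f x > 0 \<longrightarrow> A j x > 0) \<and> (f x < 0 \<longrightarrow> R j x > 0))"
    proof -
      consider "A j (c k) < 0" | "R j (c i) < 0" | "A j (c k) > 0" "R j (c i) > 0"
        using nzc[of j i] nzc[of j k] j by fastforce
      then show ?thesis
      proof cases
        case 1
        have "A j = ori (c j) (z (j - 1))" unfolding A_def by (rule ext) (rule ori_rot[symmetric])
        moreover have "R j x > 0" if "x \<in> X" "A j x < 0" for x using cl[OF j that(1)] that(2) unfolding A_def R_def by auto
        ultimately show ?thesis using 1 Ai nzx[OF j] by (intro exI[of _ "A j"]) blast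
      next
        case 2
        have "- R j p = ori (c j) (z j) p" for p unfolding R_def using ori_swap2[of "c j" p "z j"] by simp
        then have "(\<lambda>p. - R j p) = ori (c j) (z j)" by (rule ext)
        moreover have "A j x > 0" if "x \<in> X" "- R j x > 0" for x using cl[OF j that(1)] that(2) unfolding A_def R_def by auto
        ultimately show ?thesis using 2 Rk nzx[OF j] by (intro exI[of _ "\<lambda>p. - R j p"]) (auto; blast)
      next
        case 3
        define \<mu> where "\<mu> t = (1 - t) *\<^sub>R c i + t *\<^sub>R c k" for t
        have om: "ori (c j) (\<mu> t) p = (1 - t) * ori (c j) (c i) p + t * ori (c j) (c k) p" for t p
          unfolding \<mu>_def by (simp add: ori_def algebra_simps)
        have fin1: "finite {t. ori (c j) (\<mu> t) p = 0}" if p: "p \<in> X" for p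
        proof -
          have "p \<noteq> c j" "p \<noteq> c k" "c j \<noteq> c k" using p cX[of j] cX[of k] cne[of j k] j by auto
          then have nz: "ori (c j) (c k) p \<noteq> 0" using gpD[OF gen_pos, of "c j" "c k" p] cS[of j] cS[of k] xS[OF p] j by auto
          have "t = t'" if "ori (c j) (\<mu> t) p = 0" "ori (c j) (\<mu> t') p = 0" for t t'
          proof -
            have "(t - t') * (ori (c j) (c k) p - ori (c j) (c i) p) = 0" using that unfolding om by (simp add: algebra_simps)
            then have "t = t' \<or> ori (c j) (c k) p = ori (c j) (c i) p" by auto
            moreover have "ori (c j) (c k) p = 0" if "ori (c j) (c k) p = ori (c j) (c i) p"
              using \<open>ori (c j) (\<mu> t) p = 0\<close> that unfolding om by (simp add: algebra_simps)
            ultimately show ?thesis using nz by auto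
          qed
          then have "\<exists>t0. {t. ori (c j) (\<mu> t) p = 0} \<subseteq> {t0}" by blast
          then show ?thesis by (meson finite.emptyI finite_insert finite_subset)
        qed
        have "finite (\<Union>p\<in>X. {t. ori (c j) (\<mu> t) p = 0})" using fin fin1 by auto
        moreover have "infinite {0<..<1::real}" by (simp add: infinite_Ioo)
        ultimately have "infinite ({0<..<1} - (\<Union>p\<in>X. {t. ori (c j) (\<mu> t) p = 0}))" by (rule Diff_infinite_finite)
        then have "{0<..<1} - (\<Union>p\<in>X. {t. ori (c j) (\<mu> t) p = 0}) \<noteq> {}" by (metis finite.emptyI)
        then obtain t where "t \<in> {0<..<1} - (\<Union>p\<in>X. {t. ori (c j) (\<mu> t) p = 0})" by blast
        then have t: "0 < t" "t < 1" and gen: "\<And>p. p \<in> X \<Longrightarrow> ori (c j) (\<mu> t) p \<noteq> 0" by auto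
        define f where "f p = - ori (c j) (\<mu> t) p" for p
        have faff: "affine_fun f"
          using aff_comb[OF aff_ori[of "c j" "\<mu> t"] aff_ori[of "c j" "\<mu> t"], of "-1" 0] unfolding f_def by simp
        have o: "ori (c j) (c k) (c i) < 0" using cv[of i j k] j ori_rot[of "c j" "c k" "c i"] by simp
        have fi': "f (c i) = - t * ori (c j) (c k) (c i)" "f (c k) = (1 - t) * ori (c j) (c k) (c i)"
          unfolding f_def \<mu>_def by (simp_all add: ori_def algebra_simps)
        have f1: "f (c i) > 0" "f (c k) < 0" unfolding fi' using t o by (auto simp: mult_less_0_iff mult_pos_neg)
        have f0: "f (c j) = 0" unfolding f_def by simp
        note sd = sides[OF cv j faff f0 f1]
        have Am: "A j (\<mu> t) > 0" unfolding \<mu>_def aff_seg[OF affA] using 3 Ai t by (simp add: add_pos_pos)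
        have Rm: "R j (\<mu> t) > 0" unfolding \<mu>_def aff_seg[OF affR] using 3 Rk t by (simp add: add_pos_pos)
        have A1: "A j (c (j - 1)) > 0" unfolding A_def using zl[of "j - 1"] j by simp
        have R1: "R j (c (Suc j)) > 0" unfolding R_def using zl[of j] j by simp
        \<comment> \<open>\<open>A j\<close> is positive at \<open>\<mu> t\<close> and at the
          neighbour of \<open>c j\<close> on the left part, hence on the cone at \<open>c j\<close>
          spanned by them, and \<open>x\<close> lies in this cone.\<close>
        have "A j x > 0" if x: "x \<in> X" "f x > 0" for x
        proof -
          have "A j x * ori (c j) (\<mu> t) (c (j - 1)) = A j (\<mu> t) * ori (c j) x (c (j - 1)) + A j (c (j - 1)) * ori (c j) (\<mu> t) x"
            using aff_bary[OF affA[of j], of x "c j" "\<mu> t" "c (j - 1)"] AR0 by simp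
          moreover have "ori (c j) x (c (j - 1)) < 0"
            using xr[of "j - 1" x] x j ori_rot[of "c j" x "c (j - 1)"] by simp
          moreover have "ori (c j) (\<mu> t) x < 0" using x unfolding f_def by simp
          moreover have "ori (c j) (\<mu> t) (c (j - 1)) < 0" using sd(1)[of "j - 1"] j unfolding f_def by simp
          ultimately show ?thesis using Am A1 by (smt (verit) mult_pos_neg mult_nonpos_nonpos)
        qed
        moreover have "R j x > 0" if x: "x \<in> X" "f x < 0" for x
        proof -
          have "R j x * ori (c j) (\<mu> t) (c (Suc j)) = R j (\<mu> t) * ori (c j) x (c (Suc j)) + R j (c (Suc j)) * ori (c j) (\<mu> t) x"
            using aff_bary[OF affR[of j], of x "c j" "\<mu> t" "c (Suc j)"] AR0 by simp
          moreover have "ori (c j) x (c (Suc j)) > 0"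
            using xr[of j x] x j ori_swap2[of "c j" x "c (Suc j)"] by simp
          moreover have "ori (c j) (\<mu> t) x > 0" using x unfolding f_def by simp
          moreover have "ori (c j) (\<mu> t) (c (Suc j)) > 0" using sd(2)[of "Suc j"] j unfolding f_def by simp
          ultimately show ?thesis using Rm R1 by (smt (verit) mult_pos_pos mult_nonpos_nonneg)
        qed
        moreover have "\<forall>x\<in>X. f x \<noteq> 0" using gen unfolding f_def by auto
        moreover have "f = (\<lambda>p. - ori (c j) (\<mu> t) p)" unfolding f_def ..
        ultimately show ?thesis using f1 by (intro exI[of _ f]) blast
      qed
    qed
    then obtain f q where fq: "f = ori (c j) q \<or> f = (\<lambda>p. - ori (c j) q p)" and f1: "f (c i) > 0" "f (c k) < 0"
      and fx: "\<And>x. x \<in> X \<Longrightarrow> f x \<noteq> 0 \<and> (f x > 0 \<longrightarrow> A j x > 0) \<and> (f x < 0 \<longrightarrow> R j x > 0)" by blast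
    have faff: "affine_fun f"
      using fq aff_comb[OF aff_ori[of "c j" q] aff_ori[of "c j" q], of "-1" 0] by auto
    have f0: "f (c j) = 0" using fq by auto
    note sd = sides[OF cv j faff f0 f1]
    define Xl where "Xl = {x\<in>X. f x > 0}"
    define Xr where "Xr = {x\<in>X. f x < 0}"
    have XX: "Xl \<union> Xr = X" "Xl \<inter> Xr = {}" "Xl \<subseteq> X" "Xr \<subseteq> X" using fx unfolding Xl_def Xr_def by force+
    have "\<exists>cell. (\<Union>m\<in>{i..<j}. cell m) = Xl \<and> (\<forall>a\<in>{i..<j}. \<forall>m\<in>{i..<j}. a \<noteq> m \<longrightarrow> cell a \<inter> cell m = {}) \<and>
      (\<forall>a\<in>{i..<j}. \<forall>x\<in>cell a. ori (c a) x (z a) > 0 \<and> ori x (c (Suc a)) (z a) > 0) \<and>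
      (\<forall>l. (\<forall>a\<in>{i..<j}. set (l a) = cell a \<and> separable (c a # l a @ [c (Suc a)])) \<longrightarrow> separable (full c l i j))"
    proof (rule less.hyps)
      show "j - i < k - i" using j by simp
      show "finite Xl" using fin XX finite_subset by blast
      show "c ` {i..j} \<union> z ` {i..<j} \<union> Xl \<subseteq> S" using S XX j by auto
      show "inj_on c {i..j}" by (rule inj_on_subset[OF inj]) (use j in auto)
      show "ori x (c j) (z (j - 1)) > 0" if "x \<in> Xl" for x
        using that fx unfolding Xl_def A_def by auto
    qed (use j gen_pos cX zX zc cv zl xr fi cl XX in \<open>auto simp: Xl_def\<close>)
    then obtain cl' where L: "(\<Union>m\<in>{i..<j}. cl' m) = Xl" "\<forall>a\<in>{i..<j}. \<forall>m\<in>{i..<j}. a \<noteq> m \<longrightarrow> cl' a \<inter> cl' m = {}"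
      "\<forall>a\<in>{i..<j}. \<forall>x\<in>cl' a. ori (c a) x (z a) > 0 \<and> ori x (c (Suc a)) (z a) > 0"
      "\<forall>l. (\<forall>a\<in>{i..<j}. set (l a) = cl' a \<and> separable (c a # l a @ [c (Suc a)])) \<longrightarrow> separable (full c l i j)" by blast
    have "\<exists>cell. (\<Union>m\<in>{j..<k}. cell m) = Xr \<and> (\<forall>a\<in>{j..<k}. \<forall>m\<in>{j..<k}. a \<noteq> m \<longrightarrow> cell a \<inter> cell m = {}) \<and>
      (\<forall>a\<in>{j..<k}. \<forall>x\<in>cell a. ori (c a) x (z a) > 0 \<and> ori x (c (Suc a)) (z a) > 0) \<and>
      (\<forall>l. (\<forall>a\<in>{j..<k}. set (l a) = cell a \<and> separable (c a # l a @ [c (Suc a)])) \<longrightarrow> separable (full c l j k))"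
    proof (rule less.hyps)
      show "k - j < k - i" using j by simp
      show "finite Xr" using fin XX finite_subset by blast
      show "c ` {j..k} \<union> z ` {j..<k} \<union> Xr \<subseteq> S" using S XX j by auto
      show "inj_on c {j..k}" by (rule inj_on_subset[OF inj]) (use j in auto)
      show "ori (c j) x (z j) > 0" if "x \<in> Xr" for x
        using that fx unfolding Xr_def R_def by auto
    qed (use j gen_pos cX zX zc cv zl xr la cl XX in \<open>auto simp: Xr_def\<close>)
    then obtain cr where Rr: "(\<Union>m\<in>{j..<k}. cr m) = Xr" "\<forall>a\<in>{j..<k}. \<forall>m\<in>{j..<k}. a \<noteq> m \<longrightarrow> cr a \<inter> cr m = {}"
      "\<forall>a\<in>{j..<k}. \<forall>x\<in>cr a. ori (c a) x (z a) > 0 \<and> ori x (c (Suc a)) (z a) > 0"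
      "\<forall>l. (\<forall>a\<in>{j..<k}. set (l a) = cr a \<and> separable (c a # l a @ [c (Suc a)])) \<longrightarrow> separable (full c l j k)" by blast
    define cell where "cell m = (if m < j then cl' m else cr m)" for m
    have sub: "m \<in> {i..<j} \<Longrightarrow> cl' m \<subseteq> Xl" "m \<in> {j..<k} \<Longrightarrow> cr m \<subseteq> Xr" for m using L(1) Rr(1) by auto
    have un: "{i..<k} = {i..<j} \<union> {j..<k}" using j by auto
    have "(\<Union>m\<in>{i..<k}. cell m) = X"
    proof -
      have "(\<Union>m\<in>{i..<j}. cell m) = Xl" "(\<Union>m\<in>{j..<k}. cell m) = Xr" using L(1) Rr(1) unfolding cell_def by auto
      then show ?thesis unfolding un using XX(1) by auto
    qed
    moreover have "cell a \<inter> cell m = {}" if "a \<in> {i..<k}" "m \<in> {i..<k}" "a \<noteq> m" for a m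
    proof -
      have am: "a \<in> {i..<j} \<or> a \<in> {j..<k}" "m \<in> {i..<j} \<or> m \<in> {j..<k}" using that unfolding un by auto
      show ?thesis
      proof (cases "a < j"; cases "m < j")
        assume "a < j" "m < j" then show ?thesis using L(2) am that(3) unfolding cell_def by auto
      next
        assume "a < j" "\<not> m < j" then show ?thesis using sub(1)[of a] sub(2)[of m] am XX(2) unfolding cell_def by auto
      next
        assume "\<not> a < j" "m < j" then show ?thesis using sub(1)[of m] sub(2)[of a] am XX(2) unfolding cell_def by auto
      next
        assume "\<not> a < j" "\<not> m < j" then show ?thesis using Rr(2) am that(3) unfolding cell_def by auto
      qed
    qed
    moreover have "ori (c a) x (z a) > 0 \<and> ori x (c (Suc a)) (z a) > 0" if "a \<in> {i..<k}" "x \<in> cell a" for a x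
      using that L(3) Rr(3) unfolding cell_def by (auto split: if_splits)
    moreover have "separable (full c l i k)" if l: "\<forall>a\<in>{i..<k}. set (l a) = cell a \<and> separable (c a # l a @ [c (Suc a)])" for l
    proof -
      have s1: "separable (full c l i j)" using L(4) l j unfolding cell_def by auto
      have s2: "separable (full c l j k)" using Rr(4) l j unfolding cell_def by auto
      define xs where "xs = concat (map (\<lambda>j. c j # l j) [i..<j])"
      define ys where "ys = tl (full c l j k)"
      have jk: "[j..<k] = j # [Suc j..<k]" using j by (simp add: upt_conv_Cons)
      have e1: "full c l i j = xs @ [c j]" unfolding full_def xs_def ..
      have e2: "full c l j k = c j # ys" unfolding ys_def full_def jk by simp
      have "[i..<k] = [i..<j] @ [j..<k]" using j by (metis less_imp_le upt_add_eq_append le_Suc_ex)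
      then have e: "full c l i k = xs @ c j # ys" unfolding e2[symmetric] unfolding full_def xs_def by simp
      have sx: "f x > 0" if "x \<in> set xs" for x
      proof -
        obtain a where a: "i \<le> a" "a < j" "x = c a \<or> x \<in> set (l a)" using \<open>x \<in> set xs\<close> unfolding xs_def by auto
        then show ?thesis using sd(1)[of a] sub(1)[of a] l j unfolding cell_def Xl_def by auto
      qed
      have sy: "f y < 0" if "y \<in> set ys" for y
      proof -
        have "ys = l j @ concat (map (\<lambda>j. c j # l j) [Suc j..<k]) @ [c k]" unfolding ys_def full_def jk by simp
        then have "y \<in> set (l j) \<or> y = c k \<or> (\<exists>a. j < a \<and> a < k \<and> (y = c a \<or> y \<in> set (l a)))"
          using \<open>y \<in> set ys\<close> by (auto simp: Suc_le_eq)
        then have "(\<exists>a. j \<le> a \<and> a < k \<and> y \<in> set (l a)) \<or> (\<exists>a. j < a \<and> a \<le> k \<and> y = c a)"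
        proof (elim disjE exE conjE)
          assume "y \<in> set (l j)" then show ?thesis using j by (intro disjI1 exI[of _ j]) simp
        next
          assume "y = c k" then show ?thesis using j by (intro disjI2 exI[of _ k]) simp
        next
          fix a assume "j < a" "a < k" "y = c a" then show ?thesis by (intro disjI2 exI[of _ a]) simp
        next
          fix a assume "j < a" "a < k" "y \<in> set (l a)" then show ?thesis by (intro disjI1 exI[of _ a]) simp
        qed
        then show ?thesis
        proof
          assume "\<exists>a. j \<le> a \<and> a < k \<and> y \<in> set (l a)"
          then obtain a where a: "j \<le> a" "a < k" "y \<in> set (l a)" by blast
          then have "y \<in> cr a" using l j unfolding cell_def by auto
          then show ?thesis using sub(2)[of a] a unfolding Xr_def by auto
        next
          assume "\<exists>a. j < a \<and> a \<le> k \<and> y = c a" then show ?thesis using sd(2) by auto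
        qed
      qed
      show ?thesis unfolding e
        using fq
      proof
        assume "f = ori (c j) q"
        then show "separable (xs @ c j # ys)" using sp_join[of xs "c j" ys q] s1 s2 sx sy unfolding e1 e2 by auto
      next
        assume "f = (\<lambda>p. - ori (c j) q p)"
        then show "separable (xs @ c j # ys)" using sp_join'[of xs "c j" ys q] s1 s2 sx sy unfolding e1 e2 by auto
      qed
    qed
    ultimately show ?thesis by (intro exI[of _ cell]) blast
  qed
qed

lemma pe_nth: "(a, b) \<in> set (path_edges l) \<longleftrightarrow> (\<exists>j. Suc j < length l \<and> a = l ! j \<and> b = l ! Suc j)"
proof -
  have "set (path_edges l) = {(l ! j, tl l ! j) | j. j < length l \<and> j < length (tl l)}"
    unfolding pe_zip set_zip by auto
  then have "(a, b) \<in> set (path_edges l) \<longleftrightarrow> (\<exists>j. j < length l - 1 \<and> a = l ! j \<and> b = tl l ! j)" by fastforce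
  also have "\<dots> \<longleftrightarrow> (\<exists>j. Suc j < length l \<and> a = l ! j \<and> b = l ! Suc j)"
    by (rule ex_cong1) (auto simp: nth_tl)
  finally show ?thesis .
qed

lemma subseq_nth3:
  assumes "a < b" "b < d" "d < length l" shows "subseq [l ! a, l ! b, l ! d] l"
proof -
  have 1: "l = take b l @ drop b l" by simp
  have "l ! a \<in> set (take b l)" using assms by (auto simp: in_set_conv_nth intro!: exI[of _ a])
  then have s1: "subseq [l ! a] (take b l)" by (simp add: subseq_singleton_left)
  have db: "drop b l = l ! b # drop (Suc b) l" using assms by (simp add: Cons_nth_drop_Suc)
  have "l ! d \<in> set (drop (Suc b) l)" using assms
    by (auto simp: in_set_conv_nth intro!: exI[of _ "d - Suc b"])
  then have s2: "subseq [l ! b, l ! d] (drop b l)" unfolding db by (simp add: subseq_singleton_left)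
  have "subseq ([l ! a] @ [l ! b, l ! d]) (take b l @ drop b l)" using s1 s2 by (rule list_emb_append_mono)
  then show ?thesis by simp
qed

text \<open>The form of \<open>body\<close> for lists without indices: an edge of the chain is named
  by its first vertex, and these are the members of \<open>butlast ch\<close>.\<close>

lemma body_list:
  fixes ch :: "point list" and z :: "point \<Rightarrow> point"
  assumes len: "length ch \<ge> 2" and d: "distinct ch" and fin: "finite X" and gen_pos: "gen_pos S" and S: "set ch \<subseteq> S" "X \<subseteq> S"
    and XS: "set ch \<inter> X = {}" and z: "\<And>a b. (a, b) \<in> set (path_edges ch) \<Longrightarrow> z a \<in> S \<and> z a \<notin> X \<and> z a \<notin> set ch \<and> ori a b (z a) > 0"
    and cv: "\<And>a b c. subseq [a, b, c] ch \<Longrightarrow> ori a b c < 0"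
    and xr: "\<And>a b x. (a, b) \<in> set (path_edges ch) \<Longrightarrow> x \<in> X \<Longrightarrow> ori a b x < 0"
    and fi: "\<And>x. x \<in> X \<Longrightarrow> ori (hd ch) x (z (hd ch)) > 0"
    and la: "\<And>x. x \<in> X \<Longrightarrow> ori x (last ch) (z (last (butlast ch))) > 0"
    and cl: "\<And>a b c x. (a, b) \<in> set (path_edges ch) \<Longrightarrow> (b, c) \<in> set (path_edges ch) \<Longrightarrow> x \<in> X \<Longrightarrow> ori x b (z a) > 0 \<or> ori b x (z b) > 0"
  shows "\<exists>cell. (\<Union>a\<in>set (butlast ch). cell a) = X \<and>
    (\<forall>a\<in>set (butlast ch). \<forall>b\<in>set (butlast ch). a \<noteq> b \<longrightarrow> cell a \<inter> cell b = {}) \<and>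
    (\<forall>(a, b)\<in>set (path_edges ch). \<forall>x\<in>cell a. ori a x (z a) > 0 \<and> ori x b (z a) > 0) \<and>
    (\<forall>l. (\<forall>(a, b)\<in>set (path_edges ch). set (l a) = cell a \<and> separable (a # l a @ [b])) \<longrightarrow>
       separable (concat (map (\<lambda>a. a # l a) (butlast ch)) @ [last ch]))"
proof -
  define k where "k = length ch - 1"
  have k: "0 < k" "length ch = Suc k" using len unfolding k_def by auto
  define c where "c j = ch ! j" for j
  have e: "(c j, c (Suc j)) \<in> set (path_edges ch)" if "j < k" for j
    unfolding pe_nth c_def using that k by auto
  have inj: "inj_on c {0..k}" using d k unfolding c_def inj_on_def by (auto simp: nth_eq_iff_index_eq)
  have cm: "j \<le> k \<Longrightarrow> c j \<in> set ch" for j unfolding c_def using k by simp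
  have ne: "ch \<noteq> []" using len by auto
  have bl: "set (butlast ch) = c ` {0..<k}"
  proof -
    have "butlast ch = map c [0..<k]" unfolding c_def using k by (intro nth_equalityI) (auto simp: nth_butlast)
    then show ?thesis by simp
  qed
  have hd: "hd ch = c 0" and lst: "last ch = c k" unfolding c_def using ne k by (simp_all add: hd_conv_nth last_conv_nth)
  have lb: "last (butlast ch) = c (k - 1)"
  proof -
    have "butlast ch \<noteq> []" using k by (cases ch rule: rev_cases) auto
    then show ?thesis unfolding c_def using k by (simp add: last_conv_nth nth_butlast)
  qed
  have "\<exists>cell. (\<Union>j\<in>{0..<k}. cell j) = X \<and> (\<forall>j\<in>{0..<k}. \<forall>m\<in>{0..<k}. j \<noteq> m \<longrightarrow> cell j \<inter> cell m = {}) \<and>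
    (\<forall>j\<in>{0..<k}. \<forall>x\<in>cell j. ori (c j) x (z (c j)) > 0 \<and> ori x (c (Suc j)) (z (c j)) > 0) \<and>
    (\<forall>l. (\<forall>j\<in>{0..<k}. set (l j) = cell j \<and> separable (c j # l j @ [c (Suc j)])) \<longrightarrow> separable (full c l 0 k))"
  proof (rule body[OF k(1) fin gen_pos])
    show "c ` {0..k} \<union> (\<lambda>j. z (c j)) ` {0..<k} \<union> X \<subseteq> S"
    proof -
      have "c j \<in> S" if "j \<le> k" for j using S(1) cm[OF that] by blast
      moreover have "z (c j) \<in> S" if "j < k" for j using z[OF e[OF that]] by simp
      ultimately show ?thesis using S(2) by auto
    qed
    show "c j \<notin> X" if "0 \<le> j" "j \<le> k" for j using XS cm[OF that(2)] by auto
    show "z (c j) \<notin> X" if "0 \<le> j" "j < k" for j using z[OF e[OF that(2)]] by auto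
    show "z (c j) \<noteq> c m" if "0 \<le> j" "j < k" "0 \<le> m" "m \<le> k" for j m using z[OF e[OF that(2)]] cm[OF that(4)] by auto
    show "inj_on c {0..k}" by (rule inj)
    show "ori (c a) (c b) (c d) < 0" if "0 \<le> a" "a < b" "b < d" "d \<le> k" for a b d
      unfolding c_def by (rule cv, rule subseq_nth3) (use that k in auto)
    show "ori (c j) (c (Suc j)) (z (c j)) > 0" if "0 \<le> j" "j < k" for j using z[OF e[OF that(2)]] by auto
    show "ori (c j) (c (Suc j)) x < 0" if "0 \<le> j" "j < k" "x \<in> X" for j x by (rule xr[OF e[OF that(2)] that(3)])
    show "ori (c 0) x (z (c 0)) > 0" if "x \<in> X" for x using fi[OF that] hd by simp
    show "ori x (c k) (z (c (k - 1))) > 0" if "x \<in> X" for x using la[OF that] lst lb by simp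
    show "ori x (c j) (z (c (j - 1))) > 0 \<or> ori (c j) x (z (c j)) > 0" if "0 < j" "j < k" "x \<in> X" for j x
      using cl[OF _ e[OF that(2)] that(3), of "c (j - 1)"] e[of "j - 1"] that by simp
  qed
  then obtain cell where C: "(\<Union>j\<in>{0..<k}. cell j) = X" "\<forall>j\<in>{0..<k}. \<forall>m\<in>{0..<k}. j \<noteq> m \<longrightarrow> cell j \<inter> cell m = {}"
    "\<forall>j\<in>{0..<k}. \<forall>x\<in>cell j. ori (c j) x (z (c j)) > 0 \<and> ori x (c (Suc j)) (z (c j)) > 0"
    "\<forall>l. (\<forall>j\<in>{0..<k}. set (l j) = cell j \<and> separable (c j # l j @ [c (Suc j)])) \<longrightarrow> separable (full c l 0 k)" by blast
  define ix where "ix = inv_into {0..k} c"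
  have ix: "ix (c j) = j" if "j \<le> k" for j unfolding ix_def using inv_into_f_f[OF inj, of j] that by simp
  define cell' where "cell' a = cell (ix a)" for a
  have cc: "cell' (c j) = cell j" if "j \<le> k" for j unfolding cell'_def ix[OF that] ..
  have path_edges: "\<exists>j<k. a = c j \<and> b = c (Suc j)" if "(a, b) \<in> set (path_edges ch)" for a b
    using that k unfolding pe_nth c_def by auto
  show ?thesis
  proof (intro exI[of _ cell'] conjI)
    show "(\<Union>a\<in>set (butlast ch). cell' a) = X" unfolding bl using C(1) cc by auto
    show "\<forall>a\<in>set (butlast ch). \<forall>b\<in>set (butlast ch). a \<noteq> b \<longrightarrow> cell' a \<inter> cell' b = {}"
    proof (intro ballI impI)
      fix a b assume "a \<in> set (butlast ch)" "b \<in> set (butlast ch)" and ab: "a \<noteq> b"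
      then obtain i j where ij: "i < k" "j < k" "a = c i" "b = c j" unfolding bl by auto
      then have "i \<noteq> j" using ab by auto
      then have "cell i \<inter> cell j = {}" using C(2)[rule_format, of i j] ij by simp
      then show "cell' a \<inter> cell' b = {}" using ij cc[of i] cc[of j] by simp
    qed
    show "\<forall>(a, b)\<in>set (path_edges ch). \<forall>x\<in>cell' a. ori a x (z a) > 0 \<and> ori x b (z a) > 0"
    proof (clarify)
      fix a b x assume h: "(a, b) \<in> set (path_edges ch)" "x \<in> cell' a"
      obtain j where j: "j < k" "a = c j" "b = c (Suc j)" using path_edges[OF h(1)] by blast
      then have "x \<in> cell j" using h(2) cc[of j] by simp
      then show "ori a x (z a) > 0 \<and> ori x b (z a) > 0" using C(3) j by auto
    qed
    show "\<forall>l. (\<forall>(a, b)\<in>set (path_edges ch). set (l a) = cell' a \<and> separable (a # l a @ [b])) \<longrightarrow>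
       separable (concat (map (\<lambda>a. a # l a) (butlast ch)) @ [last ch])"
    proof (intro allI impI)
      fix l assume l: "\<forall>(a, b)\<in>set (path_edges ch). set (l a) = cell' a \<and> separable (a # l a @ [b])"
      have "\<forall>j\<in>{0..<k}. set (l (c j)) = cell j \<and> separable (c j # l (c j) @ [c (Suc j)])"
      proof
        fix j assume "j \<in> {0..<k}"
        then have j: "j < k" by simp
        have "set (l (c j)) = cell' (c j) \<and> separable (c j # l (c j) @ [c (Suc j)])" using l e[OF j] by auto
        then show "set (l (c j)) = cell j \<and> separable (c j # l (c j) @ [c (Suc j)])" using cc[of j] j by simp
      qed
      then have "separable (full c (\<lambda>j. l (c j)) 0 k)" by (rule mp[OF spec[OF C(4), of "\<lambda>j. l (c j)"]])
      moreover have bl2: "butlast ch = map c [0..<k]" unfolding c_def using k by (intro nth_equalityI) (auto simp: nth_butlast)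
      have "concat (map (\<lambda>a. a # l a) (butlast ch)) @ [last ch] = full c (\<lambda>j. l (c j)) 0 k"
        unfolding bl2 lst full_def by (simp only: map_map comp_def)
      ultimately show "separable (concat (map (\<lambda>a. a # l a) (butlast ch)) @ [last ch])" by simp
    qed
  qed
qed

section \<open>Assigning the inner points to the hull edges\<close>

lemma pe_concat:
  "path_edges (concat (map (\<lambda>i. Q i # p i) [0..<m]) @ [Q m]) = concat (map (\<lambda>i. path_edges (Q i # p i @ [Q (Suc i)])) [0..<m])"
proof (induction m)
  case (Suc m)
  have "path_edges (concat (map (\<lambda>i. Q i # p i) [0..<Suc m]) @ [Q (Suc m)])
      = path_edges (concat (map (\<lambda>i. Q i # p i) [0..<m]) @ Q m # p m @ [Q (Suc m)])" by simp
  also have "\<dots> = path_edges (concat (map (\<lambda>i. Q i # p i) [0..<m]) @ [Q m]) @ path_edges (Q m # p m @ [Q (Suc m)])"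
    by (rule pe_append)
  finally show ?case using Suc by simp
qed simp

lemma fibres_exist:
  assumes "finite I" "(\<Sum>i<n. c i) = card I"
  shows "\<exists>g :: 'a \<Rightarrow> nat. (\<forall>x\<in>I. g x < n) \<and> (\<forall>i<n. card {x\<in>I. g x = i} = c i)"
  using assms
proof (induction n arbitrary: I)
  case (Suc n)
  then have "c n \<le> card I" by simp
  then obtain J where J: "J \<subseteq> I" "card J = c n" "finite J" by (meson obtain_subset_with_card_n)
  have "card (I - J) = (\<Sum>i<n. c i)" using Suc.prems J by (simp add: card_Diff_subset)
  then obtain g where g: "\<forall>x\<in>I - J. g x < n" "\<forall>i<n. card {x\<in>I - J. g x = i} = c i"
    using Suc.IH[of "I - J"] Suc.prems(1) by auto
  define h where "h x = (if x \<in> J then n else g x)" for x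
  have "{x\<in>I. h x = i} = {x\<in>I - J. g x = i}" if "i < n" for i unfolding h_def using that by auto
  moreover have "{x\<in>I. h x = n} = J" unfolding h_def using J g by auto
  ultimately have "card {x\<in>I. h x = i} = c i" if "i < Suc n" for i
    using that g(2) J by (cases "i = n") auto
  moreover have "\<forall>x\<in>I. h x < Suc n" unfolding h_def using g by (auto intro: less_SucI)
  ultimately show ?case by blast
qed auto

text \<open>The hull vertices in counterclockwise order, with the repetition
  \<open>Q n = Q 0\<close>: for \<open>i < n\<close> the hull edge is always from \<open>Q i\<close>
  to \<open>Q (Suc i)\<close> and no index has to be reduced.\<close>

locale hull_data =
  fixes n :: nat and Q :: "nat \<Rightarrow> point" and I :: "point set"
  assumes n3: "n \<ge> 3" and finI: "finite I" and inj: "inj_on Q {..<n}" and per: "Q n = Q 0"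
    and QI: "\<And>i. i < n \<Longrightarrow> Q i \<notin> I" and gen_pos: "gen_pos (Q ` {..<n} \<union> I)"
    and hull: "\<And>i p. i < n \<Longrightarrow> p \<in> Q ` {..<n} \<union> I \<Longrightarrow> p \<noteq> Q i \<Longrightarrow> p \<noteq> Q (Suc i) \<Longrightarrow> ori (Q i) (Q (Suc i)) p > 0"
begin

definition V where "V = Q ` {..<n} \<union> I"

text \<open>The distance to the line of a hull edge, times the length of the edge; this factor
  cancels in every exchange inequality.\<close>

definition edge_dist where "edge_dist i = ori (Q i) (Q (Suc i))"

definition next_idx where "next_idx i = (if Suc i = n then 0 else Suc i)"

lemma next_idx: "i < n \<Longrightarrow> next_idx i < n" "Q (Suc i) = Q (next_idx i)" "i < n \<Longrightarrow> next_idx i \<noteq> i" "i < n \<Longrightarrow> next_idx (next_idx i) \<noteq> i"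
  using per n3 unfolding next_idx_def by auto

lemma Q_eq: "i < n \<Longrightarrow> j < n \<Longrightarrow> Q i = Q j \<longleftrightarrow> i = j"
  using inj unfolding inj_on_def by auto

lemma QV [simp]: "i < n \<Longrightarrow> Q i \<in> V" "i < n \<Longrightarrow> Q (Suc i) \<in> V"
  using next_idx(1,2)[of i] unfolding V_def by auto

lemma IV: "x \<in> I \<Longrightarrow> x \<in> V"
  unfolding V_def by auto

lemma finV: "finite V"
  unfolding V_def using finI by auto

lemma gpV: "gen_pos V"
  unfolding V_def by (rule gen_pos)

lemma QS_ne: "i < n \<Longrightarrow> Q i \<noteq> Q (Suc i)"
  using next_idx Q_eq by metis

lemma dd_pos: "i < n \<Longrightarrow> p \<in> V \<Longrightarrow> p \<noteq> Q i \<Longrightarrow> p \<noteq> Q (Suc i) \<Longrightarrow> edge_dist i p > 0"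
  unfolding edge_dist_def V_def by (rule hull)

lemma dd_zero [simp]: "edge_dist i (Q i) = 0" "edge_dist i (Q (Suc i)) = 0"
  unfolding edge_dist_def by simp_all

lemma dd_nonneg: "i < n \<Longrightarrow> p \<in> V \<Longrightarrow> edge_dist i p \<ge> 0"
  using dd_pos by (cases "p = Q i \<or> p = Q (Suc i)") (auto intro: less_imp_le)

lemma inner_ne: "x \<in> I \<Longrightarrow> i < n \<Longrightarrow> x \<noteq> Q i \<and> x \<noteq> Q (Suc i)"
  using QI next_idx by metis

lemma dd_inner: "i < n \<Longrightarrow> x \<in> I \<Longrightarrow> edge_dist i x > 0"
  using dd_pos IV inner_ne by blast

text \<open>Minimising the product of the distances to the assigned edges makes every exchange unfavourable.\<close>

lemma classes_exist:
  assumes c: "(\<Sum>i<n. c i) = card I"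
  shows "\<exists>g. (\<forall>x\<in>I. g x < n) \<and> (\<forall>i<n. card {x\<in>I. g x = i} = c i) \<and>
    (\<forall>x\<in>I. \<forall>y\<in>I. g x \<noteq> g y \<longrightarrow> edge_dist (g x) x * edge_dist (g y) y \<le> edge_dist (g x) y * edge_dist (g y) x)"
proof -
  define G where "G = {g \<in> I \<rightarrow>\<^sub>E {..<n}. \<forall>i<n. card {x\<in>I. g x = i} = c i}"
  have "finite (I \<rightarrow>\<^sub>E {..<n})" by (rule finite_PiE[OF finI]) simp
  then have fG: "finite G" unfolding G_def by (rule rev_finite_subset) auto
  obtain g0 where g0: "\<forall>x\<in>I. g0 x < n" "\<forall>i<n. card {x\<in>I. g0 x = i} = c i"
    using fibres_exist[OF finI c] by blast
  have r: "{x\<in>I. restrict g0 I x = i} = {x\<in>I. g0 x = i}" for i by auto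
  have "restrict g0 I \<in> I \<rightarrow>\<^sub>E {..<n}" using g0(1) by auto
  then have "restrict g0 I \<in> G" unfolding G_def mem_Collect_eq r using g0(2) by (rule conjI)
  then have "G \<noteq> {}" by auto
  \<comment> \<open>The logarithm of the product, so that exchanging the classes of two points
    changes only two summands.\<close>
  define F where "F g = (\<Sum>x\<in>I. ln (edge_dist (g x) x))" for g
  obtain g where g: "g \<in> G" and min: "\<forall>h\<in>G. - F h \<le> - F g"
    using finite_argmax[OF fG \<open>G \<noteq> {}\<close>, of "\<lambda>g. - F g"] by blast
  have gn: "\<forall>x\<in>I. g x < n" and gc: "\<forall>i<n. card {x\<in>I. g x = i} = c i" using g unfolding G_def by auto
  have "edge_dist (g x) x * edge_dist (g y) y \<le> edge_dist (g x) y * edge_dist (g y) x" if xy: "x \<in> I" "y \<in> I" "g x \<noteq> g y" for x y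
  proof -
    have ne: "x \<noteq> y" using xy by auto
    define h where "h = g(x := g y, y := g x)"
    have hull_list: "h x = g y" "h y = g x" "\<And>z. z \<noteq> x \<Longrightarrow> z \<noteq> y \<Longrightarrow> h z = g z" unfolding h_def using ne by auto
    have "h \<in> G"
    proof -
      have "h \<in> I \<rightarrow>\<^sub>E {..<n}" using g xy unfolding G_def h_def PiE_def extensional_def by auto
      moreover have "card {z\<in>I. h z = i} = c i" if i: "i < n" for i
      proof -
        \<comment> \<open>The transposition of \<open>x\<close> and \<open>y\<close> is a bijection
          between old and new classes, so the exchange keeps all sizes.\<close>
        define \<tau> where "\<tau> z = (if z = x then y else if z = y then x else z)" for z
        have "bij_betw \<tau> {z\<in>I. g z = i} {z\<in>I. h z = i}"
        proof (rule bij_betw_byWitness[where f' = \<tau>])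
          have tx: "\<tau> x = y" "\<tau> y = x" "\<And>z. z \<noteq> x \<Longrightarrow> z \<noteq> y \<Longrightarrow> \<tau> z = z" unfolding \<tau>_def by simp_all
          have "\<tau> z \<in> I \<and> h (\<tau> z) = g z \<and> g (\<tau> z) = h z" if "z \<in> I" for z
          proof -
            consider "z = x" | "z = y" | "z \<noteq> x" "z \<noteq> y" by blast
            then show ?thesis
            proof cases
              case 1 then show ?thesis by (simp only: tx hull_list xy simp_thms)
            next
              case 2 then show ?thesis by (simp only: tx hull_list xy simp_thms)
            next
              case 3 show ?thesis using that by (simp only: tx(3)[OF 3] hull_list(3)[OF 3] simp_thms)
            qed
          qed
          then show "\<tau> ` {z\<in>I. g z = i} \<subseteq> {z\<in>I. h z = i}" "\<tau> ` {z\<in>I. h z = i} \<subseteq> {z\<in>I. g z = i}" by auto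
          have "\<tau> (\<tau> z) = z" for z
          proof -
            consider "z = x" | "z = y" | "z \<noteq> x" "z \<noteq> y" by blast
            then show ?thesis
            proof cases
              case 1 then show ?thesis by (simp only: tx)
            next
              case 2 then show ?thesis by (simp only: tx)
            next
              case 3 show ?thesis by (simp only: tx(3)[OF 3])
            qed
          qed
          then show "\<forall>z\<in>{z\<in>I. g z = i}. \<tau> (\<tau> z) = z" "\<forall>z\<in>{z\<in>I. h z = i}. \<tau> (\<tau> z) = z" by blast+
        qed
        then have "card {z\<in>I. g z = i} = card {z\<in>I. h z = i}" by (rule bij_betw_same_card)
        then show ?thesis using gc i by simp
      qed
      ultimately show ?thesis unfolding G_def by auto
    qed
    then have le: "F g \<le> F h" using min by auto
    have split: "F k = ln (edge_dist (k x) x) + ln (edge_dist (k y) y) + (\<Sum>z\<in>I - {x, y}. ln (edge_dist (k z) z))" for k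
    proof -
      have "F k = ln (edge_dist (k x) x) + (\<Sum>z\<in>I - {x}. ln (edge_dist (k z) z))"
        unfolding F_def using xy finI by (simp add: sum.remove)
      also have "(\<Sum>z\<in>I - {x}. ln (edge_dist (k z) z)) = ln (edge_dist (k y) y) + (\<Sum>z\<in>I - {x} - {y}. ln (edge_dist (k z) z))"
        using xy ne finI by (intro sum.remove) auto
      also have "I - {x} - {y} = I - {x, y}" by auto
      finally show ?thesis by simp
    qed
    have "(\<Sum>z\<in>I - {x, y}. ln (edge_dist (h z) z)) = (\<Sum>z\<in>I - {x, y}. ln (edge_dist (g z) z))"
      by (rule sum.cong) (auto simp: hull_list)
    then have "ln (edge_dist (g x) x) + ln (edge_dist (g y) y) \<le> ln (edge_dist (g y) x) + ln (edge_dist (g x) y)"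
      using le unfolding split[of g] split[of h] hull_list by simp
    moreover have p: "edge_dist (g x) x > 0" "edge_dist (g y) y > 0" "edge_dist (g y) x > 0" "edge_dist (g x) y > 0"
      using dd_inner gn xy by auto
    ultimately have "ln (edge_dist (g x) x * edge_dist (g y) y) \<le> ln (edge_dist (g y) x * edge_dist (g x) y)" by (simp add: ln_mult)
    then show ?thesis using p by (simp add: mult.commute)
  qed
  then show ?thesis using gn gc by blast
qed

end

locale class_data = hull_data +
  fixes C :: "nat \<Rightarrow> point set"
  assumes CI: "(\<Union>i<n. C i) = I" and Cdisj: "\<And>i j. i < n \<Longrightarrow> j < n \<Longrightarrow> i \<noteq> j \<Longrightarrow> C i \<inter> C j = {}"
    and swap: "\<And>i j x y. i < n \<Longrightarrow> j < n \<Longrightarrow> i \<noteq> j \<Longrightarrow> x \<in> C i \<Longrightarrow> y \<in> C j \<Longrightarrow>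
      edge_dist i x * edge_dist j y \<le> edge_dist i y * edge_dist j x"
begin

definition S where "S i = insert (Q i) (insert (Q (Suc i)) (C i))"

lemma C_sub: "i < n \<Longrightarrow> x \<in> C i \<Longrightarrow> x \<in> I"
  using CI by auto

lemma finC: "i < n \<Longrightarrow> finite (C i)"
  using finI CI by (metis UN_upper finite_subset lessThan_iff)

lemma S_sub: "i < n \<Longrightarrow> S i \<subseteq> V"
  using C_sub IV unfolding S_def by auto

lemma inner_class: "i < n \<Longrightarrow> j < n \<Longrightarrow> x \<in> C i \<Longrightarrow> x \<in> S j \<Longrightarrow> i = j"
  using Cdisj[of i j] inner_ne[OF C_sub, of i x j] unfolding S_def by auto

text \<open>Around the common vertex \<open>Q (Suc i)\<close> the ratio of the distances to its two
  hull edges measures the angle. By the exchange inequality class \<open>i\<close> therefore comes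
  before the next class, strictly so by general position.\<close>

lemma corner:
  assumes i: "i < n" and a: "a \<in> S i" "a \<noteq> Q (Suc i)" and b: "b \<in> S (next_idx i)" "b \<noteq> Q (Suc i)"
  shows "ori a (Q (Suc i)) b > 0"
proof -
  let ?j = "next_idx i"
  have j: "?j < n" "Q ?j = Q (Suc i)" "?j \<noteq> i" "next_idx ?j \<noteq> i" using next_idx i by auto
  have Qjj: "Q (Suc ?j) = Q (next_idx ?j)" "next_idx ?j < n" using next_idx j by auto
  have T: "ori (Q i) (Q (Suc i)) (Q (Suc ?j)) > 0"
  proof -
    have "Q (Suc ?j) \<noteq> Q i" using Q_eq[of "next_idx ?j" i] j i Qjj by simp
    moreover have "Q (Suc ?j) \<noteq> Q (Suc i)" using QS_ne[OF j(1)] j(2) by simp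
    ultimately show ?thesis using dd_pos[OF i, of "Q (Suc ?j)"] j(1) unfolding edge_dist_def by simp
  qed
  have id: "edge_dist i b * edge_dist ?j a - edge_dist i a * edge_dist ?j b = ori (Q i) (Q (Suc i)) (Q (Suc ?j)) * ori a (Q (Suc i)) b"
    unfolding edge_dist_def j(2) by (simp add: ori_def algebra_simps)
  have ab: "a \<noteq> b"
  proof
    assume "a = b"
    have "a \<noteq> Q i \<or> b \<noteq> Q (Suc ?j)" using \<open>a = b\<close> Qjj Q_eq[of "next_idx ?j" i] j i by auto
    then show False
    proof
      assume "a \<noteq> Q i"
      then have "a \<in> C i" using a unfolding S_def by auto
      then show False using inner_class[OF i j(1), of a] b \<open>a = b\<close> j by auto
    next
      assume "b \<noteq> Q (Suc ?j)"
      then have "b \<in> C ?j" using b j unfolding S_def by auto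
      then show False using inner_class[OF j(1) i, of b] a \<open>a = b\<close> j by auto
    qed
  qed
  have "edge_dist i b * edge_dist ?j a - edge_dist i a * edge_dist ?j b \<ge> 0"
  proof (cases "a = Q i \<or> b = Q (Suc ?j)")
    case True
    then have "edge_dist i a * edge_dist ?j b = 0" by auto
    moreover have "edge_dist i b * edge_dist ?j a \<ge> 0" using dd_nonneg[OF i] dd_nonneg[OF j(1)] a b S_sub i j by (meson mult_nonneg_nonneg subsetD)
    ultimately show ?thesis by (simp only: diff_0_right)
  next
    case False
    then have "a \<in> C i" "b \<in> C ?j" using a b j unfolding S_def by auto
    then show ?thesis using swap[OF i j(1) j(3)[symmetric]] by auto
  qed
  then have "ori a (Q (Suc i)) b \<ge> 0" unfolding id using T by (simp add: zero_le_mult_iff)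
  moreover have "ori a (Q (Suc i)) b \<noteq> 0"
    by (rule gpD[OF gpV]) (use a b ab S_sub i j in auto)
  ultimately show ?thesis by simp
qed

text \<open>Different classes, together with their hull edges, are separated by a line of the pencil of the two edges.\<close>

lemma bodies_nocross:
  assumes ij: "i < n" "j < n" "i \<noteq> j" and ab: "a \<in> S i" "b \<in> S i" and cd: "c \<in> S j" "d \<in> S j"
  shows "\<not> crosses a b c d"
proof
  assume X: "crosses a b c d"
  \<comment> \<open>The maximal ratio on class \<open>i\<close> bounds the ratios there from above
    and, by the exchange inequality, those on class \<open>j\<close> from below. The member 0 covers
    an empty class and makes the threshold nonnegative.\<close>
  define R where "R = insert 0 ((\<lambda>x. edge_dist i x / edge_dist j x) ` C i)"
  have fR: "finite R" "R \<noteq> {}" unfolding R_def using finC[OF ij(1)] by auto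
  define \<rho> where "\<rho> = Max R"
  have r0: "\<rho> \<ge> 0" unfolding \<rho>_def by (rule Max_ge[OF fR(1)]) (simp add: R_def)
  have r1: "edge_dist i x \<le> \<rho> * edge_dist j x" if "x \<in> C i" for x
  proof -
    have "edge_dist i x / edge_dist j x \<le> \<rho>" unfolding \<rho>_def by (rule Max_ge[OF fR(1)]) (use that in \<open>simp add: R_def\<close>)
    moreover have "edge_dist j x > 0" using dd_inner[OF ij(2)] C_sub[OF ij(1) that] by simp
    ultimately show ?thesis by (simp add: field_simps)
  qed
  have r2: "\<rho> * edge_dist j y \<le> edge_dist i y" if "y \<in> C j" for y
  proof -
    have jy: "edge_dist j y > 0" "edge_dist i y > 0" using dd_inner ij C_sub[OF ij(2) that] by auto
    have "\<rho> \<in> R" unfolding \<rho>_def using Max_in[OF fR] .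
    then consider "\<rho> = 0" | x where "x \<in> C i" "\<rho> = edge_dist i x / edge_dist j x" unfolding R_def by auto
    then show ?thesis
    proof cases
      case 1 then show ?thesis using jy by simp
    next
      case 2
      have jx: "edge_dist j x > 0" using dd_inner[OF ij(2)] C_sub[OF ij(1) 2(1)] by simp
      show ?thesis unfolding 2(2) using swap[OF ij 2(1) that] jx by (simp add: field_simps)
    qed
  qed
  define f where "f p = \<rho> * edge_dist j p + -1 * edge_dist i p" for p
  have fa: "affine_fun f" unfolding f_def edge_dist_def by (rule aff_comb) auto
  have f1: "f p \<ge> 0" if "p \<in> S i" for p
    using that r1 r0 dd_nonneg[OF ij(2)] S_sub[OF ij(1)] ij unfolding f_def S_def by auto
  have f2: "f p \<le> 0" if "p \<in> S j" for p
    using that r2 r0 dd_nonneg[OF ij(1)] S_sub[OF ij(2)] ij unfolding f_def S_def by auto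
  have z: "f a = 0" "f b = 0" "f c = 0"
    using crs_sep[OF fa f1[OF ab(1)] f1[OF ab(2)] f2[OF cd(1)] f2[OF cd(2)] X] by auto
  have abc: "ori a b c \<noteq> 0" using X unfolding crosses_def by auto
  have all0: "f p = 0" for p using aff_bary[OF fa, of p a b c] z abc by simp
  \<comment> \<open>An end of hull edge \<open>j\<close> that is not on hull edge \<open>i\<close>
    witnesses that \<open>f\<close> is not identically zero.\<close>
  have "\<exists>p. p \<in> V \<and> edge_dist j p = 0 \<and> edge_dist i p > 0"
  proof -
    have "Q j \<noteq> Q i" using Q_eq ij by auto
    show ?thesis
    proof (cases "Q j = Q (Suc i)")
      case False
      then show ?thesis using dd_pos[OF ij(1), of "Q j"] \<open>Q j \<noteq> Q i\<close> ij by (intro exI[of _ "Q j"]) auto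
    next
      case True
      then have "j = next_idx i" using next_idx(1,2) Q_eq ij by metis
      then have "Q (Suc j) \<noteq> Q i" using next_idx ij Q_eq by metis
      moreover have "Q (Suc j) \<noteq> Q (Suc i)" using QS_ne[OF ij(2)] True by simp
      ultimately show ?thesis using dd_pos[OF ij(1), of "Q (Suc j)"] ij by (intro exI[of _ "Q (Suc j)"]) auto
    qed
  qed
  then obtain p where "edge_dist j p = 0" "edge_dist i p > 0" by blast
  then show False using all0[of p] unfolding f_def by simp
qed

text \<open>Strict separation, as needed for \<open>zigzag\<close>, is possible once the common
  vertex is removed. The sum \<open>t\<close> of both distances is positive elsewhere and normalises
  the ratio, since a single distance may vanish; any \<open>r\<close> strictly between the ratios of
  the two sets gives the line.\<close>

lemma separator:
  assumes "finite A" "finite B" "A \<noteq> {}" "B \<noteq> {}" and i: "i < n"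
    and A: "A \<subseteq> S i - {Q (Suc i)}" and B: "B \<subseteq> S (next_idx i) - {Q (Suc i)}"
  shows "\<exists>s. affine_fun s \<and> (\<forall>a\<in>A. s a < 0) \<and> (\<forall>b\<in>B. s b > 0)"
proof -
  let ?j = "next_idx i"
  have j: "?j < n" "Q ?j = Q (Suc i)" "?j \<noteq> i" "next_idx ?j \<noteq> i" using next_idx i by auto
  define t where "t p = 1 * edge_dist i p + 1 * edge_dist ?j p" for p
  have AV: "a \<in> V" "a \<noteq> Q (Suc i)" if "a \<in> A" for a using that A S_sub[OF i] by auto
  have BV: "a \<in> V" "a \<noteq> Q (Suc i)" if "a \<in> B" for a using that B S_sub[OF j(1)] by auto
  have tp: "t p > 0" if "p \<in> V" "p \<noteq> Q (Suc i)" for p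
  proof (cases "p = Q i")
    case True
    have "Q i \<noteq> Q (Suc ?j)" using next_idx j i Q_eq by metis
    then have "edge_dist ?j p > 0" using dd_pos[OF j(1), of p] that True j by auto
    then show ?thesis unfolding t_def True by simp
  next
    case False
    then show ?thesis using dd_pos[OF i that(1)] dd_nonneg[OF j(1) that(1)] that unfolding t_def by simp
  qed
  have lt: "edge_dist i a / t a < edge_dist i b / t b" if "a \<in> A" "b \<in> B" for a b
  proof -
    have "ori a (Q (Suc i)) b > 0" using corner[OF i, of a b] that A B by auto
    moreover have "ori (Q i) (Q (Suc i)) (Q (Suc ?j)) > 0"
      using corner[OF i, of "Q i" "Q (Suc ?j)"] QS_ne[OF i] QS_ne[OF j(1)] j unfolding S_def by auto
    moreover have "edge_dist i b * edge_dist ?j a - edge_dist i a * edge_dist ?j b = ori (Q i) (Q (Suc i)) (Q (Suc ?j)) * ori a (Q (Suc i)) b"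
      unfolding edge_dist_def j(2) by (simp add: ori_def algebra_simps)
    ultimately have "edge_dist i a * edge_dist ?j b < edge_dist i b * edge_dist ?j a" by (metis diff_gt_0_iff_gt mult_pos_pos)
    then have "edge_dist i a * t b < edge_dist i b * t a" unfolding t_def by (simp add: algebra_simps)
    then show ?thesis using tp[OF AV[OF that(1)]] tp[OF BV[OF that(2)]] by (simp add: divide_simps mult.commute)
  qed
  define m where "m = Max ((\<lambda>a. edge_dist i a / t a) ` A)"
  define M where "M = Min ((\<lambda>b. edge_dist i b / t b) ` B)"
  have "m \<in> (\<lambda>a. edge_dist i a / t a) ` A" "M \<in> (\<lambda>b. edge_dist i b / t b) ` B"
    unfolding m_def M_def using assms by auto
  then have "m < M" using lt by auto
  then obtain r where r: "m < r" "r < M" using dense by blast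
  define s where "s p = 1 * edge_dist i p + (- r) * t p" for p
  have "affine_fun t" unfolding t_def edge_dist_def by (rule aff_comb) auto
  then have "affine_fun s" unfolding s_def edge_dist_def by (intro aff_comb) auto
  moreover have "s a < 0" if "a \<in> A" for a
  proof -
    have "edge_dist i a / t a \<le> m" unfolding m_def using assms that by auto
    then have "edge_dist i a / t a < r" using r by simp
    then show ?thesis unfolding s_def using tp[OF AV[OF that]] by (simp add: divide_simps)
  qed
  moreover have "s b > 0" if "b \<in> B" for b
  proof -
    have "edge_dist i b / t b \<ge> M" unfolding M_def using assms that by auto
    then have "edge_dist i b / t b > r" using r by simp
    then show ?thesis unfolding s_def using tp[OF BV[OF that]] by (simp add: divide_simps)
  qed
  ultimately show ?thesis by blast
qed

end

section \<open>Triangulating between the bodies\<close>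

lemma distinct_concat_map:
  "(\<And>i. i < n \<Longrightarrow> distinct (p i)) \<Longrightarrow> (\<And>i j. i < n \<Longrightarrow> j < n \<Longrightarrow> i \<noteq> j \<Longrightarrow> set (p i) \<inter> set (p j) = {}) \<Longrightarrow>
    distinct (concat (map p [0..<n]))"
proof (induction n)
  case (Suc n)
  have "set (p i) \<inter> set (p n) = {}" if "i < n" for i using Suc.prems(2)[of i n] that by simp
  then have "set (concat (map p [0..<n])) \<inter> set (p n) = {}" by fastforce
  moreover have "distinct (concat (map p [0..<n]))" by (rule Suc.IH) (use Suc.prems in auto)
  moreover have "distinct (p n)" using Suc.prems(1) by simp
  ultimately show ?case by simp
qed simp

text \<open>A weight that sees only the directed edge \<open>a b\<close> has value 1 on the cycle,
  so some triangle must contain this edge.\<close>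

lemma edge_tr:
  assumes d: "distinct p" "length p \<ge> 3" and bdp: "\<And>w. antisym_weight w \<Longrightarrow> boundary D w = cycle_weight w p" and e: "(a, b) \<in> set (cycle_edges p)"
  shows "\<exists>x. tile D a b x"
proof -
  have p0: "p \<noteq> []" using d by auto
  obtain us vs where p: "p = us @ a # vs" using split_list ce_mem[OF e p0] by metis
  define q where "q = vs @ us"
  have dq: "distinct (a # q)" "length q \<ge> 2" using d unfolding p q_def by auto
  have q0: "q \<noteq> []" using dq by auto
  have ceq: "set (cycle_edges (a # q)) = set (cycle_edges p)" unfolding p q_def using ce_rotate[of us "a # vs"] by simp
  have cwq: "cycle_weight w (a # q) = cycle_weight w p" for w unfolding p q_def using cw_rotate[of w us "a # vs"] by simp
  have "b = hd q"
    using e dq last_in_set[OF q0] pe_mem[of a b q] unfolding ceq[symmetric] ce_Cons[OF q0] by auto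
  have ab: "a \<noteq> b" using \<open>b = hd q\<close> q0 dq(1) by auto
  have lb: "last q \<noteq> b"
  proof -
    obtain x y r where "q = x # y # r" using dq(2) by (auto simp: numeral_2_eq_2 Suc_le_length_iff)
    then show ?thesis using dq(1) \<open>b = hd q\<close> by auto
  qed
  define w where "w x y = (if x = a \<and> y = b then 1 else if x = b \<and> y = a then - 1 else 0 :: real)" for x y
  have antisym_weight: "antisym_weight w" unfolding antisym_weight_def w_def using ab by auto
  have "path_weight w q = 0" by (rule pw_zero) (use pe_mem[of _ _ q] dq(1) in \<open>auto simp: w_def\<close>)
  then have "cycle_weight w (a # q) = 1" using \<open>b = hd q\<close> lb ab unfolding cw_Cons[OF q0] w_def by auto
  then have "boundary D w > 0" using bdp[OF antisym_weight] cwq by simp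
  then obtain x y u where t: "(x, y, u) \<in> set D" and pos: "w x y + w y u + w u x > 0"
    using bd_pos_elem by fast
  have "(x = a \<and> y = b) \<or> (y = a \<and> u = b) \<or> (u = a \<and> x = b)"
    using pos unfolding w_def by (auto split: if_splits)
  then show ?thesis using t unfolding tile_def by blast
qed

text \<open>Each edge of the list is taken against its direction, so that the triangles over a
  clockwise chain starting at \<open>u\<close> are positive.\<close>

fun fan :: "'a \<Rightarrow> 'a list \<Rightarrow> ('a \<times> 'a \<times> 'a) list" where
  "fan u (x # y # r) = (u, y, x) # fan u (y # r)"
| "fan u _ = []"

lemma bd_fan: "antisym_weight w \<Longrightarrow> l \<noteq> [] \<Longrightarrow> boundary (fan u l) w = w u (last l) - w u (hd l) - path_weight w l"
proof (induction u l rule: fan.induct)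
  case (1 u x y r)
  then show ?case using asymD[OF 1(2), of y x] asymD[OF 1(2), of x u] by auto
qed auto

lemma fan_mem: "(a, b, c) \<in> set (fan u l) \<Longrightarrow> a = u \<and> (c, b) \<in> set (path_edges l)"
  by (induction u l rule: fan.induct) auto

lemma cseq_prefix:
  assumes d: "distinct (xs @ ys)" and m: "a \<in> set xs" "b \<in> set xs" "c \<in> set xs" and c: "cyclic_subseq (xs @ ys) a b c"
  shows "cyclic_subseq xs a b c"
proof -
  have f: "filter (\<lambda>x. x \<in> set xs) (xs @ ys) = xs" using d by (auto simp: filter_empty_conv)
  have "subseq l xs" if "subseq l (xs @ ys)" "set l \<subseteq> set xs" for l
  proof -
    have "subseq (filter (\<lambda>x. x \<in> set xs) l) (filter (\<lambda>x. x \<in> set xs) (xs @ ys))" by (rule subseq_filter[OF that(1)])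
    moreover have "filter (\<lambda>x. x \<in> set xs) l = l" using that(2) by (auto simp: filter_id_conv)
    ultimately show ?thesis unfolding f by simp
  qed
  then show ?thesis using c m unfolding cyclic_subseq_def by auto
qed

context class_data
begin

lemma chains_exist: "\<exists>bs. \<forall>i<n. convex_chain (C i) (Q i) (Q (Suc i)) (bs i)"
proof -
  have "\<exists>b. convex_chain (C i) (Q i) (Q (Suc i)) b" if i: "i < n" for i
  proof (rule chain_exists[OF finC[OF i] _ QS_ne[OF i]])
    show "gen_pos (insert (Q i) (insert (Q (Suc i)) (C i)))" using gp_subset[OF gpV S_sub[OF i]] unfolding S_def .
    show "Q i \<notin> C i" "Q (Suc i) \<notin> C i" using C_sub[OF i] inner_ne i by blast+
    show "ori (Q i) (Q (Suc i)) x > 0" if "x \<in> C i" for x using dd_inner[OF i C_sub[OF i that]] unfolding edge_dist_def .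
  qed
  then show ?thesis by metis
qed

end

context hull_data
begin

definition hull_list where "hull_list = map Q [0..<n]"

lemma hd_concat: "hd (concat (map (\<lambda>i. Q i # p i) [0..<n])) = Q 0"
proof -
  have "[0..<n] = 0 # [Suc 0..<n]" using n3 by (simp add: upt_conv_Cons)
  then show ?thesis by simp
qed

lemma ce_cycle: "cycle_edges (concat (map (\<lambda>i. Q i # p i) [0..<n])) = concat (map (\<lambda>i. path_edges (Q i # p i @ [Q (Suc i)])) [0..<n])"
  unfolding cycle_edges_def hd_concat using pe_concat[of Q p n] per by simp

lemma cw_cycle: "cycle_weight w (concat (map (\<lambda>i. Q i # p i) [0..<n])) = (\<Sum>i<n. path_weight w (Q i # p i @ [Q (Suc i)]))"
proof -
  have "(\<Sum>(a, b)\<leftarrow>concat (map f [0..<m]). w a b) = (\<Sum>i<m. \<Sum>(a, b)\<leftarrow>f i. w a b)" for f m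
    by (induction m) simp_all
  then show ?thesis unfolding cycle_weight_def ce_cycle path_weight_def by simp
qed

lemma hv_concat: "hull_list = concat (map (\<lambda>i. Q i # []) [0..<n])"
  unfolding hull_list_def by (induction n) auto

lemma ce_hv: "(a, b) \<in> set (cycle_edges hull_list) \<longleftrightarrow> (\<exists>i<n. a = Q i \<and> b = Q (Suc i))"
  unfolding hv_concat ce_cycle by auto

lemma cw_hv: "cycle_weight w hull_list = (\<Sum>i<n. w (Q i) (Q (Suc i)))"
  unfolding hv_concat cw_cycle by simp

lemma hullp_sub: "U \<subseteq> V \<Longrightarrow> Q ` {..<n} \<subseteq> U \<Longrightarrow> hull_cycle U hull_list"
  unfolding hull_cycle_def
proof (intro conjI)
  assume U: "U \<subseteq> V" "Q ` {..<n} \<subseteq> U"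
  show "distinct hull_list" unfolding hull_list_def using inj by (simp add: distinct_map lessThan_atLeast0)
  show "3 \<le> length hull_list" unfolding hull_list_def using n3 by simp
  show "set hull_list \<subseteq> U" unfolding hull_list_def using U(2) by (auto simp: lessThan_atLeast0)
  show "\<forall>(a, b)\<in>set (cycle_edges hull_list). \<forall>p\<in>U. p \<noteq> a \<longrightarrow> p \<noteq> b \<longrightarrow> 0 < ori a b p"
  proof (clarify)
    fix a b p assume h: "(a, b) \<in> set (cycle_edges hull_list)" "p \<in> U" "p \<noteq> a" "p \<noteq> b"
    then obtain i where "i < n" "a = Q i" "b = Q (Suc i)" unfolding ce_hv by blast
    then show "0 < ori a b p" using dd_pos[of i p] h U(1) unfolding edge_dist_def by auto
  qed
qed

end

section \<open>The polygon bounded by the inner hull chains\<close>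

locale chain_data = class_data +
  fixes bs :: "nat \<Rightarrow> point list"
  assumes bs: "\<And>i. i < n \<Longrightarrow> convex_chain (C i) (Q i) (Q (Suc i)) (bs i)"
begin

definition ch where "ch i = Q i # bs i @ [Q (Suc i)]"

definition frame where "frame = concat (map (\<lambda>i. Q i # bs i) [0..<n])"

lemma ch_sub: "i < n \<Longrightarrow> set (ch i) \<subseteq> S i"
  using bs[of i] unfolding convex_chain_def ch_def S_def by auto

lemma ch_distinct: "i < n \<Longrightarrow> distinct (ch i)"
  using bs[of i] unfolding convex_chain_def ch_def by auto

lemma ch_right: "i < n \<Longrightarrow> (a, b) \<in> set (path_edges (ch i)) \<Longrightarrow> x \<in> S i \<Longrightarrow> x \<noteq> a \<Longrightarrow> x \<noteq> b \<Longrightarrow> ori a b x < 0"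
  using bs[of i] unfolding convex_chain_def ch_def S_def by auto

lemma ch_right': "i < n \<Longrightarrow> (a, b) \<in> set (path_edges (ch i)) \<Longrightarrow> x \<in> S i \<Longrightarrow> ori a b x \<le> 0"
  using ch_right[of i a b x] by (cases "x = a \<or> x = b") (auto intro: less_imp_le)

lemma ch_triple: "i < n \<Longrightarrow> subseq [a, b, c] (ch i) \<Longrightarrow> ori a b c < 0"
  by (rule convex_triples[OF ch_distinct]) (use ch_right ch_sub in blast)+

lemma bs_C: "i < n \<Longrightarrow> set (bs i) \<subseteq> C i"
  using bs[of i] unfolding convex_chain_def by auto

lemma ce_LF: "(a, b) \<in> set (cycle_edges frame) \<longleftrightarrow> (\<exists>i<n. (a, b) \<in> set (path_edges (ch i)))"
  unfolding frame_def ce_cycle ch_def by auto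

lemma cw_LF: "cycle_weight w frame = (\<Sum>i<n. path_weight w (ch i))"
  unfolding frame_def cw_cycle ch_def ..

lemma LF_mem: "x \<in> set frame \<longleftrightarrow> (\<exists>i<n. x = Q i \<or> x \<in> set (bs i))"
  unfolding frame_def by auto

lemma LF_V: "set frame \<subseteq> V"
proof
  fix x assume "x \<in> set frame"
  then obtain i where "i < n" "x = Q i \<or> x \<in> set (bs i)" unfolding LF_mem by blast
  then show "x \<in> V" using bs_C C_sub IV QV(1) by blast
qed

lemma QLF: "Q ` {..<n} \<subseteq> set frame"
  using LF_mem by auto

lemma LF_distinct: "distinct frame"
  unfolding frame_def
proof (rule distinct_concat_map)
  show "distinct (Q i # bs i)" if "i < n" for i using ch_distinct[OF that] unfolding ch_def by auto
  show "set (Q i # bs i) \<inter> set (Q j # bs j) = {}" if ij: "i < n" "j < n" "i \<noteq> j" for i j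
  proof -
    have "C i \<inter> C j = {}" "Q i \<noteq> Q j" using Cdisj Q_eq ij by auto
    moreover have "Q i \<notin> C j" "Q j \<notin> C i" using C_sub inner_ne ij by blast+
    ultimately show ?thesis using bs_C ij by auto
  qed
qed

lemma LF_len: "length frame \<ge> 3"
proof -
  have "card (Q ` {..<n}) \<le> card (set frame)" using QLF by (intro card_mono) auto
  moreover have "card (Q ` {..<n}) = n" using inj by (simp add: card_image)
  ultimately show ?thesis using n3 card_length[of frame] by simp
qed

lemma LF_S: "i < n \<Longrightarrow> x \<in> set frame \<Longrightarrow> x \<in> S i \<Longrightarrow> x \<in> set (ch i)"
proof -
  assume i: "i < n" "x \<in> set frame" "x \<in> S i"
  show ?thesis
  proof (cases "x \<in> C i")
    case True
    obtain k where k: "k < n" "x = Q k \<or> x \<in> set (bs k)" using i(2) unfolding LF_mem by blast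
    have "x \<noteq> Q k" using inner_ne[OF C_sub[OF i(1) True] k(1)] by simp
    then have xb: "x \<in> set (bs k)" using k by simp
    then have "x \<in> C k" using bs_C k by auto
    then have "k = i" using Cdisj[OF k(1) i(1)] True by auto
    then show ?thesis using xb unfolding ch_def by simp
  next
    case False
    then show ?thesis using i(3) unfolding S_def ch_def by auto
  qed
qed

text \<open>Edges of one chain are supporting edges of their class and cannot cross; edges of
  different chains are kept apart by \<open>bodies_nocross\<close>.\<close>

lemma LF_simple: "simple frame"
proof -
  have "\<not> crosses a b c d" if e: "(a, b) \<in> set (cycle_edges frame)" "(c, d) \<in> set (cycle_edges frame)" for a b c d
  proof -
    obtain i j where ij: "i < n" "(a, b) \<in> set (path_edges (ch i))" "j < n" "(c, d) \<in> set (path_edges (ch j))"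
      using e unfolding ce_LF by blast
    have m: "a \<in> S i" "b \<in> S i" "c \<in> S j" "d \<in> S j"
      using pe_mem[OF ij(2)] pe_mem[OF ij(4)] ch_sub ij by blast+
    show ?thesis
    proof (cases "i = j")
      case True
      then have "ori a b c \<le> 0" "ori a b d \<le> 0" using ch_right'[OF ij(1,2)] m by auto
      then show ?thesis unfolding crosses_def by (auto simp: mult_less_0_iff)
    next
      case False
      then show ?thesis using bodies_nocross[OF ij(1,3) _ m] by simp
    qed
  qed
  then show ?thesis unfolding simple_def by fast
qed

lemma LF_head: "\<exists>q. frame = Q 0 # q \<and> q \<noteq> [] \<and> hd q \<in> S 0 \<and> hd q \<noteq> Q 0 \<and> last q \<in> S (n - 1) \<and> last q \<noteq> Q 0"
proof -
  have up: "[0..<n] = 0 # [Suc 0..<n]" using n3 by (simp add: upt_conv_Cons)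
  define q where "q = bs 0 @ concat (map (\<lambda>i. Q i # bs i) [Suc 0..<n])"
  have L: "frame = Q 0 # q" unfolding frame_def q_def up by simp
  have up1: "[Suc 0..<n] = Suc 0 # [Suc (Suc 0)..<n]" using n3 by (simp add: upt_conv_Cons)
  have up2: "[Suc 0..<n] = [Suc 0..<n - 1] @ [n - 1]"
    using upt_Suc_append[of "Suc 0" "n - 1"] n3 by simp
  have q0: "q \<noteq> []" unfolding q_def up1 by simp
  have 1: "hd q \<in> set (ch 0)" unfolding q_def up1 ch_def by (cases "bs 0") auto
  have 2: "last q \<in> set (ch (n - 1))" unfolding q_def up2 ch_def by (cases "bs (n - 1)" rule: rev_cases) auto
  have "Q 0 \<notin> set q" using LF_distinct unfolding L by simp
  then have "hd q \<noteq> Q 0" "last q \<noteq> Q 0" using hd_in_set[OF q0] last_in_set[OF q0] by metis+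
  then show ?thesis using L q0 1 2 ch_sub[of 0] ch_sub[of "n - 1"] n3 by auto
qed

text \<open>The orientation is read off at the hull vertex \<open>Q 0\<close>. The sum of the
  distances to its two hull edges is a supporting function there, and \<open>corner\<close> gives
  the sign.\<close>

lemma LF_fills: "\<exists>D. fills frame D 1"
proof -
  obtain D s where F: "fills frame D s"
    using simple_polygon_fills[OF LF_distinct LF_len gp_subset[OF gpV LF_V] LF_simple] by blast
  obtain q where q: "frame = Q 0 # q" "q \<noteq> []" "hd q \<in> S 0" "hd q \<noteq> Q 0" "last q \<in> S (n - 1)" "last q \<noteq> Q 0"
    using LF_head by blast
  define f where "f p = 1 * edge_dist 0 p + 1 * edge_dist (n - 1) p" for p
  have fa: "affine_fun f" unfolding f_def edge_dist_def by (rule aff_comb) auto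
  have k: "n - 1 < n" "0 < n" "Suc (n - 1) = n" using n3 by auto
  have f0: "f (Q 0) = 0" unfolding f_def edge_dist_def using k per by simp
  have fpos: "f p > 0" if "p \<in> set q" for p
  proof -
    have pV: "p \<in> V" using that LF_V q(1) by auto
    have p0: "p \<noteq> Q 0" using that LF_distinct q(1) by auto
    show ?thesis
    proof (cases "p = Q (Suc 0)")
      case True
      have "p \<noteq> Q (n - 1)" unfolding True using Q_eq[of "Suc 0" "n - 1"] n3 by auto
      then have "edge_dist (n - 1) p > 0" using dd_pos[OF k(1) pV] p0 per k by simp
      then show ?thesis unfolding f_def True by simp
    next
      case False
      then show ?thesis using dd_pos[OF k(2) pV p0] dd_nonneg[OF k(1) pV] unfolding f_def by simp
    qed
  qed
  have next_idx: "next_idx (n - 1) = 0" unfolding next_idx_def using k by simp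
  have "ori (last q) (Q (Suc (n - 1))) (hd q) > 0"
    by (rule corner[OF k(1)]) (use q k per next_idx in auto)
  then have o: "ori (Q 0) (hd q) (last q) > 0" using k per ori_rot[of "Q 0" "hd q" "last q"] by simp
  have "s * ori (Q 0) (hd q) (last q) > 0"
    by (rule sign_at_extreme[OF F[unfolded q(1)] fa f0 fpos q(2)]) (use o in auto)
  then have "s > 0" using o by (simp add: zero_less_mult_iff)
  then have "s = 1" using F unfolding fills_def by auto
  then show ?thesis using F by blast
qed

end

locale fill_data = chain_data +
  fixes D
  assumes D: "fills frame D 1"
begin

lemma D_bd: "antisym_weight w \<Longrightarrow> boundary D w = cycle_weight w frame"
  using D unfolding fills_def by auto

lemma D_tr: "tile D a b c \<Longrightarrow> a \<in> set frame \<and> b \<in> set frame \<and> c \<in> set frame \<and> ori a b c > 0 \<and> cyclic_subseq frame a b c"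
proof -
  assume "tile D a b c"
  then have h: "cyclic_subseq frame a b c \<and> ori a b c > 0"
    using D ori_rot[of b c a] ori_rot2[of c a b] unfolding tile_def fills_def cyclic_subseq_def by fastforce
  then show ?thesis using cseq_mem by metis
qed

text \<open>A positively oriented triangle within one chain would have to be increasing and decreasing along it.\<close>

lemma D_not_mono:
  assumes t: "tile D a b c" and i: "i < n" shows "\<not> {a, b, c} \<subseteq> S i"
proof
  assume "{a, b, c} \<subseteq> S i"
  then have m: "a \<in> set (ch i)" "b \<in> set (ch i)" "c \<in> set (ch i)" using LF_S[OF i] D_tr[OF t] by auto
  have up: "[0..<n] = [0..<i] @ i # [Suc i..<n]" using i by (metis le0 less_imp_le upt_add_eq_append upt_conv_Cons le_Suc_ex)
  define X where "X = concat (map (\<lambda>i. Q i # bs i) [0..<i])"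
  define Y where "Y = concat (map (\<lambda>i. Q i # bs i) [Suc i..<n])"
  have L: "frame = X @ (Q i # bs i) @ Y" unfolding frame_def X_def Y_def up by simp
  \<comment> \<open>Cyclically, the \<open>i\<close>-th block is followed by
    \<open>Q (Suc i)\<close>, so a rotation of the frame has the complete chain, with its last
    vertex, as a prefix.\<close>
  have "\<exists>Z. Y @ X = Q (Suc i) # Z"
  proof (cases "Suc i < n")
    case True
    then show ?thesis unfolding Y_def by (simp add: upt_conv_Cons)
  next
    case False
    then have "Suc i = n" using i by simp
    then have Y: "Y = []" unfolding Y_def by simp
    have "i > 0" using \<open>Suc i = n\<close> n3 by simp
    then have "X = Q 0 # tl X" unfolding X_def by (simp add: upt_conv_Cons)
    then show ?thesis using Y per \<open>Suc i = n\<close> by (metis append_Nil)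
  qed
  then obtain Z where Z: "Y @ X = Q (Suc i) # Z" by blast
  have rot: "(Q i # bs i) @ Y @ X = ch i @ Z" unfolding Z ch_def by simp
  have "cyclic_subseq (((Q i # bs i) @ Y) @ X) a b c" by (rule cseq_rotate) (use D_tr[OF t] L in simp)
  then have "cyclic_subseq (ch i @ Z) a b c" using rot by simp
  moreover have "distinct (ch i @ Z)" unfolding rot[symmetric] using LF_distinct unfolding L by auto
  ultimately have "cyclic_subseq (ch i) a b c" using cseq_prefix m by metis
  then have "ori a b c < 0" using ch_triple[OF i] ori_rot[of b c a] ori_rot2[of c a b] unfolding cyclic_subseq_def by fastforce
  then show False using D_tr[OF t] by simp
qed

text \<open>An auxiliary filling of the pockets that takes only chain vertices into account. With it
  \<open>D\<close> becomes a covering of the hull, which makes the disjointness of the triangles of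
  \<open>D\<close> available in \<open>wedge_claim\<close>.\<close>

definition fans where "fans = concat (map (\<lambda>i. fan (Q i) (bs i @ [Q (Suc i)])) [0..<n])"

lemma covers_LF: "covers (set frame) hull_list (D @ fans)"
  unfolding covers_def
proof (intro conjI allI impI)
  show "finite (set frame)" by simp
  show "gen_pos (set frame)" by (rule gp_subset[OF gpV LF_V])
  show "hull_cycle (set frame) hull_list" by (rule hullp_sub[OF LF_V QLF])
  show "\<forall>(a, b, c)\<in>set (D @ fans). a \<in> set frame \<and> b \<in> set frame \<and> c \<in> set frame \<and> 0 < ori a b c"
  proof (clarify)
    fix a b c assume "(a, b, c) \<in> set (D @ fans)"
    then consider "tile D a b c" | i where "i < n" "(a, b, c) \<in> set (fan (Q i) (bs i @ [Q (Suc i)]))"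
      unfolding tile_def fans_def by auto
    then show "a \<in> set frame \<and> b \<in> set frame \<and> c \<in> set frame \<and> 0 < ori a b c"
    proof cases
      case 1 then show ?thesis using D_tr by blast
    next
      case 2
      have f: "a = Q i" "(c, b) \<in> set (path_edges (bs i @ [Q (Suc i)]))" using fan_mem[OF 2(2)] by auto
      obtain j where j: "Suc j < length (bs i @ [Q (Suc i)])" "c = (bs i @ [Q (Suc i)]) ! j" "b = (bs i @ [Q (Suc i)]) ! Suc j"
        using f(2) unfolding pe_nth by blast
      have "subseq [ch i ! 0, ch i ! Suc j, ch i ! Suc (Suc j)] (ch i)"
        by (rule subseq_nth3) (use j(1) in \<open>auto simp: ch_def\<close>)
      then have "subseq [a, c, b] (ch i)" unfolding ch_def f(1) j(2,3) by simp
      then have "ori a c b < 0" by (rule ch_triple[OF 2(1)])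
      then have "ori a b c > 0" using ori_swap2[of a b c] by simp
      moreover have "Q (Suc i) \<in> set frame" using QLF next_idx[of i] 2(1) by auto
      moreover have "Q i \<in> set frame" using QLF 2(1) by auto
      moreover have "set (bs i) \<subseteq> set frame" using LF_mem 2(1) by auto
      ultimately show ?thesis using f(1) pe_mem[OF f(2)] by auto
    qed
  qed
  show "boundary (D @ fans) w = cycle_weight w hull_list" if w: "antisym_weight w" for w
  proof -
    have F: "boundary (concat (map f [0..<m])) w = (\<Sum>i<m. boundary (f i) w)" for f m
      by (induction m) simp_all
    have b: "boundary (fan (Q i) (bs i @ [Q (Suc i)])) w = w (Q i) (Q (Suc i)) - path_weight w (ch i)" for i
    proof -
      have "path_weight w (ch i) = w (Q i) (hd (bs i @ [Q (Suc i)])) + path_weight w (bs i @ [Q (Suc i)])"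
        unfolding ch_def by (cases "bs i") auto
      then show ?thesis using bd_fan[OF w, of "bs i @ [Q (Suc i)]" "Q i"] by simp
    qed
    have "boundary fans w = (\<Sum>i<n. w (Q i) (Q (Suc i)) - path_weight w (ch i))" unfolding fans_def F b ..
    then show ?thesis using D_bd[OF w] by (simp add: cw_LF cw_hv sum_subtractf)
  qed
qed

lemma ori_back: "ori p q (b + d *\<^sub>R (b - x)) = (1 + d) * ori p q b - d * ori p q x"
  by (simp add: ori_def algebra_simps)

text \<open>If the two wedges at the chain vertex \<open>b\<close> missed \<open>x\<close>, two triangles would overlap opposite to \<open>x\<close>.\<close>

lemma wedge_claim:
  assumes i: "i < n" and e1: "(a, b) \<in> set (path_edges (ch i))" and e2: "(b, c) \<in> set (path_edges (ch i))"
    and t1: "tile D a b z'" and t2: "tile D b c z" and x: "x \<in> C i" "x \<notin> set frame"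
  shows "ori x b z' > 0 \<or> ori b x z > 0"
proof (rule ccontr)
  assume no: "\<not> ?thesis"
  note T1 = D_tr[OF t1] and T2 = D_tr[OF t2]
  have xV: "x \<in> V" using x C_sub[OF i] IV by auto
  have xS: "x \<in> S i" using x unfolding S_def by auto
  have LV: "p \<in> set frame \<Longrightarrow> p \<in> V" for p using LF_V by auto
  have "ori x b z' \<noteq> 0" by (rule gpD[OF gpV xV]) (use T1 LV x(2) in auto)
  moreover have "ori b x z \<noteq> 0" by (rule gpD[OF gpV _ xV]) (use T2 LV x(2) in auto)
  ultimately have N: "ori x b z' < 0" "ori b x z < 0" using no by auto
  have R: "ori a b x < 0" "ori b c x < 0"
    using ch_right[OF i e1 xS] ch_right[OF i e2 xS] T1 T2 x(2) by auto
  have t1': "tile (D @ fans) a b z'" "tile (D @ fans) b c z" using t1 t2 unfolding tile_def by auto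
  obtain t where t: "t \<in> set (D @ fans)" and ti: "\<And>y. inside t y \<longleftrightarrow> ori a b y > 0 \<and> ori b z' y > 0 \<and> ori z' a y > 0"
    and ts: "{fst t, fst (snd t), snd (snd t)} = {a, b, z'}" using tr_inside[OF t1'(1)] by auto
  obtain t' where t': "t' \<in> set (D @ fans)" and t'i: "\<And>y. inside t' y \<longleftrightarrow> ori b c y > 0 \<and> ori c z y > 0 \<and> ori z b y > 0"
    and ts': "{fst t', fst (snd t'), snd (snd t')} = {b, c, z}" using tr_inside[OF t1'(2)] by auto
  have mem: "a \<in> S i" "b \<in> S i" "c \<in> S i" using pe_mem[OF e1] pe_mem[OF e2] ch_sub[OF i] by auto
  have ne: "t \<noteq> t'"
  proof
    assume "t = t'"
    then have "{a, b, z'} = {b, c, z}" using ts ts' by simp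
    then have "c \<in> {a, b, z'}" by blast
    moreover have "c \<noteq> a"
    proof -
      obtain j k where "Suc j < length (ch i)" "a = ch i ! j" "b = ch i ! Suc j"
        "Suc k < length (ch i)" "b = ch i ! k" "c = ch i ! Suc k" using e1 e2 unfolding pe_nth by blast
      moreover from this have "k = Suc j" using ch_distinct[OF i] by (simp add: nth_eq_iff_index_eq)
      ultimately show ?thesis using ch_distinct[OF i] by (simp add: nth_eq_iff_index_eq)
    qed
    moreover have "c \<noteq> b" using pe_neq[OF ch_distinct[OF i] e2] by simp
    ultimately have "c = z'" by simp
    then show False using D_not_mono[OF t1 i] mem by simp
  qed
  have p1: "ori z' a b > 0" using T1 ori_rot2[of z' a b] by simp
  have p2: "ori c z b > 0" using T2 ori_rot[of c z b] by simp
  have q1: "ori b z' x < 0" using N(1) ori_rot[of b z' x] by simp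
  have q2: "ori z b x < 0" using N(2) ori_rot2[of z b x] by simp
  \<comment> \<open>The points \<open>b + d (b - x)\<close> lie opposite to \<open>x\<close> at
    \<open>b\<close>. As \<open>x\<close> is on the negative side of the four edges at
    \<open>b\<close>, they are on the positive side, and for small \<open>d\<close> also on that of
    the two remaining edges.\<close>
  have ev: "\<forall>\<^sub>F d in at_right 0. ori p q (b + d *\<^sub>R (b - x)) > 0" if "ori p q b > 0" for p q
    unfolding ori_shift by (rule at_right_eventually_pos[OF that])
  from ev[OF p1] ev[OF p2] eventually_at_right_less[of "0::real"]
  have "\<forall>\<^sub>F d in at_right 0. inside t (b + d *\<^sub>R (b - x)) \<and> inside t' (b + d *\<^sub>R (b - x))"
  proof eventually_elim
    case (elim d)
    have "ori a b (b + d *\<^sub>R (b - x)) > 0" "ori b z' (b + d *\<^sub>R (b - x)) > 0"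
      "ori b c (b + d *\<^sub>R (b - x)) > 0" "ori z b (b + d *\<^sub>R (b - x)) > 0"
      unfolding ori_back using elim(3) R q1 q2 by (auto simp: mult_less_0_iff)
    then show ?case using elim unfolding ti t'i by simp
  qed
  then obtain d where "inside t (b + d *\<^sub>R (b - x)) \<and> inside t' (b + d *\<^sub>R (b - x))"
    using eventually_happens'[OF trivial_limit_at_right_real] by blast
  then show False using covers_disjoint'[OF covers_LF t t' ne] by blast
qed

end

section \<open>Threading the remaining points\<close>

definition rot3 :: "'a \<times> 'a \<times> 'a \<Rightarrow> 'a \<Rightarrow> 'a \<Rightarrow> 'a \<Rightarrow> bool" where
  "rot3 t a b c \<longleftrightarrow> t = (a, b, c) \<or> t = (b, c, a) \<or> t = (c, a, b)"

lemma tr_rot3: "tile D a b c \<longleftrightarrow> (\<exists>k<length D. rot3 (D ! k) a b c)"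
  unfolding tile_def rot3_def in_set_conv_nth by blast

lemma subseq_concat_map:
  "subseq xs ys \<Longrightarrow> (\<And>v. v \<in> set xs \<Longrightarrow> subseq (M v) (l v)) \<Longrightarrow>
    subseq (concat (map (\<lambda>v. v # M v) xs)) (concat (map (\<lambda>v. v # l v) ys))"
proof (induction xs ys rule: list_emb.induct)
  case (list_emb_Cons xs ys y)
  then have "subseq (concat (map (\<lambda>v. v # M v) xs)) (concat (map (\<lambda>v. v # l v) ys))" by simp
  then have "subseq (concat (map (\<lambda>v. v # M v) xs)) ((y # l y) @ concat (map (\<lambda>v. v # l v) ys))"
    by (rule subseq_drop_many)
  then show ?case by simp
next
  case (list_emb_Cons2 x y xs ys)
  then have "subseq (concat (map (\<lambda>v. v # M v) xs)) (concat (map (\<lambda>v. v # l v) ys))" by simp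
  moreover have "subseq (x # M x) (y # l y)" using list_emb_Cons2 by simp
  ultimately have "subseq ((x # M x) @ concat (map (\<lambda>v. v # M v) xs)) ((y # l y) @ concat (map (\<lambda>v. v # l v) ys))"
    by (intro list_emb_append_mono)
  then show ?case by simp
qed simp

lemma pw_threaded:
  "ch \<noteq> [] \<Longrightarrow> path_weight w (concat (map (\<lambda>a. a # l a) (butlast ch)) @ [last ch]) = (\<Sum>(a, b)\<leftarrow>path_edges ch. path_weight w (a # l a @ [b]))"
proof (induction ch rule: path_edges.induct)
  case (1 x y zs)
  have "concat (map (\<lambda>a. a # l a) (butlast (x # y # zs))) @ [last (x # y # zs)]
      = (x # l x) @ (concat (map (\<lambda>a. a # l a) (butlast (y # zs))) @ [last (y # zs)])" by simp
  moreover obtain r where r: "concat (map (\<lambda>a. a # l a) (butlast (y # zs))) @ [last (y # zs)] = y # r"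
    by (cases zs) auto
  ultimately show ?case using 1 pw_append[of w "x # l x" y r] unfolding r by simp
qed auto

lemma map_fst_pe: "map fst (path_edges xs) = butlast xs"
  by (induction xs rule: path_edges.induct) auto

context hull_data
begin

text \<open>The line through \<open>Q (Suc i)\<close> parallel to the chord of its two hull
  neighbours supports the set.\<close>

lemma corner_halfplane:
  assumes i: "i < n" shows "\<exists>r. \<forall>s\<in>V. s \<noteq> Q (Suc i) \<longrightarrow> ori r (Q (Suc i)) s < 0"
proof -
  let ?j = "next_idx i"
  have j: "?j < n" "Q ?j = Q (Suc i)" "?j \<noteq> i" "next_idx ?j \<noteq> i" using next_idx i by auto
  define r where "r = Q (Suc i) + (Q (Suc ?j) - Q i)"
  have e: "ori r (Q (Suc i)) s = - (edge_dist i s + edge_dist ?j s)" for s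
    unfolding r_def edge_dist_def j(2) by (simp add: ori_def algebra_simps)
  have p: "edge_dist i s + edge_dist ?j s > 0" if s: "s \<in> V" "s \<noteq> Q (Suc i)" for s
  proof (cases "s = Q i")
    case True
    have "Q i \<noteq> Q (Suc ?j)" using next_idx j i Q_eq by metis
    then have "edge_dist ?j s > 0" using dd_pos[OF j(1), of s] s True j by auto
    then show ?thesis using True by simp
  next
    case False
    then show ?thesis using dd_pos[OF i s(1)] dd_nonneg[OF j(1) s(1)] s by simp
  qed
  have "ori r (Q (Suc i)) s < 0" if "s \<in> V" "s \<noteq> Q (Suc i)" for s using e[of s] p[OF that] by linarith
  then show ?thesis by blast
qed

lemma pred_ex: "i < n \<Longrightarrow> \<exists>j<n. Q (Suc j) = Q i"
proof -
  assume i: "i < n"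
  show ?thesis
  proof (cases "i = 0")
    case True then show ?thesis using per n3 by (intro exI[of _ "n - 1"]) auto
  next
    case False then show ?thesis using i by (intro exI[of _ "i - 1"]) auto
  qed
qed

end

context fill_data
begin

definition next_vertex where "next_vertex v = (SOME b. (v, b) \<in> set (cycle_edges frame))"

lemma next_vertex: "v \<in> set frame \<Longrightarrow> (v, next_vertex v) \<in> set (cycle_edges frame)"
  unfolding next_vertex_def using ce_ex someI_ex by metis

lemma nv_eq: "(v, b) \<in> set (cycle_edges frame) \<Longrightarrow> next_vertex v = b"
proof -
  assume e: "(v, b) \<in> set (cycle_edges frame)"
  have "frame \<noteq> []" using LF_len by auto
  then have "v \<in> set frame" using ce_mem[OF e] by simp
  then show ?thesis using ce_fst_inj[OF LF_distinct next_vertex e] by simp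
qed

lemma ch_LF: "i < n \<Longrightarrow> set (ch i) \<subseteq> set frame"
  using LF_mem QLF next_idx[of i] unfolding ch_def by auto

lemma pe_ch: "i < n \<Longrightarrow> (a, b) \<in> set (path_edges (ch i)) \<Longrightarrow> (a, b) \<in> set (cycle_edges frame) \<and> next_vertex a = b \<and> a \<in> set frame \<and> b \<in> set frame"
proof -
  assume i: "i < n" and e: "(a, b) \<in> set (path_edges (ch i))"
  have c: "(a, b) \<in> set (cycle_edges frame)" unfolding ce_LF using i e by blast
  then show ?thesis using nv_eq[OF c] pe_mem[OF e] ch_LF[OF i] by blast
qed

text \<open>Every directed edge of the frame lies on a triangle of \<open>D\<close>. The owner is a
  position in the list rather than a triangle, so that exactly one entry will receive the points
  behind the edge.\<close>

lemma owners_exist: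
  "\<exists>own z. \<forall>v\<in>set frame. own v < length D \<and> rot3 (D ! own v) v (next_vertex v) (z v)"
proof -
  have "\<exists>k z. k < length D \<and> rot3 (D ! k) v (next_vertex v) z" if "v \<in> set frame" for v
    using edge_tr[OF LF_distinct LF_len D_bd next_vertex[OF that]] unfolding tr_rot3 by blast
  then show ?thesis by metis
qed

text \<open>An application of \<open>body_list\<close> to each chain: \<open>wedge_claim\<close>
  supplies the condition at the inner vertices of a chain, and supporting lines at the hull vertices
  supply those at its ends.\<close>

lemma cells_exist:
  assumes z: "\<And>v. v \<in> set frame \<Longrightarrow> tile D v (next_vertex v) (z v)"
  shows "\<exists>cell. \<forall>i<n. (\<Union>a\<in>set (Q i # bs i). cell a) = C i - set frame \<and>
    (\<forall>a\<in>set (Q i # bs i). \<forall>b\<in>set (Q i # bs i). a \<noteq> b \<longrightarrow> cell a \<inter> cell b = {}) \<and>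
    (\<forall>(a, b)\<in>set (path_edges (ch i)). \<forall>x\<in>cell a. ori a x (z a) > 0 \<and> ori x b (z a) > 0) \<and>
    (\<forall>l. (\<forall>(a, b)\<in>set (path_edges (ch i)). set (l a) = cell a \<and> separable (a # l a @ [b])) \<longrightarrow>
       separable (concat (map (\<lambda>a. a # l a) (Q i # bs i)) @ [Q (Suc i)]))"
proof -
  define P where "P i cell \<longleftrightarrow> (\<Union>a\<in>set (Q i # bs i). cell a) = C i - set frame \<and>
    (\<forall>a\<in>set (Q i # bs i). \<forall>b\<in>set (Q i # bs i). a \<noteq> b \<longrightarrow> cell a \<inter> cell b = {}) \<and>
    (\<forall>(a, b)\<in>set (path_edges (ch i)). \<forall>x\<in>cell a. ori a x (z a) > 0 \<and> ori x b (z a) > 0) \<and>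
    (\<forall>l. (\<forall>(a, b)\<in>set (path_edges (ch i)). set (l a) = cell a \<and> separable (a # l a @ [b])) \<longrightarrow>
       separable (concat (map (\<lambda>a. a # l a) (Q i # bs i)) @ [Q (Suc i)]))" for i and cell :: "point \<Rightarrow> point set"
  have "\<exists>cell. P i cell" if i: "i < n" for i
  proof -
    have bl: "butlast (ch i) = Q i # bs i" and lst: "last (ch i) = Q (Suc i)" and hd: "hd (ch i) = Q i"
      unfolding ch_def by auto
    have za: "tile D a b (z a)" if "(a, b) \<in> set (path_edges (ch i))" for a b
      using z[of a] pe_ch[OF i that] by auto
    have "\<exists>cell. (\<Union>a\<in>set (butlast (ch i)). cell a) = C i - set frame \<and>
      (\<forall>a\<in>set (butlast (ch i)). \<forall>b\<in>set (butlast (ch i)). a \<noteq> b \<longrightarrow> cell a \<inter> cell b = {}) \<and>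
      (\<forall>(a, b)\<in>set (path_edges (ch i)). \<forall>x\<in>cell a. ori a x (z a) > 0 \<and> ori x b (z a) > 0) \<and>
      (\<forall>l. (\<forall>(a, b)\<in>set (path_edges (ch i)). set (l a) = cell a \<and> separable (a # l a @ [b])) \<longrightarrow>
         separable (concat (map (\<lambda>a. a # l a) (butlast (ch i))) @ [last (ch i)]))"
    proof (rule body_list[of "ch i" "C i - set frame" V z])
      show "2 \<le> length (ch i)" unfolding ch_def by simp
      show "distinct (ch i)" by (rule ch_distinct[OF i])
      show "finite (C i - set frame)" using finC[OF i] by simp
      show "gen_pos V" by (rule gpV)
      show "set (ch i) \<subseteq> V" using ch_LF[OF i] LF_V by blast
      show "C i - set frame \<subseteq> V" using C_sub[OF i] IV by auto
      show "set (ch i) \<inter> (C i - set frame) = {}" using ch_LF[OF i] by auto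
      show "z a \<in> V \<and> z a \<notin> C i - set frame \<and> z a \<notin> set (ch i) \<and> 0 < ori a b (z a)" if e: "(a, b) \<in> set (path_edges (ch i))" for a b
      proof -
        have "z a \<notin> set (ch i)" using D_not_mono[OF za[OF e] i] pe_mem[OF e] ch_sub[OF i] by auto
        then show ?thesis using D_tr[OF za[OF e]] LF_V by auto
      qed
      show "ori a b c < 0" if "subseq [a, b, c] (ch i)" for a b c by (rule ch_triple[OF i that])
      show "ori a b x < 0" if e: "(a, b) \<in> set (path_edges (ch i))" and x: "x \<in> C i - set frame" for a b x
        using ch_right[OF i e, of x] x pe_mem[OF e] ch_LF[OF i] unfolding S_def by auto
      show "0 < ori x b (z a) \<or> 0 < ori b x (z b)"
        if e: "(a, b) \<in> set (path_edges (ch i))" "(b, c) \<in> set (path_edges (ch i))" and x: "x \<in> C i - set frame" for a b c x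
        by (rule wedge_claim[OF i e za[OF e(1)] za[OF e(2)]]) (use x in auto)
      \<comment> \<open>At a hull vertex all points are seen within a half-plane, where the angular
        order is transitive: \<open>x\<close> comes before \<open>b\<close>, and \<open>b\<close>
        before the apex.\<close>
      show "0 < ori (hd (ch i)) x (z (hd (ch i)))" if x: "x \<in> C i - set frame" for x
      proof -
        obtain j where j: "j < n" "Q (Suc j) = Q i" using pred_ex[OF i] by blast
        obtain r where r: "\<forall>s\<in>V. s \<noteq> Q i \<longrightarrow> ori r (Q i) s < 0" using corner_halfplane[OF j(1)] j(2) by auto
        obtain b where e: "(Q i, b) \<in> set (path_edges (ch i))" unfolding ch_def by (cases "bs i") auto
        note T = D_tr[OF za[OF e]]
        have xV: "x \<in> V" using x C_sub[OF i] IV by auto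
        have "ori (Q i) b x < 0" using ch_right[OF i e, of x] x pe_mem[OF e] ch_LF[OF i] unfolding S_def by auto
        then have 1: "ori (Q i) x b > 0" using ori_swap2[of "Q i" x b] by simp
        have ne: "x \<noteq> Q i" "b \<noteq> Q i" "z (Q i) \<noteq> Q i" using 1 T by auto
        have "ori (Q i) x (z (Q i)) > 0"
          by (rule cone_trans[of r "Q i" x b]) (use r xV T LF_V ne 1 in auto)
        then show ?thesis unfolding hd .
      qed
      show "0 < ori x (last (ch i)) (z (last (butlast (ch i))))" if x: "x \<in> C i - set frame" for x
      proof -
        define a where "a = last (butlast (ch i))"
        let ?p = "Q (Suc i)"
        obtain r where r: "\<forall>s\<in>V. s \<noteq> ?p \<longrightarrow> ori r ?p s < 0" using corner_halfplane[OF i] by auto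
        have "ch i = (Q i # bs i) @ [?p]" unfolding ch_def by simp
        then have e: "(a, ?p) \<in> set (path_edges (ch i))" unfolding a_def bl using pe_last[of "Q i # bs i" ?p] by simp
        note T = D_tr[OF za[OF e]]
        have xV: "x \<in> V" using x C_sub[OF i] IV by auto
        have "ori a ?p x < 0" using ch_right[OF i e, of x] x pe_mem[OF e] ch_LF[OF i] unfolding S_def by auto
        then have 1: "ori ?p a x > 0" using ori_swap[of ?p a x] by simp
        have 2: "ori ?p (z a) a > 0" using T ori_rot[of ?p "z a" a] by simp
        have ne: "x \<noteq> ?p" "a \<noteq> ?p" "z a \<noteq> ?p" using 1 2 by auto
        have "ori ?p (z a) x > 0"
          by (rule cone_trans[of r ?p "z a" a]) (use r xV T LF_V ne 1 2 in auto)
        then show ?thesis unfolding lst a_def[symmetric] using ori_rot2[of x ?p "z a"] by simp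
      qed
    qed
    then show ?thesis unfolding P_def bl lst by blast
  qed
  then obtain cf where cf: "\<And>i. i < n \<Longrightarrow> P i (cf i)" by metis
  \<comment> \<open>A frame vertex starts an edge of only one chain, so the cells of all classes
    combine to a single function on vertices.\<close>
  define cl where "cl v = (SOME i. i < n \<and> v \<in> set (Q i # bs i))" for v
  have cl: "cl v = i" if "i < n" "v \<in> set (Q i # bs i)" for v i
  proof -
    have c: "cl v < n \<and> v \<in> set (Q (cl v) # bs (cl v))" unfolding cl_def by (rule someI[of _ i]) (use that in auto)
    have d: "set (Q j # bs j) \<inter> set (Q i # bs i) = {}" if "j < n" "j \<noteq> i" for j
    proof -
      have "C i \<inter> C j = {}" "Q i \<noteq> Q j" using Cdisj Q_eq that \<open>i < n\<close> by auto
      moreover have "Q i \<notin> C j" "Q j \<notin> C i" using C_sub inner_ne that \<open>i < n\<close> by blast+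
      ultimately show ?thesis using bs_C that \<open>i < n\<close> by auto
    qed
    show ?thesis
    proof (rule ccontr)
      assume "cl v \<noteq> i"
      from d[OF conjunct1[OF c] this] show False using conjunct2[OF c] that(2) by blast
    qed
  qed
  define cell where "cell v = cf (cl v) v" for v
  have eq: "cell a = cf i a" if "i < n" "a \<in> set (Q i # bs i)" for a i unfolding cell_def cl[OF that] ..
  have "P i cell" if i: "i < n" for i
  proof -
    note p = cf[OF i, unfolded P_def]
    have eq': "cell a = cf i a" if "(a, b) \<in> set (path_edges (ch i))" for a b
    proof -
      have "a \<in> set (map fst (path_edges (ch i)))" using that by force
      then have "a \<in> set (Q i # bs i)" unfolding map_fst_pe ch_def by simp
      then show ?thesis by (rule eq[OF i])
    qed
    show ?thesis unfolding P_def
    proof (intro conjI)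
      show "(\<Union>a\<in>set (Q i # bs i). cell a) = C i - set frame" using p eq[OF i] by auto
      show "\<forall>a\<in>set (Q i # bs i). \<forall>b\<in>set (Q i # bs i). a \<noteq> b \<longrightarrow> cell a \<inter> cell b = {}"
        using p eq[OF i] by simp
      show "\<forall>(a, b)\<in>set (path_edges (ch i)). \<forall>x\<in>cell a. ori a x (z a) > 0 \<and> ori x b (z a) > 0"
        using p eq' by fast
      show "\<forall>l. (\<forall>(a, b)\<in>set (path_edges (ch i)). set (l a) = cell a \<and> separable (a # l a @ [b])) \<longrightarrow>
        separable (concat (map (\<lambda>a. a # l a) (Q i # bs i)) @ [Q (Suc i)])"
      proof (intro allI impI)
        fix l assume l: "\<forall>(a, b)\<in>set (path_edges (ch i)). set (l a) = cell a \<and> separable (a # l a @ [b])"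
        have "\<forall>(a, b)\<in>set (path_edges (ch i)). set (l a) = cf i a \<and> separable (a # l a @ [b])" using l eq' by fast
        moreover have "\<forall>l. (\<forall>(a, b)\<in>set (path_edges (ch i)). set (l a) = cf i a \<and> separable (a # l a @ [b])) \<longrightarrow>
          separable (concat (map (\<lambda>a. a # l a) (Q i # bs i)) @ [Q (Suc i)])" using p by (elim conjE) assumption
        ultimately show "separable (concat (map (\<lambda>a. a # l a) (Q i # bs i)) @ [Q (Suc i)])" by blast
      qed
    qed
  qed
  then show ?thesis unfolding P_def by blast
qed

text \<open>A tile of \<open>D\<close> enlarged behind its three sides by the sets \<open>X\<close>,
  \<open>Y\<close>, \<open>Z\<close>: the sides become separable paths through these sets, and
  \<open>E\<close> fills the enlarged region with no triangle inside one class.\<close>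

definition threaded_tile :: "point \<Rightarrow> point \<Rightarrow> point \<Rightarrow> point set \<Rightarrow> point set \<Rightarrow> point set \<Rightarrow> point list \<Rightarrow> point list \<Rightarrow> point list \<Rightarrow>
    (point \<times> point \<times> point) list \<Rightarrow> bool" where
  "threaded_tile a b c X Y Z la lb lc E \<longleftrightarrow> set la = X \<and> distinct la \<and> set lb = Y \<and> distinct lb \<and> set lc = Z \<and> distinct lc \<and>
     separable (a # la @ [b]) \<and> separable (b # lb @ [c]) \<and> separable (c # lc @ [a]) \<and>
     (\<forall>w. antisym_weight w \<longrightarrow> boundary E w = path_weight w (a # la @ [b]) + path_weight w (b # lb @ [c]) + path_weight w (c # lc @ [a])) \<and>
     (\<forall>x y u. (x, y, u) \<in> set E \<longrightarrow> ori x y u > 0 \<and> cyclic_subseq (a # la @ b # lb @ c # lc) x y u \<and> (\<forall>i<n. \<not> {x, y, u} \<subseteq> S i))"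

lemma TF_rot: "threaded_tile a b c X Y Z la lb lc E \<Longrightarrow> threaded_tile b c a Y Z X lb lc la E"
proof -
  assume T: "threaded_tile a b c X Y Z la lb lc E"
  have "cyclic_subseq (b # lb @ c # lc @ a # la) x y u" if "cyclic_subseq (a # la @ b # lb @ c # lc) x y u" for x y u
    using cseq_rotate[of "a # la" "b # lb @ c # lc" x y u] that by simp
  then show ?thesis using T unfolding threaded_tile_def by (simp add: add.commute add.left_commute)
qed

text \<open>If both sides at \<open>b\<close> carry points, these sides belong to different chains
  because a tile of \<open>D\<close> never lies in one class. Then \<open>b\<close> is the hull
  vertex between consecutive classes, where \<open>corner\<close> and \<open>separator\<close>
  provide what \<open>zigzag\<close> needs.\<close>

lemma triple_fill_base:
  assumes t: "tile D a b c"
    and X: "X \<noteq> {} \<Longrightarrow> \<exists>i<n. (a, b) \<in> set (path_edges (ch i)) \<and> X \<subseteq> C i - set frame \<and> (\<forall>x\<in>X. ori a x c > 0 \<and> ori x b c > 0)"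
    and Y: "Y \<noteq> {} \<Longrightarrow> \<exists>i<n. (b, c) \<in> set (path_edges (ch i)) \<and> Y \<subseteq> C i - set frame \<and> (\<forall>x\<in>Y. ori b x a > 0 \<and> ori x c a > 0)"
  shows "\<exists>la lb E. threaded_tile a b c X Y {} la lb [] E"
proof -
  note T = D_tr[OF t]
  have abc: "a \<in> V" "b \<in> V" "c \<in> V" using T LF_V by auto
  have XV: "X \<subseteq> V - set frame" and YV: "Y \<subseteq> V - set frame" using X Y C_sub IV by blast+
  have fX: "finite X" "finite Y" using XV YV finV by (meson finite_Diff finite_subset)+
  have up: "ori a p c > 0" if p: "p \<in> X \<union> Y" for p
  proof (cases "p \<in> X")
    case True then show ?thesis using X by blast
  next
    case False
    then have "p \<in> Y" using p by simp
    then have "ori p c a > 0" using Y by blast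
    then show ?thesis using ori_rot[of p c a] by simp
  qed
  have both: "\<exists>i<n. b = Q (Suc i) \<and> X \<subseteq> C i \<and> a \<in> S i \<and> Y \<subseteq> C (next_idx i) \<and> c \<in> S (next_idx i)" if ne: "X \<noteq> {}" "Y \<noteq> {}"
  proof -
    obtain i where i: "i < n" "(a, b) \<in> set (path_edges (ch i))" "X \<subseteq> C i" using X[OF ne(1)] by blast
    obtain j where j: "j < n" "(b, c) \<in> set (path_edges (ch j))" "Y \<subseteq> C j" using Y[OF ne(2)] by blast
    have m: "a \<in> S i" "b \<in> S i" "b \<in> S j" "c \<in> S j" using pe_mem[OF i(2)] pe_mem[OF j(2)] ch_sub[OF i(1)] ch_sub[OF j(1)] by auto
    have "i \<noteq> j" using D_not_mono[OF t i(1)] m by auto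
    have bQ: "b \<notin> C i" using inner_class[OF i(1) j(1) _ m(3)] \<open>i \<noteq> j\<close> by blast
    have "b \<noteq> Q i" using pe_hd_notsnd[OF ch_distinct[OF i(1)] i(2)] unfolding ch_def by simp
    then have b: "b = Q (Suc i)" using m(2) bQ unfolding S_def by auto
    have "b \<noteq> Q (Suc j)" using pe_last_notfst[OF ch_distinct[OF j(1)] j(2)] unfolding ch_def by simp
    moreover have "b \<notin> C j" using inner_class[OF j(1) i(1) _ m(2)] \<open>i \<noteq> j\<close> by blast
    ultimately have "b = Q j" using m(3) unfolding S_def by auto
    then have "j = next_idx i" using b next_idx[of i] i(1) j(1) Q_eq by metis
    then show ?thesis using i j b m by blast
  qed
  have VV: "ori p b q > 0" if p: "p \<in> insert a X" and q: "q \<in> insert c Y" for p q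
  proof -
    consider "Y = {}" | "X = {}" | "X \<noteq> {}" "Y \<noteq> {}" by blast
    then show ?thesis
    proof cases
      case 1
      then have "q = c" using q by simp
      then show ?thesis using p T X by blast
    next
      case 2
      then have pa: "p = a" using p by simp
      show ?thesis
      proof (cases "q = c")
        case False
        then have "ori b q a > 0" using q Y by blast
        then show ?thesis using pa ori_rot[of b q a] by simp
      qed (use T pa in simp)
    next
      case 3
      obtain i where i: "i < n" "b = Q (Suc i)" "X \<subseteq> C i" "a \<in> S i" "Y \<subseteq> C (next_idx i)" "c \<in> S (next_idx i)" using both[OF 3] by blast
      have "p \<noteq> b" "q \<noteq> b" using p q XV YV T by auto
      moreover have "p \<in> S i" "q \<in> S (next_idx i)" using p q i unfolding S_def by auto
      ultimately show ?thesis unfolding i(2) by (intro corner[OF i(1)]) auto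
    qed
  qed
  have disj: "X \<inter> Y = {}"
  proof (rule ccontr)
    assume ne: "X \<inter> Y \<noteq> {}"
    then obtain i where i: "i < n" "X \<subseteq> C i" "Y \<subseteq> C (next_idx i)" using both by blast
    then show False using ne Cdisj[OF i(1) next_idx(1)[OF i(1)]] next_idx(3)[OF i(1)] by auto
  qed
  have "\<exists>la lb E. zigzag_between X Y a b c la lb E"
  proof (rule zigzag[OF fX])
    show "gen_pos (X \<union> Y \<union> {a, b, c})" by (rule gp_subset[OF gpV]) (use XV YV abc in auto)
    show "distinct [a, b, c]" using T by auto
    show "\<exists>s. affine_fun s \<and> (\<forall>a\<in>insert a X. s a < 0) \<and> (\<forall>b\<in>insert c Y. s b > 0)" if XY: "X \<noteq> {}" "Y \<noteq> {}"
    proof -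
      obtain i where i: "i < n" "b = Q (Suc i)" "X \<subseteq> C i" "a \<in> S i" "Y \<subseteq> C (next_idx i)" "c \<in> S (next_idx i)" using both[OF XY] by blast
      have "a \<noteq> b" "c \<noteq> b" "b \<notin> X" "b \<notin> Y" using T XV YV by auto
      then show ?thesis
        by (intro separator[OF _ _ _ _ i(1)]) (use fX i in \<open>auto simp: S_def\<close>)
    qed
  qed (use XV YV T up VV disj in auto)
  then obtain la lb E where Z: "zigzag_between X Y a b c la lb E" by blast
  have good: "\<not> {x, y, u} \<subseteq> S i" if E: "(x, y, u) \<in> set E" and i: "i < n" for x y u i
  proof
    assume sub: "{x, y, u} \<subseteq> S i"
    note z = zzD(8)[OF Z E]
    have xX: "x \<in> insert a X" and uY: "u \<in> insert c Y" using z by auto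
    have nX: False if pX: "p \<in> X" "p \<in> S i" and q: "q \<in> insert c Y" "q \<in> S i" for p q
    proof -
      obtain k where k: "k < n" "(a, b) \<in> set (path_edges (ch k))" "X \<subseteq> C k" using X pX by blast
      have "k = i" using inner_class[OF k(1) i _ pX(2)] k(3) pX(1) by blast
      then have ab: "a \<in> S i" "b \<in> S i" using pe_mem[OF k(2)] ch_sub[OF k(1)] by auto
      show False
      proof (cases "q = c")
        case True
        then show False using D_not_mono[OF t i] ab q by auto
      next
        case False
        then have "q \<in> Y" using q by simp
        then obtain m where m: "m < n" "X \<subseteq> C m" "Y \<subseteq> C (next_idx m)" using both pX by blast
        have "m = i" "next_idx m = i" using inner_class[OF m(1) i] inner_class[OF next_idx(1)[OF m(1)] i] m pX \<open>q \<in> Y\<close> q(2) by blast+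
        then show False using next_idx(3)[OF m(1)] by simp
      qed
    qed
    have nY: False if pY: "p \<in> Y" "p \<in> S i" and q: "q \<in> insert a X" "q \<in> S i" for p q
    proof (cases "q = a")
      case True
      obtain k where k: "k < n" "(b, c) \<in> set (path_edges (ch k))" "Y \<subseteq> C k" using Y pY by blast
      have "k = i" using inner_class[OF k(1) i _ pY(2)] k(3) pY(1) by blast
      then have "c \<in> S i" "b \<in> S i" using pe_mem[OF k(2)] ch_sub[OF k(1)] by auto
      then show False using D_not_mono[OF t i] True q by auto
    next
      case False
      then show False using nX[of q p] q pY by auto
    qed
    have xyu: "x \<in> S i" "y \<in> S i" "u \<in> S i" using sub by auto
    consider "y \<in> X" | "y \<in> Y" | "y = b" "X \<noteq> {}" "x \<in> X" | "y = b" "Y \<noteq> {}" "u \<in> Y" | "y = b" "X = {}" "Y = {}"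
      using z by blast
    then show False
    proof cases
      case 1 then show False using nX uY xyu by blast
    next
      case 2 then show False using nY xX xyu by blast
    next
      case 3 then show False using nX uY xyu by blast
    next
      case 4 then show False using nY xX xyu by blast
    next
      case 5
      then have "x = a" "u = c" using xX uY by auto
      then show False using D_not_mono[OF t i] 5 xyu by auto
    qed
  qed
  have cs: "cyclic_subseq (a # la @ b # lb @ c # []) x y u" if "(x, y, u) \<in> set E" for x y u
    using zzD(8)[OF Z that] unfolding cyclic_subseq_def by simp
  have "threaded_tile a b c X Y {} la lb [] E"
    unfolding threaded_tile_def
  proof (intro conjI allI impI)
    show "boundary E w = path_weight w (a # la @ [b]) + path_weight w (b # lb @ [c]) + path_weight w (c # [] @ [a])" if "antisym_weight w" for w
      using zzD(7)[OF Z that] by simp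
    show "separable (c # [] @ [a])" by (simp add: sp_edge)
  qed (use zzD(1-6)[OF Z] zzD(8)[OF Z] cs good in auto)
  then show ?thesis by blast
qed

text \<open>Three occupied sides are impossible: \<open>a b\<close> would be a chain consisting of
  the hull edge alone, and the points of its class would lie to its right. With two occupied sides a
  rotation leads to \<open>triple_fill_base\<close>.\<close>

lemma triple_fill:
  assumes t: "tile D a b c"
    and X: "X \<noteq> {} \<Longrightarrow> \<exists>i<n. (a, b) \<in> set (path_edges (ch i)) \<and> X \<subseteq> C i - set frame \<and> (\<forall>x\<in>X. ori a x c > 0 \<and> ori x b c > 0)"
    and Y: "Y \<noteq> {} \<Longrightarrow> \<exists>i<n. (b, c) \<in> set (path_edges (ch i)) \<and> Y \<subseteq> C i - set frame \<and> (\<forall>x\<in>Y. ori b x a > 0 \<and> ori x c a > 0)"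
    and Z: "Z \<noteq> {} \<Longrightarrow> \<exists>i<n. (c, a) \<in> set (path_edges (ch i)) \<and> Z \<subseteq> C i - set frame \<and> (\<forall>x\<in>Z. ori c x b > 0 \<and> ori x a b > 0)"
  shows "\<exists>la lb lc E. threaded_tile a b c X Y Z la lb lc E"
proof -
  have t2: "tile D b c a" "tile D c a b" using tr_rot[OF t] tr_rot[OF tr_rot[OF t]] by auto
  consider "Z = {}" | "X = {}" | "Y = {}" | "X \<noteq> {}" "Y \<noteq> {}" "Z \<noteq> {}" by blast
  then show ?thesis
  proof cases
    case 1
    then show ?thesis using triple_fill_base[OF t X Y] by blast
  next
    case 2
    obtain lb lc E where "threaded_tile b c a Y Z {} lb lc [] E" using triple_fill_base[OF t2(1) Y Z] by blast
    then have "threaded_tile a b c {} Y Z [] lb lc E" by (intro TF_rot[of c a b Z "{}" Y lc "[]" lb E] TF_rot[of b c a])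
    then show ?thesis using 2 by blast
  next
    case 3
    obtain lc la E where "threaded_tile c a b Z X {} lc la [] E" using triple_fill_base[OF t2(2) Z X] by blast
    then have "threaded_tile a b c X {} Z la [] lc E" by (rule TF_rot)
    then show ?thesis using 3 by blast
  next
    case 4
    obtain i where i: "i < n" "(a, b) \<in> set (path_edges (ch i))" "X \<subseteq> C i" using X[OF 4(1)] by blast
    obtain j where j: "j < n" "(b, c) \<in> set (path_edges (ch j))" using Y[OF 4(2)] by blast
    obtain k where k: "k < n" "(c, a) \<in> set (path_edges (ch k))" using Z[OF 4(3)] by blast
    have m: "a \<in> S i" "b \<in> S i" "b \<in> S j" "c \<in> S j" "c \<in> S k" "a \<in> S k"
      using pe_mem[OF i(2)] pe_mem[OF j(2)] pe_mem[OF k(2)] ch_sub i(1) j(1) k(1) by blast+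
    have "i \<noteq> j" "i \<noteq> k" using D_not_mono[OF t i(1)] m by auto
    then have "a \<notin> C i" "b \<notin> C i" using inner_class[OF i(1) j(1) _ m(3)] inner_class[OF i(1) k(1) _ m(6)] by blast+
    moreover have "b \<noteq> Q i" using pe_hd_notsnd[OF ch_distinct[OF i(1)] i(2)] unfolding ch_def by simp
    moreover have "a \<noteq> Q (Suc i)" using pe_last_notfst[OF ch_distinct[OF i(1)] i(2)] unfolding ch_def by simp
    ultimately have ab: "a = Q i" "b = Q (Suc i)" using m(1,2) unfolding S_def by auto
    obtain x where x: "x \<in> C i" using 4(1) i(3) by auto
    have "edge_dist i x < 0" unfolding edge_dist_def using ch_right[OF i(1,2), of x] x inner_ne[OF C_sub[OF i(1) x] i(1)]
      unfolding ab S_def by auto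
    then show ?thesis using dd_inner[OF i(1) C_sub[OF i(1) x]] by simp
  qed
qed

end

section \<open>Filling the pockets and assembling the covering\<close>

lemma distinct_concat_list:
  "distinct xs \<Longrightarrow> (\<And>x. x \<in> set xs \<Longrightarrow> distinct (f x)) \<Longrightarrow>
    (\<And>x y. x \<in> set xs \<Longrightarrow> y \<in> set xs \<Longrightarrow> x \<noteq> y \<Longrightarrow> set (f x) \<inter> set (f y) = {}) \<Longrightarrow> distinct (concat (map f xs))"
proof (induction xs)
  case (Cons a xs)
  have "set (f a) \<inter> set (f y) = {}" if "y \<in> set xs" for y
    using Cons.prems(3)[of a y] Cons.prems(1) that by auto
  then have "set (f a) \<inter> set (concat (map f xs)) = {}" by fastforce
  moreover have "distinct (concat (map f xs))" by (rule Cons.IH) (use Cons.prems in auto)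
  moreover have "distinct (f a)" using Cons.prems(2) by simp
  ultimately show ?case by simp
qed simp

lemma bd_reverse: "antisym_weight w \<Longrightarrow> boundary (map (\<lambda>(a, b, c). (c, b, a)) D) w = - boundary D w"
proof (induction D)
  case (Cons t D)
  obtain a b c where t: "t = (a, b, c)" by (cases t)
  have "w c b = - w b c" "w b a = - w a b" "w a c = - w c a" using asymD[OF Cons.prems] by blast+
  then show ?case using Cons unfolding t by simp
qed simp

lemma bd_concat: "boundary (concat (map f [0..<m])) w = (\<Sum>i<m. boundary (f i) w)"
  by (induction m) simp_all

lemma bd_nth: "boundary D w = (\<Sum>k<length D. case D ! k of (a, b, c) \<Rightarrow> w a b + w b c + w c a)"
  unfolding boundary_def by (simp add: sum_list_sum_nth lessThan_atLeast0)

context fill_data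
begin

text \<open>The threaded path closed by its hull edge is a simple polygon. It runs clockwise, since
  the points are on the left of the hull edge, so its triangles are reversed to become positive and
  are then decreasing along the path.\<close>

lemma pocket_fill:
  assumes i: "i < n" and d: "distinct (Q i # p @ [Q (Suc i)])" and p: "set p = C i" and s: "separable (Q i # p @ [Q (Suc i)])"
  shows "\<exists>E. (\<forall>a b c. (a, b, c) \<in> set E \<longrightarrow> ori a b c > 0 \<and> cyclic_subseq (Q i # p @ [Q (Suc i)]) c b a) \<and>
    (\<forall>w. antisym_weight w \<longrightarrow> boundary E w = w (Q i) (Q (Suc i)) - path_weight w (Q i # p @ [Q (Suc i)]))"
proof (cases "p = []")
  case True
  then show ?thesis by (intro exI[of _ "[]"]) simp
next
  case False
  let ?q = "p @ [Q (Suc i)]"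
  let ?P = "Q i # ?q"
  have PS: "set ?P \<subseteq> S i" using p unfolding S_def by auto
  have PV: "set ?P \<subseteq> V" using PS S_sub[OF i] by blast
  have hl: "hd ?P = Q i" "last ?P = Q (Suc i)" by simp_all
  have cycle_edges: "cycle_edges ?P = path_edges ?P @ [(Q (Suc i), Q i)]" using ce_pe[of ?P] by simp
  have "simple ?P"
  proof (rule simple_insert_edge[of _ "Q (Suc i)" "Q i" "set (path_edges ?P)"])
    show "set (cycle_edges ?P) \<subseteq> insert (Q (Suc i), Q i) (set (path_edges ?P))" unfolding cycle_edges by auto
    show "\<not> crosses a b c d" if "(a, b) \<in> set (path_edges ?P)" "(c, d) \<in> set (path_edges ?P)" for a b c d
      by (rule sp_nocross[OF s that])
    show "\<not> crosses a b (Q (Suc i)) (Q i)" if "(a, b) \<in> set (path_edges ?P)" for a b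
    proof -
      have "edge_dist i a \<ge> 0" "edge_dist i b \<ge> 0" using dd_nonneg[OF i] PV pe_mem[OF that] by blast+
      then show ?thesis unfolding crosses_def edge_dist_def using ori_swap[of "Q (Suc i)" "Q i"] by (auto simp: mult_less_0_iff)
    qed
  qed
  moreover have "length ?P \<ge> 3" using False by (cases p) auto
  ultimately obtain D' r where F: "fills ?P D' r"
    using simple_polygon_fills[OF d _ gp_subset[OF gpV PV]] by blast
  obtain j where j: "j < n" "Q (Suc j) = Q i" using pred_ex[OF i] by blast
  obtain q where q: "\<forall>s\<in>V. s \<noteq> Q i \<longrightarrow> ori q (Q i) s < 0" using corner_halfplane[OF j(1)] j(2) by auto
  define f where "f x = -1 * ori q (Q i) x + 0 * ori q (Q i) x" for x
  have fa: "affine_fun f" unfolding f_def by (rule aff_comb) auto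
  have "f (Q i) = 0" unfolding f_def by simp
  moreover have fp: "f y > 0" if "y \<in> set ?q" for y
  proof -
    have "y \<in> V" "y \<noteq> Q i" using that PV d by auto
    then show ?thesis using q unfolding f_def by simp
  qed
  moreover have x: "hd ?q \<in> C i" using False p by (cases p) auto
  then have o: "ori (Q i) (hd ?q) (Q (Suc i)) < 0"
    using dd_inner[OF i C_sub[OF i x]] ori_swap2[of "Q i" "hd ?q" "Q (Suc i)"] unfolding edge_dist_def by simp
  ultimately have "r * ori (Q i) (hd ?q) (last ?q) > 0"
    by (intro sign_at_extreme[OF F fa]) auto
  then have "r < 0" using o by (simp add: zero_less_mult_iff)
  then have r: "r = -1" using F unfolding fills_def by auto
  let ?E = "map (\<lambda>(a, b, c). (c, b, a)) D'"
  have "ori a b c > 0 \<and> cyclic_subseq ?P c b a" if "(a, b, c) \<in> set ?E" for a b c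
  proof -
    have "(c, b, a) \<in> set D'" using that by auto
    then have "cyclic_subseq ?P c b a \<and> ori c b a < 0" using F r unfolding fills_def by auto
    then show ?thesis using ori_swap3[of a b c] by simp
  qed
  moreover have "boundary ?E w = w (Q i) (Q (Suc i)) - path_weight w ?P" if "antisym_weight w" for w
  proof -
    have "boundary D' w = path_weight w ?P + w (Q (Suc i)) (Q i)" using F that cw_pw[of ?P w] unfolding fills_def by simp
    then show ?thesis using bd_reverse[OF that] asymD[OF that, of "Q i" "Q (Suc i)"] by simp
  qed
  ultimately show ?thesis by blast
qed

lemma ce_LF_list: "cycle_edges frame = map (\<lambda>v. (v, next_vertex v)) frame"
proof -
  have "cycle_edges frame = map (\<lambda>e. (fst e, next_vertex (fst e))) (cycle_edges frame)"
    by (rule map_idI[symmetric]) (use nv_eq in auto)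
  also have "\<dots> = map (\<lambda>v. (v, next_vertex v)) (map fst (cycle_edges frame))" by simp
  finally show ?thesis unfolding map_fst_ce .
qed

lemma LF_class: "v \<in> set frame \<Longrightarrow> \<exists>i<n. (v, next_vertex v) \<in> set (path_edges (ch i)) \<and> v \<in> set (Q i # bs i)"
proof -
  assume "v \<in> set frame"
  then obtain i where i: "i < n" "(v, next_vertex v) \<in> set (path_edges (ch i))" using next_vertex ce_LF by blast
  then have "v \<in> set (map fst (path_edges (ch i)))" by force
  then have "v \<in> set (Q i # bs i)" unfolding map_fst_pe ch_def by simp
  then show ?thesis using i by blast
qed

theorem threaded_covering:
  "\<exists>p E. (\<forall>i<n. set (p i) = C i \<and> distinct (p i)) \<and> distinct (concat (map (\<lambda>i. Q i # p i) [0..<n])) \<and>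
    set (concat (map (\<lambda>i. Q i # p i) [0..<n])) = V \<and> covers V hull_list E \<and>
    (\<forall>a b c. (a, b, c) \<in> set E \<longrightarrow>
      cyclic_subseq (concat (map (\<lambda>i. Q i # p i) [0..<n])) a b c \<and> (\<forall>i<n. \<not> {a, b, c} \<subseteq> S i) \<or>
      (\<exists>i<n. cyclic_subseq (Q i # p i @ [Q (Suc i)]) c b a)) \<and>
    (\<forall>v\<in>V. \<exists>q r. tile E v q r)"
proof -
  obtain own z where oz: "\<And>v. v \<in> set frame \<Longrightarrow> own v < length D \<and> rot3 (D ! own v) v (next_vertex v) (z v)"
    using owners_exist by blast
  have ztr: "tile D v (next_vertex v) (z v)" if "v \<in> set frame" for v unfolding tr_rot3 using oz[OF that] by blast
  obtain cell where cell: "\<forall>i<n. (\<Union>a\<in>set (Q i # bs i). cell a) = C i - set frame \<and>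
    (\<forall>a\<in>set (Q i # bs i). \<forall>b\<in>set (Q i # bs i). a \<noteq> b \<longrightarrow> cell a \<inter> cell b = {}) \<and>
    (\<forall>(a, b)\<in>set (path_edges (ch i)). \<forall>x\<in>cell a. ori a x (z a) > 0 \<and> ori x b (z a) > 0) \<and>
    (\<forall>l. (\<forall>(a, b)\<in>set (path_edges (ch i)). set (l a) = cell a \<and> separable (a # l a @ [b])) \<longrightarrow>
       separable (concat (map (\<lambda>a. a # l a) (Q i # bs i)) @ [Q (Suc i)]))"
    using cells_exist[OF ztr] by blast
  have cU: "(\<Union>a\<in>set (Q i # bs i). cell a) = C i - set frame" if "i < n" for i
    using cell[THEN spec, THEN mp, OF that] by (elim conjE) assumption
  have cD: "\<forall>a\<in>set (Q i # bs i). \<forall>b\<in>set (Q i # bs i). a \<noteq> b \<longrightarrow> cell a \<inter> cell b = {}" if "i < n" for i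
    using cell[THEN spec, THEN mp, OF that] by (elim conjE) assumption
  have cW: "\<forall>(a, b)\<in>set (path_edges (ch i)). \<forall>x\<in>cell a. ori a x (z a) > 0 \<and> ori x b (z a) > 0" if "i < n" for i
    using cell[THEN spec, THEN mp, OF that] by (elim conjE) assumption
  have cS: "\<forall>l. (\<forall>(a, b)\<in>set (path_edges (ch i)). set (l a) = cell a \<and> separable (a # l a @ [b])) \<longrightarrow>
       separable (concat (map (\<lambda>a. a # l a) (Q i # bs i)) @ [Q (Suc i)])" if "i < n" for i
    using cell[THEN spec, THEN mp, OF that] by (elim conjE) assumption
  \<comment> \<open>The points behind an edge are handed to its owner only; a triangle keeps the
    straight side wherever it is not the owner.\<close>
  define X where "X k v = (if v \<in> set frame \<and> own v = k then cell v else {})" for k v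
  have "\<exists>L E. case D ! k of (a, b, c) \<Rightarrow> threaded_tile a b c (X k a) (X k b) (X k c) (L a) (L b) (L c) E" if k: "k < length D" for k
  proof -
    obtain a b c where t: "D ! k = (a, b, c)" by (cases "D ! k")
    have tile: "tile D a b c" unfolding tr_rot3 rot3_def using k t by blast
    note T = D_tr[OF tile]
    have ne: "a \<noteq> b" "b \<noteq> c" "a \<noteq> c" using T by auto
    have ok: "\<exists>i<n. (v, v') \<in> set (path_edges (ch i)) \<and> X k v \<subseteq> C i - set frame \<and> (\<forall>x\<in>X k v. ori v x v'' > 0 \<and> ori x v' v'' > 0)"
      if r: "rot3 (D ! k) v v' v''" and X: "X k v \<noteq> {}" for v v' v''
    proof -
      have v: "v \<in> set frame" "own v = k" "X k v = cell v" using X unfolding X_def by (auto split: if_splits)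
      have r2: "rot3 (D ! k) v (next_vertex v) (z v)" using oz[OF v(1)] v(2) by simp
      then have e: "next_vertex v = v'" "z v = v''" using r ne unfolding t rot3_def by auto
      obtain i where i: "i < n" "(v, next_vertex v) \<in> set (path_edges (ch i))" "v \<in> set (Q i # bs i)" using LF_class[OF v(1)] by blast
      have "cell v \<subseteq> C i - set frame" using cU[OF i(1)] i(3) by blast
      moreover have "\<forall>x\<in>cell v. ori v x (z v) > 0 \<and> ori x (next_vertex v) (z v) > 0" using cW[OF i(1)] i(2) by fast
      ultimately show ?thesis using i e v(3) by auto
    qed
    have "\<exists>la lb lc E. threaded_tile a b c (X k a) (X k b) (X k c) la lb lc E"
      by (rule triple_fill[OF tile]) (rule ok; simp add: t rot3_def)+
    then obtain la lb lc E where "threaded_tile a b c (X k a) (X k b) (X k c) la lb lc E" by blast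
    then show ?thesis using ne unfolding t prod.case
      by (intro exI[of _ "\<lambda>v. if v = a then la else if v = b then lb else lc"] exI[of _ E]) simp
  qed
  then obtain Lf Ef where LE: "\<And>k a b c. k < length D \<Longrightarrow> D ! k = (a, b, c) \<Longrightarrow>
      threaded_tile a b c (X k a) (X k b) (X k c) (Lf k a) (Lf k b) (Lf k c) (Ef k)"
    by (metis (no_types, lifting) case_prod_conv)
  define l where "l v = Lf (own v) v" for v
  have Lrot: "set (Lf k v) = X k v \<and> distinct (Lf k v) \<and> separable (v # Lf k v @ [v'])" if "k < length D" "rot3 (D ! k) v v' v''" for k v v' v''
  proof -
    obtain a b c where t: "D ! k = (a, b, c)" by (cases "D ! k")
    show ?thesis using LE[OF that(1) t] that(2) unfolding t rot3_def threaded_tile_def by auto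
  qed
  have l: "set (l v) = cell v" "distinct (l v)" "separable (v # l v @ [next_vertex v])" if "v \<in> set frame" for v
    using Lrot[of "own v" v "next_vertex v" "z v"] oz[OF that] that unfolding l_def X_def by auto
  define p where "p i = l (Q i) @ concat (map (\<lambda>a. a # l a) (bs i))" for i
  have Qp: "Q i # p i = concat (map (\<lambda>a. a # l a) (Q i # bs i))" for i unfolding p_def by simp
  define L where "L = concat (map (\<lambda>i. Q i # p i) [0..<n])"
  have LL: "L = concat (map (\<lambda>v. v # l v) frame)"
  proof -
    have "concat (map (\<lambda>i. concat (map h (g i))) xs) = concat (map h (concat (map g xs)))"
      for h :: "point \<Rightarrow> point list" and g :: "nat \<Rightarrow> point list" and xs by (induction xs) simp_all
    then show ?thesis unfolding L_def frame_def Qp .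
  qed
  have cellLF: "cell v \<inter> set frame = {}" "\<exists>i<n. v \<in> set (Q i # bs i) \<and> cell v \<subseteq> C i" if vL: "v \<in> set frame" for v
  proof -
    obtain i where i: "i < n" "v \<in> set (Q i # bs i)" using LF_class[OF vL] by blast
    then have "cell v \<subseteq> C i - set frame" using cU[OF i(1)] by blast
    then show "cell v \<inter> set frame = {}" "\<exists>i<n. v \<in> set (Q i # bs i) \<and> cell v \<subseteq> C i" using i by blast+
  qed
  have dL: "distinct L" unfolding LL
  proof (rule distinct_concat_list[OF LF_distinct])
    show "distinct (v # l v)" if "v \<in> set frame" for v using l[OF that] cellLF(1)[OF that] that by auto
    show "set (v # l v) \<inter> set (v' # l v') = {}" if v: "v \<in> set frame" "v' \<in> set frame" "v \<noteq> v'" for v v'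
    proof -
      obtain i where i: "i < n" "v \<in> set (Q i # bs i)" "cell v \<subseteq> C i" using cellLF(2)[OF v(1)] by blast
      obtain j where j: "j < n" "v' \<in> set (Q j # bs j)" "cell v' \<subseteq> C j" using cellLF(2)[OF v(2)] by blast
      have "cell v \<inter> cell v' = {}"
      proof (cases "i = j")
        case True then show ?thesis using cD[OF i(1)] i j v(3) by blast
      next
        case False then show ?thesis using Cdisj[OF i(1) j(1)] i j by blast
      qed
      then show ?thesis using l(1)[OF v(1)] l(1)[OF v(2)] cellLF(1)[OF v(1)] cellLF(1)[OF v(2)] v by auto
    qed
  qed
  have setp: "insert (Q i) (set (p i)) = insert (Q i) (C i)" if i: "i < n" for i
  proof -
    have bl: "a \<in> set frame" if "a \<in> set (Q i # bs i)" for a using that i LF_mem by auto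
    have "set (Q i # p i) = (\<Union>a\<in>set (Q i # bs i). insert a (set (l a)))" unfolding Qp by auto
    also have "\<dots> = set (Q i # bs i) \<union> (\<Union>a\<in>set (Q i # bs i). cell a)" using l(1)[OF bl] by auto
    also have "\<dots> = set (Q i # bs i) \<union> (C i - set frame)" using cU[OF i] by simp
    also have "\<dots> = insert (Q i) (C i)"
    proof -
      have "x \<in> set (bs i)" if x: "x \<in> C i" "x \<in> set frame" for x
      proof -
        have "x \<in> set (ch i)" using LF_S[OF i x(2)] x(1) unfolding S_def by simp
        then show ?thesis using inner_ne[OF C_sub[OF i x(1)] i] unfolding ch_def by auto
      qed
      then show ?thesis using bs_C[OF i] by auto
    qed
    finally show ?thesis by simp
  qed
  have dp: "distinct (Q i # p i)" if i: "i < n" for i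
  proof -
    have "[0..<n] = [0..<i] @ i # [Suc i..<n]" using upt_add_eq_append[of 0 i "n - i"] upt_conv_Cons[OF i] i by simp
    then have "L = concat (map (\<lambda>i. Q i # p i) [0..<i]) @ (Q i # p i) @ concat (map (\<lambda>i. Q i # p i) [Suc i..<n])"
      unfolding L_def by simp
    then have "distinct (concat (map (\<lambda>i. Q i # p i) [0..<i]) @ (Q i # p i) @ concat (map (\<lambda>i. Q i # p i) [Suc i..<n]))"
      using dL by (rule subst)
    then show ?thesis by (simp only: distinct_append)
  qed
  have pC: "set (p i) = C i" if i: "i < n" for i
  proof -
    have "Q i \<notin> set (p i)" using dp[OF i] by simp
    moreover have "Q i \<notin> C i" using C_sub[OF i] inner_ne[OF _ i] by blast
    ultimately show ?thesis using setp[OF i] by (metis insert_ident)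
  qed
  have setL: "set L = V"
  proof -
    have "set L = (\<Union>i<n. insert (Q i) (set (p i)))" unfolding L_def by auto
    also have "\<dots> = (\<Union>i<n. insert (Q i) (C i))" using pC by auto
    also have "\<dots> = V" unfolding V_def using CI by auto
    finally show ?thesis .
  qed
  define E1 where "E1 = concat (map Ef [0..<length D])"
  have Lsub: "subseq (Lf k v) (l v)" if "k < length D" "rot3 (D ! k) v v' v''" for k v v' v''
  proof (cases "v \<in> set frame \<and> own v = k")
    case True then show ?thesis unfolding l_def by simp
  next
    case False
    then have "set (Lf k v) = {}" using Lrot[OF that] unfolding X_def by auto
    then show ?thesis by simp
  qed
  have E1: "ori x y u > 0 \<and> cyclic_subseq L x y u \<and> (\<forall>i<n. \<not> {x, y, u} \<subseteq> S i)" if xyu: "(x, y, u) \<in> set E1" for x y u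
  proof -
    obtain k where k: "k < length D" "(x, y, u) \<in> set (Ef k)" using xyu unfolding E1_def by auto
    obtain a b c where t: "D ! k = (a, b, c)" by (cases "D ! k")
    have r: "rot3 (D ! k) a b c" "rot3 (D ! k) b c a" "rot3 (D ! k) c a b" unfolding t rot3_def by auto
    have tile: "tile D a b c" unfolding tr_rot3 using k r by blast
    have TE: "ori x y u > 0" "cyclic_subseq (a # Lf k a @ b # Lf k b @ c # Lf k c) x y u" "\<forall>i<n. \<not> {x, y, u} \<subseteq> S i"
      using LE[OF k(1) t] k(2) unfolding threaded_tile_def by auto
    have sb: "v \<in> {a, b, c} \<Longrightarrow> subseq (Lf k v) (l v)" for v using Lsub[OF k(1)] r by auto
    have "cyclic_subseq frame a b c" using D_tr[OF tile] by blast
    then have "cyclic_subseq L x y u" unfolding cyclic_subseq_def[of frame]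
    proof (elim disjE)
      assume "subseq [a, b, c] frame"
      then have "subseq (concat (map (\<lambda>v. v # Lf k v) [a, b, c])) L" unfolding LL by (rule subseq_concat_map) (use sb in auto)
      then show ?thesis using cseq_subseq[OF TE(2)] by simp
    next
      assume "subseq [b, c, a] frame"
      then have s: "subseq (concat (map (\<lambda>v. v # Lf k v) [b, c, a])) L" unfolding LL by (rule subseq_concat_map) (use sb in auto)
      have "cyclic_subseq ((b # Lf k b @ c # Lf k c) @ (a # Lf k a)) x y u" by (rule cseq_rotate) (use TE(2) in simp)
      then show ?thesis using cseq_subseq s by simp
    next
      assume "subseq [c, a, b] frame"
      then have s: "subseq (concat (map (\<lambda>v. v # Lf k v) [c, a, b])) L" unfolding LL by (rule subseq_concat_map) (use sb in auto)
      have "cyclic_subseq ((c # Lf k c) @ (a # Lf k a @ b # Lf k b)) x y u" by (rule cseq_rotate) (use TE(2) in simp)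
      then show ?thesis using cseq_subseq s by simp
    qed
    then show ?thesis using TE by blast
  qed
  have bdE1: "boundary E1 w = cycle_weight w L" if w: "antisym_weight w" for w
  proof -
    \<comment> \<open>The gain when a frame edge is replaced by the path threaded behind it. Each
      edge has one owner, so the sum over all triangles collects every gain once.\<close>
    define G where "G v = path_weight w (v # l v @ [next_vertex v]) - w v (next_vertex v)" for v
    have per_k: "boundary (Ef k) w = (case D ! k of (a, b, c) \<Rightarrow> w a b + w b c + w c a) + (\<Sum>v\<in>set frame. if own v = k then G v else 0)"
      if k: "k < length D" for k
    proof -
      obtain a b c where t: "D ! k = (a, b, c)" by (cases "D ! k")
      have r: "rot3 (D ! k) a b c" "rot3 (D ! k) b c a" "rot3 (D ! k) c a b" unfolding t rot3_def by auto
      have tile: "tile D a b c" unfolding tr_rot3 using k r by blast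
      note T = D_tr[OF tile]
      have ne: "a \<noteq> b" "b \<noteq> c" "a \<noteq> c" using T by auto
      have g: "path_weight w (v # Lf k v @ [v']) = w v v' + (if own v = k then G v else 0)" if rr: "rot3 (D ! k) v v' v''" "v \<in> set frame" for v v' v''
      proof (cases "own v = k")
        case True
        then have "rot3 (D ! k) v (next_vertex v) (z v)" using oz[OF rr(2)] by simp
        then have "next_vertex v = v'" using rr(1) ne unfolding t rot3_def by auto
        then show ?thesis using True unfolding G_def l_def by simp
      next
        case False
        then have "set (Lf k v) = {}" using Lrot[OF k rr(1)] unfolding X_def by auto
        then show ?thesis using False by simp
      qed
      have "(\<Sum>v\<in>set frame. if own v = k then G v else 0) = (\<Sum>v\<in>{a, b, c}. if own v = k then G v else 0)"
      proof (rule sum.mono_neutral_right)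
        show "\<forall>v\<in>set frame - {a, b, c}. (if own v = k then G v else 0) = 0"
        proof
          fix v assume v: "v \<in> set frame - {a, b, c}"
          then have "own v \<noteq> k" using oz[of v] t unfolding rot3_def by auto
          then show "(if own v = k then G v else 0) = 0" by simp
        qed
      qed (use T in auto)
      also have "\<dots> = (if own a = k then G a else 0) + (if own b = k then G b else 0) + (if own c = k then G c else 0)"
        using ne by simp
      finally have sm: "(\<Sum>v\<in>set frame. if own v = k then G v else 0) =
        (if own a = k then G a else 0) + (if own b = k then G b else 0) + (if own c = k then G c else 0)" .
      have "boundary (Ef k) w = path_weight w (a # Lf k a @ [b]) + path_weight w (b # Lf k b @ [c]) + path_weight w (c # Lf k c @ [a])"
        using LE[OF k t] w unfolding threaded_tile_def by blast
      then show ?thesis using g[OF r(1)] g[OF r(2)] g[OF r(3)] T unfolding sm t by simp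
    qed
    have "boundary E1 w = (\<Sum>k<length D. boundary (Ef k) w)" unfolding E1_def by (rule bd_concat)
    also have "\<dots> = (\<Sum>k<length D. (case D ! k of (a, b, c) \<Rightarrow> w a b + w b c + w c a) + (\<Sum>v\<in>set frame. if own v = k then G v else 0))"
      by (rule sum.cong) (use per_k in auto)
    also have "\<dots> = boundary D w + (\<Sum>k<length D. \<Sum>v\<in>set frame. if own v = k then G v else 0)"
      unfolding bd_nth[of D w] by (rule sum.distrib)
    also have "(\<Sum>k<length D. \<Sum>v\<in>set frame. if own v = k then G v else 0) = (\<Sum>v\<in>set frame. \<Sum>k<length D. if own v = k then G v else 0)"
      by (rule sum.swap)
    also have "\<dots> = (\<Sum>v\<in>set frame. G v)"
      by (rule sum.cong) (use oz in auto)
    also have "boundary D w = (\<Sum>v\<in>set frame. w v (next_vertex v))"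
    proof -
      have "boundary D w = (\<Sum>v\<leftarrow>frame. w v (next_vertex v))" unfolding D_bd[OF w] cycle_weight_def ce_LF_list by (simp add: comp_def)
      then show ?thesis using sum_list_distinct_conv_sum_set[OF LF_distinct] by simp
    qed
    also have "(\<Sum>v\<in>set frame. w v (next_vertex v)) + (\<Sum>v\<in>set frame. G v) = (\<Sum>v\<in>set frame. path_weight w (v # l v @ [next_vertex v]))"
      unfolding G_def by (simp only: sum.distrib[symmetric]) simp
    also have "\<dots> = (\<Sum>v\<leftarrow>frame. path_weight w (v # l v @ [next_vertex v]))"
      by (rule sum_list_distinct_conv_sum_set[OF LF_distinct, symmetric])
    also have "\<dots> = (\<Sum>(a, b)\<leftarrow>cycle_edges frame. path_weight w (a # l a @ [b]))" unfolding ce_LF_list by (simp add: comp_def)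
    also have "\<dots> = (\<Sum>i<n. \<Sum>(a, b)\<leftarrow>path_edges (ch i). path_weight w (a # l a @ [b]))"
    proof -
      have "(\<Sum>(a, b)\<leftarrow>concat (map f [0..<m]). h a b) = (\<Sum>i<m. \<Sum>(a, b)\<leftarrow>f i. h a b)" for f m and h :: "point \<Rightarrow> point \<Rightarrow> real"
        by (induction m) simp_all
      then show ?thesis unfolding frame_def ce_cycle ch_def by blast
    qed
    also have "\<dots> = (\<Sum>i<n. path_weight w (Q i # p i @ [Q (Suc i)]))"
    proof (rule sum.cong[OF refl])
      fix i
      have "path_weight w (concat (map (\<lambda>a. a # l a) (butlast (ch i))) @ [last (ch i)]) = (\<Sum>(a, b)\<leftarrow>path_edges (ch i). path_weight w (a # l a @ [b]))"
        by (rule pw_threaded) (simp add: ch_def)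
      moreover have "concat (map (\<lambda>a. a # l a) (butlast (ch i))) @ [last (ch i)] = Q i # p i @ [Q (Suc i)]"
        unfolding ch_def using Qp[of i] by simp
      ultimately show "(\<Sum>(a, b)\<leftarrow>path_edges (ch i). path_weight w (a # l a @ [b])) = path_weight w (Q i # p i @ [Q (Suc i)])" by simp
    qed
    also have "\<dots> = cycle_weight w L" unfolding L_def cw_cycle ..
    finally show ?thesis .
  qed
  have "\<exists>E. (\<forall>a b c. (a, b, c) \<in> set E \<longrightarrow> ori a b c > 0 \<and> cyclic_subseq (Q i # p i @ [Q (Suc i)]) c b a) \<and>
    (\<forall>w. antisym_weight w \<longrightarrow> boundary E w = w (Q i) (Q (Suc i)) - path_weight w (Q i # p i @ [Q (Suc i)]))" if i: "i < n" for i
  proof (rule pocket_fill[OF i _ pC[OF i]])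
    have "Q (Suc i) \<notin> C i" using C_sub[OF i] inner_ne[OF _ i] by blast
    then show "distinct (Q i # p i @ [Q (Suc i)])" using dp[OF i] pC[OF i] QS_ne[OF i] by auto
    have "\<forall>(a, b)\<in>set (path_edges (ch i)). set (l a) = cell a \<and> separable (a # l a @ [b])"
    proof (clarify)
      fix a b assume e: "(a, b) \<in> set (path_edges (ch i))"
      have "a \<in> set frame" "next_vertex a = b" using pe_ch[OF i e] by auto
      then show "set (l a) = cell a \<and> separable (a # l a @ [b])" using l[of a] by simp
    qed
    then have "separable (concat (map (\<lambda>a. a # l a) (Q i # bs i)) @ [Q (Suc i)])" by (rule mp[OF spec[OF cS[OF i], of l]])
    then show "separable (Q i # p i @ [Q (Suc i)])" using Qp[of i] by simp
  qed
  then obtain Ep where Ep: "\<And>i a b c. i < n \<Longrightarrow> (a, b, c) \<in> set (Ep i) \<Longrightarrow> ori a b c > 0 \<and> cyclic_subseq (Q i # p i @ [Q (Suc i)]) c b a"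
    and bdp: "\<And>i w. i < n \<Longrightarrow> antisym_weight w \<Longrightarrow> boundary (Ep i) w = w (Q i) (Q (Suc i)) - path_weight w (Q i # p i @ [Q (Suc i)])"
    by metis
  define E where "E = E1 @ concat (map Ep [0..<n])"
  have Ecases: "(a, b, c) \<in> set E1 \<or> (\<exists>i<n. (a, b, c) \<in> set (Ep i))" if "(a, b, c) \<in> set E" for a b c
    using that unfolding E_def by auto
  have Epos: "a \<in> V \<and> b \<in> V \<and> c \<in> V \<and> ori a b c > 0" if "(a, b, c) \<in> set E" for a b c
    using Ecases[OF that]
  proof
    assume "(a, b, c) \<in> set E1"
    then show ?thesis using E1 cseq_mem[of L a b c] setL by blast
  next
    assume "\<exists>i<n. (a, b, c) \<in> set (Ep i)"
    then obtain i where i: "i < n" "(a, b, c) \<in> set (Ep i)" by blast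
    have "set (Q i # p i @ [Q (Suc i)]) \<subseteq> V" using pC[OF i(1)] S_sub[OF i(1)] unfolding S_def by auto
    then show ?thesis using Ep[OF i] cseq_mem[of "Q i # p i @ [Q (Suc i)]" c b a] by blast
  qed
  \<comment> \<open>The threaded tiles and the pockets meet along the threaded paths with opposite
    signs, so only the hull edges remain.\<close>
  have bdE: "boundary E w = cycle_weight w hull_list" if w: "antisym_weight w" for w
  proof -
    have "boundary (concat (map Ep [0..<n])) w = (\<Sum>i<n. w (Q i) (Q (Suc i)) - path_weight w (Q i # p i @ [Q (Suc i)]))"
      unfolding bd_concat by (rule sum.cong) (use bdp w in auto)
    then show ?thesis unfolding E_def using bdE1[OF w] unfolding L_def cw_cycle by (simp add: cw_hv sum_subtractf)
  qed
  have cov: "covers V hull_list E"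
    unfolding covers_def using finV gpV hullp_sub[of V] QV(1) Epos bdE by (auto simp: image_subset_iff)
  have full: "\<exists>q r. tile E v q r" if v: "v \<in> V" for v
  proof -
    have "v \<in> set L" using v setL by simp
    then obtain b where e: "(v, b) \<in> set (cycle_edges L)" using ce_ex by metis
    have "length L \<ge> 3"
    proof -
      have "set frame \<subseteq> set L" using LF_V setL by simp
      then have "card (set frame) \<le> card (set L)" by (intro card_mono) auto
      then show ?thesis using LF_len distinct_card[OF LF_distinct] distinct_card[OF dL] by simp
    qed
    from edge_tr[OF dL this bdE1 e] obtain x where "tile E1 v b x" by blast
    then have "tile E v b x" unfolding tile_def E_def by auto
    then show ?thesis by blast
  qed
  have E: "cyclic_subseq L a b c \<and> (\<forall>i<n. \<not> {a, b, c} \<subseteq> S i) \<or> (\<exists>i<n. cyclic_subseq (Q i # p i @ [Q (Suc i)]) c b a)"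
    if abc: "(a, b, c) \<in> set E" for a b c
    using Ecases[OF abc]
  proof
    assume "(a, b, c) \<in> set E1"
    then show ?thesis using E1 by blast
  next
    assume "\<exists>i<n. (a, b, c) \<in> set (Ep i)"
    then show ?thesis using Ep by blast
  qed
  show ?thesis
  proof (intro exI[of _ p] exI[of _ E] conjI)
    show "\<forall>i<n. set (p i) = C i \<and> distinct (p i)" using pC dp by auto
    show "distinct (concat (map (\<lambda>i. Q i # p i) [0..<n]))" using dL unfolding L_def .
    show "set (concat (map (\<lambda>i. Q i # p i) [0..<n])) = V" using setL unfolding L_def .
    show "covers V hull_list E" by (rule cov)
    show "\<forall>v\<in>V. \<exists>q r. tile E v q r" using full by blast
  qed (intro allI impI E[unfolded L_def])
qed

end

section \<open>The order type of a generalized double circle\<close>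

lemma intri_aff_neg:
  assumes f: "affine_fun f" and i: "in_triangle a b c x" and le: "f a \<le> 0" "f b \<le> 0" "f c \<le> 0"
    and ne: "f a < 0 \<or> f b < 0 \<or> f c < 0"
  shows "f x < 0"
proof -
  let ?O = "ori a b c"
  have w: "?O * ori x b c > 0" "?O * ori a x c > 0" "?O * ori a b x > 0"
    using i ori_rot[of b c x] ori_rot2[of c a x] unfolding in_triangle_def by simp_all
  have "f x * (?O * ?O) = f a * (?O * ori x b c) + f b * (?O * ori a x c) + f c * (?O * ori a b x)"
    using arg_cong[OF aff_bary[OF f, of x a b c], of "\<lambda>t. t * ?O"] by (simp add: algebra_simps)
  moreover have "f a * (?O * ori x b c) \<le> 0" "f b * (?O * ori a x c) \<le> 0" "f c * (?O * ori a b x) \<le> 0"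
    using le w by (simp_all add: mult_nonpos_nonneg)
  moreover have "f a * (?O * ori x b c) < 0 \<or> f b * (?O * ori a x c) < 0 \<or> f c * (?O * ori a b x) < 0"
    using ne w by (meson mult_neg_pos)
  ultimately have "f x * (?O * ?O) < 0" by linarith
  then show ?thesis by (metis mult_nonneg_nonneg not_less zero_le_square)
qed

lemma intri_distinct: "in_triangle a b c x \<Longrightarrow> a \<noteq> b \<and> b \<noteq> c \<and> a \<noteq> c"
  unfolding in_triangle_def by auto

text \<open>The ray from \<open>y\<close> through \<open>y'\<close> passes between \<open>p\<close>
  and \<open>q\<close>, so \<open>p q\<close> is the only side through which it can leave the
  triangle, and that side is not crossed.\<close>

lemma tri_exit_side:
  assumes O: "ori p q r > 0" and y: "ori p q y > 0" "ori q r y > 0" "ori r p y > 0"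
    and s: "ori y y' p < 0" "ori y y' q > 0" and nc: "\<not> crosses y y' p q" and nz: "ori p q y' \<noteq> 0"
  shows "ori p q y' > 0 \<and> ori q r y' > 0 \<and> ori r p y' > 0"
proof -
  have 1: "ori p q y' > 0"
  proof (rule ccontr)
    assume "\<not> ?thesis"
    then have "ori p q y' < 0" using nz by simp
    then show False using nc y(1) s unfolding crosses_def by (simp add: mult_neg_pos mult_pos_neg)
  qed
  have "ori q r y' * ori y p q = ori q r y * ori y' p q + ori q r p * ori y y' q + ori q r q * ori y p y'"
    by (rule aff_bary) simp
  moreover have e: "ori y p q = ori p q y" "ori y' p q = ori p q y'" "ori q r p = ori p q r" "ori r p q = ori p q r"
    "ori y p y' = - ori y y' p"
    by (simp_all add: ori_def algebra_simps)
  ultimately have "ori q r y' * ori p q y = ori q r y * ori p q y' + ori p q r * ori y y' q" by simp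
  moreover have "ori q r y * ori p q y' > 0" "ori p q r * ori y y' q > 0" using 1 y O s by simp_all
  ultimately have "ori q r y' * ori p q y > 0" by linarith
  then have 2: "ori q r y' > 0" using y(1) by (simp add: zero_less_mult_iff)
  have "ori r p y' * ori y p q = ori r p y * ori y' p q + ori r p p * ori y y' q + ori r p q * ori y p y'"
    by (rule aff_bary) simp
  then have "ori r p y' * ori p q y = ori r p y * ori p q y' + ori p q r * (- ori y y' p)" unfolding e by simp
  moreover have "ori r p y * ori p q y' > 0" using 1 y by simp
  moreover have "ori p q r * (- ori y y' p) > 0" by (rule mult_pos_pos) (use O s in simp_all)
  ultimately have "ori r p y' * ori p q y > 0" by linarith
  then show ?thesis using 1 2 y(1) by (simp add: zero_less_mult_iff)
qed

lemma tri_exit: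
  assumes O: "ori a b c > 0" and i: "in_triangle a b c y" and gen_pos: "gen_pos S" and S: "{a, b, c, y, y'} \<subseteq> S"
    and ne: "y' \<notin> {a, b, c}" "y' \<noteq> y" and nc: "\<not> crosses y y' a b" "\<not> crosses y y' b c" "\<not> crosses y y' c a"
  shows "in_triangle a b c y'"
proof -
  have y: "ori a b y > 0" "ori b c y > 0" "ori c a y > 0" using i O unfolding in_triangle_def by (simp_all add: zero_less_mult_iff)
  have d: "a \<noteq> b" "b \<noteq> c" "a \<noteq> c" using intri_distinct[OF i] by auto
  have yd: "y \<notin> {a, b, c}" using y by auto
  have nz: "ori a b y' \<noteq> 0" "ori b c y' \<noteq> 0" "ori c a y' \<noteq> 0" "ori y y' a \<noteq> 0" "ori y y' b \<noteq> 0" "ori y y' c \<noteq> 0"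
    by (rule gpD[OF gen_pos]; use S ne d yd in blast)+
  have O': "ori b c a > 0" "ori c a b > 0" using O ori_rot[of b c a] ori_rot2[of c a b] by simp_all
  \<comment> \<open>As a positive combination of the vertices, \<open>y\<close> does not have all of
    them on one side of the line through \<open>y\<close> and \<open>y'\<close>. Hence some side is
    passed in the forward direction.\<close>
  have bal: "0 = ori y y' a * ori b c y + ori y y' b * ori c a y + ori y y' c * ori a b y"
    by (simp add: ori_def algebra_simps)
  have "\<not> (ori y y' a > 0 \<and> ori y y' b > 0 \<and> ori y y' c > 0)"
  proof
    assume "ori y y' a > 0 \<and> ori y y' b > 0 \<and> ori y y' c > 0"
    then have "ori y y' a * ori b c y > 0" "ori y y' b * ori c a y > 0" "ori y y' c * ori a b y > 0" using y by simp_all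
    then show False using bal by linarith
  qed
  moreover have "\<not> (ori y y' a < 0 \<and> ori y y' b < 0 \<and> ori y y' c < 0)"
  proof
    assume "ori y y' a < 0 \<and> ori y y' b < 0 \<and> ori y y' c < 0"
    then have "ori y y' a * ori b c y < 0" "ori y y' b * ori c a y < 0" "ori y y' c * ori a b y < 0"
      using y by (simp_all add: mult_neg_pos)
    then show False using bal by linarith
  qed
  ultimately consider "ori y y' a < 0" "ori y y' b > 0" | "ori y y' b < 0" "ori y y' c > 0" | "ori y y' c < 0" "ori y y' a > 0"
    using nz by linarith
  then have "ori a b y' > 0 \<and> ori b c y' > 0 \<and> ori c a y' > 0"
  proof cases
    case 1 then show ?thesis using tri_exit_side[OF O y _ _ nc(1) nz(1)] by blast
  next
    case 2 then show ?thesis using tri_exit_side[OF O'(1) y(2,3,1) _ _ nc(2) nz(2)] by blast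
  next
    case 3 then show ?thesis using tri_exit_side[OF O'(2) y(3,1,2) _ _ nc(3) nz(3)] by blast
  qed
  then show ?thesis using O unfolding in_triangle_def by simp
qed

text \<open>If a chord from the first vertex had \<open>y\<close> not on its left, the sign would
  switch at some edge \<open>p q\<close> of the chain. There \<open>y\<close> is on the left and the
  first vertex on the right, which contradicts the signs of the areas.\<close>

lemma chain_chord:
  assumes "\<And>p q x. (p, q) \<in> set (path_edges l) \<Longrightarrow> x \<in> set l \<Longrightarrow> x \<noteq> p \<Longrightarrow> x \<noteq> q \<Longrightarrow> ori p q x < 0"
    and "\<And>p q. (p, q) \<in> set (path_edges l) \<Longrightarrow> ori p q y > 0" and "distinct l" and "subseq [a, b] l"
  shows "ori a b y > 0"
  using assms
proof (induction l)
  case (Cons k r)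
  have er: "(p, q) \<in> set (path_edges r) \<Longrightarrow> (p, q) \<in> set (path_edges (k # r))" for p q by (cases r) auto
  show ?case
  proof (cases "a = k")
    case True
    then have b: "b \<in> set r" using Cons.prems(4) by (simp add: subseq_singleton_left)
    show ?thesis
    proof (rule ccontr)
      assume n: "\<not> ori a b y > 0"
      have "(k, hd r) \<in> set (path_edges (k # r))" using b by (cases r) auto
      then have "ori k (hd r) y > 0" by (rule Cons.prems(2))
      from pe_switch[of "\<lambda>z. ori k z y > 0", OF this b] n True
      obtain p q where pq: "(p, q) \<in> set (path_edges r)" "ori k p y > 0" "\<not> ori k q y > 0" by blast
      have "p \<in> set r" "q \<in> set r" using pe_mem[OF pq(1)] by auto
      then have "ori p q k < 0" using Cons.prems(1)[OF er[OF pq(1)], of k] Cons.prems(3) by auto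
      moreover have "ori p q y > 0" using Cons.prems(2)[OF er[OF pq(1)]] .
      moreover have "ori k q y = ori p q y + ori k p y - ori p q k" by (simp add: ori_def algebra_simps)
      ultimately show False using pq by linarith
    qed
  next
    case False
    then have "subseq [a, b] r" using Cons.prems(4) by (metis subseq_Cons2_neq)
    then show ?thesis using Cons.IH Cons.prems er by (metis distinct.simps(2) list.set_intros(2))
  qed
qed simp

text \<open>For the two end edges: were \<open>x\<close> not on the left of the first one, some
  chain edge \<open>a b\<close> would have \<open>x\<close> in the angle it spans at
  \<open>u\<close>. As \<open>a b\<close> is not crossed by the segment from \<open>x\<close> to
  \<open>u\<close>, the point would lie in the triangle \<open>u a b\<close>, against
  \<open>ni\<close>. The other edges follow from barycentric identities.\<close>

lemma chain_visible:
  assumes K: "K = u # M @ [z]" "M \<noteq> []" and d: "distinct K"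
    and cv: "\<And>a b y. (a, b) \<in> set (path_edges K) \<Longrightarrow> y \<in> set K \<Longrightarrow> y \<noteq> a \<Longrightarrow> y \<noteq> b \<Longrightarrow> ori a b y < 0"
    and x: "x \<notin> set K" and gen_pos: "gen_pos (insert x (set K))" and h: "ori u z x > 0"
    and nc: "\<And>a b y. (a, b) \<in> set (path_edges K) \<Longrightarrow> y \<in> set K \<Longrightarrow> \<not> crosses a b x y"
    and ni: "\<And>a b c. a \<in> set K \<Longrightarrow> b \<in> set K \<Longrightarrow> c \<in> set K \<Longrightarrow> \<not> in_triangle a b c x"
    and e: "(p, q) \<in> set (path_edges K)"
  shows "ori p q x > 0"
proof -
  have nz: "ori a b x \<noteq> 0" if "a \<in> set K" "b \<in> set K" "a \<noteq> b" for a b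
    using gpD[OF gen_pos, of a b x] that x by auto
  have mem: "u \<in> set K" "z \<in> set K" "hd M \<in> set K" "last M \<in> set K" using K by auto
  have ne: "u \<noteq> z" "hd M \<noteq> u" "hd M \<noteq> z" "last M \<noteq> u" "last M \<noteq> z" using d K by auto
  have first: "(u, hd M) \<in> set (path_edges K)" using K by (cases M) auto
  have "path_edges ((u # butlast M) @ last M # [z]) = path_edges ((u # butlast M) @ [last M]) @ path_edges (last M # [z])" by (rule pe_append)
  moreover have "(u # butlast M) @ last M # [z] = K" "(u # M) @ [z] = K" "(u # butlast M) @ [last M] = u # M" using K by simp_all
  ultimately have pK: "path_edges K = path_edges (u # M) @ [(last M, z)]" by simp
  then have lst: "(last M, z) \<in> set (path_edges K)" by simp
  have A: "ori u (hd M) x > 0"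
  proof (rule ccontr)
    assume "\<not> ?thesis"
    then have "\<not> ori u (hd (M @ [z])) x > 0" using K(2) by simp
    moreover have "(a, b) \<in> set (path_edges (M @ [z])) \<Longrightarrow> (a, b) \<in> set (path_edges K)" for a b using K by (cases M) auto
    ultimately obtain a b where ab: "(a, b) \<in> set (path_edges K)" "(a, b) \<in> set (path_edges (M @ [z]))" "\<not> ori u a x > 0" "ori u b x > 0"
      using pe_switch[of "\<lambda>y. \<not> ori u y x > 0" "M @ [z]" z] h by auto
    have m: "a \<in> set (M @ [z])" "b \<in> set (M @ [z])" using pe_mem[OF ab(2)] by auto
    then have m': "a \<in> set K" "b \<in> set K" "a \<noteq> u" "b \<noteq> u" using K d by auto
    have "a \<noteq> b" using pe_neq[OF d ab(1)] .
    have o: "ori a b u < 0" using cv[OF ab(1) mem(1)] m' by simp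
    have t: "ori u a x < 0" using nz[OF mem(1) m'(1)] m' ab(3) by force
    have "ori x u a = ori u a x" "ori x u b = ori u b x" by (simp_all add: ori_def algebra_simps)
    then have "ori x u a * ori x u b < 0" using t ab(4) by (simp add: mult_neg_pos)
    then have "\<not> ori a b x * ori a b u < 0" using nc[OF ab(1) mem(1)] unfolding crosses_def by simp
    then have s: "ori a b x < 0" using o nz[OF m'(1,2) \<open>a \<noteq> b\<close>] by (force simp: mult_less_0_iff)
    have "ori u a b = ori a b u" "ori b u x = - ori u b x" by (simp_all add: ori_def algebra_simps)
    then have "in_triangle u a b x" unfolding in_triangle_def using o t s ab(4) by (simp add: mult_neg_neg mult_neg_pos)
    then show False using ni mem m' by blast
  qed
  have B: "ori (last M) z x > 0"
  proof (rule ccontr)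
    assume n: "\<not> ?thesis"
    have "hd (u # M) = u" by simp
    have sub: "(a, b) \<in> set (path_edges (u # M)) \<Longrightarrow> (a, b) \<in> set (path_edges K)" for a b
      unfolding pK by simp
    have "last M \<in> set (u # M)" using K(2) by simp
    from pe_switch[of "\<lambda>y. ori y z x > 0" "u # M", OF _ this n] h
    obtain a b where ab: "(a, b) \<in> set (path_edges K)" "(a, b) \<in> set (path_edges (u # M))" "ori a z x > 0" "\<not> ori b z x > 0"
      using sub by auto
    have m: "a \<in> set (u # M)" "b \<in> set (u # M)" using pe_mem[OF ab(2)] by auto
    then have m': "a \<in> set K" "b \<in> set K" "a \<noteq> z" "b \<noteq> z" using K d by auto
    have "a \<noteq> b" using pe_neq[OF d ab(1)] .
    have o: "ori a b z < 0" using cv[OF ab(1) mem(2)] m' by simp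
    have t: "ori b z x < 0" using nz[OF m'(2) mem(2)] m' ab(4) by force
    have "ori x z a = - ori a z x" "ori x z b = - ori b z x" by (simp_all add: ori_def algebra_simps)
    then have "ori x z a * ori x z b < 0" using t ab(3) by (simp add: mult_pos_neg)
    then have "\<not> ori a b x * ori a b z < 0" using nc[OF ab(1) mem(2)] unfolding crosses_def by simp
    then have s: "ori a b x < 0" using o nz[OF m'(1,2) \<open>a \<noteq> b\<close>] by (force simp: mult_less_0_iff)
    have "ori z a x = - ori a z x" by (simp add: ori_def algebra_simps)
    then have "in_triangle a b z x" unfolding in_triangle_def using o t s ab(3) by (simp add: mult_neg_neg mult_neg_pos)
    then show False using ni mem m' by blast
  qed
  show ?thesis
  proof (cases "p = u")
    case True
    have "distinct (u # M @ [z])" using d K by simp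
    then have "q = hd M" using e True K(2) unfolding K(1) by (cases M) (auto dest: pe_mem)
    then show ?thesis using A True by simp
  next
    case False
    have "p \<noteq> last K" using pe_last_notfst[OF d e] .
    then have pz: "p \<noteq> z" using K by simp
    have pK: "p \<in> set K" "q \<in> set K" using pe_mem[OF e] by auto
    then have pM: "p \<in> set M" using K False pz by auto
    have qu: "q \<noteq> u" using pe_hd_notsnd[OF d e] K by simp
    have su: "subseq [u, p, z] K" unfolding K(1) using pM
      by (simp add: subseq_singleton_left) (metis append_Cons append_Nil list_emb_append_mono subseq_order.refl subseq_singleton_left)
    have t: "ori u p z < 0" by (rule convex_triples[OF d _ su]) (rule cv)
    have 1: "ori u p x > 0"
    proof -
      have "ori u p x * ori u (hd M) z = ori u p u * ori x (hd M) z + ori u p (hd M) * ori u x z + ori u p z * ori u (hd M) x"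
        by (rule aff_bary) simp
      moreover have "ori u p (hd M) \<ge> 0"
      proof (cases "p = hd M")
        case False
        then have "ori u (hd M) p < 0" using cv[OF first pK(1)] \<open>p \<noteq> u\<close> by simp
        then show ?thesis using ori_swap2[of u p "hd M"] by simp
      qed simp
      moreover have "ori u x z < 0" using h ori_swap2[of u x z] by simp
      moreover have o: "ori u (hd M) z < 0" using cv[OF first mem(2)] ne by simp
      ultimately have "ori u p x * ori u (hd M) z < 0"
        using t A mult_neg_pos[of "ori u p z" "ori u (hd M) x"] mult_nonneg_nonpos[of "ori u p (hd M)" "ori u x z"] by simp
      then show ?thesis using o by (simp add: mult_less_0_iff)
    qed
    have 2: "ori p z x > 0"
    proof -
      have "ori p z x * ori u (last M) z = ori p z u * ori x (last M) z + ori p z (last M) * ori u x z + ori p z z * ori u (last M) x"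
        by (rule aff_bary) simp
      moreover have "ori p z (last M) \<ge> 0"
      proof (cases "p = last M")
        case False
        then have "ori (last M) z p < 0" using cv[OF lst pK(1)] pz by simp
        then show ?thesis using ori_swap3[of p z "last M"] ori_rot[of z "last M" p] ori_swap[of z "last M" p] by simp
      qed simp
      moreover have "ori u x z < 0" using h ori_swap2[of u x z] by simp
      moreover have o: "ori u (last M) z < 0" using cv[OF lst mem(1)] ne ori_rot[of "last M" z u] by simp
      moreover have "ori x (last M) z > 0" using B ori_rot[of "last M" z x] by simp
      moreover have "ori p z u < 0" using t ori_rot[of p z u] by simp
      ultimately have "ori p z x * ori u (last M) z < 0"
        using mult_neg_pos[of "ori p z u" "ori x (last M) z"] mult_nonneg_nonpos[of "ori p z (last M)" "ori u x z"] by simp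
      then show ?thesis using o by (simp add: mult_less_0_iff)
    qed
    have "ori p q x * ori u p z = ori p q u * ori x p z + ori p q p * ori u x z + ori p q z * ori u p x"
      by (rule aff_bary) simp
    moreover have "ori p q u < 0" using cv[OF e mem(1)] False qu by simp
    moreover have "ori x p z > 0" using 2 ori_rot[of p z x] by simp
    moreover have "ori p q z \<le> 0" using cv[OF e mem(2)] pz by (cases "z = q") auto
    ultimately have "ori p q x * ori u p z < 0"
      using 1 mult_neg_pos[of "ori p q u" "ori x p z"] mult_nonpos_nonneg[of "ori p q z" "ori u p x"] by simp
    then show ?thesis using t by (simp add: mult_less_0_iff)
  qed
qed

text \<open>The generalized double circle normalised to a counterclockwise hull. Unavoidability
  enters as \<open>unav\<close>: no segment between two of the points crosses the closed
  chain.\<close>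

locale crown = hull_data +
  fixes A :: "nat \<Rightarrow> point list"
  assumes AI: "(\<Union>i<n. set (A i)) = I"
    and dist: "distinct (concat (map (\<lambda>i. Q i # A i) [0..<n]))"
    and conv: "\<And>i a b x. i < n \<Longrightarrow> (a, b) \<in> set (path_edges (Q i # A i @ [Q (Suc i)])) \<Longrightarrow>
      x \<in> set (Q i # A i @ [Q (Suc i)]) \<Longrightarrow> x \<noteq> a \<Longrightarrow> x \<noteq> b \<Longrightarrow> ori a b x < 0"
    and unav: "\<And>a b x y. (a, b) \<in> set (cycle_edges (concat (map (\<lambda>i. Q i # A i) [0..<n]))) \<Longrightarrow> x \<in> V \<Longrightarrow> y \<in> V \<Longrightarrow> \<not> crosses a b x y"
begin

definition K where "K i = Q i # A i @ [Q (Suc i)]"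

definition L where "L = concat (map (\<lambda>i. Q i # A i) [0..<n])"

lemma set_L: "set L = V"
  unfolding L_def V_def using AI by auto

lemma ce_L: "(a, b) \<in> set (cycle_edges L) \<longleftrightarrow> (\<exists>i<n. (a, b) \<in> set (path_edges (K i)))"
  unfolding L_def ce_cycle K_def by auto

lemma A_sub: "i < n \<Longrightarrow> x \<in> set (A i) \<Longrightarrow> x \<in> I"
  using AI by auto

lemma K_V: "i < n \<Longrightarrow> x \<in> set (K i) \<Longrightarrow> x \<in> V"
  using A_sub IV unfolding K_def by auto

lemma blocks: "i < n \<Longrightarrow> distinct (Q i # A i)" "i < n \<Longrightarrow> j < n \<Longrightarrow> i \<noteq> j \<Longrightarrow> set (A i) \<inter> set (A j) = {}"
proof -
  have d: "\<forall>ys\<in>set (map (\<lambda>i. Q i # A i) [0..<n]). distinct ys"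
    "\<forall>ys zs. ys \<in> set (map (\<lambda>i. Q i # A i) [0..<n]) \<and> zs \<in> set (map (\<lambda>i. Q i # A i) [0..<n]) \<and> ys \<noteq> zs \<longrightarrow> set ys \<inter> set zs = {}"
    using dist unfolding distinct_concat_iff by auto
  show "i < n \<Longrightarrow> distinct (Q i # A i)" using d(1) by auto
  assume i: "i < n" "j < n" "i \<noteq> j"
  then have "Q i # A i \<noteq> Q j # A j" using Q_eq by simp
  moreover have "Q i # A i \<in> set (map (\<lambda>i. Q i # A i) [0..<n])" "Q j # A j \<in> set (map (\<lambda>i. Q i # A i) [0..<n])" using i by auto
  ultimately have "set (Q i # A i) \<inter> set (Q j # A j) = {}" using d(2) by blast
  then show "set (A i) \<inter> set (A j) = {}" by auto
qed

lemma K_distinct: "i < n \<Longrightarrow> distinct (K i)"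
  using blocks(1)[of i] QS_ne[of i] A_sub[of i] inner_ne[of _ i] unfolding K_def by auto

lemma K_conv: "i < n \<Longrightarrow> (a, b) \<in> set (path_edges (K i)) \<Longrightarrow> x \<in> set (K i) \<Longrightarrow> x \<noteq> a \<Longrightarrow> x \<noteq> b \<Longrightarrow> ori a b x < 0"
  unfolding K_def by (rule conv)

lemma K_uncrossed: "i < n \<Longrightarrow> (a, b) \<in> set (path_edges (K i)) \<Longrightarrow> x \<in> V \<Longrightarrow> y \<in> V \<Longrightarrow> \<not> crosses a b x y"
  using unav[folded L_def] ce_L by blast

lemma hull_not_inside:
  assumes k: "k < n" and V: "a \<in> V" "b \<in> V" "c \<in> V" and i: "in_triangle a b c (Q k)" shows False
proof -
  let ?f = "\<lambda>x. -1 * ori (Q k) (Q (Suc k)) x + 0 * ori (Q k) (Q (Suc k)) x"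
  have d: "a \<noteq> b \<and> b \<noteq> c \<and> a \<noteq> c" by (rule intri_distinct[OF i])
  have f: "?f x = - edge_dist k x" for x unfolding edge_dist_def by simp
  have "?f (Q k) < 0"
  proof (rule intri_aff_neg[where f = ?f, OF _ i])
    show "affine_fun ?f" by (rule aff_comb) auto
    show "?f a \<le> 0" "?f b \<le> 0" "?f c \<le> 0" unfolding f using dd_nonneg[OF k] V by auto
    have "(a \<noteq> Q k \<and> a \<noteq> Q (Suc k)) \<or> (b \<noteq> Q k \<and> b \<noteq> Q (Suc k)) \<or> (c \<noteq> Q k \<and> c \<noteq> Q (Suc k))" using d by metis
    then show "?f a < 0 \<or> ?f b < 0 \<or> ?f c < 0" unfolding f using dd_pos[OF k] V by auto
  qed
  then show False by simp
qed

lemma K_visible_aux: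
  assumes i: "i < n" and x: "x \<in> V" "x \<notin> set (K i)"
    and ni: "\<And>a b c. a \<in> set (K i) \<Longrightarrow> b \<in> set (K i) \<Longrightarrow> c \<in> set (K i) \<Longrightarrow> \<not> in_triangle a b c x"
    and e: "(p, q) \<in> set (path_edges (K i))"
  shows "ori p q x > 0"
proof -
  have h: "ori (Q i) (Q (Suc i)) x > 0" using dd_pos[OF i x(1)] x(2) unfolding edge_dist_def K_def by auto
  show ?thesis
  proof (cases "A i = []")
    case True then show ?thesis using e h unfolding K_def by simp
  next
    case False
    show ?thesis
    proof (rule chain_visible[OF K_def False K_distinct[OF i] _ x(2) _ h _ _ e])
      show "ori a b y < 0" if "(a, b) \<in> set (path_edges (K i))" "y \<in> set (K i)" "y \<noteq> a" "y \<noteq> b" for a b y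
        by (rule K_conv[OF i that])
      show "gen_pos (insert x (set (K i)))" by (rule gp_subset[OF gpV]) (use x K_V[OF i] in auto)
      show "\<not> crosses a b x y" if "(a, b) \<in> set (path_edges (K i))" "y \<in> set (K i)" for a b y
        by (rule K_uncrossed[OF i that(1) x(1) K_V[OF i that(2)]])
      show "\<not> in_triangle a b c x" if "a \<in> set (K i)" "b \<in> set (K i)" "c \<in> set (K i)" for a b c by (rule ni[OF that])
    qed
  qed
qed

text \<open>It remains to exclude that \<open>x\<close> lies in a triangle of chain points. A hull
  vertex \<open>w\<close> off the chain sees all chain edges from the left and sees \<open>x\<close>
  in the angle between the ends of the chain, so the segment \<open>w x\<close> would cross a chain
  edge.\<close>

lemma K_visible:
  assumes i: "i < n" and x: "x \<in> V" "x \<notin> set (K i)" and e: "(p, q) \<in> set (path_edges (K i))"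
  shows "ori p q x > 0"
proof (rule K_visible_aux[OF i x _ e], rule notI)
  fix a b c assume abc: "a \<in> set (K i)" "b \<in> set (K i)" "c \<in> set (K i)" and t: "in_triangle a b c x"
  \<comment> \<open>Since there are at least three hull vertices, the one two steps after
    \<open>Q i\<close> is no end of chain \<open>i\<close>.\<close>
  let ?k = "next_idx (next_idx i)"
  define w where "w = Q ?k"
  have k: "?k < n" "?k \<noteq> i" "?k \<noteq> next_idx i" using next_idx i by auto
  have w: "w \<in> V" "w \<notin> set (K i)"
    unfolding w_def K_def using k i Q_eq next_idx(1)[OF i] next_idx(2)[of i] A_sub[OF i] QI by auto
  have ve: "ori a b w > 0" if "(a, b) \<in> set (path_edges (K i))" for a b
    by (rule K_visible_aux[OF i w _ that]) (use hull_not_inside[OF k(1)] K_V[OF i] in \<open>auto simp: w_def\<close>)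
  have chord: "ori a b w > 0" if "subseq [a, b] (K i)" for a b
    by (rule chain_chord[OF K_conv[OF i] ve K_distinct[OF i] that])
  have d: "a \<noteq> b \<and> b \<noteq> c \<and> a \<noteq> c" by (rule intri_distinct[OF t])
  have f1: "ori w (Q i) y > 0" if y: "y \<in> set (K i)" "y \<noteq> Q i" for y
  proof -
    have "subseq [Q i, y] (K i)" using y unfolding K_def by (simp add: subseq_singleton_left)
    then have "ori (Q i) y w > 0" by (rule chord)
    then show ?thesis unfolding ori_rot[of "Q i" y w] .
  qed
  have f2: "ori w (Q (Suc i)) y < 0" if y: "y \<in> set (K i)" "y \<noteq> Q (Suc i)" for y
  proof -
    have "y \<in> set (Q i # A i)" using y unfolding K_def by auto
    then have "subseq ([y] @ [Q (Suc i)]) ((Q i # A i) @ [Q (Suc i)])"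
      by (intro list_emb_append_mono) (simp_all only: subseq_singleton_left, simp)
    then have "ori y (Q (Suc i)) w > 0" by (intro chord) (simp add: K_def)
    then show ?thesis using ori_swap3[of w "Q (Suc i)" y] by simp
  qed
  have F1: "ori w (Q i) x > 0"
  proof -
    let ?f = "\<lambda>x. -1 * ori w (Q i) x + 0 * ori w (Q i) x"
    have n: "?f y \<le> 0" if "y \<in> set (K i)" for y using f1[OF that] by (cases "y = Q i") auto
    have m: "?f a < 0 \<or> ?f b < 0" using f1 abc d by auto
    have "?f x < 0"
    proof (rule intri_aff_neg[where f = ?f, OF _ t])
      show "affine_fun ?f" by (rule aff_comb) auto
    qed (use n abc m in auto)
    then show ?thesis by simp
  qed
  have F2: "ori w (Q (Suc i)) x < 0"
  proof -
    have n: "ori w (Q (Suc i)) y \<le> 0" if "y \<in> set (K i)" for y using f2[OF that] by (cases "y = Q (Suc i)") auto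
    have m: "ori w (Q (Suc i)) a < 0 \<or> ori w (Q (Suc i)) b < 0" using f2 abc d by metis
    show ?thesis by (rule intri_aff_neg[where f = "ori w (Q (Suc i))", OF aff_ori t]) (use n abc m in auto)
  qed
  have "Q (Suc i) \<in> set (K i)" "hd (K i) = Q i" unfolding K_def by auto
  then obtain u v where uv: "(u, v) \<in> set (path_edges (K i))" "ori w u x > 0" "\<not> ori w v x > 0"
    using pe_switch[of "\<lambda>y. ori w y x > 0" "K i" "Q (Suc i)"] F1 F2 by auto
  have m: "u \<in> set (K i)" "v \<in> set (K i)" using pe_mem[OF uv(1)] by auto
  have un: "u \<noteq> v" by (rule pe_neq[OF K_distinct[OF i] uv(1)])
  have "w \<noteq> x" using F1 by auto
  then have "ori w v x < 0" using uv(3) gpD[OF gpV w(1) K_V[OF i m(2)] x(1)] m w x by force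
  moreover have "ori u v x < 0"
  proof (rule intri_aff_neg[where f = "ori u v", OF aff_ori t])
    have n: "ori u v y \<le> 0" if "y \<in> set (K i)" for y using K_conv[OF i uv(1) that] by (cases "y = u \<or> y = v") auto
    then show "ori u v a \<le> 0" "ori u v b \<le> 0" "ori u v c \<le> 0" using abc by auto
    have "(a \<noteq> u \<and> a \<noteq> v) \<or> (b \<noteq> u \<and> b \<noteq> v) \<or> (c \<noteq> u \<and> c \<noteq> v)" using d by metis
    then show "ori u v a < 0 \<or> ori u v b < 0 \<or> ori u v c < 0" using K_conv[OF i uv(1)] abc by metis
  qed
  moreover have "ori u v w > 0" by (rule ve[OF uv(1)])
  moreover have "ori w x u = - ori w u x" "ori w x v = - ori w v x" by (simp_all add: ori_def algebra_simps)
  ultimately have "crosses u v w x" unfolding crosses_def using uv(2) by (simp add: mult_pos_neg mult_neg_pos)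
  then show False using K_uncrossed[OF i uv(1) w(1) x(1)] by blast
qed

lemma K_chord:
  assumes "i < n" "x \<in> V" "x \<notin> set (K i)" "subseq [a, b] (K i)"
  shows "ori a b x > 0"
  using K_conv[OF assms(1)] K_visible[OF assms(1-3)] by (rule chain_chord[OF _ _ K_distinct[OF assms(1)] assms(4)])

end

section \<open>Orientation of triples along the closed chain\<close>

lemma subseq_skip: "subseq (c # r) (xs @ ys) \<Longrightarrow> c \<notin> set xs \<Longrightarrow> subseq (c # r) ys"
  by (induction xs) (auto simp: subseq_Cons2_neq)

lemma pe_const: "(\<And>y y'. (y, y') \<in> set (path_edges l) \<Longrightarrow> P y \<longleftrightarrow> P y') \<Longrightarrow> z \<in> set l \<Longrightarrow> P z \<longleftrightarrow> P (hd l)"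
  by (induction l rule: path_edges.induct) auto

context crown
begin

definition rotation_of_L where "rotation_of_L M \<longleftrightarrow> (\<exists>xs ys. L = xs @ ys \<and> M = ys @ xs)"

lemma rotn_L: "rotation_of_L M \<Longrightarrow> distinct M \<and> set M = V \<and> set (cycle_edges M) = set (cycle_edges L) \<and> (cyclic_subseq M a b c \<longleftrightarrow> cyclic_subseq L a b c)"
proof -
  assume "rotation_of_L M"
  then obtain xs ys where L: "L = xs @ ys" and M: "M = ys @ xs" unfolding rotation_of_L_def by blast
  have d: "distinct L" using dist unfolding L_def .
  have "distinct M" using d unfolding L M by auto
  moreover have "set M = V" using set_L unfolding L M by auto
  moreover have "set (cycle_edges M) = set (cycle_edges L)" unfolding L M by (rule ce_rotate)
  moreover have "cyclic_subseq M a b c \<longleftrightarrow> cyclic_subseq L a b c" unfolding L M using cseq_rotate by metis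
  ultimately show ?thesis by blast
qed

lemma rotn_Cons: "rotation_of_L (x # r) \<Longrightarrow> rotation_of_L (r @ [x])"
proof -
  assume "rotation_of_L (x # r)"
  then obtain xs ys where L: "L = xs @ ys" and M: "x # r = ys @ xs" unfolding rotation_of_L_def by blast
  show ?thesis
  proof (cases ys)
    case Nil
    then have "L = [x] @ r" using L M by simp
    then show ?thesis unfolding rotation_of_L_def by blast
  next
    case (Cons y ys')
    then have "L = (xs @ [x]) @ ys'" "r @ [x] = ys' @ (xs @ [x])" using L M by auto
    then show ?thesis unfolding rotation_of_L_def by blast
  qed
qed

lemma K_prefix: "i < n \<Longrightarrow> \<exists>r. rotation_of_L (K i @ r)"
proof -
  assume i: "i < n"
  define f where "f i = Q i # A i" for i
  have "[0..<n] = [0..<i] @ i # [Suc i..<n]" using upt_add_eq_append[of 0 i "n - i"] upt_conv_Cons[OF i] i by simp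
  then have L: "L = concat (map f [0..<i]) @ f i @ concat (map f [Suc i..<n])" unfolding L_def f_def by simp
  show ?thesis
  proof (cases "Suc i < n")
    case True
    then have "f i @ concat (map f [Suc i..<n]) = K i @ A (Suc i) @ concat (map f [Suc (Suc i)..<n])"
      unfolding f_def K_def by (simp add: upt_conv_Cons)
    then have "L = concat (map f [0..<i]) @ K i @ A (Suc i) @ concat (map f [Suc (Suc i)..<n])" using L by simp
    then show ?thesis unfolding rotation_of_L_def by (metis append.assoc)
  next
    case False
    then have n: "Suc i = n" using i by simp
    then have "0 < i" using n3 by simp
    then have "concat (map f [0..<i]) = Q (Suc i) # A 0 @ concat (map f [Suc 0..<i])"
      unfolding f_def n per by (simp add: upt_conv_Cons)
    then have "f i @ concat (map f [0..<i]) = K i @ A 0 @ concat (map f [Suc 0..<i])" unfolding f_def K_def by simp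
    moreover have "L = concat (map f [0..<i]) @ f i" using L n by simp
    ultimately show ?thesis unfolding rotation_of_L_def by metis
  qed
qed

text \<open>In a rotation of the cycle with chain \<open>i\<close> as a prefix, \<open>c\<close>
  comes after the chain, so the cyclic order of the triple becomes the linear order of
  \<open>a\<close> and \<open>b\<close>.\<close>

lemma K_order:
  assumes i: "i < n" and c: "cyclic_subseq L a b c" and m: "a \<in> set (K i)" "b \<in> set (K i)" "c \<notin> set (K i)"
  shows "subseq [a, b] (K i)"
proof -
  obtain r where r: "rotation_of_L (K i @ r)" using K_prefix[OF i] by blast
  have d: "distinct (K i @ r)" and C: "cyclic_subseq (K i @ r) a b c" using rotn_L[OF r] c by auto
  have nr: "a \<notin> set r" using d m by auto
  have no: "\<not> subseq [c, a] (K i @ r)"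
  proof
    assume "subseq [c, a] (K i @ r)"
    then have "subseq [c, a] r" using m(3) by (rule subseq_skip)
    then show False using subseq_mem[of "[c, a]" r a] nr by simp
  qed
  have "subseq [c, a] [b, c, a]" "subseq [c, a] [c, a, b]" by simp_all
  then have "subseq [a, b, c] (K i @ r)" using C no subseq_order.trans unfolding cyclic_subseq_def by blast
  then have "subseq (filter (\<lambda>x. x \<in> set (K i)) [a, b, c]) (filter (\<lambda>x. x \<in> set (K i)) (K i @ r))" by (rule subseq_filter)
  moreover have "filter (\<lambda>x. x \<in> set (K i)) r = []" using d by (auto simp: filter_empty_conv)
  ultimately show ?thesis using m by simp
qed

lemma two_in_chain:
  assumes c: "cyclic_subseq L a b c" and i: "i < n" "a \<in> set (K i)" "b \<in> set (K i)" and ns: "\<not> (\<exists>i<n. {a, b, c} \<subseteq> set (K i))"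
  shows "ori a b c > 0"
proof -
  have ci: "c \<notin> set (K i)" using ns i by blast
  have "c \<in> V" using cseq_mem[OF c] set_L by blast
  then show ?thesis using K_chord[OF i(1) _ ci K_order[OF i(1) c i(2,3) ci]] by blast
qed

text \<open>Different chains share only hull vertices, so an arc of the cycle without inner hull
  vertices stays in the chain in which it starts.\<close>

lemma hullfree_arc:
  assumes "i < n" "set (path_edges (b # ws @ [a])) \<subseteq> set (cycle_edges L)" "set ws \<subseteq> I" "(b, hd (ws @ [a])) \<in> set (path_edges (K i))"
  shows "a \<in> set (K i)"
  using assms(2-)
proof (induction ws arbitrary: b)
  case Nil then show ?case by (auto dest: pe_mem)
next
  case (Cons y ws)
  have "(y, hd (ws @ [a])) \<in> set (cycle_edges L)" using Cons.prems(1) by (cases ws) auto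
  then obtain j where j: "j < n" "(y, hd (ws @ [a])) \<in> set (path_edges (K j))" using ce_L by blast
  have yI: "y \<in> I" using Cons.prems(2) by simp
  have "y \<in> set (K j)" "y \<in> set (K i)" using pe_mem[OF j(2)] pe_mem[OF Cons.prems(3)] by auto
  then have "y \<in> set (A j)" "y \<in> set (A i)" using inner_ne[OF yI] j(1) assms(1) unfolding K_def by auto
  then have "j = i" using blocks(2)[OF j(1) assms(1)] by blast
  then have e: "(y, hd (ws @ [a])) \<in> set (path_edges (K i))" using j(2) by simp
  have "set (path_edges (y # ws @ [a])) \<subseteq> set (cycle_edges L)" "set ws \<subseteq> I" using Cons.prems by auto
  then show ?case using e by (rule Cons.IH)
qed

text \<open>
  If \<open>ori a b c\<close> were negative, then \<open>c\<close> would lie in the triangle spanned by \<open>a\<close>, its successor and \<open>b\<close>.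
  The cycle cannot leave this triangle on the arc from \<open>b\<close> to \<open>a\<close>, although that arc contains a hull vertex.
\<close>

lemma rotation_pos:
  assumes "rotation_of_L (a # us @ b # ws @ c # zs)" "\<not> (\<exists>i<n. {a, b, c} \<subseteq> set (K i))"
  shows "ori a b c > 0"
  using assms
proof (induction us arbitrary: a zs)
  case Nil
  note R = rotn_L[OF Nil.prems(1)]
  have "(a, b) \<in> set (cycle_edges (a # [] @ b # ws @ c # zs))" unfolding cycle_edges_def by simp
  then have "(a, b) \<in> set (cycle_edges L)" using R by blast
  then obtain i where i: "i < n" "(a, b) \<in> set (path_edges (K i))" using ce_L by blast
  have "subseq [b, c] (b # ws @ c # zs)" by (simp add: subseq_singleton_left)
  then have "cyclic_subseq (a # [] @ b # ws @ c # zs) a b c" unfolding cyclic_subseq_def by simp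
  then show ?case using two_in_chain[of a b c i] R Nil.prems(2) i pe_mem[OF i(2)] by blast
next
  case (Cons x us)
  let ?M = "a # (x # us) @ b # ws @ c # zs"
  let ?W = "ws @ c # zs"
  note R = rotn_L[OF Cons.prems(1)]
  have sM: "set ?M = V" using R by blast
  have V: "a \<in> V" "b \<in> V" "c \<in> V" "x \<in> V" unfolding sM[symmetric] by auto
  have d: "distinct ?M" using R by blast
  have "subseq [b, c] (us @ b # ws @ c # zs)"
    by (rule list_emb_append2) (simp add: subseq_singleton_left)
  then have "subseq [b, c] ((x # us) @ b # ws @ c # zs)" by (simp only: append_Cons list_emb_Cons)
  then have "subseq [a, b, c] ?M" unfolding subseq_Cons2_iff by simp
  then have "cyclic_subseq ?M a b c" unfolding cyclic_subseq_def by blast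
  then have C: "cyclic_subseq L a b c" using R by blast
  show ?case
  proof (rule ccontr)
    assume neg: "\<not> ori a b c > 0"
    have n1: "\<not> (\<exists>i<n. a \<in> set (K i) \<and> b \<in> set (K i))" using two_in_chain[OF C _ _ _ Cons.prems(2)] neg by blast
    have n2: "\<not> (\<exists>i<n. b \<in> set (K i) \<and> c \<in> set (K i))"
    proof
      assume "\<exists>i<n. b \<in> set (K i) \<and> c \<in> set (K i)"
      then obtain i where i: "i < n" "b \<in> set (K i)" "c \<in> set (K i)" by blast
      have "ori b c a > 0" by (rule two_in_chain[OF cseq_rot[OF C] i]) (use Cons.prems(2) in blast)
      then show False using neg ori_rot[of b c a] by simp
    qed
    have n3: "\<not> (\<exists>i<n. c \<in> set (K i) \<and> a \<in> set (K i))"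
    proof
      assume "\<exists>i<n. c \<in> set (K i) \<and> a \<in> set (K i)"
      then obtain i where i: "i < n" "c \<in> set (K i)" "a \<in> set (K i)" by blast
      have "ori c a b > 0" by (rule two_in_chain[OF cseq_rot[OF cseq_rot[OF C]] i]) (use Cons.prems(2) in blast)
      then show False using neg ori_rot2[of c a b] by simp
    qed
    have "(a, x) \<in> set (cycle_edges ?M)" unfolding cycle_edges_def by simp
    then have "(a, x) \<in> set (cycle_edges L)" using R by blast
    then obtain i where i: "i < n" "(a, x) \<in> set (path_edges (K i))" using ce_L by blast
    have "a \<in> set (K i)" using pe_mem[OF i(2)] by blast
    then have nb: "b \<notin> set (K i)" and nc: "c \<notin> set (K i)" using n1 n3 i(1) by blast+
    have o: "ori a x b > 0" "ori a x c > 0" using K_visible[OF i(1) V(2) nb i(2)] K_visible[OF i(1) V(3) nc i(2)] by auto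
    \<comment> \<open>Moving \<open>a\<close> to the end makes \<open>x\<close> the head and
      shortens the arc before \<open>b\<close>, as the induction requires. The triple
      \<open>x\<close>, \<open>b\<close>, \<open>c\<close> lies in no chain because \<open>b\<close>
      and \<open>c\<close> share none.\<close>
    have "rotation_of_L (x # us @ b # ws @ c # (zs @ [a]))" using rotn_Cons[OF Cons.prems(1)] by simp
    then have "ori x b c > 0" by (rule Cons.IH) (use n2 in blast)
    moreover have "ori a b c < 0" using neg gpD[OF gpV V(1-3)] d by force
    ultimately have tc: "in_triangle a x b c" unfolding in_triangle_def using o ori_swap[of b a c] by (simp add: mult_pos_neg)
    have eM: "set (path_edges (b # ?W @ [a])) \<subseteq> set (cycle_edges L)"
    proof -
      have "path_edges (((a # x # us) @ b # ?W) @ [a]) = path_edges ((a # x # us) @ [b]) @ path_edges (b # ?W @ [a])"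
        using pe_append[of "a # x # us" b "?W @ [a]"] by simp
      then have "set (path_edges (b # ?W @ [a])) \<subseteq> set (cycle_edges ?M)" unfolding cycle_edges_def by auto
      then show ?thesis using R by blast
    qed
    have "\<exists>h\<in>set ?W. h \<notin> I"
    proof (rule ccontr)
      assume "\<not> ?thesis"
      then have WI: "set ?W \<subseteq> I" by blast
      have "(b, hd (?W @ [a])) \<in> set (path_edges (b # ?W @ [a]))" by (cases ws) auto
      then obtain j where j: "j < n" "(b, hd (?W @ [a])) \<in> set (path_edges (K j))" using eM ce_L by blast
      have "a \<in> set (K j)" by (rule hullfree_arc[OF j(1) eM WI j(2)])
      then show False using n1 j pe_mem[OF j(2)] by blast
    qed
    then obtain h where h: "h \<in> set ?W" "h \<notin> I" by blast
    have WV: "set ?W \<subseteq> V" unfolding sM[symmetric] by auto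
    have step: "in_triangle a x b y'" if y: "in_triangle a x b y" and e: "(y, y') \<in> set (cycle_edges L) \<or> (y', y) \<in> set (cycle_edges L)"
      and W: "y \<in> set ?W" "y' \<in> set ?W" "y \<noteq> y'" for y y'
    proof (rule tri_exit[OF o(1) y gpV])
      show "{a, x, b, y, y'} \<subseteq> V" using V WV W by auto
      show "y' \<notin> {a, x, b}" using W d by auto
      have nX: "\<not> crosses y y' p q" if "p \<in> V" "q \<in> V" for p q
        using e unav[of y y' p q, folded L_def] unav[of y' y p q, folded L_def] that crs_swap(1)[of y' y p q] by blast
      show "\<not> crosses y y' a x" "\<not> crosses y y' x b" "\<not> crosses y y' b a" using nX V by blast+
    qed (use W in auto)
    have eq: "in_triangle a x b y \<longleftrightarrow> in_triangle a x b y'" if e: "(y, y') \<in> set (path_edges ?W)" for y y'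
    proof -
      have W: "y \<in> set ?W" "y' \<in> set ?W" using pe_mem[OF e] by auto
      have dW: "distinct ?W" using d by simp
      have ne: "y \<noteq> y'" by (rule pe_neq[OF dW e])
      have "path_edges (?W @ [a]) = path_edges ?W @ path_edges [last ?W, a]"
        using pe_append[of "butlast ?W" "last ?W" "[a]"] append_butlast_last_id[of ?W] by (metis append.assoc append_Cons append_Nil append_is_Nil_conv list.distinct(1))
      moreover have "set (path_edges (?W @ [a])) \<subseteq> set (path_edges (b # ?W @ [a]))" by (cases ws) auto
      ultimately have "(y, y') \<in> set (path_edges (b # ?W @ [a]))" using e by auto
      then have "(y, y') \<in> set (cycle_edges L)" using eM by blast
      then show ?thesis using step[of y y'] step[of y' y] W ne by blast
    qed
    have "in_triangle a x b h \<longleftrightarrow> in_triangle a x b (hd ?W)" by (rule pe_const[OF eq h(1)])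
    moreover have "in_triangle a x b c \<longleftrightarrow> in_triangle a x b (hd ?W)" by (rule pe_const[OF eq]) auto
    ultimately have ih: "in_triangle a x b h" using tc by blast
    obtain k where "k < n" "h = Q k" using h WV unfolding V_def by auto
    then show False using hull_not_inside[of k a x b] V ih by blast
  qed
qed

theorem cycle_pos:
  assumes c: "cyclic_subseq L a b c" and ns: "\<not> (\<exists>i<n. {a, b, c} \<subseteq> set (K i))"
  shows "ori a b c > 0"
proof -
  have "a \<in> set L" using cseq_mem[OF c] by blast
  then obtain p s where L: "L = p @ a # s" by (meson split_list)
  define r where "r = s @ p"
  have rot: "rotation_of_L (a # r)" unfolding rotation_of_L_def r_def using L by (metis append_Cons)
  note R = rotn_L[OF rot]
  have nr: "a \<notin> set r" using R by simp
  have no: "\<not> subseq l r" if "a \<in> set l" for l using subseq_mem[of l r a] that nr by blast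
  have "cyclic_subseq (a # r) a b c" using R c by blast
  then have "subseq [b, c] r"
    unfolding cyclic_subseq_def
  proof (elim disjE)
    assume "subseq [a, b, c] (a # r)" then show ?thesis by simp
  next
    assume "subseq [b, c, a] (a # r)"
    then have "subseq [c, a] r" by (cases "b = a") (auto simp: subseq_Cons2_neq dest: subseq_Cons')
    then show ?thesis using no[of "[c, a]"] by simp
  next
    assume "subseq [c, a, b] (a # r)"
    then have "subseq [a, b] r" by (cases "c = a") (auto simp: subseq_Cons2_neq dest: subseq_Cons')
    then show ?thesis using no[of "[a, b]"] by simp
  qed
  then obtain us ws' where 1: "r = us @ b # ws'" "subseq [c] ws'" by (auto dest: list_emb_ConsD)
  then obtain ws zs where "ws' = ws @ c # zs" by (metis split_list subseq_singleton_left)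
  then show ?thesis using rotation_pos[of a us b ws c zs] rot ns 1 by simp
qed

theorem chain_pos:
  assumes i: "i < n" and c: "cyclic_subseq (K i) c b a" shows "ori a b c > 0"
proof -
  have t: "ori x y z < 0" if "subseq [x, y, z] (K i)" for x y z
    by (rule convex_triples[OF K_distinct[OF i] K_conv[OF i] that])
  show ?thesis using c t[of c b a] t[of b a c] t[of a c b] ori_swap3[of a b c] ori_swap[of b a c] ori_swap2[of a c b]
    unfolding cyclic_subseq_def by auto
qed

end

section \<open>Carrying a triangulation over\<close>

lemma pe_map: "path_edges (map f xs) = map (\<lambda>(a, b). (f a, f b)) (path_edges xs)"
  by (induction xs rule: path_edges.induct) simp_all

lemma ce_map: "xs \<noteq> [] \<Longrightarrow> cycle_edges (map f xs) = map (\<lambda>(a, b). (f a, f b)) (cycle_edges xs)"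
  using pe_map[of f "xs @ [hd xs]"] unfolding cycle_edges_def by (simp add: hd_map)

lemma cw_map: "cycle_weight w (map f xs) = cycle_weight (\<lambda>a b. w (f a) (f b)) xs" if ne: "xs \<noteq> []"
proof -
  have "(\<Sum>(a, b)\<leftarrow>map (\<lambda>(a, b). (f a, f b)) l. w a b) = (\<Sum>(a, b)\<leftarrow>l. w (f a) (f b))" for l
    by (induction l) auto
  then show ?thesis unfolding cycle_weight_def ce_map[OF ne] by blast
qed

lemma bd_map: "boundary (map (\<lambda>(a, b, c). (f a, f b, f c)) D) w = boundary D (\<lambda>a b. w (f a) (f b))"
  by (induction D) auto

lemma tr_map: "tile D a b c \<Longrightarrow> tile (map (\<lambda>(a, b, c). (f a, f b, f c)) D) (f a) (f b) (f c)"
  unfolding tile_def by force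

lemma cseq_map: "cyclic_subseq xs a b c \<Longrightarrow> cyclic_subseq (map f xs) (f a) (f b) (f c)"
  using subseq_map[of "[a, b, c]" xs f] subseq_map[of "[b, c, a]" xs f] subseq_map[of "[c, a, b]" xs f]
  unfolding cyclic_subseq_def by auto

lemma map_between: "distinct xs \<Longrightarrow> length xs = length ys \<Longrightarrow> \<exists>f. map f xs = ys"
proof (induction xs arbitrary: ys)
  case (Cons x xs)
  obtain y zs where y: "ys = y # zs" using Cons.prems(2) by (cases ys) auto
  obtain f where f: "map f xs = zs" using Cons.IH[of zs] Cons.prems y by auto
  have "map (f(x := y)) (x # xs) = ys" using f y Cons.prems(1) by simp
  then show ?case by blast
qed simp

lemma map_blocks:
  "(\<And>i. i < m \<Longrightarrow> length (a i) = length (b i)) \<Longrightarrow> map f (concat (map a [0..<m])) = concat (map b [0..<m]) \<Longrightarrow>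
    i < m \<Longrightarrow> map f (a i) = b i"
proof (induction m)
  case (Suc m)
  have "length (a m) = length (b m)" using Suc.prems(1) by simp
  then have "map f (concat (map a [0..<m])) = concat (map b [0..<m]) \<and> map f (a m) = b m"
    using Suc.prems(2) by simp
  then show ?case using Suc by (cases "i = m") auto
qed simp

lemma segs_iff: "closed_segment a b \<in> tile_edges D \<longleftrightarrow> (\<exists>c. tile D a b c \<or> tile D b a c)"
proof
  assume "closed_segment a b \<in> tile_edges D"
  then obtain x y c where "closed_segment a b = closed_segment x y" "tile D x y c" unfolding tile_edges_def by blast
  then show "\<exists>c. tile D a b c \<or> tile D b a c" by (auto simp: closed_segment_eq doubleton_eq_iff)
next
  assume "\<exists>c. tile D a b c \<or> tile D b a c"
  then show "closed_segment a b \<in> tile_edges D" unfolding tile_edges_def using closed_segment_commute by blast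
qed

text \<open>The two cycles have blocks of equal length, so \<open>g\<close> and its inverse
  \<open>h\<close> are defined by position. As \<open>g\<close> maps chain \<open>i\<close> onto
  \<open>W.S i\<close>, every triangle of \<open>E\<close> has a preimage to which
  \<open>cycle_pos\<close> or \<open>chain_pos\<close> applies, and which is therefore
  positive.\<close>

theorem (in crown) matching_triangulations:
  assumes W: "hull_data n W J" and cJ: "card J = (\<Sum>i<n. length (A i))"
  shows "\<exists>g TP TQ. bij_betw g V (W ` {..<n} \<union> J) \<and> (\<forall>i<n. g (Q i) = W i) \<and>
    compatible_triangulation V (W ` {..<n} \<union> J) g TP TQ"
proof -
  interpret W: hull_data n W J by (rule W)
  obtain k where k: "\<forall>x\<in>J. k x < n" "\<forall>i<n. card {x\<in>J. k x = i} = length (A i)"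
    "\<forall>x\<in>J. \<forall>y\<in>J. k x \<noteq> k y \<longrightarrow> W.edge_dist (k x) x * W.edge_dist (k y) y \<le> W.edge_dist (k x) y * W.edge_dist (k y) x"
    using W.classes_exist[of "\<lambda>i. length (A i)"] cJ by auto
  define C where "C i = {x\<in>J. k x = i}" for i
  interpret W: class_data n W J C
  proof
    show "(\<Union>i<n. C i) = J" using k(1) unfolding C_def by auto
    show "C i \<inter> C j = {}" if "i \<noteq> j" for i j using that unfolding C_def by auto
    show "W.edge_dist i x * W.edge_dist j y \<le> W.edge_dist i y * W.edge_dist j x" if "i \<noteq> j" "x \<in> C i" "y \<in> C j" for i j x y
      using k(3) that unfolding C_def by auto
  qed
  obtain bs where "\<And>i. i < n \<Longrightarrow> convex_chain (C i) (W i) (W (Suc i)) (bs i)" using W.chains_exist by blast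
  then interpret W: chain_data n W J C bs by unfold_locales
  obtain D where "fills W.frame D 1" using W.LF_fills by blast
  then interpret W: fill_data n W J C bs D by unfold_locales
  obtain p E where p: "\<forall>i<n. set (p i) = C i \<and> distinct (p i)"
    and dM: "distinct (concat (map (\<lambda>i. W i # p i) [0..<n]))"
    and sM: "set (concat (map (\<lambda>i. W i # p i) [0..<n])) = W.V"
    and cov: "covers W.V W.hull_list E"
    and E: "\<forall>a b c. (a, b, c) \<in> set E \<longrightarrow> cyclic_subseq (concat (map (\<lambda>i. W i # p i) [0..<n])) a b c \<and> (\<forall>i<n. \<not> {a, b, c} \<subseteq> W.S i) \<or>
      (\<exists>i<n. cyclic_subseq (W i # p i @ [W (Suc i)]) c b a)"
    and full: "\<forall>v\<in>W.V. \<exists>q r. tile E v q r"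
    using W.threaded_covering by (elim exE conjE) (rule that; assumption)
  define M where "M = concat (map (\<lambda>i. W i # p i) [0..<n])"
  have len: "length (Q i # A i) = length (W i # p i)" if "i < n" for i
    using p k(2) distinct_card[of "p i"] that unfolding C_def by simp
  have lm: "length (concat (map a [0..<m])) = length (concat (map b [0..<m]))"
    if "\<And>i. i < m \<Longrightarrow> length (a i) = length (b i)" for a b :: "nat \<Rightarrow> point list" and m
    using that by (induction m) simp_all
  have LM: "length L = length M" unfolding L_def M_def by (rule lm) (rule len)
  have dL: "distinct L" using dist unfolding L_def .
  obtain g where g: "map g L = M" using map_between[OF dL LM] by blast
  obtain h where h: "map h M = L" using map_between[OF dM[folded M_def] LM[symmetric]] by blast
  have hg: "h (g x) = x" if "x \<in> V" for x
  proof -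
    have m: "map (h \<circ> g) L = map id L" unfolding map_map[symmetric] g h by simp
    have "x \<in> set L" using that set_L by simp
    then show ?thesis using m unfolding map_eq_conv by simp
  qed
  have gh: "g (h x) = x" if "x \<in> W.V" for x
  proof -
    have m: "map (g \<circ> h) M = map id M" unfolding map_map[symmetric] g h by simp
    have "x \<in> set M" using that sM[folded M_def] by simp
    then show ?thesis using m unfolding map_eq_conv by simp
  qed
  have gi: "map g (Q i # A i) = W i # p i" if "i < n" for i
    by (rule map_blocks[where a = "\<lambda>i. Q i # A i" and b = "\<lambda>i. W i # p i", OF len g[unfolded L_def M_def] that])
  have gQ: "g (Q i) = W i" if "i < n" for i using gi[OF that] by simp
  have gS: "g (Q (Suc i)) = W (Suc i)" if "i < n" for i
  proof (cases "Suc i = n")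
    case True then show ?thesis using gQ[of 0] per W.per that by simp
  next
    case False then show ?thesis using gQ[of "Suc i"] that by simp
  qed
  have gK: "map g (K i) = W i # p i @ [W (Suc i)]" if "i < n" for i using gi[OF that] gS[OF that] unfolding K_def by simp
  have gV: "g ` V = W.V" using arg_cong[OF g, of set] set_L sM[folded M_def] by simp
  have hV: "h ` W.V = V" using arg_cong[OF h, of set] set_L sM[folded M_def] by simp
  have hK: "map h (W i # p i @ [W (Suc i)]) = K i" if "i < n" for i
  proof -
    have "map h (map g (K i)) = K i" unfolding map_map by (rule map_idI) (use hg K_V[OF that] in auto)
    then show ?thesis using gK[OF that] by simp
  qed
  have hull: "map h W.hull_list = hull_list"
    unfolding W.hull_list_def hull_list_def using hg gQ by (auto simp: gQ[symmetric])
  \<comment> \<open>The boundary condition involves no coordinates and survives the relabelling by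
    \<open>h\<close>; only the positivity of the new triangles has to be checked.\<close>
  define F where "F = map (\<lambda>(a, b, c). (h a, h b, h c)) E"
  have Fpos: "a \<in> V \<and> b \<in> V \<and> c \<in> V \<and> ori a b c > 0" if abc: "(a, b, c) \<in> set F" for a b c
  proof -
    obtain a' b' c' where t: "(a', b', c') \<in> set E" "a = h a'" "b = h b'" "c = h c'" using abc unfolding F_def by auto
    have m: "a' \<in> W.V" "b' \<in> W.V" "c' \<in> W.V" using covers_mem[OF cov t(1)] by auto
    have V3: "a \<in> V" "b \<in> V" "c \<in> V" using m hV t by auto
    have ga: "g a = a'" "g b = b'" "g c = c'" using t gh m by auto
    consider "cyclic_subseq M a' b' c'" "\<forall>i<n. \<not> {a', b', c'} \<subseteq> W.S i" | i where "i < n" "cyclic_subseq (W i # p i @ [W (Suc i)]) c' b' a'"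
      using E t(1) unfolding M_def by blast
    then have "ori a b c > 0"
    proof cases
      case 1
      have "cyclic_subseq L a b c" using cseq_map[OF 1(1), of h] t h by simp
      moreover have "\<not> {a, b, c} \<subseteq> set (K i)" if i: "i < n" for i
      proof
        assume "{a, b, c} \<subseteq> set (K i)"
        then have "{a', b', c'} \<subseteq> g ` set (K i)" using ga by blast
        also have "g ` set (K i) = W.S i" using arg_cong[OF gK[OF i], of set] p i unfolding W.S_def by auto
        finally show False using 1(2) i by blast
      qed
      ultimately show ?thesis using cycle_pos by blast
    next
      case 2
      have "cyclic_subseq (K i) c b a" using cseq_map[OF 2(2), of h] hK[OF 2(1)] t by simp
      then show ?thesis by (rule chain_pos[OF 2(1)])
    qed
    then show ?thesis using V3 by blast
  qed
  have bdF: "boundary F w = cycle_weight w hull_list" if w: "antisym_weight w" for w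
  proof -
    have "antisym_weight (\<lambda>a b. w (h a) (h b))" using w unfolding antisym_weight_def by blast
    then have "boundary F w = cycle_weight (\<lambda>a b. w (h a) (h b)) W.hull_list" unfolding F_def bd_map using cov unfolding covers_def by blast
    also have "\<dots> = cycle_weight w hull_list" using cw_map[of W.hull_list w h] n3 unfolding hull by (simp add: W.hull_list_def)
    finally show ?thesis .
  qed
  have covF: "covers V hull_list F"
    unfolding covers_def using finV gpV hullp_sub[of V] QV(1) Fpos bdF by (auto simp: image_subset_iff)
  have EF: "E = map (\<lambda>(a, b, c). (g a, g b, g c)) F"
  proof -
    have "(\<lambda>(a, b, c). (g (h a), g (h b), g (h c))) t = t" if "t \<in> set E" for t
      using covers_mem[OF cov] gh that by (cases t) auto
    then show ?thesis unfolding F_def by (simp add: comp_def case_prod_beta map_idI)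
  qed
  show ?thesis
  proof (intro exI conjI)
    show "bij_betw g V (W ` {..<n} \<union> J)"
      unfolding bij_betw_def using gV hg unfolding W.V_def by (metis inj_on_inverseI)
    show "\<forall>i<n. g (Q i) = W i" using gQ by blast
    have F_full: "\<exists>q r. tile F v q r" if v: "v \<in> V" for v
    proof -
      have "g v \<in> W.V" using gV v by blast
      then obtain q r where "tile E (g v) q r" using full by blast
      from tr_map[OF this, of h] show ?thesis using hg[OF v] unfolding F_def by auto
    qed
    have "closed_segment x y \<in> tile_edges F \<longleftrightarrow> closed_segment (g x) (g y) \<in> tile_edges E" if "x \<in> V" "y \<in> V" for x y
    proof -
      have "tile F a b c \<Longrightarrow> tile E (g a) (g b) (g c)" for a b c unfolding EF by (rule tr_map)
      moreover have "tile F (h (g a)) (h (g b)) (h c)" if "tile E (g a) (g b) c" for a b c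
        unfolding F_def using that by (rule tr_map)
      ultimately show ?thesis unfolding segs_iff using hg that by metis
    qed
    then show "compatible_triangulation V (W ` {..<n} \<union> J) g (tile_edges F) (tile_edges E)"
      unfolding compatible_triangulation_def
      using covers_triangulation[OF covF] F_full covers_triangulation[OF cov] full unfolding W.V_def by blast
  qed
qed

section \<open>Hull edges and orientations\<close>

lemma ori_zero_collinear: "ori a b c = 0 \<Longrightarrow> collinear {a, b, c}"
proof -
  assume o: "ori a b c = 0"
  let ?u = "a - b" and ?v = "c - b"
  have e: "?u$1 * ?v$2 = ?u$2 * ?v$1" using o unfolding ori_def by (simp add: algebra_simps)
  have "v = (v$1 / u$1) *\<^sub>R u" if "u$1 * v$2 = u$2 * v$1" "u$1 \<noteq> 0" for u v :: point
    using that by (simp add: vec_eq_iff forall_2 field_simps)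
  moreover have "v = (v$2 / u$2) *\<^sub>R u" if "u$1 * v$2 = u$2 * v$1" "u$2 \<noteq> 0" for u v :: point
    using that by (simp add: vec_eq_iff forall_2 field_simps)
  moreover have "?u = 0" if "?u$1 = 0" "?u$2 = 0" using that by (simp add: vec_eq_iff forall_2)
  ultimately have "collinear {0, ?u, ?v}" unfolding collinear_lemma using e by metis
  then show ?thesis using collinear_3[of a b c] by (simp add: NO_MATCH_def)
qed

lemma general_position_gp: "general_position P \<Longrightarrow> gen_pos P"
  unfolding general_position_def gen_pos_def using ori_zero_collinear by blast

text \<open>Faces of a polytope are exposed, so a supporting functional exists along the edge. It
  vanishes at \<open>p\<close> and \<open>q\<close> and is therefore proportional to
  \<open>ori p q\<close>.\<close>

lemma hull_edge_side:
  assumes fin: "finite V" and gen_pos: "gen_pos V" and pq: "p \<in> V" "q \<in> V" "p \<noteq> q" and e: "hull_edge V p q"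
  shows "\<exists>s. (s = 1 \<or> s = -1) \<and> (\<forall>x\<in>V. x \<noteq> p \<longrightarrow> x \<noteq> q \<longrightarrow> s * ori p q x > 0)"
proof -
  let ?H = "convex hull V"
  have "closed_segment p q face_of ?H" using e unfolding hull_edge_def edge_of_def by blast
  moreover have "polyhedron ?H" using fin polytope_convex_hull polytope_imp_polyhedron by blast
  ultimately have "closed_segment p q exposed_face_of ?H" using exposed_face_of_polyhedron by blast
  then obtain a b where ab: "?H \<subseteq> {x. a \<bullet> x \<le> b}" "closed_segment p q = ?H \<inter> {x. a \<bullet> x = b}"
    unfolding exposed_face_of_def by blast
  define f where "f x = b - a \<bullet> x" for x
  have f: "affine_fun f"
  proof -
    have "\<forall>x. f x = (- a$1) * x$1 + (- a$2) * x$2 + b"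
      unfolding f_def inner_vec_def by (simp add: sum_2 algebra_simps)
    then show ?thesis unfolding affine_fun_def by blast
  qed
  have f0: "f p = 0" "f q = 0" using ab(2) unfolding f_def by auto
  have fp: "f x > 0" if x: "x \<in> V" "x \<noteq> p" "x \<noteq> q" for x
  proof -
    have xH: "x \<in> ?H" using x hull_subset by fast
    then have "f x \<ge> 0" using ab(1) unfolding f_def by auto
    moreover have "f x \<noteq> 0"
    proof
      assume "f x = 0"
      then have "x \<in> closed_segment p q" using ab(2) xH unfolding f_def by auto
      then obtain t where "x = (1 - t) *\<^sub>R p + t *\<^sub>R q" unfolding closed_segment_def by blast
      then have "ori p q x = 0" using aff_seg[OF aff_ori, of p q t p q] by simp
      then show False using gpD[OF gen_pos pq(1,2) x(1) pq(3)] x by metis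
    qed
    ultimately show ?thesis by simp
  qed
  have same: "f y * ori p q x = f x * ori p q y" for x y using aff_bary[OF f, of y p q x] f0 by simp
  show ?thesis
  proof (cases "\<exists>x\<in>V. x \<noteq> p \<and> x \<noteq> q")
    case True
    then obtain x where x: "x \<in> V" "x \<noteq> p" "x \<noteq> q" by blast
    have nz: "ori p q x \<noteq> 0" using gpD[OF gen_pos pq(1,2) x(1) pq(3)] x by metis
    define s :: real where "s = (if ori p q x > 0 then 1 else -1)"
    have sx: "s * ori p q x > 0" using nz unfolding s_def by auto
    have "s * ori p q y > 0" if "y \<in> V" "y \<noteq> p" "y \<noteq> q" for y
    proof -
      have "f x * (s * ori p q y) = f y * (s * ori p q x)" using same[of y x] by (simp add: mult.left_commute)
      also have "\<dots> > 0" using fp[OF that] sx by simp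
      finally show ?thesis using fp[OF x] by (simp add: zero_less_mult_iff)
    qed
    moreover have "s = 1 \<or> s = -1" unfolding s_def by auto
    ultimately show ?thesis by blast
  next
    case False then show ?thesis by (intro exI[of _ 1]) auto
  qed
qed

text \<open>The signs of two consecutive edges agree because the orientation of the triple of their
  vertices is tested by both.\<close>

lemma hull_orientation:
  assumes fin: "finite V" and gen_pos: "gen_pos V" and d: "distinct vs" and len: "length vs \<ge> 3" and sub: "set vs \<subseteq> V"
    and e: "\<And>i. i < length vs \<Longrightarrow> hull_edge V (vs ! i) (vs ! (Suc i mod length vs))"
  shows "\<exists>s. (s = 1 \<or> s = -1) \<and> (\<forall>i<length vs. \<forall>x\<in>V. x \<noteq> vs ! i \<longrightarrow> x \<noteq> vs ! (Suc i mod length vs) \<longrightarrow>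
    s * ori (vs ! i) (vs ! (Suc i mod length vs)) x > 0)"
proof -
  let ?n = "length vs"
  let ?v = "\<lambda>i. vs ! (i mod ?n)"
  have mV: "?v i \<in> V" for i
  proof -
    have "i mod ?n < ?n" by (rule mod_less_divisor) (use len in linarith)
    then show ?thesis using sub nth_mem by blast
  qed
  have ne: "?v i \<noteq> ?v (Suc i)" "?v i \<noteq> ?v (Suc (Suc i))" for i
  proof -
    have lt: "k mod ?n < ?n" for k by (rule mod_less_divisor) (use len in linarith)
    show "?v i \<noteq> ?v (Suc i)" "?v i \<noteq> ?v (Suc (Suc i))"
      unfolding nth_eq_iff_index_eq[OF d lt lt] using len by (auto simp: mod_Suc)
  qed
  have "\<exists>s. (s = 1 \<or> s = -1) \<and> (\<forall>x\<in>V. x \<noteq> ?v i \<longrightarrow> x \<noteq> ?v (Suc i) \<longrightarrow> s * ori (?v i) (?v (Suc i)) x > 0)" for i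
  proof -
    have "hull_edge V (vs ! (i mod ?n)) (vs ! (Suc (i mod ?n) mod ?n))" by (rule e, rule mod_less_divisor) (use len in linarith)
    then have "hull_edge V (?v i) (?v (Suc i))" by (simp add: mod_Suc_eq)
    then show ?thesis by (intro hull_edge_side[OF fin gen_pos mV mV ne(1)])
  qed
  then obtain s :: "nat \<Rightarrow> real" where s: "\<And>i. s i = 1 \<or> s i = -1"
    "\<And>i x. x \<in> V \<Longrightarrow> x \<noteq> ?v i \<Longrightarrow> x \<noteq> ?v (Suc i) \<Longrightarrow> s i * ori (?v i) (?v (Suc i)) x > 0" by metis
  have "s (Suc i) = s i" for i
  proof -
    have "s i * ori (?v i) (?v (Suc i)) (?v (Suc (Suc i))) > 0" using s(2)[OF mV] ne by metis
    moreover have "s (Suc i) * ori (?v (Suc i)) (?v (Suc (Suc i))) (?v i) > 0" using s(2)[OF mV] ne by metis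
    ultimately show ?thesis using s(1)[of i] s(1)[of "Suc i"] ori_rot[of "?v (Suc i)" "?v (Suc (Suc i))" "?v i"] by auto
  qed
  then have c: "s i = s 0" for i by (induction i) auto
  have "s 0 * ori (vs ! i) (vs ! (Suc i mod ?n)) x > 0"
    if "i < ?n" "x \<in> V" "x \<noteq> vs ! i" "x \<noteq> vs ! (Suc i mod ?n)" for i x
    using s(2)[of x i] that c[of i] by simp
  then show ?thesis using s(1)[of 0] by blast
qed

text \<open>The identity for \<open>s = 1\<close> and a reflection for \<open>s = -1\<close>: a cyclic bijection may reverse the orientation.\<close>

definition reflect :: "real \<Rightarrow> point \<Rightarrow> point" where
  "reflect s x = vector [x$1, s * x$2]"

lemma rf_ori: "ori (reflect s a) (reflect s b) (reflect s c) = s * ori a b c"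
  unfolding ori_def reflect_def by (simp add: algebra_simps)

lemma rf_rf: "s = 1 \<or> s = -1 \<Longrightarrow> reflect s (reflect s x) = x"
  unfolding reflect_def by (auto simp: vec_eq_iff forall_2)

lemma rf_linear: "linear (reflect s)"
  unfolding reflect_def by (rule linearI) (auto simp: vec_eq_iff forall_2 algebra_simps)

lemma rf_eq: "s = 1 \<or> s = -1 \<Longrightarrow> reflect s x = reflect s y \<longleftrightarrow> x = y"
  using rf_rf by metis

lemma rf_inj: "s = 1 \<or> s = -1 \<Longrightarrow> inj (reflect s)"
  unfolding inj_def using rf_eq by blast

lemma rf_image: "s = 1 \<or> s = -1 \<Longrightarrow> reflect s ` reflect s ` X = X"
  unfolding image_image by (simp add: rf_rf)

lemma rf_crs: "s = 1 \<or> s = -1 \<Longrightarrow> crosses (reflect s a) (reflect s b) (reflect s c) (reflect s d) \<longleftrightarrow> crosses a b c d"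
  unfolding crosses_def rf_ori by auto

lemma planar_triangulation_rf:
  assumes s: "s = 1 \<or> s = -1" and T: "planar_triangulation V T"
  shows "planar_triangulation (reflect s ` V) ((`) (reflect s) ` T)"
proof -
  have nc: "noncrossing (reflect s ` a) (reflect s ` b) \<longleftrightarrow> noncrossing a b" for a b
    unfolding noncrossing_def rel_interior_injective_linear_image[OF rf_linear[of s, unfolded linear_conv_bounded_linear] rf_inj[OF s]]
    using image_Int[OF rf_inj[OF s]] by (metis image_is_empty)
  have path_weight: "pairwise noncrossing X \<Longrightarrow> pairwise noncrossing ((`) (reflect s) ` X)" for X
    unfolding pairwise_def using nc by auto
  have ed: "(`) (reflect s) ` X \<subseteq> point_set_edges (reflect s ` U)" if XU: "X \<subseteq> point_set_edges U" for X U
  proof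
    fix e assume "e \<in> (`) (reflect s) ` X"
    then obtain p q where "p \<in> U" "q \<in> U" "p \<noteq> q" "e = reflect s ` closed_segment p q"
      using XU unfolding point_set_edges_def by blast
    then show "e \<in> point_set_edges (reflect s ` U)"
      unfolding point_set_edges_def using closed_segment_linear_image[OF rf_linear, of s p q] rf_eq[OF s] by blast
  qed
  show ?thesis
    unfolding planar_triangulation_def
  proof (intro conjI allI impI)
    show "(`) (reflect s) ` T \<subseteq> point_set_edges (reflect s ` V)" "pairwise noncrossing ((`) (reflect s) ` T)"
      using ed path_weight T unfolding planar_triangulation_def by auto
    fix T' assume T': "(`) (reflect s) ` T \<subseteq> T' \<and> T' \<subseteq> point_set_edges (reflect s ` V) \<and> pairwise noncrossing T'"
    let ?U = "(`) (reflect s) ` T'"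
    have bk: "(`) (reflect s) ` (`) (reflect s) ` X = X" for X using rf_image[OF s] by (simp add: image_image)
    have "T \<subseteq> ?U" using image_mono[of "(`) (reflect s) ` T" T' "(`) (reflect s)"] T' bk by simp
    moreover have "?U \<subseteq> point_set_edges V" using ed[of T' "reflect s ` V"] T' rf_image[OF s] by simp
    moreover have "pairwise noncrossing ?U" using path_weight T' by blast
    ultimately have "?U = T" using T unfolding planar_triangulation_def by blast
    then show "T' = (`) (reflect s) ` T" using bk by metis
  qed
qed

text \<open>By Krein-Milman the extreme points span the same hull.\<close>

lemma hull_edge_hull_vertices:
  assumes "finite P" shows "hull_edge (hull_vertices P) p q \<longleftrightarrow> hull_edge P p q"
proof -
  have "compact (convex hull P)" "convex (convex hull P)" using assms finite_imp_compact_convex_hull by auto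
  from Krein_Milman_Minkowski[OF this] show ?thesis unfolding hull_edge_def hull_vertices_def by simp
qed

lemma hull_vertices_subset: "hull_vertices P \<subseteq> P"
  unfolding hull_vertices_def using extreme_point_of_convex_hull by blast

lemma ce_nth: "(a, b) \<in> set (cycle_edges xs) \<Longrightarrow> \<exists>i<length xs. a = xs ! i \<and> b = xs ! (Suc i mod length xs)"
proof -
  assume "(a, b) \<in> set (cycle_edges xs)"
  then obtain j where j: "Suc j < length (xs @ [hd xs])" "a = (xs @ [hd xs]) ! j" "b = (xs @ [hd xs]) ! Suc j"
    unfolding cycle_edges_def pe_nth by blast
  then have l: "j < length xs" by simp
  moreover have "a = xs ! j" using j(2) l by (simp add: nth_append)
  moreover have "b = xs ! (Suc j mod length xs)"
  proof (cases "Suc j = length xs")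
    case True then show ?thesis using j(3) l hd_conv_nth[of xs] by (cases xs) (auto simp: nth_append)
  next
    case False then show ?thesis using j(3) l by (simp add: nth_append)
  qed
  ultimately show ?thesis by blast
qed

text \<open>Reducing the index modulo \<open>n\<close> supplies the repeated vertex that
  \<open>hull_data\<close> asks for, and the reflection by \<open>s\<close> turns the hull cycle
  counterclockwise.\<close>

lemma rf_hull_data:
  assumes fin: "finite V" and gen_pos: "gen_pos V" and d: "distinct vs" and len: "length vs = n" "n \<ge> 3" and sub: "set vs \<subseteq> V"
    and s: "s = 1 \<or> s = -1" and pos: "\<forall>i<n. \<forall>x\<in>V. x \<noteq> vs ! i \<longrightarrow> x \<noteq> vs ! (Suc i mod n) \<longrightarrow>
    s * ori (vs ! i) (vs ! (Suc i mod n)) x > 0"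
  shows "hull_data n (\<lambda>i. reflect s (vs ! (i mod n))) (reflect s ` (V - set vs))"
    "(\<lambda>i. reflect s (vs ! (i mod n))) ` {..<n} \<union> reflect s ` (V - set vs) = reflect s ` V"
proof -
  have im: "(\<lambda>i. reflect s (vs ! (i mod n))) ` {..<n} = reflect s ` set vs"
    unfolding set_conv_nth len(1) by auto
  then show U: "(\<lambda>i. reflect s (vs ! (i mod n))) ` {..<n} \<union> reflect s ` (V - set vs) = reflect s ` V" using sub by auto
  show "hull_data n (\<lambda>i. reflect s (vs ! (i mod n))) (reflect s ` (V - set vs))"
  proof
    show "inj_on (\<lambda>i. reflect s (vs ! (i mod n))) {..<n}"
      by (rule inj_onI) (use rf_eq[OF s] d len in \<open>auto simp: nth_eq_iff_index_eq\<close>)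
    show "reflect s (vs ! (i mod n)) \<notin> reflect s ` (V - set vs)" if "i < n" for i
      using rf_eq[OF s] len that by auto
    show "gen_pos ((\<lambda>i. reflect s (vs ! (i mod n))) ` {..<n} \<union> reflect s ` (V - set vs))"
    proof -
      have "s \<noteq> 0" using s by auto
      then show ?thesis unfolding U using gen_pos unfolding gen_pos_def by (simp add: rf_ori rf_eq[OF s])
    qed
    show "ori (reflect s (vs ! (i mod n))) (reflect s (vs ! (Suc i mod n))) p > 0"
      if i: "i < n" and p: "p \<in> (\<lambda>i. reflect s (vs ! (i mod n))) ` {..<n} \<union> reflect s ` (V - set vs)"
        "p \<noteq> reflect s (vs ! (i mod n))" "p \<noteq> reflect s (vs ! (Suc i mod n))" for i p
    proof -
      obtain x where x: "x \<in> V" "p = reflect s x" using p(1) unfolding U by blast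
      then show ?thesis using pos i p(2,3) by (auto simp: rf_ori)
    qed
  qed (use len fin in auto)
qed

section \<open>Unavoidable edges are crossed by no segment\<close>

lemma finite_point_set_edges:
  assumes "finite P"
  shows "finite (point_set_edges P)"
proof -
  have "point_set_edges P \<subseteq> (\<lambda>(p, q). closed_segment p q) ` (P \<times> P)"
    unfolding point_set_edges_def by auto
  then show ?thesis
    using assms by (meson finite_SigmaI finite_imageI finite_subset)
qed

lemma planar_triangulation_extends:
  assumes fin: "finite P"
    and S: "S \<subseteq> point_set_edges P" "pairwise noncrossing S"
  obtains T where "planar_triangulation P T" "S \<subseteq> T"
proof -
  let ?F = "{T. S \<subseteq> T \<and> T \<subseteq> point_set_edges P \<and> pairwise noncrossing T}"
  have "finite ?F"
    by (rule finite_subset[of _ "Pow (point_set_edges P)"])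
       (auto simp: finite_point_set_edges[OF fin])
  moreover have "S \<in> ?F"
    using S by auto
  ultimately obtain T where T: "T \<in> ?F" and max: "\<forall>T'\<in>?F. T \<subseteq> T' \<longrightarrow> T = T'"
    by (metis (no_types, lifting) empty_iff finite_has_maximal2)
  have "planar_triangulation P T"
    unfolding planar_triangulation_def
  proof (intro conjI allI impI)
    fix T' assume T': "T \<subseteq> T' \<and> T' \<subseteq> point_set_edges P \<and> pairwise noncrossing T'"
    then have "T' \<in> ?F" using T by auto
    then show "T' = T" using max T' by auto
  qed (use T in auto)
  with T that show ?thesis by auto
qed

text \<open>The segment \<open>s\<close> alone extends to a triangulation, which contains the
  unavoidable edge too, and distinct edges of a triangulation do not cross.\<close>

lemma unavoidable_cycle_uncrossed:
  assumes fin: "finite P"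
    and cyc: "unavoidable_spanning_cycle P xs" and i: "i < length xs"
    and s: "s \<in> point_set_edges P"
    and ne: "s \<noteq> closed_segment (xs ! i) (xs ! (Suc i mod length xs))"
  shows "noncrossing s (closed_segment (xs ! i) (xs ! (Suc i mod length xs)))"
proof -
  obtain T where T: "planar_triangulation P T" "{s} \<subseteq> T"
    using planar_triangulation_extends[OF fin, of "{s}"] s by auto
  have "closed_segment (xs ! i) (xs ! (Suc i mod length xs)) \<in> T"
    using cyc i T(1) unfolding unavoidable_spanning_cycle_def by blast
  moreover have "pairwise noncrossing T"
    using T(1) unfolding planar_triangulation_def by blast
  ultimately show ?thesis
    using T(2) ne unfolding pairwise_def by auto
qed

lemma cycle_uncrossed:
  assumes fin: "finite P" and cyc: "unavoidable_spanning_cycle P xs" and e: "(a, b) \<in> set (cycle_edges xs)" and xy: "x \<in> P" "y \<in> P"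
  shows "\<not> crosses a b x y"
proof
  assume c: "crosses a b x y"
  obtain i where i: "i < length xs" "a = xs ! i" "b = xs ! (Suc i mod length xs)" using ce_nth[OF e] by blast
  have d: "a \<noteq> b" "x \<noteq> y" "a \<noteq> x" "a \<noteq> y" using crs_distinct[OF c] by auto
  have "closed_segment x y \<noteq> closed_segment a b" using d by (auto simp: closed_segment_eq doubleton_eq_iff)
  moreover have "closed_segment x y \<in> point_set_edges P" unfolding point_set_edges_def using xy d by blast
  ultimately have "noncrossing (closed_segment x y) (closed_segment a b)"
    using unavoidable_cycle_uncrossed[OF fin cyc i(1)] i(2,3) by blast
  then have "open_segment x y \<inter> open_segment a b = {}"
    unfolding noncrossing_def using d by (simp add: rel_interior_closed_segment)
  then show False using crs_open[OF c] by blast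
qed

lemma block_notin:
  assumes "distinct (concat (map (\<lambda>i. q i # a i) [0..<n]))" "i < n" "j < n"
  shows "q j \<notin> set (a i)"
proof
  assume m: "q j \<in> set (a i)"
  have i: "q i # a i \<in> set (map (\<lambda>i. q i # a i) [0..<n])" and j: "q j # a j \<in> set (map (\<lambda>i. q i # a i) [0..<n])"
    using assms(2,3) by auto
  then have "distinct (q i # a i)" using assms(1) unfolding distinct_concat_iff by blast
  then have "q i # a i \<noteq> q j # a j" using m by auto
  then have "set (q i # a i) \<inter> set (q j # a j) = {}" using assms(1) i j unfolding distinct_concat_iff by blast
  then show False using m by auto
qed

text \<open>The polygon of a chain is closed by its hull edge in reverse direction, with the inner
  points on the side of the hull interior. Its orientation is thus opposite to that of the
  hull.\<close>

lemma chain_orientation: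
  assumes fin: "finite P" and gen_pos: "gen_pos P" and s: "s = 1 \<or> s = -1" and C: "convex_polygon (p # as @ [q])" and sub: "set (p # as @ [q]) \<subseteq> P"
    and h: "\<And>x. x \<in> set as \<Longrightarrow> s * ori p q x > 0"
    and e: "(a, b) \<in> set (path_edges (p # as @ [q]))" and x: "x \<in> set (p # as @ [q])" "x \<noteq> a" "x \<noteq> b"
  shows "s * ori a b x < 0"
proof (cases "as = []")
  case True then show ?thesis using e x by simp
next
  case False
  let ?K = "p # as @ [q]"
  have d: "distinct ?K" and ed: "\<And>i. i < length ?K \<Longrightarrow> hull_edge (set ?K) (?K ! i) (?K ! (Suc i mod length ?K))"
    using C unfolding convex_polygon_def by auto
  have l: "length ?K \<ge> 3" using False by (cases as) auto
  obtain t where t: "t = 1 \<or> t = -1" and T: "\<forall>i<length ?K. \<forall>x\<in>set ?K. x \<noteq> ?K ! i \<longrightarrow> x \<noteq> ?K ! (Suc i mod length ?K) \<longrightarrow>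
      t * ori (?K ! i) (?K ! (Suc i mod length ?K)) x > 0"
    using hull_orientation[OF _ gp_subset[OF gen_pos sub] d l subset_refl ed] by auto
  have E: "t * ori a b x > 0" if "(a, b) \<in> set (cycle_edges ?K)" "x \<in> set ?K" "x \<noteq> a" "x \<noteq> b" for a b x
    using ce_nth[OF that(1)] T that(2-) by blast
  have cycle_edges: "cycle_edges ?K = path_edges ?K @ [(q, p)]" using ce_pe[of ?K] by simp
  obtain y where y: "y \<in> set as" using False by (cases as) auto
  have "t * ori q p y > 0" by (rule E) (use cycle_edges y d in auto)
  moreover have "s * ori p q y > 0" by (rule h[OF y])
  ultimately have "t = - s" using s t ori_swap[of q p y] by auto
  moreover have "t * ori a b x > 0" by (rule E) (use cycle_edges e x in auto)
  ultimately show ?thesis by simp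
qed

text \<open>A convex polygon may be listed in either cyclic order; \<open>s\<close> records which
  one occurs, and reflecting by it gives the normal form of \<open>crown\<close>.\<close>

lemma double_circle_crown:
  assumes G: "generalized_double_circle c P" and len: "length c = n" "n \<ge> 3"
  shows "\<exists>vs A s. (s = 1 \<or> s = -1) \<and> finite P \<and> card P = n + (\<Sum>i<n. length (A i)) \<and> distinct vs \<and> length vs = n \<and> set vs = hull_vertices P \<and>
    (\<forall>i<n. hull_edge P (vs ! i) (vs ! (Suc i mod n))) \<and>
    reflect s ` P = (\<lambda>i. reflect s (vs ! (i mod n))) ` {..<n} \<union> reflect s ` (P - set vs) \<and>
    crown n (\<lambda>i. reflect s (vs ! (i mod n))) (reflect s ` (P - set vs)) A"
proof -
  obtain vs As where P: "point_set P" "card P = length c + sum_list c" and l: "length vs = length c" "map length As = c"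
    and cv: "convex_polygon vs" "hull_vertices P = set vs"
    and ch: "\<forall>i<length c. convex_polygon (vs ! i # As ! i @ [vs ! (Suc i mod length c)])"
    and U: "unavoidable_spanning_cycle P (concat (map (\<lambda>i. vs ! i # As ! i) [0..<length c]))"
    using G unfolding generalized_double_circle_def by auto
  have fin: "finite P" and gen_pos: "gen_pos P" using P general_position_gp unfolding point_set_def by auto
  have lv: "length vs = n" using l len by simp
  have d: "distinct vs" using cv unfolding convex_polygon_def by blast
  have sub: "set vs \<subseteq> P" using cv(2) hull_vertices_subset by blast
  have e: "hull_edge P (vs ! i) (vs ! (Suc i mod n))" if "i < n" for i
    using cv that lv hull_edge_hull_vertices[OF fin] unfolding convex_polygon_def by auto
  obtain s where s: "s = 1 \<or> s = -1" and pos: "\<forall>i<n. \<forall>x\<in>P. x \<noteq> vs ! i \<longrightarrow> x \<noteq> vs ! (Suc i mod n) \<longrightarrow> s * ori (vs ! i) (vs ! (Suc i mod n)) x > 0"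
    using hull_orientation[OF fin gen_pos d _ sub] e lv len(2) by auto
  note HD = rf_hull_data[OF fin gen_pos d lv len(2) sub s pos]
  let ?Q = "\<lambda>i. reflect s (vs ! (i mod n))" and ?I = "reflect s ` (P - set vs)"
  define A where "A i = map (reflect s) (As ! i)" for i
  let ?L = "concat (map (\<lambda>i. vs ! i # As ! i) [0..<n])"
  have dL: "distinct ?L" and sL: "set ?L = P" using U len unfolding unavoidable_spanning_cycle_def by auto
  have nin: "vs ! j \<notin> set (As ! i)" if "i < n" "j < n" for i j by (rule block_notin[OF dL that])
  have AsP: "set (As ! i) \<subseteq> P - set vs" if i: "i < n" for i
  proof
    fix x assume x: "x \<in> set (As ! i)"
    then have "x \<in> P" using sL i by auto
    moreover have "x \<notin> set vs"
    proof
      assume "x \<in> set vs"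
      then obtain j where "j < n" "x = vs ! j" unfolding in_set_conv_nth lv by blast
      then show False using nin[OF i] x by blast
    qed
    ultimately show "x \<in> P - set vs" by blast
  qed
  have L: "concat (map (\<lambda>i. ?Q i # A i) [0..<n]) = map (reflect s) ?L"
  proof -
    have "map (\<lambda>i. ?Q i # A i) [0..<n] = map (\<lambda>i. map (reflect s) (vs ! i # As ! i)) [0..<n]"
      by (rule map_cong) (auto simp: A_def)
    then show ?thesis by (simp only: map_concat map_map comp_def)
  qed
  have Ln: "?L \<noteq> []" using sL sub lv len(2) by (cases vs) auto
  interpret H: hull_data n ?Q ?I by (rule HD(1))
  have HV: "H.V = reflect s ` P" unfolding H.V_def by (rule HD(2))
  have "crown n ?Q ?I A"
  proof unfold_locales
    have "(\<Union>i<n. set (As ! i)) = P - set vs"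
    proof
      show "(\<Union>i<n. set (As ! i)) \<subseteq> P - set vs" using AsP by blast
      show "P - set vs \<subseteq> (\<Union>i<n. set (As ! i))" unfolding sL[symmetric] using lv by auto
    qed
    then show "(\<Union>i<n. set (A i)) = ?I" unfolding A_def by (simp flip: image_UN)
    show "distinct (concat (map (\<lambda>i. ?Q i # A i) [0..<n]))"
      unfolding L distinct_map using dL rf_inj[OF s] inj_on_subset by blast
    show "ori a b x < 0" if i: "i < n" and ab: "(a, b) \<in> set (path_edges (?Q i # A i @ [?Q (Suc i)]))"
      and x: "x \<in> set (?Q i # A i @ [?Q (Suc i)])" "x \<noteq> a" "x \<noteq> b" for i a b x
    proof -
      let ?K = "vs ! i # As ! i @ [vs ! (Suc i mod n)]"
      have K: "?Q i # A i @ [?Q (Suc i)] = map (reflect s) ?K" unfolding A_def using i by simp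
      obtain a' b' where ab': "(a', b') \<in> set (path_edges ?K)" "a = reflect s a'" "b = reflect s b'"
        using ab unfolding K pe_map by auto
      obtain x' where x': "x' \<in> set ?K" "x = reflect s x'" using x(1) unfolding K set_map by blast
      have k: "Suc i mod n < n" by (rule mod_less_divisor) (use len in linarith)
      have m: "vs ! i \<in> P" "vs ! (Suc i mod n) \<in> P" using sub nth_mem[of i vs] nth_mem[of "Suc i mod n" vs] i k unfolding lv by blast+
      have "s * ori a' b' x' < 0"
      proof (rule chain_orientation[OF fin gen_pos s _ _ _ ab'(1) x'(1)])
        show "convex_polygon ?K" using ch i len by simp
        show "set ?K \<subseteq> P" using m AsP[OF i] by auto
        show "s * ori (vs ! i) (vs ! (Suc i mod n)) y > 0" if y: "y \<in> set (As ! i)" for y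
        proof -
          have "y \<in> P" "y \<noteq> vs ! i" "y \<noteq> vs ! (Suc i mod n)" using AsP[OF i] y nin[OF i] i k by auto
          then show ?thesis using pos i by blast
        qed
        show "x' \<noteq> a'" "x' \<noteq> b'" using x x' ab' by auto
      qed
      then show ?thesis unfolding ab'(2,3) x'(2) rf_ori .
    qed
    show "\<not> crosses a b x y" if ab: "(a, b) \<in> set (cycle_edges (concat (map (\<lambda>i. ?Q i # A i) [0..<n])))" and xy: "x \<in> H.V" "y \<in> H.V" for a b x y
    proof -
      obtain a' b' where ab': "(a', b') \<in> set (cycle_edges ?L)" "a = reflect s a'" "b = reflect s b'"
        using ab unfolding L ce_map[OF Ln] by auto
      obtain x' y' where xy': "x' \<in> P" "y' \<in> P" "x = reflect s x'" "y = reflect s y'" using xy unfolding HV by blast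
      have "\<not> crosses a' b' x' y'" using cycle_uncrossed[OF fin U] ab'(1) xy' len by simp
      then show ?thesis unfolding ab' xy' rf_crs[OF s] .
    qed
  qed
  moreover have "card P = n + (\<Sum>i<n. length (A i))"
  proof -
    have lA: "length As = n" using l(2) len by (metis length_map)
    have "sum_list c = (\<Sum>i<n. c ! i)" using len by (simp add: sum_list_sum_nth lessThan_atLeast0)
    also have "\<dots> = (\<Sum>i<n. length (A i))" unfolding A_def by (rule sum.cong) (use l(2) lA in \<open>auto simp flip: l(2)\<close>)
    finally show ?thesis using P(2) len by simp
  qed
  ultimately show ?thesis using s fin d lv cv(2) e HD(2) by metis
qed

theorem theorem7:
  fixes n :: nat and c :: "nat list" and P :: "(real ^ 2) set"
  assumes "n \<ge> 3" and "length c = n"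
    and "generalized_double_circle c P"
  shows "universal P"
  unfolding universal_def
proof (intro allI impI)
  fix Q and f0 :: "point \<Rightarrow> point" assume "point_set Q \<and> card Q = card P \<and> cyclic_bijection P Q f0"
  then have Q: "point_set Q" "card Q = card P" and f0: "cyclic_bijection P Q f0" by auto
  obtain vs A s where s: "s = 1 \<or> s = -1" and finP: "finite P" and cP: "card P = n + (\<Sum>i<n. length (A i))"
    and d: "distinct vs" and lv: "length vs = n" and sv: "set vs = hull_vertices P"
    and e: "\<forall>i<n. hull_edge P (vs ! i) (vs ! (Suc i mod n))"
    and UP: "reflect s ` P = (\<lambda>i. reflect s (vs ! (i mod n))) ` {..<n} \<union> reflect s ` (P - set vs)"
    and cr: "crown n (\<lambda>i. reflect s (vs ! (i mod n))) (reflect s ` (P - set vs)) A"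
    using double_circle_crown[OF assms(3,2,1)] by (elim exE conjE) (rule that; assumption)
  interpret crown n "\<lambda>i. reflect s (vs ! (i mod n))" "reflect s ` (P - set vs)" A by (rule cr)
  have VP: "V = reflect s ` P" unfolding V_def UP ..
  have fin: "finite Q" and gpQ: "gen_pos Q" using Q general_position_gp unfolding point_set_def by auto
  have bij: "bij_betw f0 (hull_vertices P) (hull_vertices Q)" using f0 unfolding cyclic_bijection_def by blast
  define us where "us = map f0 vs"
  have du: "distinct us" unfolding us_def distinct_map using d sv bij unfolding bij_betw_def by simp
  have su: "set us = hull_vertices Q" unfolding us_def using sv bij unfolding bij_betw_def by simp
  have sub: "set us \<subseteq> Q" using su hull_vertices_subset by blast
  have lu: "length us = n" unfolding us_def using lv by simp
  have eQ: "hull_edge Q (us ! i) (us ! (Suc i mod n))" if i: "i < n" for i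
  proof -
    have k: "Suc i mod n < n" by (rule mod_less_divisor) (use assms(1) in linarith)
    have "vs ! i \<in> hull_vertices P" "vs ! (Suc i mod n) \<in> hull_vertices P" using sv i k lv by (metis nth_mem)+
    then have "hull_edge Q (f0 (vs ! i)) (f0 (vs ! (Suc i mod n)))" using e f0 i unfolding cyclic_bijection_def by blast
    then show ?thesis unfolding us_def using i k lv by simp
  qed
  \<comment> \<open>The images of the hull vertices under \<open>f0\<close> have an orientation of
    their own, unrelated to \<open>s\<close>, because a cyclic bijection may reverse the
    sense.\<close>
  obtain t where t: "t = 1 \<or> t = -1" and pos: "\<forall>i<n. \<forall>x\<in>Q. x \<noteq> us ! i \<longrightarrow> x \<noteq> us ! (Suc i mod n) \<longrightarrow> t * ori (us ! i) (us ! (Suc i mod n)) x > 0"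
    using hull_orientation[OF fin gpQ du _ sub] eQ lu assms(1) by auto
  note HD = rf_hull_data[OF fin gpQ du lu assms(1) sub t pos]
  have "card (Q - set us) = card Q - n" using card_Diff_subset[OF _ sub] distinct_card[OF du] lu by simp
  then have "card (reflect t ` (Q - set us)) = (\<Sum>i<n. length (A i))"
    using card_image[OF inj_on_subset[OF rf_inj[OF t]], of "Q - set us"] Q(2) cP by simp
  from matching_triangulations[OF HD(1) this] obtain g TP TQ where
    g: "bij_betw g (reflect s ` P) (reflect t ` Q)" "\<forall>i<n. g (reflect s (vs ! (i mod n))) = reflect t (us ! (i mod n))"
    and T: "compatible_triangulation (reflect s ` P) (reflect t ` Q) g TP TQ"
    unfolding HD(2) VP by (elim exE conjE) (rule that; assumption)
  define f where "f x = reflect t (g (reflect s x))" for x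
  have "bij_betw (reflect s) P (reflect s ` P)" by (rule inj_on_imp_bij_betw) (rule inj_on_subset[OF rf_inj[OF s] subset_UNIV])
  moreover have "bij_betw (reflect t) (reflect t ` Q) (reflect t ` reflect t ` Q)"
    by (rule inj_on_imp_bij_betw) (rule inj_on_subset[OF rf_inj[OF t] subset_UNIV])
  then have "bij_betw (reflect t) (reflect t ` Q) Q" unfolding rf_image[OF t] .
  ultimately have "bij_betw (reflect t \<circ> (g \<circ> reflect s)) P Q" using g(1) by (intro bij_betw_trans)
  then have b: "bij_betw f P Q" unfolding f_def comp_def .
  have ext: "f p = f0 p" if p: "p \<in> hull_vertices P" for p
  proof -
    have "p \<in> set vs" using p sv by simp
    then obtain i where i: "i < n" "p = vs ! i" unfolding in_set_conv_nth lv by blast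
    then have "g (reflect s p) = reflect t (us ! i)" using g(2)[THEN spec, of i] by simp
    then show ?thesis unfolding f_def using i lv rf_rf[OF t] by (simp add: us_def)
  qed
  let ?TP = "(`) (reflect s) ` TP" and ?TQ = "(`) (reflect t) ` TQ"
  have mem: "closed_segment x y \<in> (`) (reflect r) ` X \<longleftrightarrow> closed_segment (reflect r x) (reflect r y) \<in> X" if r: "r = 1 \<or> r = -1" for r x y X
  proof -
    have e: "closed_segment (reflect r x) (reflect r y) = reflect r ` closed_segment x y" by (rule closed_segment_linear_image[OF rf_linear])
    show ?thesis
    proof
      assume "closed_segment x y \<in> (`) (reflect r) ` X"
      then obtain Z where "Z \<in> X" "closed_segment x y = reflect r ` Z" by blast
      then show "closed_segment (reflect r x) (reflect r y) \<in> X" unfolding e by (simp add: rf_image[OF r])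
    next
      assume "closed_segment (reflect r x) (reflect r y) \<in> X"
      then have "reflect r ` reflect r ` closed_segment x y \<in> (`) (reflect r) ` X" unfolding e by (rule imageI)
      then show "closed_segment x y \<in> (`) (reflect r) ` X" unfolding rf_image[OF r] .
    qed
  qed
  have "compatible_triangulation P Q f ?TP ?TQ"
    unfolding compatible_triangulation_def
  proof (intro conjI ballI)
    show "planar_triangulation P ?TP" "planar_triangulation Q ?TQ"
      using planar_triangulation_rf[OF s, of "reflect s ` P" TP] planar_triangulation_rf[OF t, of "reflect t ` Q" TQ] T
      unfolding rf_image[OF s] rf_image[OF t] compatible_triangulation_def by blast+
    show "closed_segment p p' \<in> ?TP \<longleftrightarrow> closed_segment (f p) (f p') \<in> ?TQ" if "p \<in> P" "p' \<in> P" for p p'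
      unfolding mem[OF s] mem[OF t] f_def rf_rf[OF t] using T that unfolding compatible_triangulation_def by blast
  qed
  then show "\<exists>f. bij_betw f P Q \<and> (\<forall>p\<in>hull_vertices P. f p = f0 p) \<and> (\<exists>TP TQ. compatible_triangulation P Q f TP TQ)"
    using b ext by blast
qed

end
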